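(* Let $\mathbb{K}$ be a field, let $\mathcal{T}$ be a Lawvere theory, and let $f,g\colon A\rightrightarrows B$ be two morphisms in $[\mathcal{T},\mathsf{Coalg}_{coc}]$. The coequalizer of $f$ and $g$ in $[\mathcal{T},\mathsf{Coalg}_{coc}]$ is given by the linear quotient $q\colon B\to B/\langle I\rangle_{\mathcal{T}}$, where $I:=\{f(a)-g(a)\mid a\in A\}$.
   Context: $\mathsf{Coalg}_{coc}$ is the category of coassociative, counital, cocommutative coalgebras over $\mathbb{K}$ and coalgebra homomorphisms; its finite products are given by $\otimes_{\mathbb{K}}$ and its terminal object is $\mathbb{K}$. A Lawvere theory $\mathcal{T}$ is a small category with finite products whose objects are the powers $T^0,T^1=T,T^2,\dots$ of one object $T$. $[\mathcal{T},\mathsf{Coalg}_{coc}]$ is the category of finite-product-preserving functors $\mathcal{T}\to\mathsf{Coalg}_{coc}$ and natural transformations; its objects are called $\mathcal{T}$-coalgebras. A $\mathcal{T}$-coalgebra is identified with its underlying coalgebra $A$ (its value at $T$) together with the coalgebra maps $t^A\colon A^{\otimes n}\to A$ induced by the morphisms $t\colon T^n\to T$. A coideal of $A$ is a linear subspace $I\subset A$ with $\Delta(I)\subset I\otimes A+A\otimes I$ and $\epsilon(I)=0$. A $\mathcal{T}$-ideal of $A$ is a linear subspace $I\subset A$ such that for every $t\colon T^n\to T$ one has $t^A(a_1\otimes\dots\otimes a_n)\in I$ whenever some $a_i\in I$. For a coideal $I$, $\langle I\rangle_{\mathcal{T}}$ denotes the smallest $\mathcal{T}$-ideal containing $I$;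 it is also a coideal. If $J$ is both a coideal and a $\mathcal{T}$-ideal, the linear quotient $A/J$ is a $\mathcal{T}$-coalgebra (with the induced structure) and $A\to A/J$ is a morphism of $\mathcal{T}$-coalgebras. The subspace $I=\{f(a)-g(a)\mid a\in A\}$ is a coideal of $B$. *)

theory Defs
  imports "HOL-Algebra.Module" "HOL-Algebra.AbelCoset"
begin

section \<open>Linear algebra over a field\<close>

text \<open>Vector spaces are modules (in the sense of \<^locale>\<open>module\<close>) over a field \<open>K\<close>. The fields
  \<open>mult\<close> and \<open>one\<close> of a module record carry no information; they are \<^term>\<open>undefined\<close> below.\<close>

definition lin_maps ::
  "('k, 'r) ring_scheme \<Rightarrow> ('k, 'v, 's) module_scheme \<Rightarrow> ('k, 'w, 't) module_scheme \<Rightarrow> ('v \<Rightarrow> 'w) set"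
  where "lin_maps K V W = {\<phi> \<in> carrier V \<rightarrow> carrier W.
    (\<forall>x\<in>carrier V. \<forall>y\<in>carrier V. \<phi> (x \<oplus>\<^bsub>V\<^esub> y) = \<phi> x \<oplus>\<^bsub>W\<^esub> \<phi> y) \<and>
    (\<forall>c\<in>carrier K. \<forall>x\<in>carrier V. \<phi> (c \<odot>\<^bsub>V\<^esub> x) = c \<odot>\<^bsub>W\<^esub> \<phi> x)}"

definition ground_module :: "('k, 'r) ring_scheme \<Rightarrow> ('k, 'k) module"
  where "ground_module K = \<lparr>carrier = carrier K, mult = undefined, one = undefined,
    zero = \<zero>\<^bsub>K\<^esub>, add = add K, smult = mult K\<rparr>"

definition mod_span ::
  "('k, 'r) ring_scheme \<Rightarrow> ('k, 'v, 's) module_scheme \<Rightarrow> 'v set \<Rightarrow> 'v set"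
  where "mod_span K V S = \<Inter>{N. submodule N K V \<and> S \<subseteq> N}"

definition quot_module :: "('k, 'v, 's) module_scheme \<Rightarrow> 'v set \<Rightarrow> ('k, 'v set) module"
  where "quot_module V N = \<lparr>carrier = a_rcosets\<^bsub>V\<^esub> N, mult = undefined, one = undefined,
    zero = N, add = set_add V, smult = (\<lambda>c X. \<Union>x\<in>X. N +>\<^bsub>V\<^esub> (c \<odot>\<^bsub>V\<^esub> x))\<rparr>"

text \<open>The free module on \<open>X\<close>: finitely supported functions, supported in \<open>X\<close>.\<close>

definition free_module :: "('k, 'r) ring_scheme \<Rightarrow> 'x set \<Rightarrow> ('k, 'x \<Rightarrow> 'k) module"
  where "free_module K X = \<lparr>carrier = {u. range u \<subseteq> carrier K \<and>
      finite {x. u x \<noteq> \<zero>\<^bsub>K\<^esub>} \<and> {x. u x \<noteq> \<zero>\<^bsub>K\<^esub>} \<subseteq> X},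
    mult = undefined, one = undefined, zero = (\<lambda>_. \<zero>\<^bsub>K\<^esub>),
    add = (\<lambda>u v x. u x \<oplus>\<^bsub>K\<^esub> v x), smult = (\<lambda>c u x. c \<otimes>\<^bsub>K\<^esub> u x)\<rparr>"

definition free_gen :: "('k, 'r) ring_scheme \<Rightarrow> 'x \<Rightarrow> 'x \<Rightarrow> 'k"
  where "free_gen K x = (\<lambda>y. if y = x then \<one>\<^bsub>K\<^esub> else \<zero>\<^bsub>K\<^esub>)"


section \<open>Tensor products\<close>

text \<open>For a list \<open>Vs = [V\<^sub>1, \<dots>, V\<^sub>n]\<close> of vector spaces, \<open>tensor K Vs\<close> is
  \<open>V\<^sub>1 \<otimes> \<dots> \<otimes> V\<^sub>n\<close>: the free module on the tuples \<open>[v\<^sub>1, \<dots>, v\<^sub>n]\<close> with \<open>v\<^sub>i \<in> V\<^sub>i\<close>, modulo the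
  relations of multilinearity. In particular \<open>tensor K []\<close> is \<open>K\<close>, up to isomorphism, and
  iterated tensor products are treated as unbracketed ones.\<close>

definition multilin_relations ::
  "('k, 'r) ring_scheme \<Rightarrow> ('k, 'v, 's) module_scheme list \<Rightarrow> ('v list \<Rightarrow> 'k) set"
  where "multilin_relations K Vs =
    (let F = free_module K (listset (map carrier Vs)); \<delta> = free_gen K in
      {\<delta> (p[i := x \<oplus>\<^bsub>Vs ! i\<^esub> y]) \<ominus>\<^bsub>F\<^esub> (\<delta> (p[i := x]) \<oplus>\<^bsub>F\<^esub> \<delta> (p[i := y])) | p i x y.
        p \<in> listset (map carrier Vs) \<and> i < length Vs \<and> x \<in> carrier (Vs ! i) \<and> y \<in> carrier (Vs ! i)}
      \<union> {\<delta> (p[i := c \<odot>\<^bsub>Vs ! i\<^esub> x]) \<ominus>\<^bsub>F\<^esub> c \<odot>\<^bsub>F\<^esub> \<delta> (p[i := x]) | p i c x.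
        p \<in> listset (map carrier Vs) \<and> i < length Vs \<and> c \<in> carrier K \<and> x \<in> carrier (Vs ! i)})"

definition tensor_kernel ::
  "('k, 'r) ring_scheme \<Rightarrow> ('k, 'v, 's) module_scheme list \<Rightarrow> ('v list \<Rightarrow> 'k) set"
  where "tensor_kernel K Vs =
    mod_span K (free_module K (listset (map carrier Vs))) (multilin_relations K Vs)"

definition tensor ::
  "('k, 'r) ring_scheme \<Rightarrow> ('k, 'v, 's) module_scheme list \<Rightarrow> ('k, ('v list \<Rightarrow> 'k) set) module"
  where "tensor K Vs =
    quot_module (free_module K (listset (map carrier Vs))) (tensor_kernel K Vs)"

text \<open>The elementary tensor \<open>v\<^sub>1 \<otimes> \<dots> \<otimes> v\<^sub>n\<close>.\<close>

definition tens ::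
  "('k, 'r) ring_scheme \<Rightarrow> ('k, 'v, 's) module_scheme list \<Rightarrow> 'v list \<Rightarrow> ('v list \<Rightarrow> 'k) set"
  where "tens K Vs p =
    tensor_kernel K Vs +>\<^bsub>free_module K (listset (map carrier Vs))\<^esub> free_gen K p"

text \<open>The linear map out of a tensor product that is given on elementary tensors by a multilinear
  map \<open>\<beta>\<close> (with values in \<open>W\<close>). For multilinear \<open>\<beta>\<close> the image below is a singleton.\<close>

definition tensor_lift ::
  "('k, 'r) ring_scheme \<Rightarrow> ('k, 'w, 't) module_scheme \<Rightarrow> ('v list \<Rightarrow> 'w) \<Rightarrow> ('v list \<Rightarrow> 'k) set \<Rightarrow> 'w"
  where "tensor_lift K W \<beta> X =
    the_elem ((\<lambda>u. \<Oplus>\<^bsub>W\<^esub>p\<in>{p. u p \<noteq> \<zero>\<^bsub>K\<^esub>}. u p \<odot>\<^bsub>W\<^esub> \<beta> p) ` X)"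

text \<open>\<open>\<phi>\<^sub>1 \<otimes> \<dots> \<otimes> \<phi>\<^sub>n\<close> with codomain \<open>W\<^sub>1 \<otimes> \<dots> \<otimes> W\<^sub>n\<close>.\<close>

definition tensor_map ::
  "('k, 'r) ring_scheme \<Rightarrow> ('k, 'w, 't) module_scheme list \<Rightarrow> ('v \<Rightarrow> 'w) list \<Rightarrow>
    ('v list \<Rightarrow> 'k) set \<Rightarrow> ('w list \<Rightarrow> 'k) set"
  where "tensor_map K Ws \<phi>s =
    tensor_lift K (tensor K Ws) (\<lambda>p. tens K Ws (map2 (\<lambda>\<phi> v. \<phi> v) \<phi>s p))"


section \<open>Cocommutative coalgebras\<close>

record ('k, 'a) coalgebra = "('k, 'a) module" +
  comult :: "'a \<Rightarrow> ('a list \<Rightarrow> 'k) set"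
  counit :: "'a \<Rightarrow> 'k"

text \<open>In \<open>coassoc\<close> the two sides are \<open>(\<Delta> \<otimes> id) \<circ> \<Delta>\<close> and \<open>(id \<otimes> \<Delta>) \<circ> \<Delta>\<close>, with values in
  \<open>A \<otimes> A \<otimes> A\<close>; \<open>counit_left\<close> and \<open>counit_right\<close> use \<open>K \<otimes> A \<cong> A \<cong> A \<otimes> K\<close>.\<close>

locale coc_coalgebra = field K + module K A
  for K :: "('k, 'r) ring_scheme" and A :: "('k, 'a, 's) coalgebra_scheme" +
  assumes comult_linear: "comult A \<in> lin_maps K A (tensor K [A, A])"
    and counit_linear: "counit A \<in> lin_maps K A (ground_module K)"
    and coassoc: "\<And>a. a \<in> carrier A \<Longrightarrow>
      tensor_lift K (tensor K [A, A, A])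
        (\<lambda>p. tensor_lift K (tensor K [A, A, A])
          (\<lambda>q. tens K [A, A, A] [q ! 0, q ! 1, p ! 1]) (comult A (p ! 0))) (comult A a)
      = tensor_lift K (tensor K [A, A, A])
        (\<lambda>p. tensor_lift K (tensor K [A, A, A])
          (\<lambda>q. tens K [A, A, A] [p ! 0, q ! 0, q ! 1]) (comult A (p ! 1))) (comult A a)"
    and counit_left: "\<And>a. a \<in> carrier A \<Longrightarrow>
      tensor_lift K A (\<lambda>p. counit A (p ! 0) \<odot>\<^bsub>A\<^esub> p ! 1) (comult A a) = a"
    and counit_right: "\<And>a. a \<in> carrier A \<Longrightarrow>
      tensor_lift K A (\<lambda>p. counit A (p ! 1) \<odot>\<^bsub>A\<^esub> p ! 0) (comult A a) = a"
    and cocomm: "\<And>a. a \<in> carrier A \<Longrightarrow>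
      tensor_lift K (tensor K [A, A]) (\<lambda>p. tens K [A, A] [p ! 1, p ! 0]) (comult A a) = comult A a"

definition coalg_homs ::
  "('k, 'r) ring_scheme \<Rightarrow> ('k, 'a, 's) coalgebra_scheme \<Rightarrow> ('k, 'b, 't) coalgebra_scheme \<Rightarrow> ('a \<Rightarrow> 'b) set"
  where "coalg_homs K A B = {\<phi> \<in> lin_maps K A B. \<forall>a\<in>carrier A.
    tensor_map K [B, B] [\<phi>, \<phi>] (comult A a) = comult B (\<phi> a) \<and> counit B (\<phi> a) = counit A a}"

text \<open>The iterated comultiplication \<open>A \<rightarrow> A \<otimes> \<dots> \<otimes> A\<close> with \<open>n\<close> factors: the counit for \<open>n = 0\<close>,
  and \<open>(id \<otimes> \<Delta>\<^sub>n) \<circ> \<Delta>\<close> for \<open>Suc n\<close>.\<close>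

primrec iter_comult ::
  "('k, 'r) ring_scheme \<Rightarrow> ('k, 'a, 's) coalgebra_scheme \<Rightarrow> nat \<Rightarrow> 'a \<Rightarrow> ('a list \<Rightarrow> 'k) set"
  where
    "iter_comult K A 0 = (\<lambda>a. counit A a \<odot>\<^bsub>tensor K ([] :: ('k, 'a, 's) coalgebra_scheme list)\<^esub>
      tens K ([] :: ('k, 'a, 's) coalgebra_scheme list) [])"
  | "iter_comult K A (Suc n) = (\<lambda>a. tensor_lift K (tensor K (replicate (Suc n) A))
      (\<lambda>p. tensor_lift K (tensor K (replicate (Suc n) A))
        (\<lambda>q. tens K (replicate (Suc n) A) (p ! 0 # q)) (iter_comult K A n (p ! 1)))
      (comult A a))"

text \<open>Finite products of cocommutative coalgebras are tensor products (with projections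
  \<open>\<epsilon> \<otimes> \<dots> \<otimes> id \<otimes> \<dots> \<otimes> \<epsilon>\<close>); \<open>pairing K P Cs \<phi>s\<close> is the morphism \<open>P \<rightarrow> C\<^sub>1 \<otimes> \<dots> \<otimes> C\<^sub>n\<close> whose
  components are the morphisms \<open>\<phi>\<^sub>i : P \<rightarrow> C\<^sub>i\<close>, that is \<open>(\<phi>\<^sub>1 \<otimes> \<dots> \<otimes> \<phi>\<^sub>n) \<circ> \<Delta>\<^sub>n\<close>.\<close>

definition pairing ::
  "('k, 'r) ring_scheme \<Rightarrow> ('k, 'a, 's) coalgebra_scheme \<Rightarrow> ('k, 'b, 't) coalgebra_scheme list \<Rightarrow>
    ('a \<Rightarrow> 'b) list \<Rightarrow> 'a \<Rightarrow> ('b list \<Rightarrow> 'k) set"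
  where "pairing K P Cs \<phi>s x = tensor_map K Cs \<phi>s (iter_comult K P (length Cs) x)"

definition quot_coalgebra ::
  "('k, 'r) ring_scheme \<Rightarrow> ('k, 'a, 's) coalgebra_scheme \<Rightarrow> 'a set \<Rightarrow> ('k, 'a set) coalgebra"
  where "quot_coalgebra K A J = (let V = quot_module A J; \<pi> = (\<lambda>a. J +>\<^bsub>A\<^esub> a) in
    \<lparr>carrier = carrier V, mult = mult V, one = one V, zero = zero V, add = add V, smult = smult V,
     comult = (\<lambda>X. the_elem ((\<lambda>a. tensor_map K [V, V] [\<pi>, \<pi>] (comult A a)) ` X)),
     counit = (\<lambda>X. the_elem (counit A ` X))\<rparr>)"


section \<open>Lawvere theories\<close>

record ('o, 'm) category =
  obj :: "'o set"
  arr :: "'m set"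
  src :: "'m \<Rightarrow> 'o"
  tgt :: "'m \<Rightarrow> 'o"
  idt :: "'o \<Rightarrow> 'm"
  cmp :: "'m \<Rightarrow> 'm \<Rightarrow> 'm"

definition homset :: "('o, 'm, 's) category_scheme \<Rightarrow> 'o \<Rightarrow> 'o \<Rightarrow> 'm set"
  where "homset C X Y = {u \<in> arr C. src C u = X \<and> tgt C u = Y}"

text \<open>\<open>cmp C v u\<close> is ``\<open>v\<close> after \<open>u\<close>''.\<close>

locale category =
  fixes C :: "('o, 'm, 's) category_scheme"
  assumes src_obj: "\<And>u. u \<in> arr C \<Longrightarrow> src C u \<in> obj C"
    and tgt_obj: "\<And>u. u \<in> arr C \<Longrightarrow> tgt C u \<in> obj C"
    and idt_hom: "\<And>X. X \<in> obj C \<Longrightarrow> idt C X \<in> homset C X X"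
    and cmp_hom: "\<And>u v X Y Z. u \<in> homset C X Y \<Longrightarrow> v \<in> homset C Y Z \<Longrightarrow> cmp C v u \<in> homset C X Z"
    and cmp_assoc: "\<And>u v w X Y Z W. u \<in> homset C X Y \<Longrightarrow> v \<in> homset C Y Z \<Longrightarrow> w \<in> homset C Z W \<Longrightarrow>
      cmp C w (cmp C v u) = cmp C (cmp C w v) u"
    and cmp_idt_left: "\<And>u X Y. u \<in> homset C X Y \<Longrightarrow> cmp C (idt C Y) u = u"
    and cmp_idt_right: "\<And>u X Y. u \<in> homset C X Y \<Longrightarrow> cmp C u (idt C X) = u"

definition is_product :: "('o, 'm, 's) category_scheme \<Rightarrow> 'o list \<Rightarrow> 'o \<Rightarrow> 'm list \<Rightarrow> bool"
  where "is_product C Xs P ps \<longleftrightarrow> set Xs \<subseteq> obj C \<and> P \<in> obj C \<and>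
    list_all2 (\<lambda>p X. p \<in> homset C P X) ps Xs \<and>
    (\<forall>Y\<in>obj C. \<forall>us. list_all2 (\<lambda>u X. u \<in> homset C Y X) us Xs \<longrightarrow>
      (\<exists>!h. h \<in> homset C Y P \<and> map (\<lambda>p. cmp C p h) ps = us))"

text \<open>\<open>Tpow n\<close> is the object \<open>T\<^sup>n\<close>, with projections \<open>Tproj n\<close> to \<open>T = Tpow 1\<close>. Existence of all finite
  products follows, since \<open>T\<^sup>m\<^sup>+\<^sup>n\<close> is a product of \<open>T\<^sup>m\<close> and \<open>T\<^sup>n\<close>.\<close>

record ('o, 'm) lawvere = "('o, 'm) category" +
  Tpow :: "nat \<Rightarrow> 'o"
  Tproj :: "nat \<Rightarrow> 'm list"

locale lawvere_theory = category Th for Th :: "('o, 'm, 's) lawvere_scheme" +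
  assumes obj_pow: "obj Th = range (Tpow Th)"
    and pow_product: "\<And>n. is_product Th (replicate n (Tpow Th 1)) (Tpow Th n) (Tproj Th n)"
    and proj_one: "Tproj Th 1 = [idt Th (Tpow Th 1)]"


section \<open>Coalgebras of a Lawvere theory\<close>

text \<open>A functor to coalgebras. Its values all have elements in one type \<open>'a\<close>, which is no loss of
  generality as the theory is small. Only the restriction of \<open>on_arr F u\<close> to the carrier of the
  value at the source of \<open>u\<close> is meaningful.\<close>

record ('o, 'm, 'k, 'a) coalg_functor =
  on_obj :: "'o \<Rightarrow> ('k, 'a) coalgebra"
  on_arr :: "'m \<Rightarrow> 'a \<Rightarrow> 'a"

text \<open>A finite-product-preserving functor: the comparison map from the value at any finite product
  to the product of the values is an isomorphism. As this map is a coalgebra morphism, bijectivity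
  suffices for that.\<close>

locale T_coalgebra = lawvere_theory Th + field K
  for K :: "('k, 'r) ring_scheme" and Th :: "('o, 'm, 's) lawvere_scheme"
    and F :: "('o, 'm, 'k, 'a) coalg_functor" +
  assumes on_obj_coalgebra: "\<And>X. X \<in> obj Th \<Longrightarrow> coc_coalgebra K (on_obj F X)"
    and on_arr_hom: "\<And>u X Y. u \<in> homset Th X Y \<Longrightarrow> on_arr F u \<in> coalg_homs K (on_obj F X) (on_obj F Y)"
    and on_arr_idt: "\<And>X x. X \<in> obj Th \<Longrightarrow> x \<in> carrier (on_obj F X) \<Longrightarrow> on_arr F (idt Th X) x = x"
    and on_arr_cmp: "\<And>u v X Y Z x. u \<in> homset Th X Y \<Longrightarrow> v \<in> homset Th Y Z \<Longrightarrow>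
      x \<in> carrier (on_obj F X) \<Longrightarrow> on_arr F (cmp Th v u) x = on_arr F v (on_arr F u x)"
    and preserves_products: "\<And>Xs P ps. is_product Th Xs P ps \<Longrightarrow>
      bij_betw (pairing K (on_obj F P) (map (on_obj F) Xs) (map (on_arr F) ps))
        (carrier (on_obj F P)) (carrier (tensor K (map (on_obj F) Xs)))"

definition nat_trans ::
  "('k, 'r) ring_scheme \<Rightarrow> ('o, 'm, 's) lawvere_scheme \<Rightarrow> ('o, 'm, 'k, 'a) coalg_functor \<Rightarrow>
    ('o, 'm, 'k, 'b) coalg_functor \<Rightarrow> ('o \<Rightarrow> 'a \<Rightarrow> 'b) set"
  where "nat_trans K Th F G = {\<eta>.
    (\<forall>X\<in>obj Th. \<eta> X \<in> coalg_homs K (on_obj F X) (on_obj G X)) \<and>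
    (\<forall>X Y. \<forall>u\<in>homset Th X Y. \<forall>x\<in>carrier (on_obj F X). \<eta> Y (on_arr F u x) = on_arr G u (\<eta> X x))}"

text \<open>Equality of natural transformations out of \<open>F\<close>, i.e. on the carriers of the values of \<open>F\<close>.\<close>

definition nat_trans_eq ::
  "('o, 'm, 's) lawvere_scheme \<Rightarrow> ('o, 'm, 'k, 'a) coalg_functor \<Rightarrow> ('o \<Rightarrow> 'a \<Rightarrow> 'b) \<Rightarrow> ('o \<Rightarrow> 'a \<Rightarrow> 'b) \<Rightarrow> bool"
  where "nat_trans_eq Th F \<eta> \<theta> \<longleftrightarrow> (\<forall>X\<in>obj Th. \<forall>x\<in>carrier (on_obj F X). \<eta> X x = \<theta> X x)"

text \<open>\<open>q : B \<rightarrow> Q\<close> is a coequalizer of \<open>f, g : A \<rightarrow> B\<close> in \<open>[Th, Coalg\<^sub>c\<^sub>o\<^sub>c]\<close>, tested on all objects with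
  elements in the type \<open>'c\<close>.\<close>

definition is_coequalizer ::
  "'c itself \<Rightarrow> ('k, 'r) ring_scheme \<Rightarrow> ('o, 'm, 's) lawvere_scheme \<Rightarrow>
    ('o, 'm, 'k, 'a) coalg_functor \<Rightarrow> ('o, 'm, 'k, 'b) coalg_functor \<Rightarrow>
    ('o \<Rightarrow> 'a \<Rightarrow> 'b) \<Rightarrow> ('o \<Rightarrow> 'a \<Rightarrow> 'b) \<Rightarrow> ('o, 'm, 'k, 'd) coalg_functor \<Rightarrow> ('o \<Rightarrow> 'b \<Rightarrow> 'd) \<Rightarrow> bool"
  where "is_coequalizer (_ :: 'c itself) K Th A B f g Q q \<longleftrightarrow>
    T_coalgebra K Th Q \<and> q \<in> nat_trans K Th B Q \<and>
    nat_trans_eq Th A (\<lambda>X. q X \<circ> f X) (\<lambda>X. q X \<circ> g X) \<and>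
    (\<forall>(C :: ('o, 'm, 'k, 'c) coalg_functor) h.
      T_coalgebra K Th C \<longrightarrow> h \<in> nat_trans K Th B C \<longrightarrow>
      nat_trans_eq Th A (\<lambda>X. h X \<circ> f X) (\<lambda>X. h X \<circ> g X) \<longrightarrow>
      (\<exists>k \<in> nat_trans K Th Q C. nat_trans_eq Th B (\<lambda>X. k X \<circ> q X) h \<and>
        (\<forall>k' \<in> nat_trans K Th Q C. nat_trans_eq Th B (\<lambda>X. k' X \<circ> q X) h \<longrightarrow> nat_trans_eq Th Q k' k)))"

abbreviation underlying ::
  "('o, 'm, 's) lawvere_scheme \<Rightarrow> ('o, 'm, 'k, 'a) coalg_functor \<Rightarrow> ('k, 'a) coalgebra"
  where "underlying Th F \<equiv> on_obj F (Tpow Th 1)"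

text \<open>\<open>t\<^sup>A(a\<^sub>1 \<otimes> \<dots> \<otimes> a\<^sub>n)\<close> for \<open>t : T\<^sup>n \<rightarrow> T\<close>, where \<open>A\<close> is the underlying coalgebra of \<open>F\<close>: the value of
  \<open>F\<close> at \<open>t\<close>, transported along the isomorphism between \<open>F(T\<^sup>n)\<close> and \<open>A \<otimes> \<dots> \<otimes> A\<close>.\<close>

definition T_op ::
  "('k, 'r) ring_scheme \<Rightarrow> ('o, 'm, 's) lawvere_scheme \<Rightarrow> ('o, 'm, 'k, 'a) coalg_functor \<Rightarrow>
    nat \<Rightarrow> 'm \<Rightarrow> 'a list \<Rightarrow> 'a"
  where "T_op K Th F n t as = (let As = replicate n (underlying Th F) in
    on_arr F t (inv_into (carrier (on_obj F (Tpow Th n)))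
      (pairing K (on_obj F (Tpow Th n)) As (map (on_arr F) (Tproj Th n)))
      (tens K As as)))"

definition T_ideal ::
  "('k, 'r) ring_scheme \<Rightarrow> ('o, 'm, 's) lawvere_scheme \<Rightarrow> ('o, 'm, 'k, 'a) coalg_functor \<Rightarrow> 'a set \<Rightarrow> bool"
  where "T_ideal K Th F J \<longleftrightarrow> submodule J K (underlying Th F) \<and>
    (\<forall>n. \<forall>t\<in>homset Th (Tpow Th n) (Tpow Th 1). \<forall>as.
      length as = n \<and> set as \<subseteq> carrier (underlying Th F) \<and> set as \<inter> J \<noteq> {} \<longrightarrow> T_op K Th F n t as \<in> J)"

definition T_ideal_hull ::
  "('k, 'r) ring_scheme \<Rightarrow> ('o, 'm, 's) lawvere_scheme \<Rightarrow> ('o, 'm, 'k, 'a) coalg_functor \<Rightarrow> 'a set \<Rightarrow> 'a set"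
  where "T_ideal_hull K Th F I = \<Inter>{J. T_ideal K Th F J \<and> I \<subseteq> J}"

text \<open>\<open>q : F \<rightarrow> Q\<close> is the linear quotient by \<open>J\<close>: the underlying coalgebra of \<open>Q\<close> is the quotient of
  that of \<open>F\<close> by \<open>J\<close>, with the induced structure, and \<open>q\<close> is the projection. That \<open>q\<close> is a morphism
  determines the operations of \<open>Q\<close>.\<close>

definition is_T_quotient ::
  "('k, 'r) ring_scheme \<Rightarrow> ('o, 'm, 's) lawvere_scheme \<Rightarrow> ('o, 'm, 'k, 'a) coalg_functor \<Rightarrow> 'a set \<Rightarrow>
    ('o, 'm, 'k, 'a set) coalg_functor \<Rightarrow> ('o \<Rightarrow> 'a \<Rightarrow> 'a set) \<Rightarrow> bool"
  where "is_T_quotient K Th F J Q q \<longleftrightarrow>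
    T_coalgebra K Th Q \<and> q \<in> nat_trans K Th F Q \<and>
    underlying Th Q = quot_coalgebra K (underlying Th F) J \<and>
    (\<forall>a\<in>carrier (underlying Th F). q (Tpow Th 1) a = J +>\<^bsub>underlying Th F\<^esub> a)"

end

theory Submission
  imports Defs
begin

text \<open>
  The universal property is the formal half. A morphism \<open>h : B \<rightarrow> C\<close> is determined by its component at
  \<open>T\<close>, because the pairing identifies \<open>C(T\<^sup>n)\<close> with the \<open>n\<close>-th tensor power of \<open>C(T)\<close>. The kernel of this
  component is a \<open>\<T>\<close>-ideal (\<open>T_ideal_kernel\<close>), so if \<open>h \<circ> f = h \<circ> g\<close> then it contains the \<open>\<T>\<close>-ideal \<open>J\<close>
  generated by \<open>I\<close>, and \<open>h\<close> factors through \<open>B/J\<close> at \<open>T\<close>. The factorization extends to all objects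
  (\<open>nat_trans_factor\<close>): the quotient map at \<open>T\<^sup>n\<close> is a tensor power of the one at \<open>T\<close>, and right exactness
  of the tensor product (\<open>tensor_lift_kernel\<close>) controls its kernel.

  The substance is in the existence of the quotient as a product-preserving functor. It rests on two
  computations with iterated comultiplications.

  First, \<open>F(P)\<close> for a product \<open>P\<close> of \<open>X\<^sub>1, \<dots>, X\<^sub>n\<close> has the comultiplication of a tensor product, that is,
  \<open>\<Delta>(a\<^sub>1 \<otimes> \<dots> \<otimes> a\<^sub>n)\<close> is formed entrywise (\<open>cosum_sw_sw\<close>, \<open>cosum_prod_elt\<close>); this is where
  cocommutativity enters. Consequently the elements \<open>x\<close> of a \<open>\<T>\<close>-ideal \<open>J\<close> with \<open>\<epsilon>(x) = 0\<close> and
  \<open>\<Delta> x \<in> J \<otimes> F(T) + F(T) \<otimes> J\<close> form a \<open>\<T>\<close>-ideal (\<open>T_ideal_coid_elts\<close>). For \<open>J\<close> generated by \<open>I\<close> it contains \<open>I\<close>,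
  as \<open>f\<close> and \<open>g\<close> are coalgebra maps, so it is \<open>J\<close>: thus \<open>J\<close> is a coideal.

  Second, coassociativity makes it possible to regroup factors in blocks (\<open>sw_blocks\<close>), which identifies a product
  of powers of \<open>T\<close> with a power of \<open>T\<close> compatibly with \<open>F\<close> (\<open>product_of_powers\<close>). Thereby the defining
  property of a \<open>\<T>\<close>-ideal, which is about \<open>T\<^sup>n \<rightarrow> T\<close>, extends to all finite products \<open>P \<rightarrow> T\<close>
  (\<open>T_ideal_product\<close>).

  The quotient functor sends \<open>X\<close> to \<open>F(X)/D(X)\<close>, where \<open>D(X)\<close> is the largest coideal of \<open>F(X)\<close> that all
  arrows \<open>X \<rightarrow> T\<close> send into \<open>J\<close>. This is functorial by construction, and \<open>D(T) = J\<close>. It preserves products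
  because the kernel of \<open>F(P) \<rightarrow> F(X\<^sub>1)/D(X\<^sub>1) \<otimes> \<dots> \<otimes> F(X\<^sub>n)/D(X\<^sub>n)\<close> is contained in \<open>D(P)\<close>
  (\<open>ideal_at_product\<close>): by the first computation the kernel is a coideal, and by the second one it is
  sent into \<open>J\<close>.

  Once the universal property of the tensor product is established, equations between tensors are
  treated as equations between values of multilinear maps, in Sweedler notation.
\<close>


section \<open>Linear maps, quotients and spans\<close>

lemma lin_mapsI:
  assumes "\<And>x. x \<in> carrier V \<Longrightarrow> \<phi> x \<in> carrier W"
    and "\<And>x y. x \<in> carrier V \<Longrightarrow> y \<in> carrier V \<Longrightarrow> \<phi> (x \<oplus>\<^bsub>V\<^esub> y) = \<phi> x \<oplus>\<^bsub>W\<^esub> \<phi> y"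
    and "\<And>c x. c \<in> carrier K \<Longrightarrow> x \<in> carrier V \<Longrightarrow> \<phi> (c \<odot>\<^bsub>V\<^esub> x) = c \<odot>\<^bsub>W\<^esub> \<phi> x"
  shows "\<phi> \<in> lin_maps K V W"
  using assms unfolding lin_maps_def by blast

lemma lin_maps_closed: "\<phi> \<in> lin_maps K V W \<Longrightarrow> x \<in> carrier V \<Longrightarrow> \<phi> x \<in> carrier W"
  unfolding lin_maps_def by blast

lemma lin_maps_add:
  "\<phi> \<in> lin_maps K V W \<Longrightarrow> x \<in> carrier V \<Longrightarrow> y \<in> carrier V \<Longrightarrow> \<phi> (x \<oplus>\<^bsub>V\<^esub> y) = \<phi> x \<oplus>\<^bsub>W\<^esub> \<phi> y"
  unfolding lin_maps_def by blast

lemma lin_maps_smult: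
  "\<phi> \<in> lin_maps K V W \<Longrightarrow> c \<in> carrier K \<Longrightarrow> x \<in> carrier V \<Longrightarrow> \<phi> (c \<odot>\<^bsub>V\<^esub> x) = c \<odot>\<^bsub>W\<^esub> \<phi> x"
  unfolding lin_maps_def by blast

lemma module_cring: "module K V \<Longrightarrow> cring K"
  by (simp add: module_def)

lemma module_abelian_group: "module K V \<Longrightarrow> abelian_group V"
  by (simp add: module_def)

lemma lin_maps_zero:
  assumes "module K V" "module K W" "\<phi> \<in> lin_maps K V W"
  shows "\<phi> \<zero>\<^bsub>V\<^esub> = \<zero>\<^bsub>W\<^esub>"
proof -
  interpret V: module K V by fact
  interpret W: module K W by fact
  have "\<phi> (\<zero>\<^bsub>K\<^esub> \<odot>\<^bsub>V\<^esub> \<zero>\<^bsub>V\<^esub>) = \<zero>\<^bsub>K\<^esub> \<odot>\<^bsub>W\<^esub> \<phi> \<zero>\<^bsub>V\<^esub>"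
    by (rule lin_maps_smult[OF assms(3)]) auto
  then show ?thesis
    using lin_maps_closed[OF assms(3)] by simp
qed

lemma module_minus_eq:
  assumes "module K V" "x \<in> carrier V" "y \<in> carrier V"
  shows "x \<ominus>\<^bsub>V\<^esub> y = x \<oplus>\<^bsub>V\<^esub> (\<ominus>\<^bsub>K\<^esub> \<one>\<^bsub>K\<^esub>) \<odot>\<^bsub>V\<^esub> y"
proof -
  interpret V: module K V by fact
  show ?thesis using assms by (simp add: V.smult_l_minus a_minus_def)
qed

lemma lin_maps_minus:
  assumes "module K V" "module K W" "\<phi> \<in> lin_maps K V W" "x \<in> carrier V" "y \<in> carrier V"
  shows "\<phi> (x \<ominus>\<^bsub>V\<^esub> y) = \<phi> x \<ominus>\<^bsub>W\<^esub> \<phi> y"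
proof -
  interpret V: module K V by fact
  interpret W: module K W by fact
  show ?thesis
    using assms lin_maps_closed[OF assms(3)]
    by (simp add: module_minus_eq[OF assms(1)] module_minus_eq[OF assms(2)]
        lin_maps_add[OF assms(3)] lin_maps_smult[OF assms(3)])
qed

lemma module_minus_eq_zero_iff:
  assumes "module K V" "x \<in> carrier V" "y \<in> carrier V"
  shows "x \<ominus>\<^bsub>V\<^esub> y = \<zero>\<^bsub>V\<^esub> \<longleftrightarrow> x = y"
proof -
  interpret V: module K V by fact
  show ?thesis using assms by (simp add: V.M.minus_eq) (metis V.M.add.inv_closed V.M.minus_equality V.M.minus_minus V.M.r_neg)
qed

lemma lin_maps_comp:
  "\<phi> \<in> lin_maps K V W \<Longrightarrow> \<psi> \<in> lin_maps K W U \<Longrightarrow> (\<lambda>x. \<psi> (\<phi> x)) \<in> lin_maps K V U"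
  unfolding lin_maps_def Pi_def by simp

lemma lin_maps_cong:
  assumes "module K V" "\<phi> \<in> lin_maps K V W" "\<And>x. x \<in> carrier V \<Longrightarrow> \<psi> x = \<phi> x"
  shows "\<psi> \<in> lin_maps K V W"
proof -
  interpret V: module K V by fact
  show ?thesis
    using assms(2,3) unfolding lin_maps_def Pi_def by simp
qed

lemma lin_maps_descend:
  assumes \<pi>: "\<pi> \<in> lin_maps K V V'" and surj: "\<pi> ` carrier V = carrier V'"
    and l: "(\<lambda>x. \<psi> (\<pi> x)) \<in> lin_maps K V W"
  shows "\<psi> \<in> lin_maps K V' W"
proof (rule lin_mapsI)
  have rep: "\<exists>x\<in>carrier V. y = \<pi> x" if "y \<in> carrier V'" for y
    using that surj by (metis imageE)
  show "\<psi> y \<in> carrier W" if "y \<in> carrier V'" for y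
    using rep[OF that] lin_maps_closed[OF l] by auto
  show "\<psi> (y \<oplus>\<^bsub>V'\<^esub> y') = \<psi> y \<oplus>\<^bsub>W\<^esub> \<psi> y'" if "y \<in> carrier V'" "y' \<in> carrier V'" for y y'
  proof -
    obtain x x' where "x \<in> carrier V" "x' \<in> carrier V" "y = \<pi> x" "y' = \<pi> x'"
      using rep \<open>y \<in> carrier V'\<close> \<open>y' \<in> carrier V'\<close> by blast
    then show ?thesis using lin_maps_add[OF l, of x x'] lin_maps_add[OF \<pi>, of x x'] by simp
  qed
  show "\<psi> (c \<odot>\<^bsub>V'\<^esub> y) = c \<odot>\<^bsub>W\<^esub> \<psi> y" if "c \<in> carrier K" "y \<in> carrier V'" for c y
  proof -
    obtain x where "x \<in> carrier V" "y = \<pi> x" using rep \<open>y \<in> carrier V'\<close> by blast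
    then show ?thesis
      using lin_maps_smult[OF l \<open>c \<in> carrier K\<close>, of x] lin_maps_smult[OF \<pi> \<open>c \<in> carrier K\<close>, of x] by simp
  qed
qed

lemma lin_maps_id: "(\<lambda>x. x) \<in> lin_maps K V V"
  by (rule lin_mapsI) auto

lemma lin_maps_const_zero: "module K W \<Longrightarrow> (\<lambda>x. \<zero>\<^bsub>W\<^esub>) \<in> lin_maps K V W"
proof -
  assume "module K W"
  then interpret W: module K W .
  show ?thesis by (rule lin_mapsI) auto
qed

lemma lin_maps_plus:
  assumes "module K W" "\<phi> \<in> lin_maps K V W" "\<psi> \<in> lin_maps K V W"
  shows "(\<lambda>x. \<phi> x \<oplus>\<^bsub>W\<^esub> \<psi> x) \<in> lin_maps K V W"
proof -
  interpret W: module K W by fact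
  show ?thesis
    using lin_maps_closed[OF assms(2)] lin_maps_closed[OF assms(3)]
    by (intro lin_mapsI) (simp_all add: lin_maps_add[OF assms(2)] lin_maps_add[OF assms(3)]
        lin_maps_smult[OF assms(2)] lin_maps_smult[OF assms(3)] W.smult_r_distr W.M.add.m_ac)
qed

lemma lin_maps_scale:
  assumes "module K W" "\<phi> \<in> lin_maps K V W" "c \<in> carrier K"
  shows "(\<lambda>x. c \<odot>\<^bsub>W\<^esub> \<phi> x) \<in> lin_maps K V W"
proof -
  interpret W: module K W by fact
  show ?thesis
    using lin_maps_closed[OF assms(2)] assms(3)
    by (intro lin_mapsI) (simp_all add: lin_maps_add[OF assms(2)]
        lin_maps_smult[OF assms(2)] W.smult_r_distr W.smult_assoc1[symmetric] W.R.m_comm)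
qed

lemma submodule_kernel:
  assumes "module K V" "module K W" "\<phi> \<in> lin_maps K V W"
  shows "submodule {x \<in> carrier V. \<phi> x = \<zero>\<^bsub>W\<^esub>} K V"
proof -
  interpret V: module K V by fact
  interpret W: module K W by fact
  have neg: "\<ominus>\<^bsub>V\<^esub> x = (\<ominus>\<^bsub>K\<^esub> \<one>\<^bsub>K\<^esub>) \<odot>\<^bsub>V\<^esub> x" if "x \<in> carrier V" for x
    using that by (simp add: V.smult_l_minus)
  show ?thesis
    by (rule V.submoduleI)
      (auto simp: neg lin_maps_zero[OF assms] lin_maps_add[OF assms(3)] lin_maps_smult[OF assms(3)])
qed

lemma submodule_subset: "submodule N K V \<Longrightarrow> x \<in> N \<Longrightarrow> x \<in> carrier V"
  by (auto dest!: submodule.axioms(1) subgroup.subset)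

lemma submodule_zero: "submodule N K V \<Longrightarrow> \<zero>\<^bsub>V\<^esub> \<in> N"
  by (auto dest!: submodule.axioms(1) subgroup.one_closed)

lemma submodule_add: "submodule N K V \<Longrightarrow> x \<in> N \<Longrightarrow> y \<in> N \<Longrightarrow> x \<oplus>\<^bsub>V\<^esub> y \<in> N"
  using subgroup.m_closed[OF submodule.axioms(1)] by fastforce

lemma submodule_smult: "submodule N K V \<Longrightarrow> c \<in> carrier K \<Longrightarrow> x \<in> N \<Longrightarrow> c \<odot>\<^bsub>V\<^esub> x \<in> N"
  by (rule submodule.smult_closed)

lemma submoduleI':
  assumes "module K V" "N \<subseteq> carrier V" "\<zero>\<^bsub>V\<^esub> \<in> N"
    and "\<And>x y. x \<in> N \<Longrightarrow> y \<in> N \<Longrightarrow> x \<oplus>\<^bsub>V\<^esub> y \<in> N"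
    and "\<And>c x. c \<in> carrier K \<Longrightarrow> x \<in> N \<Longrightarrow> c \<odot>\<^bsub>V\<^esub> x \<in> N"
  shows "submodule N K V"
proof -
  interpret V: module K V by fact
  have "\<ominus>\<^bsub>V\<^esub> x = (\<ominus>\<^bsub>K\<^esub> \<one>\<^bsub>K\<^esub>) \<odot>\<^bsub>V\<^esub> x" if "x \<in> N" for x
    using that assms(2) by (simp add: V.smult_l_minus subset_iff)
  then show ?thesis
    using assms by (intro V.submoduleI) auto
qed

lemma submodule_Inter:
  assumes "module K V" "\<A> \<noteq> {}" "\<And>N. N \<in> \<A> \<Longrightarrow> submodule N K V"
  shows "submodule (\<Inter>\<A>) K V"
proof (rule submoduleI'[OF assms(1)])
  obtain N where "N \<in> \<A>" using assms(2) by auto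
  then show "\<Inter>\<A> \<subseteq> carrier V"
    using submodule_subset[OF assms(3)] by auto
  show "\<zero>\<^bsub>V\<^esub> \<in> \<Inter>\<A>"
    using submodule_zero[OF assms(3)] by simp
  show "x \<oplus>\<^bsub>V\<^esub> y \<in> \<Inter>\<A>" if "x \<in> \<Inter>\<A>" "y \<in> \<Inter>\<A>" for x y
    using that submodule_add[OF assms(3)] by simp
  show "c \<odot>\<^bsub>V\<^esub> x \<in> \<Inter>\<A>" if "c \<in> carrier K" "x \<in> \<Inter>\<A>" for c x
    using that submodule_smult[OF assms(3)] by simp
qed

lemma abelian_subgroup_submodule:
  assumes "module K V" "submodule N K V"
  shows "abelian_subgroup N V"
  using assms by (intro abelian_subgroupI3 additive_subgroup.intro submodule.axioms(1)
      module_abelian_group)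

text \<open>The structure maps of quotients, and \<^const>\<open>tensor_lift\<close>, are defined by taking the image of a
  coset and extracting its only element. This is where the image is seen to be a singleton.\<close>

lemma lin_maps_coset_image:
  assumes "module K V" "module K W" "submodule N K V" and "\<phi> \<in> lin_maps K V W"
    and "\<And>x. x \<in> N \<Longrightarrow> \<phi> x = \<zero>\<^bsub>W\<^esub>" and "x \<in> carrier V"
  shows "\<phi> ` (N +>\<^bsub>V\<^esub> x) = {\<phi> x}"
proof -
  interpret V: module K V by fact
  interpret W: module K W by fact
  have "\<phi> (h \<oplus>\<^bsub>V\<^esub> x) = \<phi> x" if "h \<in> N" for h
    using that assms(5,6) lin_maps_add[OF assms(4)] lin_maps_closed[OF assms(4)]
      submodule_subset[OF assms(3)] by simp
  moreover have "\<phi> x \<in> \<phi> ` (N +>\<^bsub>V\<^esub> x)"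
    using submodule_zero[OF assms(3)] assms(6)
    unfolding a_r_coset_def' image_def by force
  ultimately show ?thesis
    unfolding a_r_coset_def' by auto
qed

lemma quot_module_simps:
  "carrier (quot_module V N) = a_rcosets\<^bsub>V\<^esub> N"
  "zero (quot_module V N) = N"
  "add (quot_module V N) = set_add V"
  "smult (quot_module V N) = (\<lambda>c X. \<Union>x\<in>X. N +>\<^bsub>V\<^esub> (c \<odot>\<^bsub>V\<^esub> x))"
  by (simp_all add: quot_module_def)

context
  fixes K :: "('k, 'r) ring_scheme" and V :: "('k, 'v, 's) module_scheme" and N :: "'v set"
  assumes V: "module K V" and N: "submodule N K V"
begin

interpretation V: module K V by (rule V)
interpretation N: abelian_subgroup N V by (rule abelian_subgroup_submodule[OF V N])

lemma quot_module_carrier: "carrier (quot_module V N) = (\<lambda>x. N +>\<^bsub>V\<^esub> x) ` carrier V"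
  by (auto simp: quot_module_simps A_RCOSETS_def')

lemma coset_add:
  "x \<in> carrier V \<Longrightarrow> y \<in> carrier V \<Longrightarrow>
    (N +>\<^bsub>V\<^esub> x) \<oplus>\<^bsub>quot_module V N\<^esub> (N +>\<^bsub>V\<^esub> y) = N +>\<^bsub>V\<^esub> (x \<oplus>\<^bsub>V\<^esub> y)"
  by (simp add: quot_module_simps N.a_rcos_sum)

lemma coset_eq_iff:
  assumes "x \<in> carrier V" "y \<in> carrier V"
  shows "N +>\<^bsub>V\<^esub> x = N +>\<^bsub>V\<^esub> y \<longleftrightarrow> x \<ominus>\<^bsub>V\<^esub> y \<in> N"
proof -
  have "x \<ominus>\<^bsub>V\<^esub> y \<in> N \<longleftrightarrow> x \<in> N +>\<^bsub>V\<^esub> y"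
    using N.a_rcos_module[OF assms(2,1)] by (simp add: V.M.minus_eq)
  then show ?thesis
    using assms N.a_rcos_self N.a_repr_independence' by metis
qed

lemma coset_smult:
  assumes "c \<in> carrier K" "x \<in> carrier V"
  shows "c \<odot>\<^bsub>quot_module V N\<^esub> (N +>\<^bsub>V\<^esub> x) = N +>\<^bsub>V\<^esub> (c \<odot>\<^bsub>V\<^esub> x)"
proof -
  have "N +>\<^bsub>V\<^esub> (c \<odot>\<^bsub>V\<^esub> z) = N +>\<^bsub>V\<^esub> (c \<odot>\<^bsub>V\<^esub> x)" if z: "z \<in> N +>\<^bsub>V\<^esub> x" for z
  proof -
    have zc: "z \<in> carrier V"
      using z N.a_elemrcos_carrier[OF assms(2)] by simp
    have "N +>\<^bsub>V\<^esub> z = N +>\<^bsub>V\<^esub> x"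
      using N.a_repr_independence'[OF z] assms(2) by simp
    then have "z \<ominus>\<^bsub>V\<^esub> x \<in> N"
      using coset_eq_iff zc assms by simp
    then have "c \<odot>\<^bsub>V\<^esub> (z \<ominus>\<^bsub>V\<^esub> x) \<in> N"
      using submodule_smult[OF N] assms by simp
    also have "c \<odot>\<^bsub>V\<^esub> (z \<ominus>\<^bsub>V\<^esub> x) = c \<odot>\<^bsub>V\<^esub> z \<ominus>\<^bsub>V\<^esub> c \<odot>\<^bsub>V\<^esub> x"
      using zc assms by (simp add: a_minus_def V.smult_r_distr V.smult_r_minus)
    finally show ?thesis using coset_eq_iff zc assms by simp
  qed
  then have "(\<Union>z\<in>N +>\<^bsub>V\<^esub> x. N +>\<^bsub>V\<^esub> (c \<odot>\<^bsub>V\<^esub> z)) = (\<Union>z\<in>N +>\<^bsub>V\<^esub> x. N +>\<^bsub>V\<^esub> (c \<odot>\<^bsub>V\<^esub> x))"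
    by (rule SUP_cong[OF refl])
  moreover have "x \<in> N +>\<^bsub>V\<^esub> x"
    using assms by (simp add: N.a_rcos_self)
  ultimately show ?thesis
    unfolding quot_module_simps by blast
qed

lemma coset_eq_self_iff:
  assumes "x \<in> carrier V"
  shows "N +>\<^bsub>V\<^esub> x = N \<longleftrightarrow> x \<in> N"
  using assms by (metis N.a_rcos_self V.a_coset_join2 N.a_subgroup)

lemma quot_module_module: "module K (quot_module V N)"
proof (rule moduleI)
  show "cring K" by (rule V.R.is_cring)
  have zero: "N +>\<^bsub>V\<^esub> \<zero>\<^bsub>V\<^esub> = N"
    using coset_eq_self_iff[OF V.M.zero_closed] submodule_zero[OF N] by blast
  show "abelian_group (quot_module V N)"
  proof (rule abelian_groupI)
    fix X assume "X \<in> carrier (quot_module V N)"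
    then obtain x where x: "x \<in> carrier V" "X = N +>\<^bsub>V\<^esub> x"
      unfolding quot_module_carrier by blast
    have "(N +>\<^bsub>V\<^esub> (\<ominus>\<^bsub>V\<^esub> x)) \<oplus>\<^bsub>quot_module V N\<^esub> X = \<zero>\<^bsub>quot_module V N\<^esub>"
      using x zero by (simp add: coset_add quot_module_simps(2) V.l_neg)
    then show "\<exists>Y\<in>carrier (quot_module V N). Y \<oplus>\<^bsub>quot_module V N\<^esub> X = \<zero>\<^bsub>quot_module V N\<^esub>"
      using x unfolding quot_module_carrier by auto
    show "\<zero>\<^bsub>quot_module V N\<^esub> \<oplus>\<^bsub>quot_module V N\<^esub> X = X"
      using x coset_add[OF V.M.zero_closed x(1)] by (simp add: zero quot_module_simps(2))
  next
    show "\<zero>\<^bsub>quot_module V N\<^esub> \<in> carrier (quot_module V N)"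
      unfolding quot_module_simps(2) quot_module_carrier using zero V.M.zero_closed by (metis imageI)
  next
    fix X Y assume "X \<in> carrier (quot_module V N)" "Y \<in> carrier (quot_module V N)"
    then obtain x y where xy: "x \<in> carrier V" "X = N +>\<^bsub>V\<^esub> x" "y \<in> carrier V" "Y = N +>\<^bsub>V\<^esub> y"
      unfolding quot_module_carrier by blast
    then show "X \<oplus>\<^bsub>quot_module V N\<^esub> Y \<in> carrier (quot_module V N)"
      unfolding quot_module_carrier by (simp add: coset_add)
    show "X \<oplus>\<^bsub>quot_module V N\<^esub> Y = Y \<oplus>\<^bsub>quot_module V N\<^esub> X"
      using xy by (simp add: coset_add V.M.a_comm)
    fix Z assume "Z \<in> carrier (quot_module V N)"
    then obtain z where z: "z \<in> carrier V" "Z = N +>\<^bsub>V\<^esub> z"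
      unfolding quot_module_carrier by blast
    then show "X \<oplus>\<^bsub>quot_module V N\<^esub> Y \<oplus>\<^bsub>quot_module V N\<^esub> Z = X \<oplus>\<^bsub>quot_module V N\<^esub> (Y \<oplus>\<^bsub>quot_module V N\<^esub> Z)"
      using xy by (simp add: coset_add V.M.a_assoc)
  qed
next
  have rep: "\<exists>x\<in>carrier V. X = N +>\<^bsub>V\<^esub> x" if "X \<in> carrier (quot_module V N)" for X
    using that unfolding quot_module_carrier by blast
  fix c X assume c: "c \<in> carrier K" and X: "X \<in> carrier (quot_module V N)"
  then obtain x where x: "x \<in> carrier V" "X = N +>\<^bsub>V\<^esub> x"
    using rep by blast
  then show "c \<odot>\<^bsub>quot_module V N\<^esub> X \<in> carrier (quot_module V N)"
    using c unfolding quot_module_carrier by (simp add: coset_smult)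
  show "c \<odot>\<^bsub>quot_module V N\<^esub> (X \<oplus>\<^bsub>quot_module V N\<^esub> Y)
      = c \<odot>\<^bsub>quot_module V N\<^esub> X \<oplus>\<^bsub>quot_module V N\<^esub> c \<odot>\<^bsub>quot_module V N\<^esub> Y"
    if Y: "Y \<in> carrier (quot_module V N)" for Y
    using x c rep[OF Y] by (auto simp add: coset_smult coset_add V.smult_r_distr)
  fix d assume d: "d \<in> carrier K"
  show "(c \<oplus>\<^bsub>K\<^esub> d) \<odot>\<^bsub>quot_module V N\<^esub> X
      = c \<odot>\<^bsub>quot_module V N\<^esub> X \<oplus>\<^bsub>quot_module V N\<^esub> d \<odot>\<^bsub>quot_module V N\<^esub> X"
    using x c d by (simp add: coset_smult coset_add V.smult_l_distr)
  show "(c \<otimes>\<^bsub>K\<^esub> d) \<odot>\<^bsub>quot_module V N\<^esub> X = c \<odot>\<^bsub>quot_module V N\<^esub> (d \<odot>\<^bsub>quot_module V N\<^esub> X)"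
    using x c d by (simp add: coset_smult V.smult_assoc1)
next
  show "\<one>\<^bsub>K\<^esub> \<odot>\<^bsub>quot_module V N\<^esub> X = X" if "X \<in> carrier (quot_module V N)" for X
    using that unfolding quot_module_carrier by (elim imageE) (simp add: coset_smult)
qed

lemma coset_lin: "(\<lambda>x. N +>\<^bsub>V\<^esub> x) \<in> lin_maps K V (quot_module V N)"
  by (rule lin_mapsI) (unfold quot_module_carrier, rule imageI, assumption,
    rule coset_add[symmetric], assumption+, rule coset_smult[symmetric], assumption+)

end

lemma submodule_mod_span:
  assumes "module K V" "S \<subseteq> carrier V"
  shows "submodule (mod_span K V S) K V"
proof -
  have "carrier V \<in> {N. submodule N K V \<and> S \<subseteq> N}"
    using assms(2) module.carrier_is_submodule[OF assms(1)] by blast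
  then show ?thesis
    unfolding mod_span_def by (intro submodule_Inter[OF assms(1)]) blast+
qed

lemma mod_span_incl: "x \<in> S \<Longrightarrow> x \<in> mod_span K V S"
  unfolding mod_span_def by blast

lemma mod_span_least: "submodule N K V \<Longrightarrow> S \<subseteq> N \<Longrightarrow> mod_span K V S \<subseteq> N"
  unfolding mod_span_def by blast

text \<open>A preimage under a surjection is determined up to the kernel, so choosing any preimage and
  applying a linear map that vanishes on the kernel gives a well-defined map on the target.\<close>

lemma factor_lin_map:
  assumes "module K V" "module K V'" "module K W" "\<pi> \<in> lin_maps K V V'"
    and surj: "\<pi> ` carrier V = carrier V'" and \<phi>: "\<phi> \<in> lin_maps K V W"
    and ker: "\<And>x. x \<in> carrier V \<Longrightarrow> \<pi> x = \<zero>\<^bsub>V'\<^esub> \<Longrightarrow> \<phi> x = \<zero>\<^bsub>W\<^esub>"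
  obtains \<psi> where "\<psi> \<in> lin_maps K V' W" "\<And>x. x \<in> carrier V \<Longrightarrow> \<psi> (\<pi> x) = \<phi> x"
proof
  interpret V: module K V by fact
  define s where "s = inv_into (carrier V) \<pi>"
  have s: "s y \<in> carrier V" "\<pi> (s y) = y" if "y \<in> carrier V'" for y
    using that surj unfolding s_def by (auto intro: inv_into_into f_inv_into_f)
  have eq: "\<phi> x = \<phi> y" if "x \<in> carrier V" "y \<in> carrier V" "\<pi> x = \<pi> y" for x y
  proof -
    have "\<pi> (x \<ominus>\<^bsub>V\<^esub> y) = \<zero>\<^bsub>V'\<^esub>"
      using that lin_maps_closed[OF assms(4)]
      by (simp add: lin_maps_minus[OF assms(1,2,4)] module_minus_eq_zero_iff[OF assms(2)])
    then have "\<phi> (x \<ominus>\<^bsub>V\<^esub> y) = \<zero>\<^bsub>W\<^esub>" using ker that by simp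
    then show ?thesis
      using that lin_maps_closed[OF \<phi>]
      by (simp add: lin_maps_minus[OF assms(1,3) \<phi>] module_minus_eq_zero_iff[OF assms(3)])
  qed
  show *: "\<phi> (s (\<pi> x)) = \<phi> x" if "x \<in> carrier V" for x
    using that s lin_maps_closed[OF assms(4)] by (intro eq) auto
  show "(\<lambda>y. \<phi> (s y)) \<in> lin_maps K V' W"
    by (rule lin_maps_descend[OF assms(4) surj lin_maps_cong[OF assms(1) \<phi> *]])
qed


section \<open>Multilinear maps and tensor products\<close>

subsection \<open>Free modules\<close>

lemma free_module_simps:
  "u \<in> carrier (free_module K X) \<longleftrightarrow> (\<forall>x. u x \<in> carrier K) \<and> finite {x. u x \<noteq> \<zero>\<^bsub>K\<^esub>} \<and>
    {x. u x \<noteq> \<zero>\<^bsub>K\<^esub>} \<subseteq> X"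
  "zero (free_module K X) = (\<lambda>_. \<zero>\<^bsub>K\<^esub>)"
  "add (free_module K X) = (\<lambda>u v x. u x \<oplus>\<^bsub>K\<^esub> v x)"
  "smult (free_module K X) = (\<lambda>c u x. c \<otimes>\<^bsub>K\<^esub> u x)"
  by (auto simp: free_module_def)

lemma free_module_module:
  assumes "cring K" shows "module K (free_module K X)"
proof -
  interpret cring K by fact
  have fin_add: "finite {x. u x \<oplus>\<^bsub>K\<^esub> v x \<noteq> \<zero>\<^bsub>K\<^esub>}"
    if "finite {x. u x \<noteq> \<zero>\<^bsub>K\<^esub>}" "finite {x. v x \<noteq> \<zero>\<^bsub>K\<^esub>}" for u v :: "'x \<Rightarrow> _"
    by (rule finite_subset[OF _ finite_UnI[OF that]]) auto
  have fin_mult: "finite {x. c \<otimes>\<^bsub>K\<^esub> u x \<noteq> \<zero>\<^bsub>K\<^esub>}"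
    if "finite {x. u x \<noteq> \<zero>\<^bsub>K\<^esub>}" "c \<in> carrier K" for u :: "'x \<Rightarrow> _" and c
    by (rule finite_subset[OF _ that(1)]) (use that(2) in auto)
  have neg0: "\<ominus>\<^bsub>K\<^esub> a = \<zero>\<^bsub>K\<^esub> \<longleftrightarrow> a = \<zero>\<^bsub>K\<^esub>" if "a \<in> carrier K" for a
    using that by (metis minus_minus minus_zero)
  show ?thesis
  proof (rule moduleI)
    show "abelian_group (free_module K X)"
    proof (rule abelian_groupI)
      fix u assume "u \<in> carrier (free_module K X)"
      then show "\<exists>v\<in>carrier (free_module K X). v \<oplus>\<^bsub>free_module K X\<^esub> u = \<zero>\<^bsub>free_module K X\<^esub>"
        by (intro bexI[of _ "\<lambda>x. \<ominus>\<^bsub>K\<^esub> u x"]) (auto simp: free_module_simps l_neg neg0)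
    next
      fix u v assume uv: "u \<in> carrier (free_module K X)" "v \<in> carrier (free_module K X)"
      then have "{x. u x \<oplus>\<^bsub>K\<^esub> v x \<noteq> \<zero>\<^bsub>K\<^esub>} \<subseteq> {x. u x \<noteq> \<zero>\<^bsub>K\<^esub>} \<union> {x. v x \<noteq> \<zero>\<^bsub>K\<^esub>}"
        by auto
      then show "u \<oplus>\<^bsub>free_module K X\<^esub> v \<in> carrier (free_module K X)"
        using uv unfolding free_module_simps by (blast intro: fin_add add.m_closed)
    qed (simp_all add: free_module_simps a_ac)
    show "c \<odot>\<^bsub>free_module K X\<^esub> u \<in> carrier (free_module K X)"
      if "c \<in> carrier K" "u \<in> carrier (free_module K X)" for c u
    proof -
      have "{x. c \<otimes>\<^bsub>K\<^esub> u x \<noteq> \<zero>\<^bsub>K\<^esub>} \<subseteq> {x. u x \<noteq> \<zero>\<^bsub>K\<^esub>}"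
        using that(1) by auto
      then show ?thesis
        using that unfolding free_module_simps by (blast intro: fin_mult m_closed)
    qed
  qed (use assms in \<open>simp_all add: free_module_simps l_distr r_distr m_assoc\<close>)
qed

lemma free_gen_closed: "cring K \<Longrightarrow> x \<in> X \<Longrightarrow> free_gen K x \<in> carrier (free_module K X)"
  by (auto simp: free_module_simps free_gen_def cring.cring_simprules)

lemma free_module_ext:
  assumes "cring K" "module K W" "\<phi> \<in> lin_maps K (free_module K X) W" "\<psi> \<in> lin_maps K (free_module K X) W"
    and "\<And>x. x \<in> X \<Longrightarrow> \<phi> (free_gen K x) = \<psi> (free_gen K x)"
    and "u \<in> carrier (free_module K X)"
  shows "\<phi> u = \<psi> u"
proof -
  let ?F = "free_module K X"
  interpret cring K by fact
  note F = free_module_module[OF assms(1)]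
  have "\<phi> u = \<psi> u" if "finite S" "u \<in> carrier ?F" "{x. u x \<noteq> \<zero>\<^bsub>K\<^esub>} \<subseteq> S" for u S
    using that
  proof (induction S arbitrary: u rule: finite_induct)
    case empty
    then have "u = \<zero>\<^bsub>?F\<^esub>"
      by (auto simp: free_module_simps)
    then show ?case
      using lin_maps_zero[OF F assms(2) assms(3)] lin_maps_zero[OF F assms(2) assms(4)] by simp
  next
    case (insert x S)
    show ?case
    proof (cases "u x = \<zero>\<^bsub>K\<^esub>")
      case True
      then show ?thesis using insert by (intro insert.IH) auto
    next
      case False
      define v where "v = u(x := \<zero>\<^bsub>K\<^esub>)"
      have x: "x \<in> X" "u x \<in> carrier K"
        using False insert.prems by (auto simp: free_module_simps)
      have v: "v \<in> carrier ?F"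
        using insert.prems unfolding v_def
        by (auto simp: free_module_simps intro: finite_subset[of _ "{x. u x \<noteq> \<zero>\<^bsub>K\<^esub>}"])
      have "{y. v y \<noteq> \<zero>\<^bsub>K\<^esub>} \<subseteq> S"
        using insert.prems by (auto simp: v_def)
      then have IH: "\<phi> v = \<psi> v"
        by (rule insert.IH[OF v])
      have u: "u = v \<oplus>\<^bsub>?F\<^esub> u x \<odot>\<^bsub>?F\<^esub> free_gen K x"
        using insert.prems(1) x
        by (auto simp: v_def free_module_simps(1,3,4) free_gen_def fun_eq_iff)
      have g: "free_gen K x \<in> carrier ?F" by (rule free_gen_closed[OF assms(1) x(1)])
      then have "u x \<odot>\<^bsub>?F\<^esub> free_gen K x \<in> carrier ?F"
        by (rule module.smult_closed[OF F x(2)])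
      then show ?thesis
        by (subst u, subst (2) u) (use v g x IH assms(5) in
            \<open>simp add: lin_maps_add[OF assms(3)] lin_maps_add[OF assms(4)]
              lin_maps_smult[OF assms(3)] lin_maps_smult[OF assms(4)]\<close>)
    qed
  qed
  then show ?thesis
    using assms(6) by (auto simp: free_module_simps)
qed

text \<open>Summing over a common finite superset of the supports makes the evaluation visibly additive.\<close>

lemma free_eval_superset:
  assumes "module K W" "u \<in> carrier (free_module K X)" "\<beta> \<in> X \<rightarrow> carrier W"
    and "finite S" "{x. u x \<noteq> \<zero>\<^bsub>K\<^esub>} \<subseteq> S" "S \<subseteq> X"
  shows "(\<Oplus>\<^bsub>W\<^esub>x\<in>{x. u x \<noteq> \<zero>\<^bsub>K\<^esub>}. u x \<odot>\<^bsub>W\<^esub> \<beta> x) = (\<Oplus>\<^bsub>W\<^esub>x\<in>S. u x \<odot>\<^bsub>W\<^esub> \<beta> x)"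
proof -
  interpret W: module K W by fact
  show ?thesis
    using assms by (intro W.M.add.finprod_mono_neutral_cong_left)
      (auto simp: free_module_simps Pi_def subset_iff)
qed

lemma free_eval_lin:
  assumes "module K W" "\<beta> \<in> X \<rightarrow> carrier W"
  shows "(\<lambda>u. \<Oplus>\<^bsub>W\<^esub>x\<in>{x. u x \<noteq> \<zero>\<^bsub>K\<^esub>}. u x \<odot>\<^bsub>W\<^esub> \<beta> x) \<in> lin_maps K (free_module K X) W"
    (is "?ev \<in> _")
proof -
  interpret W: module K W by fact
  let ?F = "free_module K X" and ?S = "\<lambda>u. {x. u x \<noteq> \<zero>\<^bsub>K\<^esub>}"
  note F = free_module_module[OF W.R.is_cring, of X]
  interpret F: module K ?F by fact
  have \<beta>: "\<beta> x \<in> carrier W" if "x \<in> X" for x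
    using that assms(2) by blast
  show ?thesis
  proof (rule lin_mapsI)
    fix u assume "u \<in> carrier ?F"
    then show "?ev u \<in> carrier W"
      using \<beta> by (intro W.M.finsum_closed) (auto simp: free_module_simps)
  next
    fix u v assume uv: "u \<in> carrier ?F" "v \<in> carrier ?F"
    then have S: "finite (?S u \<union> ?S v)" "?S u \<union> ?S v \<subseteq> X"
      by (auto simp: free_module_simps)
    have "?ev (u \<oplus>\<^bsub>?F\<^esub> v) = (\<Oplus>\<^bsub>W\<^esub>x\<in>?S u \<union> ?S v. (u \<oplus>\<^bsub>?F\<^esub> v) x \<odot>\<^bsub>W\<^esub> \<beta> x)"
      by (rule free_eval_superset[OF assms(1) _ assms(2) S(1) _ S(2)])
        (use uv F.M.add.m_closed[OF uv] in \<open>auto simp: free_module_simps(3)\<close>)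
    also have "\<dots> = (\<Oplus>\<^bsub>W\<^esub>x\<in>?S u \<union> ?S v. u x \<odot>\<^bsub>W\<^esub> \<beta> x \<oplus>\<^bsub>W\<^esub> v x \<odot>\<^bsub>W\<^esub> \<beta> x)"
      by (intro W.M.finsum_cong' refl)
        (use uv \<beta> in \<open>auto simp: free_module_simps W.smult_l_distr\<close>)
    also have "\<dots> = (\<Oplus>\<^bsub>W\<^esub>x\<in>?S u \<union> ?S v. u x \<odot>\<^bsub>W\<^esub> \<beta> x) \<oplus>\<^bsub>W\<^esub> (\<Oplus>\<^bsub>W\<^esub>x\<in>?S u \<union> ?S v. v x \<odot>\<^bsub>W\<^esub> \<beta> x)"
      by (rule W.M.finsum_addf) (use uv \<beta> in \<open>auto simp: free_module_simps\<close>)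
    also have "\<dots> = ?ev u \<oplus>\<^bsub>W\<^esub> ?ev v"
      using free_eval_superset[OF assms(1) uv(1) assms(2) S(1) _ S(2)]
        free_eval_superset[OF assms(1) uv(2) assms(2) S(1) _ S(2)] by auto
    finally show "?ev (u \<oplus>\<^bsub>?F\<^esub> v) = ?ev u \<oplus>\<^bsub>W\<^esub> ?ev v" .
  next
    fix c u assume cu: "c \<in> carrier K" "u \<in> carrier ?F"
    then have S: "finite (?S u)" "?S u \<subseteq> X"
      by (auto simp: free_module_simps)
    have "?ev (c \<odot>\<^bsub>?F\<^esub> u) = (\<Oplus>\<^bsub>W\<^esub>x\<in>?S u. (c \<odot>\<^bsub>?F\<^esub> u) x \<odot>\<^bsub>W\<^esub> \<beta> x)"
      by (rule free_eval_superset[OF assms(1) _ assms(2) S(1) _ S(2)])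
        (use cu F.smult_closed[OF cu] in \<open>auto simp: free_module_simps(4)\<close>)
    also have "\<dots> = (\<Oplus>\<^bsub>W\<^esub>x\<in>?S u. c \<odot>\<^bsub>W\<^esub> (u x \<odot>\<^bsub>W\<^esub> \<beta> x))"
      by (intro W.M.finsum_cong' refl)
        (use cu \<beta> in \<open>auto simp: free_module_simps W.smult_assoc1\<close>)
    also have "\<dots> = c \<odot>\<^bsub>W\<^esub> ?ev u"
      by (rule W.finsum_smult_ldistr[symmetric]) (use cu \<beta> in \<open>auto simp: free_module_simps\<close>)
    finally show "?ev (c \<odot>\<^bsub>?F\<^esub> u) = c \<odot>\<^bsub>W\<^esub> ?ev u" .
  qed
qed

lemma free_eval_gen:
  assumes "module K W" "\<beta> x \<in> carrier W"
  shows "(\<Oplus>\<^bsub>W\<^esub>y\<in>{y. free_gen K x y \<noteq> \<zero>\<^bsub>K\<^esub>}. free_gen K x y \<odot>\<^bsub>W\<^esub> \<beta> y) = \<beta> x"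
proof -
  interpret W: module K W by fact
  show ?thesis
  proof (cases "\<one>\<^bsub>K\<^esub> = \<zero>\<^bsub>K\<^esub>")
    case True
    have "\<beta> x = \<one>\<^bsub>K\<^esub> \<odot>\<^bsub>W\<^esub> \<beta> x" using assms by simp
    also have "\<dots> = \<zero>\<^bsub>W\<^esub>" using True assms by simp
    finally show ?thesis using True by (simp add: free_gen_def)
  next
    case False
    then have "{y. free_gen K x y \<noteq> \<zero>\<^bsub>K\<^esub>} = {x}" by (auto simp: free_gen_def)
    then show ?thesis using assms by (simp add: free_gen_def)
  qed
qed


subsection \<open>Tuples and multilinear maps\<close>

abbreviation tuples :: "('k, 'v, 's) module_scheme list \<Rightarrow> 'v list set"
  where "tuples Vs \<equiv> listset (map carrier Vs)"

abbreviation all_modules :: "('k, 'r) ring_scheme \<Rightarrow> ('k, 'v, 's) module_scheme list \<Rightarrow> bool"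
  where "all_modules K Vs \<equiv> \<forall>V\<in>set Vs. module K V"

lemma Cons_in_set_Cons [simp]: "x # xs \<in> set_Cons A B \<longleftrightarrow> x \<in> A \<and> xs \<in> B"
  by (auto simp: set_Cons_def)

lemma tuples_Cons_iff: "v # p \<in> tuples (V # Vs) \<longleftrightarrow> v \<in> carrier V \<and> p \<in> tuples Vs"
  by (auto simp: set_Cons_def)

lemma tuples_ConsE:
  assumes "r \<in> tuples (V # Vs)"
  obtains v p where "r = v # p" "v \<in> carrier V" "p \<in> tuples Vs"
  using assms by (auto simp: set_Cons_def)

lemma listset_iff: "p \<in> listset As \<longleftrightarrow> list_all2 (\<in>) p As"
proof (induction As arbitrary: p)
  case (Cons A As)
  then show ?case by (cases p) (auto simp: set_Cons_def)
qed auto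

lemma listset_replicate: "p \<in> listset (replicate n A) \<longleftrightarrow> length p = n \<and> set p \<subseteq> A"
  unfolding listset_iff by (auto simp: list_all2_conv_all_nth set_conv_nth subset_iff)

lemma tuples_iff: "p \<in> tuples Vs \<longleftrightarrow> list_all2 (\<lambda>v V. v \<in> carrier V) p Vs"
  unfolding listset_iff by (simp add: list_all2_map2)

lemma tuples_length: "p \<in> tuples Vs \<Longrightarrow> length p = length Vs"
  by (auto simp: tuples_iff dest: list_all2_lengthD)

lemma tuples_nth: "p \<in> tuples Vs \<Longrightarrow> i < length Vs \<Longrightarrow> p ! i \<in> carrier (Vs ! i)"
  by (auto simp: tuples_iff dest: list_all2_nthD2)

lemma tuples_update: "p \<in> tuples Vs \<Longrightarrow> i < length Vs \<Longrightarrow> v \<in> carrier (Vs ! i) \<Longrightarrow> p[i := v] \<in> tuples Vs"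
  by (auto simp: tuples_iff list_all2_conv_all_nth nth_list_update)

lemma tuples_append: "p \<in> tuples Us \<Longrightarrow> q \<in> tuples Vs \<Longrightarrow> p @ q \<in> tuples (Us @ Vs)"
  by (simp only: tuples_iff list_all2_appendI)

lemma tuples_appendE:
  assumes "r \<in> tuples (Us @ Vs)"
  obtains p q where "r = p @ q" "p \<in> tuples Us" "q \<in> tuples Vs"
  using assms unfolding tuples_iff by (auto simp: list_all2_append2)

lemma tuples_replicate: "p \<in> tuples (replicate n V) \<longleftrightarrow> length p = n \<and> set p \<subseteq> carrier V"
  by (simp add: listset_replicate)

text \<open>The recursion peels off one tensor factor at a time, as most inductions below do;
  \<open>multilin_slot\<close> and \<open>multilinI_slot\<close> translate to the slotwise formulation that is used in the
  relations of the tensor product.\<close>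

primrec multilin ::
  "('k, 'r) ring_scheme \<Rightarrow> ('k, 'w, 't) module_scheme \<Rightarrow> ('k, 'v, 's) module_scheme list \<Rightarrow>
    ('v list \<Rightarrow> 'w) \<Rightarrow> bool"
  where
    "multilin K W [] = (\<lambda>\<beta>. \<beta> [] \<in> carrier W)"
  | "multilin K W (V # Vs) = (\<lambda>\<beta>. (\<forall>v\<in>carrier V. multilin K W Vs (\<lambda>p. \<beta> (v # p))) \<and>
      (\<forall>p\<in>tuples Vs. (\<lambda>v. \<beta> (v # p)) \<in> lin_maps K V W))"

lemma multilin_Cons_tail: "multilin K W (V # Vs) \<beta> \<Longrightarrow> v \<in> carrier V \<Longrightarrow> multilin K W Vs (\<lambda>p. \<beta> (v # p))"
  by simp

lemma multilin_Cons_head: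
  "multilin K W (V # Vs) \<beta> \<Longrightarrow> p \<in> tuples Vs \<Longrightarrow> (\<lambda>v. \<beta> (v # p)) \<in> lin_maps K V W"
  by simp

lemma multilin_ConsI:
  assumes "\<And>v. v \<in> carrier V \<Longrightarrow> multilin K W Vs (\<lambda>p. \<beta> (v # p))"
    and "\<And>p. p \<in> tuples Vs \<Longrightarrow> (\<lambda>v. \<beta> (v # p)) \<in> lin_maps K V W"
  shows "multilin K W (V # Vs) \<beta>"
  using assms by simp

lemma multilin_closed: "multilin K W Vs \<beta> \<Longrightarrow> p \<in> tuples Vs \<Longrightarrow> \<beta> p \<in> carrier W"
proof (induction Vs arbitrary: \<beta> p)
  case (Cons V Vs)
  from Cons.prems(2) show ?case
  proof (rule tuples_ConsE)
    fix v q assume "p = v # q" "v \<in> carrier V" "q \<in> tuples Vs"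
    then show ?thesis
      using Cons.IH[OF multilin_Cons_tail[OF Cons.prems(1)]] by blast
  qed
qed auto

lemma multilin_slot:
  "multilin K W Vs \<beta> \<Longrightarrow> p \<in> tuples Vs \<Longrightarrow> i < length Vs \<Longrightarrow>
    (\<lambda>v. \<beta> (p[i := v])) \<in> lin_maps K (Vs ! i) W"
proof (induction Vs arbitrary: \<beta> p i)
  case (Cons V Vs)
  from Cons.prems(2) obtain v q where "p = v # q" "v \<in> carrier V" "q \<in> tuples Vs"
    by (rule tuples_ConsE)
  then show ?case
    using Cons.IH[OF multilin_Cons_tail[OF Cons.prems(1)]] multilin_Cons_head[OF Cons.prems(1)]
      Cons.prems(3)
    by (cases i) auto
qed auto

lemma multilinI_slot:
  "all_modules K Vs \<Longrightarrow> (\<And>p. p \<in> tuples Vs \<Longrightarrow> \<beta> p \<in> carrier W) \<Longrightarrow>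
    (\<And>p i. p \<in> tuples Vs \<Longrightarrow> i < length Vs \<Longrightarrow> (\<lambda>v. \<beta> (p[i := v])) \<in> lin_maps K (Vs ! i) W) \<Longrightarrow>
    multilin K W Vs \<beta>"
proof (induction Vs arbitrary: \<beta>)
  case (Cons V Vs)
  show ?case
  proof (rule multilin_ConsI)
    fix v assume v: "v \<in> carrier V"
    show "multilin K W Vs (\<lambda>p. \<beta> (v # p))"
    proof (rule Cons.IH)
      show "all_modules K Vs" using Cons.prems(1) by simp
      fix p assume p: "p \<in> tuples Vs"
      then have vp: "v # p \<in> tuples (V # Vs)" using v by (simp add: tuples_Cons_iff)
      then show "\<beta> (v # p) \<in> carrier W" by (rule Cons.prems(2))
      fix i assume "i < length Vs"
      then show "(\<lambda>x. \<beta> (v # p[i := x])) \<in> lin_maps K (Vs ! i) W"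
        using Cons.prems(3)[OF vp, of "Suc i"] by simp
    qed
  next
    fix p assume p: "p \<in> tuples Vs"
    have "module K V" using Cons.prems(1) by simp
    then have "\<zero>\<^bsub>V\<^esub> # p \<in> tuples (V # Vs)"
      using p by (simp add: tuples_Cons_iff module.axioms(2) abelian_group.axioms(1) abelian_monoid.zero_closed)
    from Cons.prems(3)[OF this, of 0] show "(\<lambda>v. \<beta> (v # p)) \<in> lin_maps K V W" by simp
  qed
qed auto

lemma multilin_append:
  "multilin K W (Us @ Vs) \<beta> \<longleftrightarrow> (\<forall>p\<in>tuples Us. multilin K W Vs (\<lambda>q. \<beta> (p @ q))) \<and>
    (\<forall>q\<in>tuples Vs. multilin K W Us (\<lambda>p. \<beta> (p @ q)))"
proof (induction Us arbitrary: \<beta>)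
  case Nil
  then show ?case by (auto intro: multilin_closed)
next
  case (Cons U Us)
  have *: "(\<forall>r\<in>tuples (Us @ Vs). P r) \<longleftrightarrow> (\<forall>p\<in>tuples Us. \<forall>q\<in>tuples Vs. P (p @ q))" for P
  proof (intro iffI ballI)
    show "P (p @ q)" if "\<forall>r\<in>tuples (Us @ Vs). P r" "p \<in> tuples Us" "q \<in> tuples Vs" for p q
      using that tuples_append by blast
    show "P r" if "\<forall>p\<in>tuples Us. \<forall>q\<in>tuples Vs. P (p @ q)" "r \<in> tuples (Us @ Vs)" for r
      using that(2) by (rule tuples_appendE) (use that(1) in blast)
  qed
  have "(\<forall>r\<in>tuples (U # Us). P r) \<longleftrightarrow> (\<forall>u\<in>carrier U. \<forall>p\<in>tuples Us. P (u # p))" for P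
    by (metis tuples_Cons_iff tuples_ConsE)
  then show ?case
    using Cons.IH * by (auto simp del: listset.simps list.map)
qed

lemma multilin_cong:
  "all_modules K Vs \<Longrightarrow> multilin K W Vs \<beta> \<Longrightarrow> (\<And>p. p \<in> tuples Vs \<Longrightarrow> \<beta>' p = \<beta> p) \<Longrightarrow> multilin K W Vs \<beta>'"
proof (induction Vs arbitrary: \<beta> \<beta>')
  case (Cons V Vs)
  show ?case
  proof (rule multilin_ConsI)
    show "multilin K W Vs (\<lambda>p. \<beta>' (v # p))" if "v \<in> carrier V" for v
      using Cons.prems(1)
      by (intro Cons.IH[OF _ multilin_Cons_tail[OF Cons.prems(2) that]] Cons.prems(3))
        (use that in \<open>auto simp: tuples_Cons_iff\<close>)
    show "(\<lambda>v. \<beta>' (v # p)) \<in> lin_maps K V W" if p: "p \<in> tuples Vs" for p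
      using Cons.prems(1)
      by (intro lin_maps_cong[OF _ multilin_Cons_head[OF Cons.prems(2) p]] Cons.prems(3))
        (use p in \<open>auto simp: tuples_Cons_iff\<close>)
  qed
qed auto

lemma multilin_lin_comp:
  "multilin K W Vs \<beta> \<Longrightarrow> \<phi> \<in> lin_maps K W U \<Longrightarrow> multilin K U Vs (\<lambda>p. \<phi> (\<beta> p))"
  by (induction Vs arbitrary: \<beta>) (auto intro: lin_maps_closed lin_maps_comp)

lemma multilin_zero: "module K W \<Longrightarrow> multilin K W Vs (\<lambda>_. \<zero>\<^bsub>W\<^esub>)"
  by (induction Vs) (auto intro: lin_maps_const_zero
      simp: module.axioms(2) abelian_group.axioms(1) abelian_monoid.zero_closed)

lemma multilin_scale:
  "module K W \<Longrightarrow> multilin K W Vs \<beta> \<Longrightarrow> c \<in> carrier K \<Longrightarrow> multilin K W Vs (\<lambda>p. c \<odot>\<^bsub>W\<^esub> \<beta> p)"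
  by (induction Vs arbitrary: \<beta>) (auto intro: lin_maps_scale module.smult_closed)

inductive lin_maps_list ::
  "('k, 'r) ring_scheme \<Rightarrow> ('k, 'v, 's) module_scheme list \<Rightarrow> ('k, 'w, 't) module_scheme list \<Rightarrow>
    ('v \<Rightarrow> 'w) list \<Rightarrow> bool"
  for K
  where
    Nil: "lin_maps_list K [] [] []"
  | Cons: "\<phi> \<in> lin_maps K V W \<Longrightarrow> lin_maps_list K Vs Ws \<phi>s \<Longrightarrow>
      lin_maps_list K (V # Vs) (W # Ws) (\<phi> # \<phi>s)"

abbreviation apply_each :: "('v \<Rightarrow> 'w) list \<Rightarrow> 'v list \<Rightarrow> 'w list"
  where "apply_each \<equiv> map2 (\<lambda>\<phi> v. \<phi> v)"

lemma lin_maps_listI: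
  "length \<phi>s = n \<Longrightarrow> length Vs = n \<Longrightarrow> length Ws = n \<Longrightarrow>
    (\<And>i. i < n \<Longrightarrow> \<phi>s ! i \<in> lin_maps K (Vs ! i) (Ws ! i)) \<Longrightarrow> lin_maps_list K Vs Ws \<phi>s"
proof (induction n arbitrary: \<phi>s Vs Ws)
  case (Suc n)
  then obtain \<phi> \<phi>s' V Vs' W Ws' where eq: "\<phi>s = \<phi> # \<phi>s'" "Vs = V # Vs'" "Ws = W # Ws'"
    by (metis length_Suc_conv)
  have "\<phi> \<in> lin_maps K V W" using Suc.prems(4)[of 0] eq by simp
  moreover have "lin_maps_list K Vs' Ws' \<phi>s'"
  proof (rule Suc.IH)
    show "\<phi>s' ! i \<in> lin_maps K (Vs' ! i) (Ws' ! i)" if "i < n" for i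
      using Suc.prems(4)[of "Suc i"] eq that by simp
  qed (use Suc.prems eq in auto)
  ultimately show ?case unfolding eq by (rule lin_maps_list.Cons)
qed (auto intro: lin_maps_list.Nil)

lemma apply_each_tuples:
  "lin_maps_list K Vs Ws \<phi>s \<Longrightarrow> p \<in> tuples Vs \<Longrightarrow> apply_each \<phi>s p \<in> tuples Ws"
  by (induction arbitrary: p rule: lin_maps_list.induct)
    (auto simp: set_Cons_def lin_maps_closed)

lemma multilin_apply_each:
  "lin_maps_list K Vs Ws \<phi>s \<Longrightarrow> multilin K U Ws \<beta> \<Longrightarrow> multilin K U Vs (\<lambda>p. \<beta> (apply_each \<phi>s p))"
proof (induction arbitrary: \<beta> rule: lin_maps_list.induct)
  case (Cons \<phi> V W Vs Ws \<phi>s)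
  show ?case
  proof (rule multilin_ConsI)
    show "multilin K U Vs (\<lambda>p. \<beta> (apply_each (\<phi> # \<phi>s) (v # p)))" if "v \<in> carrier V" for v
      using Cons.IH[OF multilin_Cons_tail[OF Cons.prems lin_maps_closed[OF Cons.hyps(1) that]]]
      by simp
    show "(\<lambda>v. \<beta> (apply_each (\<phi> # \<phi>s) (v # p))) \<in> lin_maps K V U" if "p \<in> tuples Vs" for p
      using lin_maps_comp[OF Cons.hyps(1)
          multilin_Cons_head[OF Cons.prems apply_each_tuples[OF Cons.hyps(2) that]]]
      by simp
  qed
qed simp


subsection \<open>The universal property\<close>

context
  fixes K :: "('k, 'r) ring_scheme" and Vs :: "('k, 'v, 's) module_scheme list"
  assumes K: "cring K" and Vs: "all_modules K Vs"
begin

abbreviation (input) "Fr \<equiv> free_module K (tuples Vs)"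

lemma multilin_relations_closed: "multilin_relations K Vs \<subseteq> carrier Fr"
proof -
  interpret F: module K Fr by (rule free_module_module[OF K])
  have g: "free_gen K p \<in> carrier Fr" if "p \<in> tuples Vs" for p
    by (rule free_gen_closed[OF K that])
  have V: "module K (Vs ! i)" if "i < length Vs" for i
    using Vs that by simp
  have "free_gen K (p[i := x \<oplus>\<^bsub>Vs ! i\<^esub> y]) \<ominus>\<^bsub>Fr\<^esub> (free_gen K (p[i := x]) \<oplus>\<^bsub>Fr\<^esub> free_gen K (p[i := y]))
      \<in> carrier Fr"
    if "p \<in> tuples Vs" "i < length Vs" "x \<in> carrier (Vs ! i)" "y \<in> carrier (Vs ! i)" for p i x y
  proof -
    interpret V: module K "Vs ! i" by (rule V[OF that(2)])
    show ?thesis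
      using that by (intro F.M.minus_closed F.M.add.m_closed g tuples_update V.M.add.m_closed)
  qed
  moreover have "free_gen K (p[i := c \<odot>\<^bsub>Vs ! i\<^esub> x]) \<ominus>\<^bsub>Fr\<^esub> c \<odot>\<^bsub>Fr\<^esub> free_gen K (p[i := x]) \<in> carrier Fr"
    if "p \<in> tuples Vs" "i < length Vs" "c \<in> carrier K" "x \<in> carrier (Vs ! i)" for p i c x
  proof -
    interpret V: module K "Vs ! i" by (rule V[OF that(2)])
    show ?thesis
      using that by (intro F.M.minus_closed F.smult_closed g tuples_update V.smult_closed)
  qed
  ultimately show ?thesis
    unfolding multilin_relations_def Let_def by auto
qed

lemma tensor_kernel_submodule: "submodule (tensor_kernel K Vs) K Fr"
  unfolding tensor_kernel_def
  by (rule submodule_mod_span[OF free_module_module[OF K] multilin_relations_closed])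

lemma tensor_module: "module K (tensor K Vs)"
  unfolding tensor_def by (rule quot_module_module[OF free_module_module[OF K] tensor_kernel_submodule])

lemma tens_closed: "p \<in> tuples Vs \<Longrightarrow> tens K Vs p \<in> carrier (tensor K Vs)"
  unfolding tensor_def tens_def quot_module_carrier[OF free_module_module[OF K] tensor_kernel_submodule]
  by (rule imageI) (rule free_gen_closed[OF K])

lemma multilin_tens: "multilin K (tensor K Vs) Vs (tens K Vs)"
proof (rule multilinI_slot[OF Vs tens_closed])
  interpret F: module K Fr by (rule free_module_module[OF K])
  note mods = free_module_module[OF K] tensor_kernel_submodule
  have g: "free_gen K p \<in> carrier Fr" if "p \<in> tuples Vs" for p
    by (rule free_gen_closed[OF K that])
  fix p i assume p: "p \<in> tuples Vs" and i: "i < length Vs"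
  interpret V: module K "Vs ! i" using Vs i by simp
  show "(\<lambda>v. tens K Vs (p[i := v])) \<in> lin_maps K (Vs ! i) (tensor K Vs)"
  proof (rule lin_mapsI)
    fix x y assume x: "x \<in> carrier (Vs ! i)" and y: "y \<in> carrier (Vs ! i)"
    have "free_gen K (p[i := x \<oplus>\<^bsub>Vs ! i\<^esub> y]) \<ominus>\<^bsub>Fr\<^esub> (free_gen K (p[i := x]) \<oplus>\<^bsub>Fr\<^esub> free_gen K (p[i := y]))
        \<in> tensor_kernel K Vs"
      unfolding tensor_kernel_def multilin_relations_def Let_def
      using p i x y by (intro mod_span_incl UnI1) blast
    then show "tens K Vs (p[i := x \<oplus>\<^bsub>Vs ! i\<^esub> y])
        = tens K Vs (p[i := x]) \<oplus>\<^bsub>tensor K Vs\<^esub> tens K Vs (p[i := y])"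
      unfolding tensor_def tens_def
      using p i x y by (simp add: coset_add[OF mods] coset_eq_iff[OF mods] g tuples_update)
  next
    fix c x assume c: "c \<in> carrier K" and x: "x \<in> carrier (Vs ! i)"
    have "free_gen K (p[i := c \<odot>\<^bsub>Vs ! i\<^esub> x]) \<ominus>\<^bsub>Fr\<^esub> c \<odot>\<^bsub>Fr\<^esub> free_gen K (p[i := x]) \<in> tensor_kernel K Vs"
      unfolding tensor_kernel_def multilin_relations_def Let_def
      using p i x c by (intro mod_span_incl UnI2) blast
    then show "tens K Vs (p[i := c \<odot>\<^bsub>Vs ! i\<^esub> x]) = c \<odot>\<^bsub>tensor K Vs\<^esub> tens K Vs (p[i := x])"
      unfolding tensor_def tens_def
      using p i x c by (simp add: coset_smult[OF mods] coset_eq_iff[OF mods] g tuples_update)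
  qed (use p i in \<open>simp add: tens_closed tuples_update\<close>)
qed

text \<open>The evaluation of finitely supported functions at \<open>\<beta>\<close> kills the multilinear relations, hence their
  span, and is therefore constant on cosets. Together with \<open>tensor_ext\<close> this yields the universal
  property; afterwards tensor products are handled through it alone.\<close>

lemma tensor_lift_coset:
  assumes W: "module K W" and \<beta>: "multilin K W Vs \<beta>" and u: "u \<in> carrier Fr"
  shows "tensor_lift K W \<beta> (tensor_kernel K Vs +>\<^bsub>Fr\<^esub> u)
    = (\<Oplus>\<^bsub>W\<^esub>p\<in>{p. u p \<noteq> \<zero>\<^bsub>K\<^esub>}. u p \<odot>\<^bsub>W\<^esub> \<beta> p)"
proof -
  let ?ev = "\<lambda>u. \<Oplus>\<^bsub>W\<^esub>p\<in>{p. u p \<noteq> \<zero>\<^bsub>K\<^esub>}. u p \<odot>\<^bsub>W\<^esub> \<beta> p"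
  interpret F: module K Fr by (rule free_module_module[OF K])
  interpret W: module K W by (rule W)
  note F = F.module_axioms
  have ev: "?ev \<in> lin_maps K Fr W"
    using multilin_closed[OF \<beta>] by (intro free_eval_lin[OF W]) auto
  have evg: "?ev (free_gen K p) = \<beta> p" if "p \<in> tuples Vs" for p
    by (rule free_eval_gen[where \<beta> = \<beta>, OF W multilin_closed[OF \<beta> that]])
  have g: "free_gen K p \<in> carrier Fr" if "p \<in> tuples Vs" for p
    by (rule free_gen_closed[OF K that])
  have rel: "?ev r = \<zero>\<^bsub>W\<^esub>" if "r \<in> multilin_relations K Vs" for r
  proof -
    from that consider
        (add) p i x y where "r = free_gen K (p[i := x \<oplus>\<^bsub>Vs ! i\<^esub> y])
            \<ominus>\<^bsub>Fr\<^esub> (free_gen K (p[i := x]) \<oplus>\<^bsub>Fr\<^esub> free_gen K (p[i := y]))"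
          "p \<in> tuples Vs" "i < length Vs" "x \<in> carrier (Vs ! i)" "y \<in> carrier (Vs ! i)"
      | (smult) p i c x where "r = free_gen K (p[i := c \<odot>\<^bsub>Vs ! i\<^esub> x]) \<ominus>\<^bsub>Fr\<^esub> c \<odot>\<^bsub>Fr\<^esub> free_gen K (p[i := x])"
          "p \<in> tuples Vs" "i < length Vs" "c \<in> carrier K" "x \<in> carrier (Vs ! i)"
      unfolding multilin_relations_def Let_def by blast
    then show ?thesis
    proof cases
      case add
      interpret V: module K "Vs ! i" using Vs add(3) by simp
      have t: "p[i := x] \<in> tuples Vs" "p[i := y] \<in> tuples Vs" "p[i := x \<oplus>\<^bsub>Vs ! i\<^esub> y] \<in> tuples Vs"
        using add by (simp_all add: tuples_update)
      have "?ev r = \<beta> (p[i := x \<oplus>\<^bsub>Vs ! i\<^esub> y]) \<ominus>\<^bsub>W\<^esub> (\<beta> (p[i := x]) \<oplus>\<^bsub>W\<^esub> \<beta> (p[i := y]))"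
        unfolding add(1)
        using t g by (simp only: lin_maps_minus[OF F W ev] lin_maps_add[OF ev] evg F.M.add.m_closed)
      also have "\<dots> = \<zero>\<^bsub>W\<^esub>"
        using t add multilin_closed[OF \<beta>] lin_maps_add[OF multilin_slot[OF \<beta> add(2,3)] add(4,5)]
        by (simp add: module_minus_eq_zero_iff[OF W])
      finally show ?thesis .
    next
      case smult
      interpret V: module K "Vs ! i" using Vs smult(3) by simp
      have t: "p[i := x] \<in> tuples Vs" "p[i := c \<odot>\<^bsub>Vs ! i\<^esub> x] \<in> tuples Vs"
        using smult by (simp_all add: tuples_update)
      have "?ev r = \<beta> (p[i := c \<odot>\<^bsub>Vs ! i\<^esub> x]) \<ominus>\<^bsub>W\<^esub> c \<odot>\<^bsub>W\<^esub> \<beta> (p[i := x])"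
        unfolding smult(1)
        using t g smult(4)
        by (simp only: lin_maps_minus[OF F W ev] lin_maps_smult[OF ev] evg F.smult_closed)
      also have "\<dots> = \<zero>\<^bsub>W\<^esub>"
        using t smult multilin_closed[OF \<beta>] lin_maps_smult[OF multilin_slot[OF \<beta> smult(2,3)] smult(4,5)]
        by (simp add: module_minus_eq_zero_iff[OF W])
      finally show ?thesis .
    qed
  qed
  have "tensor_kernel K Vs \<subseteq> {u \<in> carrier Fr. ?ev u = \<zero>\<^bsub>W\<^esub>}"
    unfolding tensor_kernel_def
    using rel multilin_relations_closed
    by (intro mod_span_least submodule_kernel[OF F W ev]) auto
  then have "?ev ` (tensor_kernel K Vs +>\<^bsub>Fr\<^esub> u) = {?ev u}"
    by (intro lin_maps_coset_image[OF F W tensor_kernel_submodule ev _ u]) auto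
  then show ?thesis
    unfolding tensor_lift_def by simp
qed

lemma tensor_carrierE:
  assumes "X \<in> carrier (tensor K Vs)"
  obtains u where "u \<in> carrier Fr" "X = tensor_kernel K Vs +>\<^bsub>Fr\<^esub> u"
  using assms unfolding tensor_def quot_module_carrier[OF free_module_module[OF K] tensor_kernel_submodule]
  by blast

lemma tensor_lift_tens:
  assumes "module K W" "multilin K W Vs \<beta>" "p \<in> tuples Vs"
  shows "tensor_lift K W \<beta> (tens K Vs p) = \<beta> p"
  unfolding tens_def tensor_lift_coset[OF assms(1,2) free_gen_closed[OF K assms(3)]]
  by (rule free_eval_gen[where \<beta> = \<beta>, OF assms(1) multilin_closed[OF assms(2,3)]])

lemma tensor_lift_lin:
  assumes W: "module K W" and \<beta>: "multilin K W Vs \<beta>"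
  shows "tensor_lift K W \<beta> \<in> lin_maps K (tensor K Vs) W"
proof -
  interpret F: module K Fr by (rule free_module_module[OF K])
  note mods = free_module_module[OF K] tensor_kernel_submodule
  let ?ev = "\<lambda>u. \<Oplus>\<^bsub>W\<^esub>p\<in>{p. u p \<noteq> \<zero>\<^bsub>K\<^esub>}. u p \<odot>\<^bsub>W\<^esub> \<beta> p"
  have ev: "?ev \<in> lin_maps K Fr W"
    using multilin_closed[OF \<beta>] by (intro free_eval_lin[OF W]) auto
  note lift = tensor_lift_coset[OF W \<beta>]
  show ?thesis
  proof (rule lin_mapsI)
    fix X assume "X \<in> carrier (tensor K Vs)"
    then show "tensor_lift K W \<beta> X \<in> carrier W"
      by (rule tensor_carrierE) (simp add: lift lin_maps_closed[OF ev])
  next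
    fix X Y assume "X \<in> carrier (tensor K Vs)" "Y \<in> carrier (tensor K Vs)"
    then obtain u v where "u \<in> carrier Fr" "X = tensor_kernel K Vs +>\<^bsub>Fr\<^esub> u"
        "v \<in> carrier Fr" "Y = tensor_kernel K Vs +>\<^bsub>Fr\<^esub> v"
      by (metis tensor_carrierE)
    then show "tensor_lift K W \<beta> (X \<oplus>\<^bsub>tensor K Vs\<^esub> Y) = tensor_lift K W \<beta> X \<oplus>\<^bsub>W\<^esub> tensor_lift K W \<beta> Y"
      by (simp add: lift tensor_def coset_add[OF mods] lin_maps_add[OF ev])
  next
    fix c X assume c: "c \<in> carrier K" and "X \<in> carrier (tensor K Vs)"
    then obtain u where "u \<in> carrier Fr" "X = tensor_kernel K Vs +>\<^bsub>Fr\<^esub> u"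
      by (metis tensor_carrierE)
    then show "tensor_lift K W \<beta> (c \<odot>\<^bsub>tensor K Vs\<^esub> X) = c \<odot>\<^bsub>W\<^esub> tensor_lift K W \<beta> X"
      using c by (simp add: lift tensor_def coset_smult[OF mods] lin_maps_smult[OF ev])
  qed
qed

lemma tensor_ext:
  assumes W: "module K W" and \<phi>: "\<phi> \<in> lin_maps K (tensor K Vs) W" and \<psi>: "\<psi> \<in> lin_maps K (tensor K Vs) W"
    and eq: "\<And>p. p \<in> tuples Vs \<Longrightarrow> \<phi> (tens K Vs p) = \<psi> (tens K Vs p)"
    and X: "X \<in> carrier (tensor K Vs)"
  shows "\<phi> X = \<psi> X"
proof -
  note mods = free_module_module[OF K] tensor_kernel_submodule
  let ?\<pi> = "\<lambda>u. tensor_kernel K Vs +>\<^bsub>Fr\<^esub> u"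
  have \<pi>: "?\<pi> \<in> lin_maps K Fr (tensor K Vs)"
    unfolding tensor_def by (rule coset_lin[OF mods])
  from X obtain u where u: "u \<in> carrier Fr" "X = ?\<pi> u" by (rule tensor_carrierE)
  have "\<phi> (?\<pi> u) = \<psi> (?\<pi> u)"
    using eq unfolding tens_def
    by (intro free_module_ext[OF K W lin_maps_comp[OF \<pi> \<phi>] lin_maps_comp[OF \<pi> \<psi>] _ u(1)])
  then show ?thesis using u by simp
qed

lemma tensor_lift_closed:
  "module K W \<Longrightarrow> multilin K W Vs \<beta> \<Longrightarrow> X \<in> carrier (tensor K Vs) \<Longrightarrow> tensor_lift K W \<beta> X \<in> carrier W"
  by (rule lin_maps_closed[OF tensor_lift_lin])

lemma tensor_lift_comp:
  assumes W: "module K W" and U: "module K U" and \<beta>: "multilin K W Vs \<beta>" and \<phi>: "\<phi> \<in> lin_maps K W U"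
    and X: "X \<in> carrier (tensor K Vs)"
  shows "\<phi> (tensor_lift K W \<beta> X) = tensor_lift K U (\<lambda>p. \<phi> (\<beta> p)) X"
  by (rule tensor_ext[OF U lin_maps_comp[OF tensor_lift_lin[OF W \<beta>] \<phi>]
        tensor_lift_lin[OF U multilin_lin_comp[OF \<beta> \<phi>]] _ X])
    (simp add: tensor_lift_tens[OF W \<beta>] tensor_lift_tens[OF U multilin_lin_comp[OF \<beta> \<phi>]])

lemma tensor_lift_cong:
  assumes W: "module K W" and \<beta>: "multilin K W Vs \<beta>"
    and eq: "\<And>p. p \<in> tuples Vs \<Longrightarrow> \<beta>' p = \<beta> p" and X: "X \<in> carrier (tensor K Vs)"
  shows "tensor_lift K W \<beta>' X = tensor_lift K W \<beta> X"
proof -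
  have \<beta>': "multilin K W Vs \<beta>'" by (rule multilin_cong[OF Vs \<beta> eq])
  show ?thesis
    by (rule tensor_ext[OF W tensor_lift_lin[OF W \<beta>'] tensor_lift_lin[OF W \<beta>] _ X])
      (simp add: tensor_lift_tens[OF W \<beta>] tensor_lift_tens[OF W \<beta>'] eq)
qed

lemma tensor_lift_tens_id: "X \<in> carrier (tensor K Vs) \<Longrightarrow> tensor_lift K (tensor K Vs) (tens K Vs) X = X"
  by (rule tensor_ext[OF tensor_module tensor_lift_lin[OF tensor_module multilin_tens] lin_maps_id])
    (simp_all add: tensor_lift_tens[OF tensor_module multilin_tens])

lemma tensor_lift_zero:
  assumes "module K W" "X \<in> carrier (tensor K Vs)" and "\<And>p. p \<in> tuples Vs \<Longrightarrow> \<beta> p = \<zero>\<^bsub>W\<^esub>"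
  shows "tensor_lift K W \<beta> X = \<zero>\<^bsub>W\<^esub>"
proof -
  note z = multilin_zero[OF assms(1), of Vs]
  have "tensor_lift K W \<beta> X = tensor_lift K W (\<lambda>_. \<zero>\<^bsub>W\<^esub>) X"
    by (rule tensor_lift_cong[OF assms(1) z assms(3,2)])
  also have "\<dots> = \<zero>\<^bsub>W\<^esub>"
    by (rule tensor_ext[OF assms(1) tensor_lift_lin[OF assms(1) z] lin_maps_const_zero[OF assms(1)] _ assms(2)])
      (simp add: tensor_lift_tens[OF assms(1) z])
  finally show ?thesis .
qed

text \<open>With the tensor \<open>X\<close> fixed, both sides of each linearity identity are linear in \<open>X\<close>, so they may be
  compared on elementary tensors, where they reduce to the linearity of \<open>G\<close> in its parameter.\<close>

lemma tensor_lift_lin_param: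
  assumes W: "module K W" and V: "module K V" and X: "X \<in> carrier (tensor K Vs)"
    and G: "\<And>a. a \<in> carrier V \<Longrightarrow> multilin K W Vs (G a)"
    and lin: "\<And>p. p \<in> tuples Vs \<Longrightarrow> (\<lambda>a. G a p) \<in> lin_maps K V W"
  shows "(\<lambda>a. tensor_lift K W (G a) X) \<in> lin_maps K V W"
proof (rule lin_mapsI)
  interpret V: module K V by (rule V)
  note lift = tensor_lift_lin[OF W G]
  show "tensor_lift K W (G a) X \<in> carrier W" if "a \<in> carrier V" for a
    by (rule tensor_lift_closed[OF W G[OF that] X])
  show "tensor_lift K W (G (a \<oplus>\<^bsub>V\<^esub> b)) X = tensor_lift K W (G a) X \<oplus>\<^bsub>W\<^esub> tensor_lift K W (G b) X"
    if ab: "a \<in> carrier V" "b \<in> carrier V" for a b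
    by (rule tensor_ext[OF W lift lin_maps_plus[OF W lift lift] _ X])
      (use ab in \<open>simp_all add: tensor_lift_tens[OF W G] lin_maps_add[OF lin]\<close>)
  show "tensor_lift K W (G (c \<odot>\<^bsub>V\<^esub> a)) X = c \<odot>\<^bsub>W\<^esub> tensor_lift K W (G a) X"
    if ca: "c \<in> carrier K" "a \<in> carrier V" for c a
    by (rule tensor_ext[OF W lift lin_maps_scale[OF W lift] _ X])
      (use ca in \<open>simp_all add: tensor_lift_tens[OF W G] lin_maps_smult[OF lin]\<close>)
qed

lemma tensor_lift_multilin_param:
  assumes W: "module K W" and X: "X \<in> carrier (tensor K Vs)"
  shows "all_modules K Us \<Longrightarrow> (\<And>q. q \<in> tuples Us \<Longrightarrow> multilin K W Vs (G q)) \<Longrightarrow>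
    (\<And>p. p \<in> tuples Vs \<Longrightarrow> multilin K W Us (\<lambda>q. G q p)) \<Longrightarrow>
    multilin K W Us (\<lambda>q. tensor_lift K W (G q) X)"
proof (induction Us arbitrary: G)
  case Nil
  then show ?case by (auto intro: tensor_lift_closed[OF W _ X])
next
  case (Cons U Us)
  show ?case
  proof (rule multilin_ConsI)
    show "multilin K W Us (\<lambda>q. tensor_lift K W (G (u # q)) X)" if u: "u \<in> carrier U" for u
    proof (rule Cons.IH)
      show "multilin K W Vs (G (u # q))" if "q \<in> tuples Us" for q
        using u that by (intro Cons.prems(2)) (simp only: tuples_Cons_iff)
      show "multilin K W Us (\<lambda>q. G (u # q) p)" if "p \<in> tuples Vs" for p
        by (rule multilin_Cons_tail[OF Cons.prems(3)[OF that] u])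
    qed (use Cons.prems(1) in simp)
    show "(\<lambda>u. tensor_lift K W (G (u # q)) X) \<in> lin_maps K U W" if q: "q \<in> tuples Us" for q
    proof (rule tensor_lift_lin_param[OF W _ X])
      show "multilin K W Vs (G (u # q))" if "u \<in> carrier U" for u
        using q that by (intro Cons.prems(2)) (simp only: tuples_Cons_iff)
      show "(\<lambda>u. G (u # q) p) \<in> lin_maps K U W" if "p \<in> tuples Vs" for p
        by (rule multilin_Cons_head[OF Cons.prems(3)[OF that] q])
    qed (use Cons.prems(1) in simp)
  qed
qed

lemma tensor_subset_submodule:
  assumes N: "submodule N K (tensor K Vs)" and "\<And>p. p \<in> tuples Vs \<Longrightarrow> tens K Vs p \<in> N"
    and X: "X \<in> carrier (tensor K Vs)"
  shows "X \<in> N"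
proof -
  note mods = tensor_module N
  let ?Q = "quot_module (tensor K Vs) N"
  have Q: "module K ?Q" by (rule quot_module_module[OF mods])
  have "N +>\<^bsub>tensor K Vs\<^esub> X = \<zero>\<^bsub>?Q\<^esub>"
    by (rule tensor_ext[OF Q coset_lin[OF mods] lin_maps_const_zero[OF Q] _ X])
      (simp add: quot_module_simps(2) coset_eq_self_iff[OF mods] assms(2) tens_closed)
  then show ?thesis
    using X by (simp add: quot_module_simps(2) coset_eq_self_iff[OF mods])
qed

end

text \<open>Fubini's theorem for Sweedler sums: the statement is linear in \<open>X\<close> and clear for elementary tensors.\<close>

lemma tensor_lift_swap:
  assumes K: "cring K" and Us: "all_modules K Us" and Vs: "all_modules K Vs" and W: "module K W"
    and X: "X \<in> carrier (tensor K Us)" and Y: "Y \<in> carrier (tensor K Vs)"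
    and G1: "\<And>p. p \<in> tuples Us \<Longrightarrow> multilin K W Vs (G p)"
    and G2: "\<And>q. q \<in> tuples Vs \<Longrightarrow> multilin K W Us (\<lambda>p. G p q)"
  shows "tensor_lift K W (\<lambda>p. tensor_lift K W (G p) Y) X
    = tensor_lift K W (\<lambda>q. tensor_lift K W (\<lambda>p. G p q) X) Y"
proof -
  note m1 = tensor_lift_multilin_param[OF K Vs W Y Us G1 G2]
  have l: "tensor_lift K W (\<lambda>q. tensor_lift K W (\<lambda>p. G p q) X') Y = tensor_lift K W (\<lambda>p. tensor_lift K W (G p) Y) X'"
    if X': "X' \<in> carrier (tensor K Us)" for X'
  proof (rule tensor_ext[OF K Us W _ tensor_lift_lin[OF K Us W m1] _ X'])
    show "(\<lambda>X'. tensor_lift K W (\<lambda>q. tensor_lift K W (\<lambda>p. G p q) X') Y) \<in> lin_maps K (tensor K Us) W"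
      by (rule tensor_lift_lin_param[OF K Vs W tensor_module[OF K Us] Y
            tensor_lift_multilin_param[OF K Us W _ Vs G2 G1] tensor_lift_lin[OF K Us W G2]])
    fix p assume p: "p \<in> tuples Us"
    have "tensor_lift K W (\<lambda>q. tensor_lift K W (\<lambda>p. G p q) (tens K Us p)) Y = tensor_lift K W (G p) Y"
      by (rule tensor_lift_cong[OF K Vs W G1[OF p] _ Y]) (rule tensor_lift_tens[OF K Us W G2 p])
    then show "tensor_lift K W (\<lambda>q. tensor_lift K W (\<lambda>p. G p q) (tens K Us p)) Y
        = tensor_lift K W (\<lambda>p. tensor_lift K W (G p) Y) (tens K Us p)"
      by (simp add: tensor_lift_tens[OF K Us W m1 p])
  qed
  show ?thesis by (rule l[OF X, symmetric])
qed


subsection \<open>Tensor products of linear maps\<close>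

context
  fixes K :: "('k, 'r) ring_scheme" and Vs :: "('k, 'v, 's) module_scheme list"
    and Ws :: "('k, 'w, 't) module_scheme list" and \<phi>s :: "('v \<Rightarrow> 'w) list"
  assumes K: "cring K" and Vs: "all_modules K Vs" and Ws: "all_modules K Ws"
    and \<phi>s: "lin_maps_list K Vs Ws \<phi>s"
begin

lemma multilin_tens_apply_each: "multilin K (tensor K Ws) Vs (\<lambda>p. tens K Ws (apply_each \<phi>s p))"
  by (rule multilin_apply_each[OF \<phi>s multilin_tens[OF K Ws]])

lemma tensor_map_lin: "tensor_map K Ws \<phi>s \<in> lin_maps K (tensor K Vs) (tensor K Ws)"
  unfolding tensor_map_def
  by (rule tensor_lift_lin[OF K Vs tensor_module[OF K Ws] multilin_tens_apply_each])

lemma tensor_map_tens: "p \<in> tuples Vs \<Longrightarrow> tensor_map K Ws \<phi>s (tens K Vs p) = tens K Ws (apply_each \<phi>s p)"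
  unfolding tensor_map_def
  by (rule tensor_lift_tens[OF K Vs tensor_module[OF K Ws] multilin_tens_apply_each])

lemma tensor_lift_tensor_map:
  assumes U: "module K U" and \<beta>: "multilin K U Ws \<beta>" and X: "X \<in> carrier (tensor K Vs)"
  shows "tensor_lift K U \<beta> (tensor_map K Ws \<phi>s X) = tensor_lift K U (\<lambda>p. \<beta> (apply_each \<phi>s p)) X"
  by (rule tensor_ext[OF K Vs U lin_maps_comp[OF tensor_map_lin tensor_lift_lin[OF K Ws U \<beta>]]
        tensor_lift_lin[OF K Vs U multilin_apply_each[OF \<phi>s \<beta>]] _ X])
    (simp add: tensor_map_tens tensor_lift_tens[OF K Ws U \<beta>] apply_each_tuples[OF \<phi>s]
      tensor_lift_tens[OF K Vs U multilin_apply_each[OF \<phi>s \<beta>]])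

end

definition surj_list ::
  "('k, 'r) ring_scheme \<Rightarrow> ('k, 'v, 's) module_scheme list \<Rightarrow> ('k, 'w, 't) module_scheme list \<Rightarrow>
    ('v \<Rightarrow> 'w) list \<Rightarrow> bool"
  where "surj_list K Vs Ws \<phi>s \<longleftrightarrow> lin_maps_list K Vs Ws \<phi>s \<and>
    (\<forall>i<length Vs. (\<phi>s ! i) ` carrier (Vs ! i) = carrier (Ws ! i))"

lemma lin_maps_list_length:
  "lin_maps_list K Vs Ws \<phi>s \<Longrightarrow> length \<phi>s = length Vs \<and> length Ws = length Vs"
  by (induction rule: lin_maps_list.induct) auto

lemma surj_list_Cons:
  "surj_list K (V # Vs) (W # Ws) (\<phi> # \<phi>s) \<longleftrightarrow>
    \<phi> \<in> lin_maps K V W \<and> \<phi> ` carrier V = carrier W \<and> surj_list K Vs Ws \<phi>s"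
proof -
  have "lin_maps_list K (V # Vs) (W # Ws) (\<phi> # \<phi>s) \<longleftrightarrow> \<phi> \<in> lin_maps K V W \<and> lin_maps_list K Vs Ws \<phi>s"
    by (auto elim: lin_maps_list.cases intro: lin_maps_list.Cons)
  moreover have "(\<forall>i<length (V # Vs). P i) \<longleftrightarrow> P 0 \<and> (\<forall>i<length Vs. P (Suc i))" for P
    by (metis length_Cons less_Suc_eq_0_disj)
  ultimately show ?thesis
    unfolding surj_list_def by (simp only: nth_Cons_0 nth_Cons_Suc) blast
qed

lemma apply_each_surj:
  "lin_maps_list K Vs Ws \<phi>s \<Longrightarrow> surj_list K Vs Ws \<phi>s \<Longrightarrow> q \<in> tuples Ws \<Longrightarrow>
    \<exists>p\<in>tuples Vs. apply_each \<phi>s p = q"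
proof (induction arbitrary: q rule: lin_maps_list.induct)
  case (Cons \<phi> V W Vs Ws \<phi>s)
  from Cons.prems(2) obtain w r where q: "q = w # r" "w \<in> carrier W" "r \<in> tuples Ws"
    by (rule tuples_ConsE)
  obtain p where p: "p \<in> tuples Vs" "apply_each \<phi>s p = r"
    using Cons.IH[OF _ q(3)] Cons.prems(1) by (auto simp only: surj_list_Cons)
  have "\<phi> ` carrier V = carrier W"
    using Cons.prems(1) by (simp only: surj_list_Cons)
  then obtain v where "v \<in> carrier V" "\<phi> v = w"
    using q(2) by (metis imageE)
  then show ?case
    using p q by (intro bexI[of _ "v # p"]) (auto simp: tuples_Cons_iff)
qed auto

lemma tensor_map_surj:
  assumes K: "cring K" and Vs: "all_modules K Vs" and Ws: "all_modules K Ws"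
    and s: "surj_list K Vs Ws \<phi>s"
  shows "tensor_map K Ws \<phi>s ` carrier (tensor K Vs) = carrier (tensor K Ws)"
proof
  have \<phi>s: "lin_maps_list K Vs Ws \<phi>s" using s by (simp add: surj_list_def)
  note l = tensor_map_lin[OF K Vs Ws \<phi>s]
  interpret T: module K "tensor K Vs" by (rule tensor_module[OF K Vs])
  interpret T': module K "tensor K Ws" by (rule tensor_module[OF K Ws])
  show "tensor_map K Ws \<phi>s ` carrier (tensor K Vs) \<subseteq> carrier (tensor K Ws)"
    using lin_maps_closed[OF l] by blast
  have N: "submodule (tensor_map K Ws \<phi>s ` carrier (tensor K Vs)) K (tensor K Ws)"
  proof (rule submoduleI'[OF T'.module_axioms])
    show "\<zero>\<^bsub>tensor K Ws\<^esub> \<in> tensor_map K Ws \<phi>s ` carrier (tensor K Vs)"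
      using lin_maps_zero[OF T.module_axioms T'.module_axioms l] T.M.zero_closed by (metis imageI)
  qed (use lin_maps_closed[OF l] in \<open>auto simp: lin_maps_add[OF l, symmetric] lin_maps_smult[OF l, symmetric]\<close>)
  show "carrier (tensor K Ws) \<subseteq> tensor_map K Ws \<phi>s ` carrier (tensor K Vs)"
  proof
    fix X assume "X \<in> carrier (tensor K Ws)"
    show "X \<in> tensor_map K Ws \<phi>s ` carrier (tensor K Vs)"
    proof (rule tensor_subset_submodule[OF K Ws N _ \<open>X \<in> carrier (tensor K Ws)\<close>])
      fix q assume "q \<in> tuples Ws"
      then obtain p where "p \<in> tuples Vs" "apply_each \<phi>s p = q"
        using apply_each_surj[OF \<phi>s s] by blast
      then show "tens K Ws q \<in> tensor_map K Ws \<phi>s ` carrier (tensor K Vs)"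
        using tensor_map_tens[OF K Vs Ws \<phi>s] tens_closed[OF K Vs] by (metis imageI)
    qed
  qed
qed

text \<open>The factorization is built slot by slot. In the first slot one chooses a preimage under \<open>\<phi>\<close>; by
  \<open>factor_lin_map\<close> the choice is immaterial, because \<open>G\<close> vanishes on the kernel.\<close>

lemma multilin_factor:
  "lin_maps_list K Vs Ws \<phi>s \<Longrightarrow> surj_list K Vs Ws \<phi>s \<Longrightarrow> all_modules K Vs \<Longrightarrow> all_modules K Ws \<Longrightarrow>
    module K U \<Longrightarrow> multilin K U Vs G \<Longrightarrow>
    (\<And>p i. p \<in> tuples Vs \<Longrightarrow> i < length Vs \<Longrightarrow> (\<phi>s ! i) (p ! i) = \<zero>\<^bsub>Ws ! i\<^esub> \<Longrightarrow> G p = \<zero>\<^bsub>U\<^esub>) \<Longrightarrow>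
    \<exists>G'. multilin K U Ws G' \<and> (\<forall>p\<in>tuples Vs. G' (apply_each \<phi>s p) = G p)"
proof (induction arbitrary: G rule: lin_maps_list.induct)
  case Nil
  have "G [] \<in> carrier U" using Nil.prems(5) by simp
  then show ?case by (intro exI[of _ "\<lambda>_. G []"]) simp
next
  case (Cons \<phi> V W Vs Ws \<phi>s)
  have surj: "\<phi> ` carrier V = carrier W" "surj_list K Vs Ws \<phi>s"
    using Cons.prems(1) by (simp_all only: surj_list_Cons)
  have V: "module K V" and W: "module K W" and mods: "all_modules K Vs" "all_modules K Ws"
    using Cons.prems(2,3) by auto
  define s where "s = inv_into (carrier V) \<phi>"
  have s: "s w \<in> carrier V" "\<phi> (s w) = w" if "w \<in> carrier W" for w
    unfolding s_def using inv_into_into[of w \<phi>] f_inv_into_f[of w \<phi>] surj(1) that by auto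
  have "\<exists>H. multilin K U Ws H \<and> (\<forall>p\<in>tuples Vs. H (apply_each \<phi>s p) = G (v # p))"
    if v: "v \<in> carrier V" for v
  proof (rule Cons.IH[OF surj(2) mods Cons.prems(4) multilin_Cons_tail[OF Cons.prems(5) v]])
    fix p i assume p: "p \<in> tuples Vs" "i < length Vs" "(\<phi>s ! i) (p ! i) = \<zero>\<^bsub>Ws ! i\<^esub>"
    show "G (v # p) = \<zero>\<^bsub>U\<^esub>"
      by (rule Cons.prems(6)[of _ "Suc i"]) (use v p in \<open>auto simp: tuples_Cons_iff\<close>)
  qed
  then obtain H where H: "\<And>v. v \<in> carrier V \<Longrightarrow> multilin K U Ws (H v)"
      "\<And>v p. v \<in> carrier V \<Longrightarrow> p \<in> tuples Vs \<Longrightarrow> H v (apply_each \<phi>s p) = G (v # p)"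
    by metis
  define G' where "G' r = H (s (hd r)) (tl r)" for r
  have slot: "\<exists>\<psi>\<in>lin_maps K W U. \<forall>v\<in>carrier V. \<psi> (\<phi> v) = G (v # p)" if p: "p \<in> tuples Vs" for p
  proof -
    obtain \<psi> where "\<psi> \<in> lin_maps K W U" "\<And>v. v \<in> carrier V \<Longrightarrow> \<psi> (\<phi> v) = G (v # p)"
    proof (rule factor_lin_map[OF V W Cons.prems(4) Cons.hyps(1) surj(1) multilin_Cons_head[OF Cons.prems(5) p]])
      fix v assume "v \<in> carrier V" "\<phi> v = \<zero>\<^bsub>W\<^esub>"
      then show "G (v # p) = \<zero>\<^bsub>U\<^esub>"
        using p by (intro Cons.prems(6)[of _ 0]) (auto simp: tuples_Cons_iff)
    qed blast
    then show ?thesis by blast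
  qed
  have "multilin K U (W # Ws) G'"
  proof (rule multilin_ConsI)
    show "multilin K U Ws (\<lambda>q. G' (w # q))" if "w \<in> carrier W" for w
      using H(1)[OF s(1)[OF that]] by (simp add: G'_def)
    fix q assume "q \<in> tuples Ws"
    then obtain p where p: "p \<in> tuples Vs" "apply_each \<phi>s p = q"
      using apply_each_surj[OF Cons.hyps(2) surj(2)] by blast
    obtain \<psi> where \<psi>: "\<psi> \<in> lin_maps K W U" "\<And>v. v \<in> carrier V \<Longrightarrow> \<psi> (\<phi> v) = G (v # p)"
      using slot[OF p(1)] by blast
    show "(\<lambda>w. G' (w # q)) \<in> lin_maps K W U"
    proof (rule lin_maps_cong[OF W \<psi>(1)])
      fix w assume w: "w \<in> carrier W"
      have "G' (w # q) = G (s w # p)"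
        using H(2)[OF s(1)[OF w] p(1)] p(2) by (simp add: G'_def)
      then show "G' (w # q) = \<psi> w"
        using \<psi>(2)[OF s(1)[OF w]] s(2)[OF w] by simp
    qed
  qed
  moreover have "G' (apply_each (\<phi> # \<phi>s) r) = G r" if "r \<in> tuples (V # Vs)" for r
  proof -
    from that obtain v p where r: "r = v # p" "v \<in> carrier V" "p \<in> tuples Vs"
      by (rule tuples_ConsE)
    obtain \<psi> where \<psi>: "\<And>v. v \<in> carrier V \<Longrightarrow> \<psi> (\<phi> v) = G (v # p)"
      using slot[OF r(3)] by blast
    have w: "\<phi> v \<in> carrier W" using lin_maps_closed[OF Cons.hyps(1) r(2)] .
    have "G' (apply_each (\<phi> # \<phi>s) r) = G (s (\<phi> v) # p)"
      using H(2)[OF s(1)[OF w] r(3)] r(1) by (simp add: G'_def)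
    also have "\<dots> = G r"
      using \<psi>[OF s(1)[OF w]] \<psi>[OF r(2)] s(2)[OF w] r(1) by simp
    finally show ?thesis .
  qed
  ultimately show ?case by blast
qed

text \<open>Right exactness of the tensor product: \<open>G\<close> factors through \<open>\<phi>\<^sub>1 \<otimes> \<dots> \<otimes> \<phi>\<^sub>n\<close>. All arguments below about
  kernels of such maps use this lemma instead of a description of the kernel as a sum of subspaces.\<close>

lemma tensor_lift_kernel:
  assumes K: "cring K" and Vs: "all_modules K Vs" and Ws: "all_modules K Ws" and U: "module K U"
    and s: "surj_list K Vs Ws \<phi>s" and G: "multilin K U Vs G"
    and van: "\<And>p i. p \<in> tuples Vs \<Longrightarrow> i < length Vs \<Longrightarrow> (\<phi>s ! i) (p ! i) = \<zero>\<^bsub>Ws ! i\<^esub> \<Longrightarrow> G p = \<zero>\<^bsub>U\<^esub>"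
    and X: "X \<in> carrier (tensor K Vs)" "tensor_map K Ws \<phi>s X = \<zero>\<^bsub>tensor K Ws\<^esub>"
  shows "tensor_lift K U G X = \<zero>\<^bsub>U\<^esub>"
proof -
  have \<phi>s: "lin_maps_list K Vs Ws \<phi>s" using s by (simp add: surj_list_def)
  obtain G' where G': "multilin K U Ws G'" "\<And>p. p \<in> tuples Vs \<Longrightarrow> G' (apply_each \<phi>s p) = G p"
  proof -
    have "\<exists>G'. multilin K U Ws G' \<and> (\<forall>p\<in>tuples Vs. G' (apply_each \<phi>s p) = G p)"
      by (rule multilin_factor[OF \<phi>s s Vs Ws U G van])
    then show thesis using that by blast
  qed
  have "tensor_lift K U G X = tensor_lift K U (\<lambda>p. G' (apply_each \<phi>s p)) X"
    by (rule tensor_lift_cong[OF K Vs U multilin_apply_each[OF \<phi>s G'(1)] _ X(1)]) (simp add: G'(2))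
  also have "\<dots> = tensor_lift K U G' (tensor_map K Ws \<phi>s X)"
    by (rule tensor_lift_tensor_map[OF K Vs Ws \<phi>s U G'(1) X(1), symmetric])
  also have "\<dots> = \<zero>\<^bsub>U\<^esub>"
    unfolding X(2) by (rule lin_maps_zero[OF tensor_module[OF K Ws] U tensor_lift_lin[OF K Ws U G'(1)]])
  finally show ?thesis .
qed

text \<open>The condition relating \<open>Ss ! i\<close> and \<open>Ts ! i\<close> says that \<open>Ts ! i\<close> lies in the span of \<open>Ss ! i\<close>, as far
  as linear maps to \<open>W\<close> can tell. In this form it can be checked with \<open>tensor_lift_kernel\<close>.\<close>

lemma multilin_zero_on_tuples:
  "length Ss = length Vs \<Longrightarrow> length Ts = length Vs \<Longrightarrow>
    (\<And>i. i < length Vs \<Longrightarrow> Ss ! i \<subseteq> carrier (Vs ! i) \<and> Ts ! i \<subseteq> carrier (Vs ! i)) \<Longrightarrow>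
    (\<And>i \<phi> x. i < length Vs \<Longrightarrow> \<phi> \<in> lin_maps K (Vs ! i) W \<Longrightarrow> (\<And>s. s \<in> Ss ! i \<Longrightarrow> \<phi> s = \<zero>\<^bsub>W\<^esub>) \<Longrightarrow>
      x \<in> Ts ! i \<Longrightarrow> \<phi> x = \<zero>\<^bsub>W\<^esub>) \<Longrightarrow>
    multilin K W Vs G \<Longrightarrow> (\<And>p. p \<in> listset Ss \<Longrightarrow> G p = \<zero>\<^bsub>W\<^esub>) \<Longrightarrow> p \<in> listset Ts \<Longrightarrow> G p = \<zero>\<^bsub>W\<^esub>"
proof (induction Vs arbitrary: Ss Ts G p)
  case (Cons V Vs)
  obtain S Ss' T Ts' where eq: "Ss = S # Ss'" "Ts = T # Ts'"
    using Cons.prems(1,2) by (metis length_Suc_conv list.size(4) add.commute plus_1_eq_Suc)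
  have ST: "S \<subseteq> carrier V" "T \<subseteq> carrier V"
    using Cons.prems(3)[of 0] eq by auto
  have len: "length Ts' = length Vs" using Cons.prems(2) eq by simp
  have Ts': "q \<in> tuples Vs" if q: "q \<in> listset Ts'" for q
  proof -
    have "list_all2 (\<lambda>v T. v \<in> T) q Ts'"
      using q by (induction Ts' arbitrary: q) (auto simp: set_Cons_def)
    then show ?thesis
      using Cons.prems(3)[of "Suc _"] eq len
      unfolding tuples_iff by (fastforce simp: list_all2_conv_all_nth)
  qed
  have IH: "G (v # q) = \<zero>\<^bsub>W\<^esub>" if v: "v \<in> S" and q: "q \<in> listset Ts'" for v q
  proof (rule Cons.IH[of Ss' Ts' "\<lambda>p. G (v # p)" q])
    show "multilin K W Vs (\<lambda>p. G (v # p))"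
      using v ST by (intro multilin_Cons_tail[OF Cons.prems(5)]) auto
    show "G (v # p) = \<zero>\<^bsub>W\<^esub>" if "p \<in> listset Ss'" for p
      by (rule Cons.prems(6)) (use that v eq in \<open>simp add: set_Cons_def\<close>)
    show "Ss' ! i \<subseteq> carrier (Vs ! i) \<and> Ts' ! i \<subseteq> carrier (Vs ! i)" if "i < length Vs" for i
      using Cons.prems(3)[of "Suc i"] eq that by simp
    show "\<phi> x = \<zero>\<^bsub>W\<^esub>" if "i < length Vs" "\<phi> \<in> lin_maps K (Vs ! i) W"
        "\<And>s. s \<in> Ss' ! i \<Longrightarrow> \<phi> s = \<zero>\<^bsub>W\<^esub>" "x \<in> Ts' ! i" for i \<phi> x
      by (rule Cons.prems(4)[of "Suc i"]) (use that eq in auto)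
  qed (use Cons.prems(1,2) eq q in auto)
  from Cons.prems(7) obtain v q where p: "p = v # q" "v \<in> T" "q \<in> listset Ts'"
    unfolding eq by (auto simp: set_Cons_def)
  have "(\<lambda>v. G (v # q)) v = \<zero>\<^bsub>W\<^esub>"
    by (rule Cons.prems(4)[of 0]) (use p eq IH multilin_Cons_head[OF Cons.prems(5) Ts'[OF p(3)]] in auto)
  then show ?case using p by simp
qed auto


section \<open>Sweedler calculus\<close>

text \<open>\<open>cosum K C W G x\<close> is \<open>\<Sum> G x\<^sub>1 x\<^sub>2\<close> and \<open>sw K C W n \<gamma> x\<close> is \<open>\<Sum> \<gamma> [x\<^sub>1, \<dots>, x\<^sub>n]\<close> in Sweedler
  notation, for a bilinear \<open>G\<close> and a multilinear \<open>\<gamma>\<close> with values in \<open>W\<close>.\<close>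

definition cosum ::
  "('k, 'r) ring_scheme \<Rightarrow> ('k, 'a, 's) coalgebra_scheme \<Rightarrow> ('k, 'w, 't) module_scheme \<Rightarrow>
    ('a \<Rightarrow> 'a \<Rightarrow> 'w) \<Rightarrow> 'a \<Rightarrow> 'w"
  where "cosum K C W G x = tensor_lift K W (\<lambda>p. G (p ! 0) (p ! 1)) (comult C x)"

definition sw ::
  "('k, 'r) ring_scheme \<Rightarrow> ('k, 'a, 's) coalgebra_scheme \<Rightarrow> ('k, 'w, 't) module_scheme \<Rightarrow> nat \<Rightarrow>
    ('a list \<Rightarrow> 'w) \<Rightarrow> 'a \<Rightarrow> 'w"
  where "sw K C W n \<gamma> x = tensor_lift K W \<gamma> (iter_comult K C n x)"

definition bilin ::
  "('k, 'r) ring_scheme \<Rightarrow> ('k, 'v, 's) module_scheme \<Rightarrow> ('k, 'w, 't) module_scheme \<Rightarrow> ('v \<Rightarrow> 'v \<Rightarrow> 'w) \<Rightarrow> bool"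
  where "bilin K V W G \<longleftrightarrow> (\<forall>a\<in>carrier V. G a \<in> lin_maps K V W) \<and>
    (\<forall>b\<in>carrier V. (\<lambda>a. G a b) \<in> lin_maps K V W)"

lemma bilinI:
  "(\<And>a. a \<in> carrier V \<Longrightarrow> (\<lambda>b. G a b) \<in> lin_maps K V W) \<Longrightarrow>
    (\<And>b. b \<in> carrier V \<Longrightarrow> (\<lambda>a. G a b) \<in> lin_maps K V W) \<Longrightarrow> bilin K V W G"
  by (simp add: bilin_def)

lemma bilin_left: "bilin K V W G \<Longrightarrow> b \<in> carrier V \<Longrightarrow> (\<lambda>a. G a b) \<in> lin_maps K V W"
  by (simp add: bilin_def)

lemma bilin_right: "bilin K V W G \<Longrightarrow> a \<in> carrier V \<Longrightarrow> (\<lambda>b. G a b) \<in> lin_maps K V W"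
  by (simp add: bilin_def)

lemma bilin_flip: "bilin K V W G \<Longrightarrow> bilin K V W (\<lambda>a b. G b a)"
  by (simp add: bilin_def)

lemma bilin_comp:
  assumes "bilin K V W G" "\<phi> \<in> lin_maps K U V"
  shows "bilin K U W (\<lambda>a b. G (\<phi> a) (\<phi> b))"
  using assms unfolding bilin_def by (auto intro: lin_maps_comp lin_maps_closed)

lemma bilin_lin_comp:
  assumes "bilin K V W G" "\<phi> \<in> lin_maps K W U"
  shows "bilin K V U (\<lambda>a b. \<phi> (G a b))"
  using assms unfolding bilin_def by (auto intro: lin_maps_comp)

lemma multilin_bilin: "bilin K V W G \<Longrightarrow> multilin K W [V, V] (\<lambda>p. G (p ! 0) (p ! 1))"
  by (auto simp: bilin_def set_Cons_def lin_maps_closed)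

lemma tuples_2E:
  assumes "p \<in> tuples [V, V']"
  obtains a b where "p = [a, b]" "a \<in> carrier V" "b \<in> carrier V'"
  using assms by (auto simp: set_Cons_def)

lemma tens_triple_lin:
  assumes K: "cring K" and V: "module K V" and bc: "b \<in> carrier V" "c \<in> carrier V"
  shows "(\<lambda>a. tens K [V, V, V] [a, b, c]) \<in> lin_maps K V (tensor K [V, V, V])"
    and "(\<lambda>a. tens K [V, V, V] [b, a, c]) \<in> lin_maps K V (tensor K [V, V, V])"
    and "(\<lambda>a. tens K [V, V, V] [b, c, a]) \<in> lin_maps K V (tensor K [V, V, V])"
proof -
  have "all_modules K [V, V, V]" using V by simp
  note slot = multilin_slot[OF multilin_tens[OF K this]]
  show "(\<lambda>a. tens K [V, V, V] [a, b, c]) \<in> lin_maps K V (tensor K [V, V, V])"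
    using slot[of "[b, b, c]" 0] bc by simp
  show "(\<lambda>a. tens K [V, V, V] [b, a, c]) \<in> lin_maps K V (tensor K [V, V, V])"
    using slot[of "[b, b, c]" 1] bc by simp
  show "(\<lambda>a. tens K [V, V, V] [b, c, a]) \<in> lin_maps K V (tensor K [V, V, V])"
    using slot[of "[b, c, c]" 2] bc by simp
qed

lemma tens_pair_bilin:
  assumes "module K W"
  shows "bilin K W (tensor K [W, W]) (\<lambda>a b. tens K [W, W] [a, b])"
proof -
  have Ws: "all_modules K [W, W]" using assms by simp
  note m = multilin_tens[OF module_cring[OF assms] Ws]
  show ?thesis
  proof (rule bilinI)
    show "(\<lambda>b. tens K [W, W] [a, b]) \<in> lin_maps K W (tensor K [W, W])" if "a \<in> carrier W" for a
      using multilin_slot[OF m, of "[a, a]" 1] that by simp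
    show "(\<lambda>a. tens K [W, W] [a, b]) \<in> lin_maps K W (tensor K [W, W])" if "b \<in> carrier W" for b
      using multilin_slot[OF m, of "[b, b]" 0] that by simp
  qed
qed

context coc_coalgebra
begin

lemma A_module: "module K A" by (rule module_axioms)
lemma K_cring: "cring K" by (rule module_cring[OF A_module])
lemma A_modules: "all_modules K (replicate n A)" by (simp add: A_module)
lemma AA_modules: "all_modules K [A, A]" by (simp add: A_module)
lemma AAA_modules: "all_modules K [A, A, A]" by (simp add: A_module)

lemma comult_closed: "x \<in> carrier A \<Longrightarrow> comult A x \<in> carrier (tensor K [A, A])"
  by (rule lin_maps_closed[OF comult_linear])

lemma cosum_lin: "module K W \<Longrightarrow> bilin K A W G \<Longrightarrow> cosum K A W G \<in> lin_maps K A W"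
  unfolding cosum_def
  by (rule lin_maps_comp[OF comult_linear tensor_lift_lin[OF K_cring AA_modules _ multilin_bilin]])

lemma cosum_closed: "module K W \<Longrightarrow> bilin K A W G \<Longrightarrow> x \<in> carrier A \<Longrightarrow> cosum K A W G x \<in> carrier W"
  by (rule lin_maps_closed[OF cosum_lin])

lemma cosum_cong:
  assumes "module K W" "bilin K A W G" "\<And>a b. a \<in> carrier A \<Longrightarrow> b \<in> carrier A \<Longrightarrow> G' a b = G a b"
    and "x \<in> carrier A"
  shows "cosum K A W G' x = cosum K A W G x"
  unfolding cosum_def
  by (rule tensor_lift_cong[OF K_cring AA_modules assms(1) multilin_bilin[OF assms(2)] _ comult_closed[OF assms(4)]])
    (erule tuples_2E, simp add: assms(3))

lemma cosum_zero:
  assumes "module K W" "\<And>a b. a \<in> carrier A \<Longrightarrow> b \<in> carrier A \<Longrightarrow> G a b = \<zero>\<^bsub>W\<^esub>" "x \<in> carrier A"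
  shows "cosum K A W G x = \<zero>\<^bsub>W\<^esub>"
  unfolding cosum_def
  by (rule tensor_lift_zero[OF K_cring AA_modules assms(1) comult_closed[OF assms(3)]])
    (erule tuples_2E, simp add: assms(2))

lemma cosum_lin_comp:
  assumes "module K W" "module K U" "bilin K A W G" "\<phi> \<in> lin_maps K W U" "x \<in> carrier A"
  shows "\<phi> (cosum K A W G x) = cosum K A U (\<lambda>a b. \<phi> (G a b)) x"
  unfolding cosum_def
  by (rule tensor_lift_comp[OF K_cring AA_modules assms(1,2) multilin_bilin[OF assms(3)] assms(4)
        comult_closed[OF assms(5)]])

lemma cosum_param:
  assumes "module K W" "module K V" "x \<in> carrier A"
    and "\<And>u. u \<in> carrier V \<Longrightarrow> bilin K A W (G u)"
    and "\<And>a b. a \<in> carrier A \<Longrightarrow> b \<in> carrier A \<Longrightarrow> (\<lambda>u. G u a b) \<in> lin_maps K V W"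
  shows "(\<lambda>u. cosum K A W (G u) x) \<in> lin_maps K V W"
  unfolding cosum_def
  by (rule tensor_lift_lin_param[OF K_cring AA_modules assms(1,2) comult_closed[OF assms(3)]
        multilin_bilin[OF assms(4)]])
    (assumption, erule tuples_2E, simp add: assms(5))

lemma cosum_multilin_param:
  assumes "module K W" "all_modules K Us" "x \<in> carrier A"
    and "\<And>q. q \<in> tuples Us \<Longrightarrow> bilin K A W (G q)"
    and "\<And>a b. a \<in> carrier A \<Longrightarrow> b \<in> carrier A \<Longrightarrow> multilin K W Us (\<lambda>q. G q a b)"
  shows "multilin K W Us (\<lambda>q. cosum K A W (G q) x)"
  unfolding cosum_def
  by (rule tensor_lift_multilin_param[OF K_cring AA_modules assms(1) comult_closed[OF assms(3)] assms(2)
        multilin_bilin[OF assms(4)]])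
    (assumption, erule tuples_2E, simp add: assms(5))

text \<open>The coassociativity axiom is the case of the universal trilinear map \<open>(a, b, c) \<mapsto> a \<otimes> b \<otimes> c\<close>; the
  general case results by applying to it the linear map that \<open>H\<close> induces on \<open>A \<otimes> A \<otimes> A\<close>.\<close>

lemma cosum_assoc:
  assumes W: "module K W" and x: "x \<in> carrier A"
    and H1: "\<And>b c. b \<in> carrier A \<Longrightarrow> c \<in> carrier A \<Longrightarrow> (\<lambda>a. H a b c) \<in> lin_maps K A W"
    and H2: "\<And>a c. a \<in> carrier A \<Longrightarrow> c \<in> carrier A \<Longrightarrow> (\<lambda>b. H a b c) \<in> lin_maps K A W"
    and H3: "\<And>a b. a \<in> carrier A \<Longrightarrow> b \<in> carrier A \<Longrightarrow> (\<lambda>c. H a b c) \<in> lin_maps K A W"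
  shows "cosum K A W (\<lambda>u c. cosum K A W (\<lambda>a b. H a b c) u) x
    = cosum K A W (\<lambda>a u. cosum K A W (\<lambda>b c. H a b c) u) x"
proof -
  let ?T = "tensor K [A, A, A]" and ?\<tau> = "tens K [A, A, A]" and ?\<gamma> = "\<lambda>p. H (p ! 0) (p ! 1) (p ! 2)"
  note T = tensor_module[OF K_cring AAA_modules]
  note slot = tens_triple_lin[OF K_cring A_module]
  have m\<gamma>: "multilin K W [A, A, A] ?\<gamma>"
    using H1 H2 H3 lin_maps_closed[OF H3] by (auto simp: set_Cons_def)
  have lift: "tensor_lift K W ?\<gamma> \<in> lin_maps K ?T W"
    by (rule tensor_lift_lin[OF K_cring AAA_modules W m\<gamma>])
  have lt: "tensor_lift K W ?\<gamma> (?\<tau> [a, b, c]) = H a b c"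
    if "a \<in> carrier A" "b \<in> carrier A" "c \<in> carrier A" for a b c
    using tensor_lift_tens[OF K_cring AAA_modules W m\<gamma>, of "[a, b, c]"] that by simp
  have b12: "bilin K A ?T (\<lambda>a b. ?\<tau> [a, b, c])" "bilin K A ?T (\<lambda>a b. ?\<tau> [c, a, b])" if "c \<in> carrier A" for c
    using slot that by (auto intro!: bilinI)
  have B12: "bilin K A ?T (\<lambda>u c. cosum K A ?T (\<lambda>a b. ?\<tau> [a, b, c]) u)"
      "bilin K A ?T (\<lambda>a u. cosum K A ?T (\<lambda>b c. ?\<tau> [a, b, c]) u)"
    by (auto intro!: bilinI cosum_lin cosum_param T A_module b12 slot)
  have h12: "bilin K A W (\<lambda>a b. H a b c)" "bilin K A W (\<lambda>a b. H c a b)" if "c \<in> carrier A" for c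
    using that by (auto intro!: bilinI H1 H2 H3)
  have h2: "bilin K A W (\<lambda>a u. cosum K A W (\<lambda>b c. H a b c) u)"
    by (auto intro!: bilinI cosum_lin cosum_param W A_module h12 H1)
  have "cosum K A W (\<lambda>u c. cosum K A W (\<lambda>a b. H a b c) u) x
      = cosum K A W (\<lambda>u c. tensor_lift K W ?\<gamma> (cosum K A ?T (\<lambda>a b. ?\<tau> [a, b, c]) u)) x"
  proof (rule cosum_cong[OF W bilin_lin_comp[OF B12(1) lift] _ x])
    fix u c assume u: "u \<in> carrier A" and c: "c \<in> carrier A"
    show "cosum K A W (\<lambda>a b. H a b c) u = tensor_lift K W ?\<gamma> (cosum K A ?T (\<lambda>a b. ?\<tau> [a, b, c]) u)"
      unfolding cosum_lin_comp[OF T W b12(1)[OF c] lift u]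
      using c by (intro cosum_cong[OF W bilin_lin_comp[OF b12(1)[OF c] lift] _ u]) (simp add: lt del: One_nat_def)
  qed
  also have "\<dots> = tensor_lift K W ?\<gamma> (cosum K A ?T (\<lambda>u c. cosum K A ?T (\<lambda>a b. ?\<tau> [a, b, c]) u) x)"
    by (rule cosum_lin_comp[OF T W B12(1) lift x, symmetric])
  also have "cosum K A ?T (\<lambda>u c. cosum K A ?T (\<lambda>a b. ?\<tau> [a, b, c]) u) x
      = cosum K A ?T (\<lambda>a u. cosum K A ?T (\<lambda>b c. ?\<tau> [a, b, c]) u) x"
    using coassoc[OF x] unfolding cosum_def by simp
  also have "tensor_lift K W ?\<gamma> \<dots> = cosum K A W (\<lambda>a u. tensor_lift K W ?\<gamma> (cosum K A ?T (\<lambda>b c. ?\<tau> [a, b, c]) u)) x"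
    by (rule cosum_lin_comp[OF T W B12(2) lift x])
  also have "\<dots> = cosum K A W (\<lambda>a u. cosum K A W (\<lambda>b c. H a b c) u) x"
  proof (rule cosum_cong[OF W h2 _ x])
    fix a u assume a: "a \<in> carrier A" and u: "u \<in> carrier A"
    show "tensor_lift K W ?\<gamma> (cosum K A ?T (\<lambda>b c. ?\<tau> [a, b, c]) u) = cosum K A W (\<lambda>b c. H a b c) u"
      unfolding cosum_lin_comp[OF T W b12(2)[OF a] lift u]
      using a by (intro cosum_cong[OF W h12(2)[OF a] _ u]) (simp add: lt del: One_nat_def)
  qed
  finally show ?thesis .
qed

lemma counit_closed: "x \<in> carrier A \<Longrightarrow> counit A x \<in> carrier K"
  using lin_maps_closed[OF counit_linear] by (simp add: ground_module_def)

lemma counit_scale_lin: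
  assumes "module K W" "w \<in> carrier W"
  shows "(\<lambda>x. counit A x \<odot>\<^bsub>W\<^esub> w) \<in> lin_maps K A W"
proof -
  interpret W: module K W by fact
  show ?thesis
    using lin_maps_add[OF counit_linear] lin_maps_smult[OF counit_linear] assms(2)
    by (intro lin_mapsI)
      (simp_all add: ground_module_def counit_closed W.smult_l_distr W.smult_assoc1)
qed

lemma counit_bilin:
  assumes "module K W" "L \<in> lin_maps K A W"
  shows "bilin K A W (\<lambda>a b. counit A a \<odot>\<^bsub>W\<^esub> L b)" "bilin K A W (\<lambda>a b. counit A b \<odot>\<^bsub>W\<^esub> L a)"
  using assms by (auto intro!: bilinI counit_scale_lin lin_maps_scale lin_maps_closed[OF assms(2)] counit_closed)

lemma cosum_counit_left:
  assumes "module K W" "L \<in> lin_maps K A W" "x \<in> carrier A"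
  shows "cosum K A W (\<lambda>a b. counit A a \<odot>\<^bsub>W\<^esub> L b) x = L x"
proof -
  note b = counit_bilin(1)[OF A_module lin_maps_id]
  have "L x = L (cosum K A A (\<lambda>a b. counit A a \<odot>\<^bsub>A\<^esub> b) x)"
    using counit_left[OF assms(3)] unfolding cosum_def by simp
  also have "\<dots> = cosum K A W (\<lambda>a b. L (counit A a \<odot>\<^bsub>A\<^esub> b)) x"
    by (rule cosum_lin_comp[OF A_module assms(1) b assms(2,3)])
  also have "\<dots> = cosum K A W (\<lambda>a b. counit A a \<odot>\<^bsub>W\<^esub> L b) x"
    by (rule cosum_cong[OF assms(1) counit_bilin(1)[OF assms(1,2)] _ assms(3)])
      (simp add: lin_maps_smult[OF assms(2)] counit_closed)
  finally show ?thesis by simp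
qed

lemma cosum_comm:
  assumes "module K W" "bilin K A W G" "x \<in> carrier A"
  shows "cosum K A W (\<lambda>a b. G b a) x = cosum K A W G x"
proof -
  let ?T = "tensor K [A, A]"
  note T = tensor_module[OF K_cring AA_modules] and m = multilin_bilin[OF assms(2)]
  note b = bilin_flip[OF tens_pair_bilin[OF A_module]]
  have "cosum K A W G x = tensor_lift K W (\<lambda>p. G (p ! 0) (p ! 1)) (cosum K A ?T (\<lambda>a b. tens K [A, A] [b, a]) x)"
    using cocomm[OF assms(3)] unfolding cosum_def by simp
  also have "\<dots> = cosum K A W (\<lambda>a b. tensor_lift K W (\<lambda>p. G (p ! 0) (p ! 1)) (tens K [A, A] [b, a])) x"
    by (rule cosum_lin_comp[OF T assms(1) b tensor_lift_lin[OF K_cring AA_modules assms(1) m] assms(3)])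
  also have "\<dots> = cosum K A W (\<lambda>a b. G b a) x"
  proof (rule cosum_cong[OF assms(1) bilin_flip[OF assms(2)] _ assms(3)])
    fix a b assume "a \<in> carrier A" "b \<in> carrier A"
    then show "tensor_lift K W (\<lambda>p. G (p ! 0) (p ! 1)) (tens K [A, A] [b, a]) = G b a"
      using tensor_lift_tens[OF K_cring AA_modules assms(1) m, of "[b, a]"] by simp
  qed
  finally show ?thesis by simp
qed

lemma cosum_counit_right:
  assumes "module K W" "L \<in> lin_maps K A W" "x \<in> carrier A"
  shows "cosum K A W (\<lambda>a b. counit A b \<odot>\<^bsub>W\<^esub> L a) x = L x"
  using cosum_comm[OF assms(1) counit_bilin(1)[OF assms(1,2)] assms(3)]
    cosum_counit_left[OF assms] by simp

text \<open>\<open>\<Sum> M x\<^sub>1 x\<^sub>2 x\<^sub>3 x\<^sub>4 = \<Sum> M x\<^sub>1 x\<^sub>3 x\<^sub>2 x\<^sub>4\<close>: both sides are brought to the form in which the two middle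
  factors come from one comultiplication.\<close>

lemma cosum_exchange:
  assumes W: "module K W" and x: "x \<in> carrier A"
    and M1: "\<And>b c d. b \<in> carrier A \<Longrightarrow> c \<in> carrier A \<Longrightarrow> d \<in> carrier A \<Longrightarrow> (\<lambda>a. M a b c d) \<in> lin_maps K A W"
    and M2: "\<And>a c d. a \<in> carrier A \<Longrightarrow> c \<in> carrier A \<Longrightarrow> d \<in> carrier A \<Longrightarrow> (\<lambda>b. M a b c d) \<in> lin_maps K A W"
    and M3: "\<And>a b d. a \<in> carrier A \<Longrightarrow> b \<in> carrier A \<Longrightarrow> d \<in> carrier A \<Longrightarrow> (\<lambda>c. M a b c d) \<in> lin_maps K A W"
    and M4: "\<And>a b c. a \<in> carrier A \<Longrightarrow> b \<in> carrier A \<Longrightarrow> c \<in> carrier A \<Longrightarrow> (\<lambda>d. M a b c d) \<in> lin_maps K A W"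
  shows "cosum K A W (\<lambda>u v. cosum K A W (\<lambda>a b. cosum K A W (\<lambda>c d. M a b c d) v) u) x
    = cosum K A W (\<lambda>u v. cosum K A W (\<lambda>a c. cosum K A W (\<lambda>b d. M a b c d) v) u) x"
proof -
  define S where "S N = cosum K A W (\<lambda>a t. cosum K A W (\<lambda>w d. cosum K A W (\<lambda>b c. N a b c d) w) t) x"
    for N :: "'a \<Rightarrow> 'a \<Rightarrow> 'a \<Rightarrow> 'a \<Rightarrow> _"
  have form: "cosum K A W (\<lambda>u v. cosum K A W (\<lambda>a b. cosum K A W (\<lambda>c d. N a b c d) v) u) x = S N"
    if N1: "\<And>b c d. b \<in> carrier A \<Longrightarrow> c \<in> carrier A \<Longrightarrow> d \<in> carrier A \<Longrightarrow> (\<lambda>a. N a b c d) \<in> lin_maps K A W"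
      and N2: "\<And>a c d. a \<in> carrier A \<Longrightarrow> c \<in> carrier A \<Longrightarrow> d \<in> carrier A \<Longrightarrow> (\<lambda>b. N a b c d) \<in> lin_maps K A W"
      and N3: "\<And>a b d. a \<in> carrier A \<Longrightarrow> b \<in> carrier A \<Longrightarrow> d \<in> carrier A \<Longrightarrow> (\<lambda>c. N a b c d) \<in> lin_maps K A W"
      and N4: "\<And>a b c. a \<in> carrier A \<Longrightarrow> b \<in> carrier A \<Longrightarrow> c \<in> carrier A \<Longrightarrow> (\<lambda>d. N a b c d) \<in> lin_maps K A W"
    for N
  proof -
    have "cosum K A W (\<lambda>u v. cosum K A W (\<lambda>a b. cosum K A W (\<lambda>c d. N a b c d) v) u) x
        = cosum K A W (\<lambda>a t. cosum K A W (\<lambda>b v. cosum K A W (\<lambda>c d. N a b c d) v) t) x"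
      by (rule cosum_assoc[OF W x])
        (auto intro!: cosum_param cosum_lin bilinI W A_module N1 N2 N3 N4)
    also have "\<dots> = S N"
      unfolding S_def
    proof (rule cosum_cong[OF W _ _ x])
      show "bilin K A W (\<lambda>a t. cosum K A W (\<lambda>w d. cosum K A W (\<lambda>b c. N a b c d) w) t)"
        by (auto intro!: cosum_param cosum_lin bilinI W A_module N1 N2 N3 N4)
      fix a t assume a: "a \<in> carrier A" and t: "t \<in> carrier A"
      show "cosum K A W (\<lambda>b v. cosum K A W (\<lambda>c d. N a b c d) v) t
          = cosum K A W (\<lambda>w d. cosum K A W (\<lambda>b c. N a b c d) w) t"
        by (rule cosum_assoc[OF W t, symmetric]) (use a in \<open>auto intro!: N2 N3 N4\<close>)
    qed
    finally show ?thesis .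
  qed
  have "S M = S (\<lambda>a c b d. M a b c d)"
    unfolding S_def
  proof (intro cosum_cong[OF W _ _ x])
    show "bilin K A W (\<lambda>a t. cosum K A W (\<lambda>w d. cosum K A W (\<lambda>b c. M a c b d) w) t)"
      by (auto intro!: cosum_param cosum_lin bilinI W A_module M1 M2 M3 M4)
    fix a t assume a: "a \<in> carrier A" and t: "t \<in> carrier A"
    show "cosum K A W (\<lambda>w d. cosum K A W (\<lambda>b c. M a b c d) w) t
        = cosum K A W (\<lambda>w d. cosum K A W (\<lambda>b c. M a c b d) w) t"
    proof (rule cosum_cong[OF W _ _ t])
      show "bilin K A W (\<lambda>w d. cosum K A W (\<lambda>b c. M a c b d) w)"
        using a by (auto intro!: cosum_param cosum_lin bilinI W A_module M2 M3 M4)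
      fix w d assume w: "w \<in> carrier A" and d: "d \<in> carrier A"
      show "cosum K A W (\<lambda>b c. M a b c d) w = cosum K A W (\<lambda>b c. M a c b d) w"
        by (rule cosum_comm[OF W _ w, symmetric]) (use a d in \<open>auto intro!: bilinI M2 M3\<close>)
    qed
  qed
  then show ?thesis
    using form[of M] form[of "\<lambda>a c b d. M a b c d"] M1 M2 M3 M4 by simp
qed

lemma iter_comult_lin: "iter_comult K A n \<in> lin_maps K A (tensor K (replicate n A))"
proof (induction n)
  case 0
  have "tens K ([] :: ('k, 'a, 's) coalgebra_scheme list) [] \<in> carrier (tensor K ([] :: ('k, 'a, 's) coalgebra_scheme list))"
    by (rule tens_closed[OF K_cring]) auto
  moreover have "module K (tensor K ([] :: ('k, 'a, 's) coalgebra_scheme list))"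
    by (rule tensor_module[OF K_cring]) auto
  ultimately show ?case using counit_scale_lin by simp
next
  case (Suc n)
  let ?R = "replicate (Suc n) A"
  let ?T = "tensor K ?R"
  note T = tensor_module[OF K_cring A_modules[of "Suc n"]]
  have m: "multilin K ?T ?R (tens K ?R)" by (rule multilin_tens[OF K_cring A_modules])
  then have m': "multilin K ?T (A # replicate n A) (tens K ?R)" by simp
  have b: "bilin K A ?T (\<lambda>a b. tensor_lift K ?T (\<lambda>q. tens K ?R (a # q)) (iter_comult K A n b))"
  proof (rule bilinI)
    show "(\<lambda>b. tensor_lift K ?T (\<lambda>q. tens K ?R (a # q)) (iter_comult K A n b)) \<in> lin_maps K A ?T"
      if "a \<in> carrier A" for a
      by (rule lin_maps_comp[OF Suc.IH tensor_lift_lin[OF K_cring A_modules T multilin_Cons_tail[OF m' that]]])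
    show "(\<lambda>a. tensor_lift K ?T (\<lambda>q. tens K ?R (a # q)) (iter_comult K A n b)) \<in> lin_maps K A ?T"
      if "b \<in> carrier A" for b
      by (rule tensor_lift_lin_param[OF K_cring A_modules T A_module lin_maps_closed[OF Suc.IH that]
            multilin_Cons_tail[OF m'] multilin_Cons_head[OF m']])
  qed
  have "iter_comult K A (Suc n)
      = cosum K A ?T (\<lambda>a b. tensor_lift K ?T (\<lambda>q. tens K ?R (a # q)) (iter_comult K A n b))"
    by (rule ext) (simp add: cosum_def)
  then show ?case using cosum_lin[OF T b] by simp
qed

lemma iter_comult_closed: "x \<in> carrier A \<Longrightarrow> iter_comult K A n x \<in> carrier (tensor K (replicate n A))"
  by (rule lin_maps_closed[OF iter_comult_lin])

lemma sw_lin: "module K W \<Longrightarrow> multilin K W (replicate n A) \<gamma> \<Longrightarrow> sw K A W n \<gamma> \<in> lin_maps K A W"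
  unfolding sw_def
  by (rule lin_maps_comp[OF iter_comult_lin tensor_lift_lin[OF K_cring A_modules]])

lemma sw_cong:
  assumes "module K W" "multilin K W (replicate n A) \<gamma>" "\<And>p. p \<in> tuples (replicate n A) \<Longrightarrow> \<gamma>' p = \<gamma> p"
    and "x \<in> carrier A"
  shows "sw K A W n \<gamma>' x = sw K A W n \<gamma> x"
  unfolding sw_def
  by (rule tensor_lift_cong[OF K_cring A_modules assms(1,2,3) iter_comult_closed[OF assms(4)]])

lemma sw_lin_comp:
  assumes "module K W" "module K U" "multilin K W (replicate n A) \<gamma>" "\<phi> \<in> lin_maps K W U" "x \<in> carrier A"
  shows "\<phi> (sw K A W n \<gamma> x) = sw K A U n (\<lambda>p. \<phi> (\<gamma> p)) x"
  unfolding sw_def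
  by (rule tensor_lift_comp[OF K_cring A_modules assms(1-4) iter_comult_closed[OF assms(5)]])

lemma sw_param:
  assumes "module K W" "module K V" "x \<in> carrier A"
    and "\<And>u. u \<in> carrier V \<Longrightarrow> multilin K W (replicate n A) (G u)"
    and "\<And>p. p \<in> tuples (replicate n A) \<Longrightarrow> (\<lambda>u. G u p) \<in> lin_maps K V W"
  shows "(\<lambda>u. sw K A W n (G u) x) \<in> lin_maps K V W"
  unfolding sw_def
  by (rule tensor_lift_lin_param[OF K_cring A_modules assms(1,2) iter_comult_closed[OF assms(3)] assms(4,5)])

lemma sw_multilin_param:
  assumes "module K W" "all_modules K Us" "x \<in> carrier A"
    and "\<And>q. q \<in> tuples Us \<Longrightarrow> multilin K W (replicate n A) (G q)"
    and "\<And>p. p \<in> tuples (replicate n A) \<Longrightarrow> multilin K W Us (\<lambda>q. G q p)"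
  shows "multilin K W Us (\<lambda>q. sw K A W n (G q) x)"
  unfolding sw_def
  by (rule tensor_lift_multilin_param[OF K_cring A_modules assms(1) iter_comult_closed[OF assms(3)] assms(2,4,5)])

lemma sw_0:
  assumes "module K W" "\<gamma> [] \<in> carrier W" "x \<in> carrier A"
  shows "sw K A W 0 \<gamma> x = counit A x \<odot>\<^bsub>W\<^esub> \<gamma> []"
proof -
  let ?N = "[] :: ('k, 'a, 's) coalgebra_scheme list"
  have m: "multilin K W ?N \<gamma>" using assms(2) by simp
  have N: "all_modules K ?N" by simp
  have t: "tens K ?N [] \<in> carrier (tensor K ?N)"
    by (rule tens_closed[OF K_cring N]) simp
  show ?thesis
    unfolding sw_def iter_comult.simps
    using lin_maps_smult[OF tensor_lift_lin[OF K_cring N assms(1) m] counit_closed[OF assms(3)] t]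
      tensor_lift_tens[OF K_cring N assms(1) m, of "[]"] by simp
qed

lemma sw_Suc_bilin:
  assumes W: "module K W" and \<gamma>: "multilin K W (replicate (Suc n) A) \<gamma>"
  shows "bilin K A W (\<lambda>a b. sw K A W n (\<lambda>q. \<gamma> (a # q)) b)"
proof -
  have \<gamma>': "multilin K W (A # replicate n A) \<gamma>" using \<gamma> by simp
  show ?thesis
    by (rule bilinI)
      (auto intro: sw_lin[OF W multilin_Cons_tail[OF \<gamma>']]
        sw_param[OF W A_module _ multilin_Cons_tail[OF \<gamma>'] multilin_Cons_head[OF \<gamma>']])
qed

lemma sw_Suc:
  assumes W: "module K W" and \<gamma>: "multilin K W (replicate (Suc n) A) \<gamma>" and x: "x \<in> carrier A"
  shows "sw K A W (Suc n) \<gamma> x = cosum K A W (\<lambda>a b. sw K A W n (\<lambda>q. \<gamma> (a # q)) b) x"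
proof -
  let ?R = "replicate (Suc n) A"
  let ?T = "tensor K ?R"
  note T = tensor_module[OF K_cring A_modules[of "Suc n"]]
  have m: "multilin K ?T ?R (tens K ?R)" by (rule multilin_tens[OF K_cring A_modules])
  then have m': "multilin K ?T (A # replicate n A) (tens K ?R)" by simp
  have lift: "tensor_lift K W \<gamma> \<in> lin_maps K ?T W"
    by (rule tensor_lift_lin[OF K_cring A_modules W \<gamma>])
  have "sw K A W (Suc n) \<gamma> x = tensor_lift K W \<gamma> (cosum K A ?T (\<lambda>a b. sw K A ?T n (\<lambda>q. tens K ?R (a # q)) b) x)"
    unfolding sw_def cosum_def by simp
  also have "\<dots> = cosum K A W (\<lambda>a b. tensor_lift K W \<gamma> (sw K A ?T n (\<lambda>q. tens K ?R (a # q)) b)) x"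
    by (rule cosum_lin_comp[OF T W sw_Suc_bilin[OF T m] lift x])
  also have "\<dots> = cosum K A W (\<lambda>a b. sw K A W n (\<lambda>q. \<gamma> (a # q)) b) x"
  proof (rule cosum_cong[OF W sw_Suc_bilin[OF W \<gamma>] _ x])
    fix a b assume a: "a \<in> carrier A" and b: "b \<in> carrier A"
    have \<gamma>': "multilin K W (A # replicate n A) \<gamma>" using \<gamma> by simp
    have "tensor_lift K W \<gamma> (sw K A ?T n (\<lambda>q. tens K ?R (a # q)) b)
        = sw K A W n (\<lambda>q. tensor_lift K W \<gamma> (tens K ?R (a # q))) b"
      by (rule sw_lin_comp[OF T W multilin_Cons_tail[OF m' a] lift b])
    also have "\<dots> = sw K A W n (\<lambda>q. \<gamma> (a # q)) b"
    proof (rule sw_cong[OF W multilin_Cons_tail[OF \<gamma>' a] _ b])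
      fix p assume "p \<in> tuples (replicate n A)"
      then have "a # p \<in> tuples ?R" using a by simp
      then show "tensor_lift K W \<gamma> (tens K ?R (a # p)) = \<gamma> (a # p)"
        by (rule tensor_lift_tens[OF K_cring A_modules W \<gamma>])
    qed
    finally show "tensor_lift K W \<gamma> (sw K A ?T n (\<lambda>q. tens K ?R (a # q)) b) = sw K A W n (\<lambda>q. \<gamma> (a # q)) b" .
  qed
  finally show ?thesis .
qed

lemma sw_1:
  assumes W: "module K W" and \<gamma>: "multilin K W [A] \<gamma>" and x: "x \<in> carrier A"
  shows "sw K A W 1 \<gamma> x = \<gamma> [x]"
proof -
  have l: "(\<lambda>a. \<gamma> [a]) \<in> lin_maps K A W"
    using multilin_Cons_head[OF \<gamma>, of "[]"] by simp
  have "sw K A W (Suc 0) \<gamma> x = cosum K A W (\<lambda>a b. sw K A W 0 (\<lambda>q. \<gamma> (a # q)) b) x"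
    using \<gamma> by (intro sw_Suc[OF W _ x]) simp
  also have "\<dots> = cosum K A W (\<lambda>a b. counit A b \<odot>\<^bsub>W\<^esub> \<gamma> [a]) x"
    by (rule cosum_cong[OF W counit_bilin(2)[OF W l] _ x]) (use lin_maps_closed[OF l] in \<open>simp add: sw_0[OF W]\<close>)
  also have "\<dots> = \<gamma> [x]" by (rule cosum_counit_right[OF W l x])
  finally show ?thesis by simp
qed

text \<open>Coassociativity in the form \<open>\<Delta>\<^sub>m\<^sub>+\<^sub>n = (\<Delta>\<^sub>m \<otimes> \<Delta>\<^sub>n) \<circ> \<Delta>\<close>. The recursion for \<open>\<Delta>\<^sub>m\<close> splits off the left-most
  factor, so the induction step is one application of \<open>cosum_assoc\<close>.\<close>

lemma sw_append:
  assumes W: "module K W"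
  shows "multilin K W (replicate (m + n) A) \<gamma> \<Longrightarrow> x \<in> carrier A \<Longrightarrow>
    sw K A W (m + n) \<gamma> x = cosum K A W (\<lambda>a b. sw K A W m (\<lambda>r. sw K A W n (\<lambda>s. \<gamma> (r @ s)) b) a) x"
proof (induction m arbitrary: \<gamma> x)
  case 0
  then have l: "sw K A W n \<gamma> \<in> lin_maps K A W" by (intro sw_lin[OF W]) simp
  have "cosum K A W (\<lambda>a b. sw K A W 0 (\<lambda>r. sw K A W n (\<lambda>s. \<gamma> (r @ s)) b) a) x
      = cosum K A W (\<lambda>a b. counit A a \<odot>\<^bsub>W\<^esub> sw K A W n \<gamma> b) x"
    using lin_maps_closed[OF l]
    by (intro cosum_cong[OF W counit_bilin(1)[OF W l] _ 0(2)]) (simp add: sw_0[OF W])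
  then show ?case using cosum_counit_left[OF W l 0(2)] by simp
next
  case (Suc m)
  let ?H = "\<lambda>a c d. sw K A W m (\<lambda>r. sw K A W n (\<lambda>s. \<gamma> (a # r @ s)) d) c"
  have \<gamma>: "multilin K W (A # replicate (m + n) A) \<gamma>" using Suc.prems by simp
  have \<gamma>': "multilin K W (replicate m A @ replicate n A) (\<lambda>q. \<gamma> (a # q))" if "a \<in> carrier A" for a
    using multilin_Cons_tail[OF \<gamma> that] by (simp add: replicate_add)
  have m1: "multilin K W (replicate n A) (\<lambda>s. \<gamma> (a # r @ s))"
    if "a \<in> carrier A" "r \<in> tuples (replicate m A)" for a r
    using \<gamma>'[OF that(1)] that(2) unfolding multilin_append by blast
  have m2: "multilin K W (replicate m A) (\<lambda>r. \<gamma> (a # r @ s))"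
    if "a \<in> carrier A" "s \<in> tuples (replicate n A)" for a s
    using \<gamma>'[OF that(1)] that(2) unfolding multilin_append by blast
  have m3: "(\<lambda>a. \<gamma> (a # r @ s)) \<in> lin_maps K A W"
    if "r \<in> tuples (replicate m A)" "s \<in> tuples (replicate n A)" for r s
    using multilin_Cons_head[OF \<gamma>, of "r @ s"] tuples_append[OF that] by (simp add: replicate_add)
  have mr: "multilin K W (replicate m A) (\<lambda>r. sw K A W n (\<lambda>s. \<gamma> (a # r @ s)) d)"
    if "a \<in> carrier A" "d \<in> carrier A" for a d
    using that by (intro sw_multilin_param[OF W A_modules] m1 m2)
  have H1: "(\<lambda>a. ?H a c d) \<in> lin_maps K A W" if "c \<in> carrier A" "d \<in> carrier A" for c d
    using that by (intro sw_param[OF W A_module] m1 m3 mr)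
  have H2: "(\<lambda>c. ?H a c d) \<in> lin_maps K A W" if "a \<in> carrier A" "d \<in> carrier A" for a d
    using that by (intro sw_lin[OF W] mr)
  have H3: "(\<lambda>d. ?H a c d) \<in> lin_maps K A W" if "a \<in> carrier A" "c \<in> carrier A" for a c
    using that by (intro sw_param[OF W A_module] mr sw_lin[OF W] m1)
  have Hm: "multilin K W (replicate (Suc m) A) (\<lambda>r. sw K A W n (\<lambda>s. \<gamma> (r @ s)) d)" if d: "d \<in> carrier A" for d
    unfolding replicate_Suc
    using d by (intro multilin_ConsI) (auto intro: mr sw_param[OF W A_module d m1 m3])
  have "sw K A W (Suc m + n) \<gamma> x = cosum K A W (\<lambda>a b. sw K A W (m + n) (\<lambda>q. \<gamma> (a # q)) b) x"
    using sw_Suc[OF W _ Suc.prems(2)] Suc.prems(1) by simp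
  also have "\<dots> = cosum K A W (\<lambda>a b. cosum K A W (\<lambda>c d. ?H a c d) b) x"
  proof (rule cosum_cong[OF W _ _ Suc.prems(2)])
    show "bilin K A W (\<lambda>a b. cosum K A W (\<lambda>c d. ?H a c d) b)"
      by (auto intro!: bilinI cosum_lin cosum_param W A_module H1 H2 H3)
    show "sw K A W (m + n) (\<lambda>q. \<gamma> (a # q)) b = cosum K A W (\<lambda>c d. ?H a c d) b"
      if "a \<in> carrier A" "b \<in> carrier A" for a b
      using multilin_Cons_tail[OF \<gamma> that(1)] by (rule Suc.IH[OF _ that(2)])
  qed
  also have "\<dots> = cosum K A W (\<lambda>u d. cosum K A W (\<lambda>a c. ?H a c d) u) x"
    by (rule cosum_assoc[OF W Suc.prems(2) H1 H2 H3, symmetric])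
  also have "\<dots> = cosum K A W (\<lambda>u d. sw K A W (Suc m) (\<lambda>r. sw K A W n (\<lambda>s. \<gamma> (r @ s)) d) u) x"
  proof (rule cosum_cong[OF W _ _ Suc.prems(2), symmetric])
    show "bilin K A W (\<lambda>u d. cosum K A W (\<lambda>a c. ?H a c d) u)"
      by (auto intro!: bilinI cosum_lin cosum_param W A_module H1 H2 H3)
    fix u d assume u: "u \<in> carrier A" and d: "d \<in> carrier A"
    show "sw K A W (Suc m) (\<lambda>r. sw K A W n (\<lambda>s. \<gamma> (r @ s)) d) u = cosum K A W (\<lambda>a c. ?H a c d) u"
      using sw_Suc[OF W Hm[OF d] u] by simp
  qed
  finally show ?case .
qed

end


subsection \<open>Coalgebra homomorphisms\<close>

lemma coc_module: "coc_coalgebra K C \<Longrightarrow> module K C"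
  by (rule coc_coalgebra.A_module)

lemma coalg_homs_lin: "\<phi> \<in> coalg_homs K C D \<Longrightarrow> \<phi> \<in> lin_maps K C D"
  by (simp add: coalg_homs_def)

lemma coalg_homs_comult:
  "\<phi> \<in> coalg_homs K C D \<Longrightarrow> x \<in> carrier C \<Longrightarrow> tensor_map K [D, D] [\<phi>, \<phi>] (comult C x) = comult D (\<phi> x)"
  by (simp add: coalg_homs_def)

lemma coalg_homs_counit: "\<phi> \<in> coalg_homs K C D \<Longrightarrow> x \<in> carrier C \<Longrightarrow> counit D (\<phi> x) = counit C x"
  by (simp add: coalg_homs_def)

lemma lin_maps_list_pair: "\<phi> \<in> lin_maps K V W \<Longrightarrow> lin_maps_list K [V, V] [W, W] [\<phi>, \<phi>]"
  by (intro lin_maps_list.intros)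

lemma tensor_map_comult:
  assumes C: "coc_coalgebra K C" and W: "module K W" and \<phi>: "\<phi> \<in> lin_maps K C W" and x: "x \<in> carrier C"
  shows "tensor_map K [W, W] [\<phi>, \<phi>] (comult C x)
    = cosum K C (tensor K [W, W]) (\<lambda>a b. tens K [W, W] [\<phi> a, \<phi> b]) x"
proof -
  interpret C: coc_coalgebra K C by (rule C)
  have Ws: "all_modules K [W, W]" using W by simp
  show ?thesis
    unfolding tensor_map_def cosum_def
    by (rule tensor_lift_cong[OF C.K_cring C.AA_modules tensor_module[OF C.K_cring Ws]
          multilin_bilin[OF bilin_comp[OF tens_pair_bilin[OF W] \<phi>]] _ C.comult_closed[OF x]])
      (erule tuples_2E, simp)
qed

lemma cosum_map:
  assumes C: "coc_coalgebra K C" and D: "module K D" and W: "module K W" and \<phi>: "\<phi> \<in> lin_maps K C D"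
    and \<Delta>: "comult D (\<phi> x) = tensor_map K [D, D] [\<phi>, \<phi>] (comult C x)"
    and G: "bilin K D W G" and x: "x \<in> carrier C"
  shows "cosum K D W G (\<phi> x) = cosum K C W (\<lambda>a b. G (\<phi> a) (\<phi> b)) x"
proof -
  interpret C: coc_coalgebra K C by (rule C)
  have Ds: "all_modules K [D, D]" using D by simp
  have "cosum K D W G (\<phi> x)
      = tensor_lift K W (\<lambda>p. G (apply_each [\<phi>, \<phi>] p ! 0) (apply_each [\<phi>, \<phi>] p ! 1)) (comult C x)"
    unfolding cosum_def \<Delta>
    by (rule tensor_lift_tensor_map[OF C.K_cring C.AA_modules Ds lin_maps_list_pair[OF \<phi>] W
          multilin_bilin[OF G] C.comult_closed[OF x]])
  also have "\<dots> = cosum K C W (\<lambda>a b. G (\<phi> a) (\<phi> b)) x"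
    unfolding cosum_def
    by (rule tensor_lift_cong[OF C.K_cring C.AA_modules W multilin_bilin[OF bilin_comp[OF G \<phi>]] _
          C.comult_closed[OF x]])
      (erule tuples_2E, simp)
  finally show ?thesis .
qed

lemma cosum_hom:
  assumes "coc_coalgebra K C" "coc_coalgebra K D" "module K W" "\<phi> \<in> coalg_homs K C D"
    "bilin K D W G" "x \<in> carrier C"
  shows "cosum K D W G (\<phi> x) = cosum K C W (\<lambda>a b. G (\<phi> a) (\<phi> b)) x"
  by (rule cosum_map[OF assms(1) coc_module[OF assms(2)] assms(3) coalg_homs_lin[OF assms(4)]
        coalg_homs_comult[OF assms(4,6), symmetric] assms(5,6)])

lemma lin_maps_list_replicate:
  "\<phi> \<in> lin_maps K V W \<Longrightarrow> lin_maps_list K (replicate n V) (replicate n W) (replicate n \<phi>)"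
  by (rule lin_maps_listI[where n = n]) auto

lemma map2_replicate: "length p = n \<Longrightarrow> apply_each (replicate n \<phi>) p = map \<phi> p"
proof (induction n arbitrary: p)
  case (Suc n)
  then show ?case by (cases p) auto
qed simp

lemma multilin_map:
  assumes "\<phi> \<in> lin_maps K V W" "module K V" "multilin K U (replicate n W) \<gamma>"
  shows "multilin K U (replicate n V) (\<lambda>p. \<gamma> (map \<phi> p))"
proof (rule multilin_cong[OF _ multilin_apply_each[OF lin_maps_list_replicate[OF assms(1)] assms(3)]])
  show "all_modules K (replicate n V)" using assms(2) by simp
  show "\<gamma> (map \<phi> p) = \<gamma> (apply_each (replicate n \<phi>) p)" if "p \<in> tuples (replicate n V)" for p
    using tuples_length[OF that] by (simp add: map2_replicate)
qed

lemma sw_hom: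
  assumes C: "coc_coalgebra K C" and D: "coc_coalgebra K D" and W: "module K W" and \<phi>: "\<phi> \<in> coalg_homs K C D"
  shows "multilin K W (replicate n D) \<gamma> \<Longrightarrow> x \<in> carrier C \<Longrightarrow>
    sw K D W n \<gamma> (\<phi> x) = sw K C W n (\<lambda>p. \<gamma> (map \<phi> p)) x"
proof (induction n arbitrary: \<gamma> x)
  interpret C: coc_coalgebra K C by (rule C)
  interpret D: coc_coalgebra K D by (rule D)
  note l = coalg_homs_lin[OF \<phi>]
  {
    case 0
    then show ?case
      using lin_maps_closed[OF l] coalg_homs_counit[OF \<phi>] by (simp add: C.sw_0[OF W] D.sw_0[OF W])
  next
    case (Suc n)
    have \<gamma>: "multilin K W (D # replicate n D) \<gamma>" using Suc.prems by simp
    note \<gamma>' = multilin_map[OF l C.A_module Suc.prems(1)]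
    have "sw K D W (Suc n) \<gamma> (\<phi> x) = cosum K D W (\<lambda>a b. sw K D W n (\<lambda>q. \<gamma> (a # q)) b) (\<phi> x)"
      by (rule D.sw_Suc[OF W Suc.prems(1) lin_maps_closed[OF l Suc.prems(2)]])
    also have "\<dots> = cosum K C W (\<lambda>a b. sw K D W n (\<lambda>q. \<gamma> (\<phi> a # q)) (\<phi> b)) x"
      by (rule cosum_hom[OF C D W \<phi> D.sw_Suc_bilin[OF W Suc.prems(1)] Suc.prems(2)])
    also have "\<dots> = cosum K C W (\<lambda>a b. sw K C W n (\<lambda>q. \<gamma> (map \<phi> (a # q))) b) x"
    proof (rule C.cosum_cong[OF W C.sw_Suc_bilin[OF W \<gamma>'] _ Suc.prems(2)])
      fix a b assume a: "a \<in> carrier C" and b: "b \<in> carrier C"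
      show "sw K D W n (\<lambda>q. \<gamma> (\<phi> a # q)) (\<phi> b) = sw K C W n (\<lambda>q. \<gamma> (map \<phi> (a # q))) b"
        using Suc.IH[OF multilin_Cons_tail[OF \<gamma> lin_maps_closed[OF l a]] b] by simp
    qed
    also have "\<dots> = sw K C W (Suc n) (\<lambda>p. \<gamma> (map \<phi> p)) x"
      by (rule C.sw_Suc[OF W \<gamma>' Suc.prems(2), symmetric])
    finally show ?case .
  }
qed

lemma pairing_sw: "pairing K P Cs \<phi>s x = sw K P (tensor K Cs) (length Cs) (\<lambda>p. tens K Cs (apply_each \<phi>s p)) x"
  by (simp add: pairing_def tensor_map_def sw_def)

context
  fixes K :: "('k, 'r) ring_scheme" and P :: "('k, 'a, 's) coalgebra_scheme"
    and Cs :: "('k, 'b, 't) coalgebra_scheme list" and \<phi>s :: "('a \<Rightarrow> 'b) list"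
  assumes P: "coc_coalgebra K P" and Cs: "all_modules K Cs"
    and \<phi>s: "lin_maps_list K (replicate (length Cs) P) Cs \<phi>s"
begin

interpretation P: coc_coalgebra K P by (rule P)

lemma pairing_lin: "pairing K P Cs \<phi>s \<in> lin_maps K P (tensor K Cs)"
proof -
  have "pairing K P Cs \<phi>s = sw K P (tensor K Cs) (length Cs) (\<lambda>p. tens K Cs (apply_each \<phi>s p))"
    by (rule ext) (rule pairing_sw)
  then show ?thesis
    using P.sw_lin[OF tensor_module[OF P.K_cring Cs] multilin_tens_apply_each[OF P.K_cring P.A_modules Cs \<phi>s]]
    by simp
qed

lemma tensor_lift_pairing:
  assumes "module K W" "multilin K W Cs \<beta>" "x \<in> carrier P"
  shows "tensor_lift K W \<beta> (pairing K P Cs \<phi>s x) = sw K P W (length Cs) (\<lambda>p. \<beta> (apply_each \<phi>s p)) x"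
  unfolding pairing_def sw_def
  by (rule tensor_lift_tensor_map[OF P.K_cring P.A_modules Cs \<phi>s assms(1,2) P.iter_comult_closed[OF assms(3)]])

end


subsection \<open>Iterated comultiplications in blocks\<close>

fun apply_blocks :: "(nat \<times> ('a list \<Rightarrow> 'v)) list \<Rightarrow> 'a list \<Rightarrow> 'v list"
  where
    "apply_blocks [] r = []"
  | "apply_blocks ((n, \<gamma>) # bs) r = \<gamma> (take n r) # apply_blocks bs (drop n r)"

definition multilin_blocks ::
  "('k, 'r) ring_scheme \<Rightarrow> ('k, 'a, 's) module_scheme \<Rightarrow> (nat \<times> ('a list \<Rightarrow> 'v)) list \<Rightarrow>
    ('k, 'v, 't) module_scheme list \<Rightarrow> bool"
  where "multilin_blocks K A = list_all2 (\<lambda>(n, \<gamma>) V. module K V \<and> multilin K V (replicate n A) \<gamma>)"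

lemma apply_blocks_tuples:
  "multilin_blocks K A bs Vs \<Longrightarrow> r \<in> tuples (replicate (sum_list (map fst bs)) A) \<Longrightarrow>
    apply_blocks bs r \<in> tuples Vs"
proof (induction bs arbitrary: Vs r)
  case Nil
  then show ?case by (simp add: multilin_blocks_def)
next
  case (Cons b bs)
  obtain n \<gamma> where b: "b = (n, \<gamma>)" by (cases b)
  obtain V Vs' where Vs: "Vs = V # Vs'" and \<gamma>: "multilin K V (replicate n A) \<gamma>" and bs: "multilin_blocks K A bs Vs'"
    using Cons.prems(1) b by (auto simp: multilin_blocks_def list_all2_Cons1)
  have "r \<in> tuples (replicate n A @ replicate (sum_list (map fst bs)) A)"
    using Cons.prems(2) b by (simp add: replicate_add)
  then obtain p q where r: "r = p @ q" "p \<in> tuples (replicate n A)" "q \<in> tuples (replicate (sum_list (map fst bs)) A)"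
    by (rule tuples_appendE)
  then show ?case
    using Cons.IH[OF bs r(3)] multilin_closed[OF \<gamma> r(2)] tuples_length[OF r(2)] by (simp add: b Vs)
qed

lemma multilin_apply_blocks:
  "multilin_blocks K A bs Vs \<Longrightarrow> module K A \<Longrightarrow> multilin K W Vs \<beta> \<Longrightarrow>
    multilin K W (replicate (sum_list (map fst bs)) A) (\<lambda>r. \<beta> (apply_blocks bs r))"
proof (induction bs arbitrary: Vs \<beta>)
  case Nil
  then show ?case by (simp add: multilin_blocks_def)
next
  case (Cons b bs)
  let ?N = "sum_list (map fst bs)"
  obtain n \<gamma> where b: "b = (n, \<gamma>)" by (cases b)
  obtain V Vs' where Vs: "Vs = V # Vs'" and \<gamma>: "multilin K V (replicate n A) \<gamma>" and bs: "multilin_blocks K A bs Vs'"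
    using Cons.prems(1) b by (auto simp: multilin_blocks_def list_all2_Cons1)
  have \<beta>: "multilin K W (V # Vs') \<beta>" using Cons.prems(3) Vs by simp
  have mods: "all_modules K (replicate k A)" for k using Cons.prems(2) by simp
  have "multilin K W (replicate ?N A) (\<lambda>q. \<beta> (apply_blocks ((n, \<gamma>) # bs) (p @ q)))"
    if p: "p \<in> tuples (replicate n A)" for p
    using Cons.IH[OF bs Cons.prems(2) multilin_Cons_tail[OF \<beta> multilin_closed[OF \<gamma> p]]] tuples_length[OF p]
    by simp
  moreover have "multilin K W (replicate n A) (\<lambda>p. \<beta> (apply_blocks ((n, \<gamma>) # bs) (p @ q)))"
    if q: "q \<in> tuples (replicate ?N A)" for q
  proof (rule multilin_cong[OF mods multilin_lin_comp[OF \<gamma> multilin_Cons_head[OF \<beta> apply_blocks_tuples[OF bs q]]]])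
    fix p assume "p \<in> tuples (replicate n A)"
    then show "\<beta> (apply_blocks ((n, \<gamma>) # bs) (p @ q)) = \<beta> (\<gamma> p # apply_blocks bs q)"
      using tuples_length by fastforce
  qed
  ultimately have "multilin K W (replicate n A @ replicate ?N A) (\<lambda>r. \<beta> (apply_blocks ((n, \<gamma>) # bs) r))"
    unfolding multilin_append by blast
  then show ?case by (simp add: b replicate_add)
qed

text \<open>Coassociativity for blocks: \<open>\<Delta>\<^sub>N\<close> with \<open>N = n\<^sub>1 + \<dots> + n\<^sub>k\<close> is \<open>\<Delta>\<^sub>k\<close> followed by \<open>\<Delta>\<^sub>n\<^sub>i\<close> in the \<open>i\<close>-th factor.\<close>

lemma sw_blocks:
  assumes C: "coc_coalgebra K C" and W: "module K W"
  shows "multilin_blocks K C bs Vs \<Longrightarrow> multilin K W Vs \<beta> \<Longrightarrow> x \<in> carrier C \<Longrightarrow>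
    sw K C W (sum_list (map fst bs)) (\<lambda>r. \<beta> (apply_blocks bs r)) x
    = sw K C W (length bs) (\<lambda>r. \<beta> (apply_each (map2 (\<lambda>(n, \<gamma>) V. sw K C V n \<gamma>) bs Vs) r)) x"
proof (induction bs arbitrary: Vs \<beta> x)
  case Nil
  then show ?case by (simp add: multilin_blocks_def)
next
  case (Cons b bs)
  interpret C: coc_coalgebra K C by (rule C)
  let ?N = "sum_list (map fst bs)"
  obtain n \<gamma> where b: "b = (n, \<gamma>)" by (cases b)
  obtain V Vs' where Vs: "Vs = V # Vs'" and V: "module K V" and \<gamma>: "multilin K V (replicate n C) \<gamma>"
    and bs: "multilin_blocks K C bs Vs'"
    using Cons.prems(1) b by (auto simp: multilin_blocks_def list_all2_Cons1)
  let ?\<phi>s = "map2 (\<lambda>(n, \<gamma>) V. sw K C V n \<gamma>) bs Vs'"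
  have \<beta>: "multilin K W (V # Vs') \<beta>" using Cons.prems(2) Vs by simp
  have len: "length Vs' = length bs"
    using bs by (auto simp: multilin_blocks_def dest: list_all2_lengthD)
  have \<phi>s: "lin_maps_list K (replicate (length bs) C) Vs' ?\<phi>s"
  proof (rule lin_maps_listI[where n = "length bs"])
    fix i assume i: "i < length bs"
    then show "?\<phi>s ! i \<in> lin_maps K (replicate (length bs) C ! i) (Vs' ! i)"
      using list_all2_nthD[OF bs[unfolded multilin_blocks_def] i] len
      by (auto split: prod.splits intro: C.sw_lin)
  qed (use len in auto)
  have full: "multilin K W (replicate (n + ?N) C) (\<lambda>r. \<beta> (apply_blocks ((n, \<gamma>) # bs) r))"
    using multilin_apply_blocks[OF Cons.prems(1) C.A_module Cons.prems(2)] by (simp add: b)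
  have each1: "multilin K W (replicate (length bs) C) (\<lambda>s. \<beta> (v # apply_each ?\<phi>s s))" if "v \<in> carrier V" for v
    by (rule multilin_apply_each[OF \<phi>s multilin_Cons_tail[OF \<beta> that]])
  have each2: "(\<lambda>v. \<beta> (v # apply_each ?\<phi>s s)) \<in> lin_maps K V W" if "s \<in> tuples (replicate (length bs) C)" for s
    by (rule multilin_Cons_head[OF \<beta> apply_each_tuples[OF \<phi>s that]])
  have L: "(\<lambda>v. sw K C W (length bs) (\<lambda>s. \<beta> (v # apply_each ?\<phi>s s)) d) \<in> lin_maps K V W"
    if "d \<in> carrier C" for d
    by (rule C.sw_param[OF W V that each1 each2])
  have eachfull: "multilin K W (replicate (Suc (length bs)) C)
      (\<lambda>r. \<beta> (apply_each (sw K C V n \<gamma> # ?\<phi>s) r))"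
    using multilin_apply_each[OF lin_maps_list.Cons[OF C.sw_lin[OF V \<gamma>] \<phi>s] \<beta>] by simp
  have "sw K C W (n + ?N) (\<lambda>r. \<beta> (apply_blocks ((n, \<gamma>) # bs) r)) x
      = cosum K C W (\<lambda>a d. sw K C W n (\<lambda>r. sw K C W ?N (\<lambda>s. \<beta> (apply_blocks ((n, \<gamma>) # bs) (r @ s))) d) a) x"
    by (rule C.sw_append[OF W full Cons.prems(3)])
  also have "\<dots> = cosum K C W (\<lambda>a d. sw K C W (length bs) (\<lambda>q. \<beta> (apply_each (sw K C V n \<gamma> # ?\<phi>s) (a # q))) d) x"
  proof (rule C.cosum_cong[OF W C.sw_Suc_bilin[OF W eachfull] _ Cons.prems(3)])
    fix a d assume a: "a \<in> carrier C" and d: "d \<in> carrier C"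
    have "sw K C W n (\<lambda>r. sw K C W ?N (\<lambda>s. \<beta> (apply_blocks ((n, \<gamma>) # bs) (r @ s))) d) a
        = sw K C W n (\<lambda>r. sw K C W (length bs) (\<lambda>s. \<beta> (\<gamma> r # apply_each ?\<phi>s s)) d) a"
    proof (rule C.sw_cong[OF W multilin_lin_comp[OF \<gamma> L[OF d]] _ a])
      fix r assume r: "r \<in> tuples (replicate n C)"
      have v: "\<gamma> r \<in> carrier V" by (rule multilin_closed[OF \<gamma> r])
      have "sw K C W ?N (\<lambda>s. \<beta> (apply_blocks ((n, \<gamma>) # bs) (r @ s))) d
          = sw K C W ?N (\<lambda>s. \<beta> (\<gamma> r # apply_blocks bs s)) d"
        using tuples_length[OF r] by simp
      also have "\<dots> = sw K C W (length bs) (\<lambda>s. \<beta> (\<gamma> r # apply_each ?\<phi>s s)) d"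
        by (rule Cons.IH[OF bs multilin_Cons_tail[OF \<beta> v] d])
      finally show "sw K C W ?N (\<lambda>s. \<beta> (apply_blocks ((n, \<gamma>) # bs) (r @ s))) d
          = sw K C W (length bs) (\<lambda>s. \<beta> (\<gamma> r # apply_each ?\<phi>s s)) d" .
    qed
    also have "\<dots> = sw K C W (length bs) (\<lambda>s. \<beta> (sw K C V n \<gamma> a # apply_each ?\<phi>s s)) d"
      by (rule C.sw_lin_comp[OF V W \<gamma> L[OF d] a, symmetric])
    finally show "sw K C W n (\<lambda>r. sw K C W ?N (\<lambda>s. \<beta> (apply_blocks ((n, \<gamma>) # bs) (r @ s))) d) a
        = sw K C W (length bs) (\<lambda>q. \<beta> (apply_each (sw K C V n \<gamma> # ?\<phi>s) (a # q))) d"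
      by simp
  qed
  also have "\<dots> = sw K C W (Suc (length bs)) (\<lambda>r. \<beta> (apply_each (sw K C V n \<gamma> # ?\<phi>s) r)) x"
    by (rule C.sw_Suc[OF W eachfull Cons.prems(3), symmetric])
  finally show ?case by (simp add: b Vs)
qed


subsection \<open>The comultiplication of a product\<close>

definition bimultilin ::
  "('k, 'r) ring_scheme \<Rightarrow> ('k, 'w, 't) module_scheme \<Rightarrow> ('k, 'v, 's) module_scheme list \<Rightarrow>
    ('v list \<Rightarrow> 'v list \<Rightarrow> 'w) \<Rightarrow> bool"
  where "bimultilin K W Vs \<Gamma> \<longleftrightarrow> (\<forall>r\<in>tuples Vs. multilin K W Vs (\<Gamma> r)) \<and>
    (\<forall>s\<in>tuples Vs. multilin K W Vs (\<lambda>r. \<Gamma> r s))"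

lemma bimultilin_right: "bimultilin K W Vs \<Gamma> \<Longrightarrow> r \<in> tuples Vs \<Longrightarrow> multilin K W Vs (\<Gamma> r)"
  by (simp add: bimultilin_def)

lemma bimultilin_left: "bimultilin K W Vs \<Gamma> \<Longrightarrow> s \<in> tuples Vs \<Longrightarrow> multilin K W Vs (\<lambda>r. \<Gamma> r s)"
  by (simp add: bimultilin_def)

lemma bimultilin_Cons:
  assumes "bimultilin K W (V # Vs) \<Gamma>"
  shows "a \<in> carrier V \<Longrightarrow> b \<in> carrier V \<Longrightarrow> bimultilin K W Vs (\<lambda>r s. \<Gamma> (a # r) (b # s))"
    and "r \<in> tuples Vs \<Longrightarrow> s \<in> tuples Vs \<Longrightarrow> b \<in> carrier V \<Longrightarrow> (\<lambda>a. \<Gamma> (a # r) (b # s)) \<in> lin_maps K V W"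
    and "r \<in> tuples Vs \<Longrightarrow> s \<in> tuples Vs \<Longrightarrow> a \<in> carrier V \<Longrightarrow> (\<lambda>b. \<Gamma> (a # r) (b # s)) \<in> lin_maps K V W"
proof -
  have t: "v # p \<in> tuples (V # Vs)" if "v \<in> carrier V" "p \<in> tuples Vs" for v p
    using that by simp
  show "bimultilin K W Vs (\<lambda>r s. \<Gamma> (a # r) (b # s))" if "a \<in> carrier V" "b \<in> carrier V"
    unfolding bimultilin_def
    using multilin_Cons_tail[OF bimultilin_right[OF assms t]] multilin_Cons_tail[OF bimultilin_left[OF assms t]] that
    by blast
  show "(\<lambda>a. \<Gamma> (a # r) (b # s)) \<in> lin_maps K V W" if "r \<in> tuples Vs" "s \<in> tuples Vs" "b \<in> carrier V"
    by (rule multilin_Cons_head[OF bimultilin_left[OF assms t[OF that(3,2)]] that(1)])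
  show "(\<lambda>b. \<Gamma> (a # r) (b # s)) \<in> lin_maps K V W" if "r \<in> tuples Vs" "s \<in> tuples Vs" "a \<in> carrier V"
    by (rule multilin_Cons_head[OF bimultilin_right[OF assms t[OF that(3,1)]] that(2)])
qed

text \<open>\<open>dbl K W Cs \<Gamma> [c\<^sub>1, \<dots>, c\<^sub>n]\<close> is \<open>\<Sum> \<Gamma> [c\<^sub>1\<^sub>1, \<dots>, c\<^sub>n\<^sub>1] [c\<^sub>1\<^sub>2, \<dots>, c\<^sub>n\<^sub>2]\<close>: the comultiplication of
  \<open>C\<^sub>1 \<otimes> \<dots> \<otimes> C\<^sub>n\<close> at an elementary tensor.\<close>

primrec dbl ::
  "('k, 'r) ring_scheme \<Rightarrow> ('k, 'w, 't) module_scheme \<Rightarrow> ('k, 'c, 's) coalgebra_scheme list \<Rightarrow>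
    ('c list \<Rightarrow> 'c list \<Rightarrow> 'w) \<Rightarrow> 'c list \<Rightarrow> 'w"
  where
    "dbl K W [] = (\<lambda>\<Gamma> cs. \<Gamma> [] [])"
  | "dbl K W (C # Cs) = (\<lambda>\<Gamma> cs. cosum K C W (\<lambda>a b. dbl K W Cs (\<lambda>r s. \<Gamma> (a # r) (b # s)) (tl cs)) (hd cs))"

abbreviation all_coc :: "('k, 'r) ring_scheme \<Rightarrow> ('k, 'c, 's) coalgebra_scheme list \<Rightarrow> bool"
  where "all_coc K Cs \<equiv> \<forall>C\<in>set Cs. coc_coalgebra K C"

lemma all_coc_modules: "all_coc K Cs \<Longrightarrow> all_modules K Cs"
  by (simp add: coc_module)

lemma dbl_param:
  fixes Cs :: "('k, 'c, 's) coalgebra_scheme list" and V :: "('k, 'c, 's) coalgebra_scheme"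
  assumes W: "module K W"
  shows "all_coc K Cs \<Longrightarrow> module K V \<Longrightarrow> (\<And>u. u \<in> carrier V \<Longrightarrow> bimultilin K W Cs (\<Gamma> u)) \<Longrightarrow>
    (\<And>r s. r \<in> tuples Cs \<Longrightarrow> s \<in> tuples Cs \<Longrightarrow> (\<lambda>u. \<Gamma> u r s) \<in> lin_maps K V W) \<Longrightarrow> cs \<in> tuples Cs \<Longrightarrow>
    (\<lambda>u. dbl K W Cs (\<Gamma> u) cs) \<in> lin_maps K V W"
proof (induction Cs arbitrary: V \<Gamma> cs)
  case Nil
  then show ?case by simp
next
  case (Cons C Cs)
  interpret C: coc_coalgebra K C using Cons.prems(1) by simp
  have Cs: "all_coc K Cs" using Cons.prems(1) by simp
  from Cons.prems(5) obtain c cs' where cs: "cs = c # cs'" "c \<in> carrier C" "cs' \<in> tuples Cs"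
    by (rule tuples_ConsE)
  have "(\<lambda>u. cosum K C W (\<lambda>a b. dbl K W Cs (\<lambda>r s. \<Gamma> u (a # r) (b # s)) cs') c) \<in> lin_maps K V W"
  proof (rule C.cosum_param[OF W Cons.prems(2) cs(2)])
    fix u assume u: "u \<in> carrier V"
    note b = bimultilin_Cons[OF Cons.prems(3)[OF u]]
    show "bilin K C W (\<lambda>a b. dbl K W Cs (\<lambda>r s. \<Gamma> u (a # r) (b # s)) cs')"
      by (rule bilinI) (rule Cons.IH[OF Cs C.A_module _ _ cs(3)]; rule b; assumption)+
  next
    fix a b assume a: "a \<in> carrier C" and b: "b \<in> carrier C"
    show "(\<lambda>u. dbl K W Cs (\<lambda>r s. \<Gamma> u (a # r) (b # s)) cs') \<in> lin_maps K V W"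
      using a b by (intro Cons.IH[OF Cs Cons.prems(2) _ _ cs(3)] bimultilin_Cons(1)[OF Cons.prems(3)] Cons.prems(4)) simp_all
  qed
  then show ?case by (simp add: cs)
qed

lemma dbl_bilin:
  fixes Cs :: "('k, 'c, 's) coalgebra_scheme list"
  assumes W: "module K W" and Cs: "all_coc K (C # Cs)" and \<Gamma>: "bimultilin K W (C # Cs) \<Gamma>" and cs: "cs \<in> tuples Cs"
  shows "bilin K C W (\<lambda>a b. dbl K W Cs (\<lambda>r s. \<Gamma> (a # r) (b # s)) cs)"
proof -
  have C: "module K C" and Cs': "all_coc K Cs" using Cs by (auto intro: coc_module)
  show ?thesis
    by (rule bilinI) (rule dbl_param[OF W Cs' C _ _ cs]; rule bimultilin_Cons[OF \<Gamma>]; assumption)+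
qed

lemma multilin_dbl:
  assumes W: "module K W"
  shows "all_coc K Cs \<Longrightarrow> bimultilin K W Cs \<Gamma> \<Longrightarrow> multilin K W Cs (dbl K W Cs \<Gamma>)"
proof (induction Cs arbitrary: \<Gamma>)
  case Nil
  then show ?case by (simp add: bimultilin_def)
next
  case (Cons C Cs)
  interpret C: coc_coalgebra K C using Cons.prems(1) by simp
  have Cs: "all_coc K Cs" using Cons.prems(1) by simp
  note b = dbl_bilin[OF W Cons.prems]
  show ?case
  proof (rule multilin_ConsI)
    show "multilin K W Cs (\<lambda>p. dbl K W (C # Cs) \<Gamma> (c # p))" if "c \<in> carrier C" for c
      unfolding dbl.simps list.sel
      by (rule C.cosum_multilin_param[OF W all_coc_modules[OF Cs] that b])
        (assumption, rule Cons.IH[OF Cs bimultilin_Cons(1)[OF Cons.prems(2)]])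
    show "(\<lambda>c. dbl K W (C # Cs) \<Gamma> (c # p)) \<in> lin_maps K C W" if "p \<in> tuples Cs" for p
      unfolding dbl.simps list.sel by (rule C.cosum_lin[OF W b[OF that]])
  qed
qed

lemma dbl_zero:
  assumes W: "module K W"
  shows "all_coc K Cs \<Longrightarrow> (\<And>r s. r \<in> tuples Cs \<Longrightarrow> s \<in> tuples Cs \<Longrightarrow> \<Gamma> r s = \<zero>\<^bsub>W\<^esub>) \<Longrightarrow> cs \<in> tuples Cs \<Longrightarrow>
    dbl K W Cs \<Gamma> cs = \<zero>\<^bsub>W\<^esub>"
proof (induction Cs arbitrary: \<Gamma> cs)
  case (Cons C Cs)
  interpret C: coc_coalgebra K C using Cons.prems(1) by simp
  from Cons.prems(3) obtain c cs' where cs: "cs = c # cs'" "c \<in> carrier C" "cs' \<in> tuples Cs"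
    by (rule tuples_ConsE)
  have "dbl K W Cs (\<lambda>r s. \<Gamma> (a # r) (b # s)) cs' = \<zero>\<^bsub>W\<^esub>" if "a \<in> carrier C" "b \<in> carrier C" for a b
    using Cons.prems(1) that by (intro Cons.IH[OF _ _ cs(3)] Cons.prems(2)) simp_all
  then show ?case
    using C.cosum_zero[OF W _ cs(2)] by (simp add: cs)
qed simp

lemma lin_maps_list_homs:
  "list_all2 (\<lambda>q C. q \<in> coalg_homs K P C) qs Cs \<Longrightarrow> lin_maps_list K (replicate (length Cs) P) Cs qs"
  by (rule lin_maps_listI[where n = "length Cs"])
    (auto dest: list_all2_lengthD list_all2_nthD2 intro: coalg_homs_lin)

lemma sw_cosum_swap:
  assumes C: "coc_coalgebra K C" and W: "module K W" and x: "x \<in> carrier C" and y: "y \<in> carrier C"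
    and N1: "\<And>r. r \<in> tuples (replicate n C) \<Longrightarrow> bilin K C W (N r)"
    and N2: "\<And>a b. a \<in> carrier C \<Longrightarrow> b \<in> carrier C \<Longrightarrow> multilin K W (replicate n C) (\<lambda>r. N r a b)"
  shows "sw K C W n (\<lambda>r. cosum K C W (N r) y) x = cosum K C W (\<lambda>a b. sw K C W n (\<lambda>r. N r a b) x) y"
proof -
  interpret C: coc_coalgebra K C by (rule C)
  show ?thesis
    unfolding sw_def cosum_def
    by (rule tensor_lift_swap[OF C.K_cring C.A_modules C.AA_modules W C.iter_comult_closed[OF x]
          C.comult_closed[OF y] multilin_bilin[OF N1]])
      (assumption, erule tuples_2E, simp add: N2)
qed

text \<open>The maps \<open>q\<^sub>j\<close> below are the projections of a product. Cocommutativity enters through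
  \<open>cosum_exchange\<close>, which moves the first component of \<open>x\<^sub>2\<close> past the remaining components of \<open>x\<^sub>1\<close>.\<close>

lemma cosum_sw_sw:
  assumes P: "coc_coalgebra K P" and W: "module K W"
  shows "all_coc K Cs \<Longrightarrow> list_all2 (\<lambda>q C. q \<in> coalg_homs K P C) qs Cs \<Longrightarrow> bimultilin K W Cs \<Gamma> \<Longrightarrow>
    y \<in> carrier P \<Longrightarrow>
    cosum K P W (\<lambda>x\<^sub>1 x\<^sub>2. sw K P W (length Cs) (\<lambda>r. sw K P W (length Cs)
      (\<lambda>s. \<Gamma> (apply_each qs r) (apply_each qs s)) x\<^sub>2) x\<^sub>1) y
    = sw K P W (length Cs) (\<lambda>r. dbl K W Cs \<Gamma> (apply_each qs r)) y"
proof (induction Cs arbitrary: qs \<Gamma> y)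
  interpret P: coc_coalgebra K P by (rule P)
  interpret W: module K W by (rule W)
  {
    case Nil
    then have g: "\<Gamma> [] [] \<in> carrier W" by (simp add: bimultilin_def)
    note l = P.counit_scale_lin[OF W g]
    have "cosum K P W (\<lambda>x\<^sub>1 x\<^sub>2. sw K P W 0 (\<lambda>r. sw K P W 0 (\<lambda>s. \<Gamma> [] []) x\<^sub>2) x\<^sub>1) y
        = cosum K P W (\<lambda>x\<^sub>1 x\<^sub>2. counit P x\<^sub>1 \<odot>\<^bsub>W\<^esub> (counit P x\<^sub>2 \<odot>\<^bsub>W\<^esub> \<Gamma> [] [])) y"
      by (rule P.cosum_cong[OF W P.counit_bilin(1)[OF W l] _ Nil(4)])
        (simp add: P.sw_0[OF W] g P.counit_closed)
    also have "\<dots> = sw K P W 0 (\<lambda>r. \<Gamma> [] []) y"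
      unfolding P.cosum_counit_left[OF W l Nil(4)] by (simp add: P.sw_0[OF W] g Nil(4))
    finally show ?case using Nil(2) by simp
  next
    case (Cons C Cs)
    interpret C: coc_coalgebra K C using Cons.prems(1) by simp
    have C: "coc_coalgebra K C" and Cs: "all_coc K Cs" using Cons.prems(1) by auto
    obtain q qs' where qs: "qs = q # qs'" and q: "q \<in> coalg_homs K P C"
      and qs': "list_all2 (\<lambda>q C. q \<in> coalg_homs K P C) qs' Cs"
      using Cons.prems(2) by (auto simp: list_all2_Cons2)
    let ?k = "length Cs" and ?E = "apply_each qs'" and ?E' = "apply_each (q # qs')"
    let ?R = "replicate (length Cs) P" and ?R' = "replicate (Suc (length Cs)) P"
    note ql = coalg_homs_lin[OF q]
    note qc = lin_maps_closed[OF ql]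
    have E: "lin_maps_list K ?R Cs qs'" by (rule lin_maps_list_homs[OF qs'])
    have E': "lin_maps_list K ?R' (C # Cs) (q # qs')"
      using lin_maps_list.Cons[OF ql E] by simp
    note Et = apply_each_tuples[OF E] and Et' = apply_each_tuples[OF E']
    define \<Theta> where "\<Theta> a c = (\<lambda>r s. \<Gamma> (a # r) (c # s))" for a c
    have \<Theta>b: "bimultilin K W Cs (\<Theta> a c)" if "a \<in> carrier C" "c \<in> carrier C" for a c
      unfolding \<Theta>_def by (rule bimultilin_Cons(1)[OF Cons.prems(3) that])
    have \<Theta>1: "multilin K W ?R (\<lambda>s. \<Theta> a c r (?E s))" if "a \<in> carrier C" "c \<in> carrier C" "r \<in> tuples Cs" for a c r
      by (rule multilin_apply_each[OF E bimultilin_right[OF \<Theta>b[OF that(1,2)] that(3)]])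
    have \<Theta>2: "multilin K W ?R (\<lambda>r. \<Theta> a c (?E r) s)" if "a \<in> carrier C" "c \<in> carrier C" "s \<in> tuples Cs" for a c s
      by (rule multilin_apply_each[OF E bimultilin_left[OF \<Theta>b[OF that(1,2)] that(3)]])
    have \<Theta>3: "(\<lambda>a. \<Theta> (q a) c r s) \<in> lin_maps K P W" if "c \<in> carrier C" "r \<in> tuples Cs" "s \<in> tuples Cs" for c r s
      unfolding \<Theta>_def by (rule lin_maps_comp[OF ql bimultilin_Cons(2)[OF Cons.prems(3) that(2,3,1)]])
    have \<Theta>4: "(\<lambda>c. \<Theta> a (q c) r s) \<in> lin_maps K P W" if "a \<in> carrier C" "r \<in> tuples Cs" "s \<in> tuples Cs" for a r s
      unfolding \<Theta>_def by (rule lin_maps_comp[OF ql bimultilin_Cons(3)[OF Cons.prems(3) that(2,3,1)]])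
    have in1: "multilin K W ?R (\<lambda>r. sw K P W ?k (\<lambda>s. \<Theta> a c (?E r) (?E s)) d)"
      if "a \<in> carrier C" "c \<in> carrier C" "d \<in> carrier P" for a c d
      using that by (intro P.sw_multilin_param[OF W P.A_modules] \<Theta>1 \<Theta>2 Et)
    have in2: "(\<lambda>d. sw K P W ?k (\<lambda>s. \<Theta> a c r (?E s)) d) \<in> lin_maps K P W"
      if "a \<in> carrier C" "c \<in> carrier C" "r \<in> tuples Cs" for a c r
      using that by (intro P.sw_lin[OF W] \<Theta>1)
    have in3: "(\<lambda>a. sw K P W ?k (\<lambda>s. \<Theta> (q a) c r (?E s)) d) \<in> lin_maps K P W"
      if "c \<in> carrier C" "r \<in> tuples Cs" "d \<in> carrier P" for c r d
      using that by (intro P.sw_param[OF W P.A_module] \<Theta>1 \<Theta>3 Et qc)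
    have in4: "(\<lambda>c. sw K P W ?k (\<lambda>s. \<Theta> a (q c) r (?E s)) d) \<in> lin_maps K P W"
      if "a \<in> carrier C" "r \<in> tuples Cs" "d \<in> carrier P" for a r d
      using that by (intro P.sw_param[OF W P.A_module] \<Theta>1 \<Theta>4 Et qc)
    define M where "M a b c d = sw K P W ?k (\<lambda>r. sw K P W ?k (\<lambda>s. \<Theta> (q a) (q c) (?E r) (?E s)) d) b" for a b c d
    have M1: "(\<lambda>a. M a b c d) \<in> lin_maps K P W" if "b \<in> carrier P" "c \<in> carrier P" "d \<in> carrier P" for b c d
      unfolding M_def using that by (intro P.sw_param[OF W P.A_module] in1 in3 qc Et)
    have M2: "(\<lambda>b. M a b c d) \<in> lin_maps K P W" if "a \<in> carrier P" "c \<in> carrier P" "d \<in> carrier P" for a c d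
      unfolding M_def using that by (intro P.sw_lin[OF W] in1 qc)
    have M3: "(\<lambda>c. M a b c d) \<in> lin_maps K P W" if "a \<in> carrier P" "b \<in> carrier P" "d \<in> carrier P" for a b d
      unfolding M_def using that by (intro P.sw_param[OF W P.A_module] in1 in4 qc Et)
    have M4: "(\<lambda>d. M a b c d) \<in> lin_maps K P W" if "a \<in> carrier P" "b \<in> carrier P" "c \<in> carrier P" for a b c
      unfolding M_def using that by (intro P.sw_param[OF W P.A_module] in1 in2 qc Et)
    have G1: "multilin K W ?R' (\<lambda>s. \<Gamma> r (?E' s))" if "r \<in> tuples (C # Cs)" for r
      by (rule multilin_apply_each[OF E' bimultilin_right[OF Cons.prems(3) that]])
    have G2: "multilin K W ?R' (\<lambda>r. \<Gamma> (?E' r) s)" if "s \<in> tuples (C # Cs)" for s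
      by (rule multilin_apply_each[OF E' bimultilin_left[OF Cons.prems(3) that]])
    have split: "sw K P W (Suc ?k) (\<lambda>r. sw K P W (Suc ?k) (\<lambda>s. \<Gamma> (?E' r) (?E' s)) v) u
        = cosum K P W (\<lambda>a b. cosum K P W (\<lambda>c d. M a b c d) v) u"
      if u: "u \<in> carrier P" and v: "v \<in> carrier P" for u v
    proof -
      have m: "multilin K W ?R' (\<lambda>r. sw K P W (Suc ?k) (\<lambda>s. \<Gamma> (?E' r) (?E' s)) v)"
        by (intro P.sw_multilin_param[OF W P.A_modules v] G1 G2 Et')
      have "sw K P W (Suc ?k) (\<lambda>r. sw K P W (Suc ?k) (\<lambda>s. \<Gamma> (?E' r) (?E' s)) v) u
          = cosum K P W (\<lambda>a b. sw K P W ?k (\<lambda>r. sw K P W (Suc ?k) (\<lambda>s. \<Gamma> (?E' (a # r)) (?E' s)) v) b) u"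
        by (rule P.sw_Suc[OF W m u])
      also have "\<dots> = cosum K P W (\<lambda>a b. cosum K P W (\<lambda>c d. M a b c d) v) u"
      proof (rule P.cosum_cong[OF W _ _ u])
        show "bilin K P W (\<lambda>a b. cosum K P W (\<lambda>c d. M a b c d) v)"
          using v by (auto intro!: bilinI P.cosum_param W P.A_module M1 M2 M3 M4)
        fix a b assume a: "a \<in> carrier P" and b: "b \<in> carrier P"
        have N1: "bilin K P W (\<lambda>c d. sw K P W ?k (\<lambda>s. \<Theta> (q a) (q c) (?E r) (?E s)) d)"
          if "r \<in> tuples ?R" for r
          using a that by (auto intro!: bilinI in2 in4 qc Et simp del: map_replicate)
        have "sw K P W ?k (\<lambda>r. sw K P W (Suc ?k) (\<lambda>s. \<Gamma> (?E' (a # r)) (?E' s)) v) b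
            = sw K P W ?k (\<lambda>r. cosum K P W (\<lambda>c d. sw K P W ?k (\<lambda>s. \<Theta> (q a) (q c) (?E r) (?E s)) d) v) b"
        proof (rule P.sw_cong[OF W _ _ b])
          show "multilin K W ?R (\<lambda>r. cosum K P W (\<lambda>c d. sw K P W ?k (\<lambda>s. \<Theta> (q a) (q c) (?E r) (?E s)) d) v)"
            using a by (intro P.cosum_multilin_param[OF W P.A_modules v N1] in1 qc)
          fix r assume r: "r \<in> tuples ?R"
          have "?E' (a # r) \<in> tuples (C # Cs)" using Et[OF r] qc[OF a] by simp
          from P.sw_Suc[OF W G1[OF this] v]
          show "sw K P W (Suc ?k) (\<lambda>s. \<Gamma> (?E' (a # r)) (?E' s)) v
              = cosum K P W (\<lambda>c d. sw K P W ?k (\<lambda>s. \<Theta> (q a) (q c) (?E r) (?E s)) d) v"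
            by (simp add: \<Theta>_def)
        qed
        also have "\<dots> = cosum K P W (\<lambda>c d. M a b c d) v"
          unfolding M_def using a by (intro sw_cosum_swap[OF P W b v N1] in1 qc)
        finally show "sw K P W ?k (\<lambda>r. sw K P W (Suc ?k) (\<lambda>s. \<Gamma> (?E' (a # r)) (?E' s)) v) b
            = cosum K P W (\<lambda>c d. M a b c d) v" .
      qed
      finally show ?thesis .
    qed
    have dm: "multilin K W ?R' (\<lambda>r. dbl K W (C # Cs) \<Gamma> (?E' r))"
      by (rule multilin_apply_each[OF E' multilin_dbl[OF W Cons.prems(1,3)]])
    have "cosum K P W (\<lambda>x\<^sub>1 x\<^sub>2. sw K P W (Suc ?k) (\<lambda>r. sw K P W (Suc ?k) (\<lambda>s. \<Gamma> (?E' r) (?E' s)) x\<^sub>2) x\<^sub>1) y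
        = cosum K P W (\<lambda>u v. cosum K P W (\<lambda>a b. cosum K P W (\<lambda>c d. M a b c d) v) u) y"
      by (rule P.cosum_cong[OF W _ _ Cons.prems(4)])
        (auto intro!: bilinI P.cosum_param P.cosum_lin W P.A_module M1 M2 M3 M4 split)
    also have "\<dots> = cosum K P W (\<lambda>u v. cosum K P W (\<lambda>a c. cosum K P W (\<lambda>b d. M a b c d) v) u) y"
      by (rule P.cosum_exchange[OF W Cons.prems(4) M1 M2 M3 M4])
    also have "\<dots> = cosum K P W (\<lambda>u v. sw K P W ?k (\<lambda>r. dbl K W (C # Cs) \<Gamma> (?E' (u # r))) v) y"
    proof (rule P.cosum_cong[OF W P.sw_Suc_bilin[OF W dm] _ Cons.prems(4)])
      fix u v assume u: "u \<in> carrier P" and v: "v \<in> carrier P"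
      have db: "bilin K P W (\<lambda>a c. dbl K W Cs (\<Theta> (q a) (q c)) (?E r))" if "r \<in> tuples ?R" for r
        using bilin_comp[OF dbl_bilin[OF W Cons.prems(1,3) Et[OF that]] ql] unfolding \<Theta>_def .
      have dm1: "multilin K W ?R (\<lambda>r. dbl K W Cs (\<Theta> (q a) (q c)) (?E r))" if "a \<in> carrier P" "c \<in> carrier P" for a c
        using that by (intro multilin_apply_each[OF E] multilin_dbl[OF W Cs] \<Theta>b qc)
      have "cosum K P W (\<lambda>a c. cosum K P W (\<lambda>b d. M a b c d) v) u
          = cosum K P W (\<lambda>a c. sw K P W ?k (\<lambda>r. dbl K W Cs (\<Theta> (q a) (q c)) (?E r)) v) u"
      proof (rule P.cosum_cong[OF W _ _ u])
        show "bilin K P W (\<lambda>a c. sw K P W ?k (\<lambda>r. dbl K W Cs (\<Theta> (q a) (q c)) (?E r)) v)"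
          using v by (intro bilinI P.sw_param[OF W P.A_module] dm1 bilin_left[OF db] bilin_right[OF db])
        fix a c assume ac: "a \<in> carrier P" "c \<in> carrier P"
        show "cosum K P W (\<lambda>b d. M a b c d) v = sw K P W ?k (\<lambda>r. dbl K W Cs (\<Theta> (q a) (q c)) (?E r)) v"
          unfolding M_def by (rule Cons.IH[OF Cs qs' \<Theta>b[OF qc[OF ac(1)] qc[OF ac(2)]] v])
      qed
      also have "\<dots> = sw K P W ?k (\<lambda>r. cosum K P W (\<lambda>a c. dbl K W Cs (\<Theta> (q a) (q c)) (?E r)) u) v"
        by (rule sw_cosum_swap[OF P W v u db dm1, symmetric])
      also have "\<dots> = sw K P W ?k (\<lambda>r. dbl K W (C # Cs) \<Gamma> (?E' (u # r))) v"
      proof (rule P.sw_cong[OF W _ _ v])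
        show "multilin K W ?R (\<lambda>r. dbl K W (C # Cs) \<Gamma> (?E' (u # r)))"
          using dm u unfolding replicate_Suc by (rule multilin_Cons_tail)
        fix r assume r: "r \<in> tuples ?R"
        show "cosum K P W (\<lambda>a c. dbl K W Cs (\<Theta> (q a) (q c)) (?E r)) u = dbl K W (C # Cs) \<Gamma> (?E' (u # r))"
          using cosum_hom[OF P C W q dbl_bilin[OF W Cons.prems(1,3) Et[OF r]] u]
          by (simp add: \<Theta>_def)
      qed
      finally show "cosum K P W (\<lambda>a c. cosum K P W (\<lambda>b d. M a b c d) v) u
          = sw K P W ?k (\<lambda>r. dbl K W (C # Cs) \<Gamma> (?E' (u # r))) v" .
    qed
    also have "\<dots> = sw K P W (Suc ?k) (\<lambda>r. dbl K W (C # Cs) \<Gamma> (?E' r)) y"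
      by (rule P.sw_Suc[OF W dm Cons.prems(4), symmetric])
    finally show ?case by (simp add: qs)
  }
qed


section \<open>Coideals and quotient coalgebras\<close>

definition same_space :: "('k, 'v, 's) module_scheme \<Rightarrow> ('k, 'v, 't) module_scheme \<Rightarrow> bool"
  where "same_space V V' \<longleftrightarrow> carrier V = carrier V' \<and> zero V = zero V' \<and> add V = add V' \<and> smult V = smult V'"

lemma module_same_space:
  assumes "same_space V V'" "module K V"
  shows "module K V'"
proof -
  interpret V: module K V by fact
  have eq: "carrier V' = carrier V" "zero V' = zero V" "add V' = add V" "smult V' = smult V"
    using assms(1) by (simp_all add: same_space_def)
  show ?thesis
  proof (rule moduleI)
    show "abelian_group V'"
    proof (rule abelian_groupI)
      show "\<exists>y\<in>carrier V'. y \<oplus>\<^bsub>V'\<^esub> x = \<zero>\<^bsub>V'\<^esub>" if "x \<in> carrier V'" for x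
        using that unfolding eq by (intro bexI[of _ "\<ominus>\<^bsub>V\<^esub> x"]) (simp_all add: V.M.l_neg)
    qed (simp_all add: eq V.M.add.m_ac)
  qed (simp_all add: eq V.is_cring V.smult_l_distr V.smult_r_distr V.smult_assoc1)
qed

lemma ground_module_simps:
  "carrier (ground_module K) = carrier K" "zero (ground_module K) = zero K"
  "add (ground_module K) = add K" "smult (ground_module K) = mult K"
  by (simp_all add: ground_module_def)

lemma ground_module_module:
  assumes "cring K"
  shows "module K (ground_module K)"
proof -
  interpret cring K by fact
  note eq = ground_module_simps[of K]
  show ?thesis
  proof (rule moduleI)
    show "abelian_group (ground_module K)"
    proof (rule abelian_groupI)
      show "\<exists>y\<in>carrier (ground_module K). y \<oplus>\<^bsub>ground_module K\<^esub> x = \<zero>\<^bsub>ground_module K\<^esub>"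
        if "x \<in> carrier (ground_module K)" for x
        using that unfolding eq by (intro bexI[of _ "\<ominus>\<^bsub>K\<^esub> x"]) (simp_all add: l_neg)
    qed (simp_all add: eq a_ac)
  qed (simp_all add: eq assms l_distr r_distr m_assoc)
qed

lemma lin_maps_same_space: "same_space W W' \<Longrightarrow> lin_maps K V W = lin_maps K V W'"
  unfolding same_space_def lin_maps_def by simp

text \<open>Quotients by the same subspace occur both as plain modules and as coalgebras. The two records have
  different types, but tensor products only depend on the linear structure.\<close>

lemma tensor_same_space:
  assumes "list_all2 same_space Vs Vs'"
  shows "tensor_kernel K Vs = tensor_kernel K Vs'" and "tensor K Vs = tensor K Vs'"
    and "tens K Vs = tens K Vs'"
proof -
  have c: "map carrier Vs = map carrier Vs'" and len: "length Vs = length Vs'"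
    using assms by (auto simp: list_all2_conv_all_nth same_space_def intro: nth_equalityI)
  have ops: "carrier (Vs ! i) = carrier (Vs' ! i)" "add (Vs ! i) = add (Vs' ! i)"
      "smult (Vs ! i) = smult (Vs' ! i)" if "i < length Vs'" for i
    using assms that len by (auto simp: list_all2_conv_all_nth same_space_def)
  have "multilin_relations K Vs = multilin_relations K Vs'"
    unfolding multilin_relations_def Let_def c len
    by (intro arg_cong2[where f = "(\<union>)"] Collect_cong ex_cong1) (auto simp: ops)
  then show kernel: "tensor_kernel K Vs = tensor_kernel K Vs'"
    by (simp add: tensor_kernel_def c)
  show "tensor K Vs = tensor K Vs'" unfolding tensor_def c kernel ..
  show "tens K Vs = tens K Vs'" unfolding tens_def[abs_def] c kernel ..
qed

lemma tensor_map_same_space: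
  "list_all2 same_space Ws Ws' \<Longrightarrow> tensor_map K Ws \<phi>s = tensor_map K Ws' \<phi>s"
  unfolding tensor_map_def by (simp add: tensor_same_space)

text \<open>Both sides of each coalgebra identity, evaluated at \<open>\<pi> x\<close>, are images of the two sides of the same
  identity for \<open>x\<close>.\<close>

lemma coc_coalgebra_surj:
  fixes K :: "('k, 'r) ring_scheme"
  assumes K: "field K" and C: "coc_coalgebra K C" and D: "module K D"
    and \<pi>: "\<pi> \<in> lin_maps K C D" and surj: "\<pi> ` carrier C = carrier D"
    and \<Delta>: "\<And>x. x \<in> carrier C \<Longrightarrow> comult D (\<pi> x) = tensor_map K [D, D] [\<pi>, \<pi>] (comult C x)"
    and \<epsilon>: "\<And>x. x \<in> carrier C \<Longrightarrow> counit D (\<pi> x) = counit C x"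
  shows "coc_coalgebra K D"
proof -
  interpret C: coc_coalgebra K C by (rule C)
  have DD: "all_modules K [D, D]" and DDD: "all_modules K [D, D, D]" using D by auto
  let ?T2 = "tensor K [D, D]" and ?T3 = "tensor K [D, D, D]"
  note T2 = tensor_module[OF C.K_cring DD] and T3 = tensor_module[OF C.K_cring DDD]
  note \<pi>c = lin_maps_closed[OF \<pi>]
  have rep: "\<exists>x\<in>carrier C. y = \<pi> x" if "y \<in> carrier D" for y
    using that surj by (metis imageE)
  have pull: "cosum K D W G (\<pi> x) = cosum K C W (\<lambda>a b. G (\<pi> a) (\<pi> b)) x"
    if "module K W" "bilin K D W G" "x \<in> carrier C" for W :: "('k, 'w, 'z) module_scheme" and G x
    using cosum_map[OF C D] that \<pi> \<Delta> by blast
  note lin_ext = lin_maps_descend[OF \<pi> surj]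
  note tm = tensor_map_lin[OF C.K_cring C.AA_modules DD lin_maps_list_pair[OF \<pi>]]
  have \<Delta>lin: "comult D \<in> lin_maps K D ?T2"
    by (rule lin_ext, rule lin_maps_cong[OF C.A_module lin_maps_comp[OF C.comult_linear tm]])
      (rule \<Delta>)
  have cl: "cosum K D W G \<in> lin_maps K D W" if "module K W" "bilin K D W G"
    for W :: "('k, 'w, 'z) module_scheme" and G
    unfolding cosum_def
    by (rule lin_maps_comp[OF \<Delta>lin tensor_lift_lin[OF C.K_cring DD that(1) multilin_bilin[OF that(2)]]])
  note slot = tens_triple_lin[OF C.K_cring D]
  have b12: "bilin K D ?T3 (\<lambda>a b. tens K [D, D, D] [a, b, c])"
      "bilin K D ?T3 (\<lambda>a b. tens K [D, D, D] [c, a, b])" if "c \<in> carrier D" for c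
    using slot that by (auto intro!: bilinI)
  have cpar: "(\<lambda>u. cosum K D ?T3 (G u) y) \<in> lin_maps K D ?T3"
    if "y \<in> carrier D" "\<And>u. u \<in> carrier D \<Longrightarrow> bilin K D ?T3 (G u)"
      "\<And>a b. a \<in> carrier D \<Longrightarrow> b \<in> carrier D \<Longrightarrow> (\<lambda>u. G u a b) \<in> lin_maps K D ?T3" for G y
    unfolding cosum_def
    by (rule tensor_lift_lin_param[OF C.K_cring DD T3 D lin_maps_closed[OF \<Delta>lin that(1)] multilin_bilin[OF that(2)]])
      (assumption, erule tuples_2E, simp add: that(3))
  show ?thesis
  proof (intro coc_coalgebra.intro[OF K D] coc_coalgebra_axioms.intro)
    show "comult D \<in> lin_maps K D ?T2" by (rule \<Delta>lin)
    show "counit D \<in> lin_maps K D (ground_module K)"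
      by (rule lin_ext, rule lin_maps_cong[OF C.A_module C.counit_linear]) (rule \<epsilon>)
    fix y assume "y \<in> carrier D"
    then obtain x where x: "x \<in> carrier C" "y = \<pi> x" using rep by blast
    have "cosum K D ?T3 (\<lambda>u c. cosum K D ?T3 (\<lambda>a b. tens K [D, D, D] [a, b, c]) u) y
        = cosum K C ?T3 (\<lambda>u c. cosum K D ?T3 (\<lambda>a b. tens K [D, D, D] [a, b, \<pi> c]) (\<pi> u)) x"
      unfolding x(2) by (intro pull[OF T3 _ x(1)] bilinI cl[OF T3] cpar b12 slot)
    also have "\<dots> = cosum K C ?T3 (\<lambda>u c. cosum K C ?T3 (\<lambda>a b. tens K [D, D, D] [\<pi> a, \<pi> b, \<pi> c]) u) x"
      by (intro C.cosum_cong[OF T3 _ _ x(1)] bilinI C.cosum_lin[OF T3] C.cosum_param[OF T3 C.A_module]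
          bilin_comp[OF b12(1) \<pi>] lin_maps_comp[OF \<pi>] slot \<pi>c pull[OF T3 b12(1)])
    also have "\<dots> = cosum K C ?T3 (\<lambda>a u. cosum K C ?T3 (\<lambda>b c. tens K [D, D, D] [\<pi> a, \<pi> b, \<pi> c]) u) x"
      by (intro C.cosum_assoc[OF T3 x(1)] lin_maps_comp[OF \<pi> slot(1)] lin_maps_comp[OF \<pi> slot(2)]
          lin_maps_comp[OF \<pi> slot(3)] \<pi>c)
    also have "\<dots> = cosum K C ?T3 (\<lambda>a u. cosum K D ?T3 (\<lambda>b c. tens K [D, D, D] [\<pi> a, b, c]) (\<pi> u)) x"
      by (intro C.cosum_cong[OF T3 _ _ x(1), symmetric] bilinI C.cosum_lin[OF T3] C.cosum_param[OF T3 C.A_module]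
          bilin_comp[OF b12(2) \<pi>] lin_maps_comp[OF \<pi>] slot \<pi>c pull[OF T3 b12(2)])
    also have "\<dots> = cosum K D ?T3 (\<lambda>a u. cosum K D ?T3 (\<lambda>b c. tens K [D, D, D] [a, b, c]) u) y"
      unfolding x(2) by (intro pull[OF T3 _ x(1), symmetric] bilinI cl[OF T3] cpar b12 slot)
    finally show "tensor_lift K ?T3 (\<lambda>p. tensor_lift K ?T3
          (\<lambda>q. tens K [D, D, D] [q ! 0, q ! 1, p ! 1]) (comult D (p ! 0))) (comult D y)
      = tensor_lift K ?T3 (\<lambda>p. tensor_lift K ?T3
          (\<lambda>q. tens K [D, D, D] [p ! 0, q ! 0, q ! 1]) (comult D (p ! 1))) (comult D y)"
      unfolding cosum_def .
    have eps: "(\<lambda>a. counit D a \<odot>\<^bsub>D\<^esub> b) \<in> lin_maps K D D" if "b \<in> carrier D" for b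
      by (rule lin_ext, rule lin_maps_cong[OF C.A_module C.counit_scale_lin[OF D that]]) (simp add: \<epsilon>)
    have eps_closed: "counit D a \<in> carrier K" if "a \<in> carrier D" for a
      using rep[OF that] \<epsilon> C.counit_closed by auto
    have eb: "bilin K D D (\<lambda>a b. counit D a \<odot>\<^bsub>D\<^esub> b)"
      by (intro bilinI eps lin_maps_scale[OF D lin_maps_id] eps_closed)
    have "cosum K D D (\<lambda>a b. counit D a \<odot>\<^bsub>D\<^esub> b) y = cosum K C D (\<lambda>a b. counit D (\<pi> a) \<odot>\<^bsub>D\<^esub> \<pi> b) x"
      unfolding x(2) by (rule pull[OF D eb x(1)])
    also have "\<dots> = cosum K C D (\<lambda>a b. counit C a \<odot>\<^bsub>D\<^esub> \<pi> b) x"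
      by (rule C.cosum_cong[OF D C.counit_bilin(1)[OF D \<pi>] _ x(1)]) (simp add: \<epsilon>)
    also have "\<dots> = y"
      unfolding x(2) by (rule C.cosum_counit_left[OF D \<pi> x(1)])
    finally show "tensor_lift K D (\<lambda>p. counit D (p ! 0) \<odot>\<^bsub>D\<^esub> p ! 1) (comult D y) = y"
      unfolding cosum_def .
    have "cosum K D D (\<lambda>a b. counit D b \<odot>\<^bsub>D\<^esub> a) y = cosum K C D (\<lambda>a b. counit D (\<pi> b) \<odot>\<^bsub>D\<^esub> \<pi> a) x"
      unfolding x(2) by (rule pull[OF D bilin_flip[OF eb] x(1)])
    also have "\<dots> = cosum K C D (\<lambda>a b. counit C b \<odot>\<^bsub>D\<^esub> \<pi> a) x"
      by (rule C.cosum_cong[OF D C.counit_bilin(2)[OF D \<pi>] _ x(1)]) (simp add: \<epsilon>)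
    also have "\<dots> = y"
      unfolding x(2) by (rule C.cosum_counit_right[OF D \<pi> x(1)])
    finally show "tensor_lift K D (\<lambda>p. counit D (p ! 1) \<odot>\<^bsub>D\<^esub> p ! 0) (comult D y) = y"
      unfolding cosum_def .
    note t2 = tens_pair_bilin[OF D]
    have "cosum K D ?T2 (\<lambda>a b. tens K [D, D] [b, a]) y = cosum K C ?T2 (\<lambda>a b. tens K [D, D] [\<pi> b, \<pi> a]) x"
      unfolding x(2) by (rule pull[OF T2 bilin_flip[OF t2] x(1)])
    also have "\<dots> = cosum K C ?T2 (\<lambda>a b. tens K [D, D] [\<pi> a, \<pi> b]) x"
      by (rule C.cosum_comm[OF T2 bilin_comp[OF t2 \<pi>] x(1)])
    also have "\<dots> = comult D y"
      unfolding x(2) \<Delta>[OF x(1)] by (rule tensor_map_comult[OF C D \<pi> x(1), symmetric])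
    finally show "tensor_lift K ?T2 (\<lambda>p. tens K [D, D] [p ! 1, p ! 0]) (comult D y) = comult D y"
      unfolding cosum_def .
  qed
qed


subsection \<open>Coideals\<close>

text \<open>The condition \<open>\<Delta> x \<in> D \<otimes> C + C \<otimes> D\<close> is expressed through the kernel of \<open>C \<otimes> C \<rightarrow> C/D \<otimes> C/D\<close>.\<close>

definition coid_elt :: "('k, 'r) ring_scheme \<Rightarrow> ('k, 'c, 's) coalgebra_scheme \<Rightarrow> 'c set \<Rightarrow> 'c \<Rightarrow> bool"
  where "coid_elt K C D x \<longleftrightarrow> x \<in> carrier C \<and> counit C x = \<zero>\<^bsub>K\<^esub> \<and>
    (let V = quot_module C D; \<pi> = (\<lambda>a. D +>\<^bsub>C\<^esub> a) in
      tensor_map K [V, V] [\<pi>, \<pi>] (comult C x) = \<zero>\<^bsub>tensor K [V, V]\<^esub>)"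

definition coideal :: "('k, 'r) ring_scheme \<Rightarrow> ('k, 'c, 's) coalgebra_scheme \<Rightarrow> 'c set \<Rightarrow> bool"
  where "coideal K C D \<longleftrightarrow> submodule D K C \<and> (\<forall>x\<in>D. coid_elt K C D x)"

context
  fixes K :: "('k, 'r) ring_scheme" and C :: "('k, 'c, 's) coalgebra_scheme" and D :: "'c set"
  assumes C: "coc_coalgebra K C" and D: "submodule D K C"
begin

interpretation C: coc_coalgebra K C by (rule C)

abbreviation (input) "VD \<equiv> quot_module C D"

lemma coset_zero_iff: "x \<in> carrier C \<Longrightarrow> D +>\<^bsub>C\<^esub> x = \<zero>\<^bsub>VD\<^esub> \<longleftrightarrow> x \<in> D"
  by (simp add: quot_module_simps(2) coset_eq_self_iff[OF C.A_module D])

lemma coset_surj_list: "surj_list K [C, C] [VD, VD] [\<lambda>a. D +>\<^bsub>C\<^esub> a, \<lambda>a. D +>\<^bsub>C\<^esub> a]"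
  unfolding surj_list_Cons
  using coset_lin[OF C.A_module D] quot_module_carrier[OF C.A_module D]
  by (auto simp: surj_list_def intro: lin_maps_list.Nil)

text \<open>The two lemmas on \<^const>\<open>coid_elt\<close> say that its condition on \<open>\<Delta> x\<close> holds iff \<open>\<Sum> G x\<^sub>1 x\<^sub>2\<close> vanishes for
  all bilinear \<open>G\<close> that vanish when one argument is in \<open>D\<close>. For this direction, such a \<open>G\<close> factors
  through the quotient; for the converse, the map \<open>(a, b) \<mapsto> \<pi> a \<otimes> \<pi> b\<close> is one of these \<open>G\<close>.\<close>

lemma coid_elt_cosum:
  assumes x: "coid_elt K C D x" and W: "module K W" and G: "bilin K C W G"
    and van: "\<And>a b. a \<in> D \<Longrightarrow> b \<in> carrier C \<Longrightarrow> G a b = \<zero>\<^bsub>W\<^esub>"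
      "\<And>a b. a \<in> carrier C \<Longrightarrow> b \<in> D \<Longrightarrow> G a b = \<zero>\<^bsub>W\<^esub>"
  shows "cosum K C W G x = \<zero>\<^bsub>W\<^esub>"
proof -
  have VV: "all_modules K [VD, VD]" using quot_module_module[OF C.A_module D] by simp
  have xc: "x \<in> carrier C" and \<Delta>: "tensor_map K [VD, VD] [\<lambda>a. D +>\<^bsub>C\<^esub> a, \<lambda>a. D +>\<^bsub>C\<^esub> a] (comult C x)
      = \<zero>\<^bsub>tensor K [VD, VD]\<^esub>"
    using x unfolding coid_elt_def Let_def by auto
  show ?thesis
    unfolding cosum_def
  proof (rule tensor_lift_kernel[OF C.K_cring C.AA_modules VV W coset_surj_list multilin_bilin[OF G] _
        C.comult_closed[OF xc] \<Delta>])
    fix p i assume p: "p \<in> tuples [C, C]" "i < length [C, C]"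
      and z: "([\<lambda>a. D +>\<^bsub>C\<^esub> a, \<lambda>a. D +>\<^bsub>C\<^esub> a] ! i) (p ! i) = \<zero>\<^bsub>[VD, VD] ! i\<^esub>"
    obtain a b where ab: "p = [a, b]" "a \<in> carrier C" "b \<in> carrier C"
      using p(1) by (rule tuples_2E)
    have "i = 0 \<or> i = 1" using p(2) by auto
    then have "a \<in> D \<or> b \<in> D"
      using z ab coset_zero_iff by auto
    then show "G (p ! 0) (p ! 1) = \<zero>\<^bsub>W\<^esub>"
      using van ab by auto
  qed
qed

lemma coid_eltI:
  assumes x: "x \<in> carrier C" "counit C x = \<zero>\<^bsub>K\<^esub>"
    and G: "\<And>(W :: ('k, ('c set list \<Rightarrow> 'k) set) module) G. module K W \<Longrightarrow> bilin K C W G \<Longrightarrow>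
      (\<And>a b. a \<in> D \<Longrightarrow> b \<in> carrier C \<Longrightarrow> G a b = \<zero>\<^bsub>W\<^esub>) \<Longrightarrow>
      (\<And>a b. a \<in> carrier C \<Longrightarrow> b \<in> D \<Longrightarrow> G a b = \<zero>\<^bsub>W\<^esub>) \<Longrightarrow> cosum K C W G x = \<zero>\<^bsub>W\<^esub>"
  shows "coid_elt K C D x"
proof -
  have V: "module K VD" by (rule quot_module_module[OF C.A_module D])
  then have VV: "all_modules K [VD, VD]" by simp
  note T = tensor_module[OF C.K_cring VV]
  note \<pi> = coset_lin[OF C.A_module D]
  note t = tens_pair_bilin[OF V]
  have z: "D +>\<^bsub>C\<^esub> a = \<zero>\<^bsub>VD\<^esub>" if "a \<in> D" for a
    using that coset_zero_iff submodule_subset[OF D that] by blast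
  have "cosum K C (tensor K [VD, VD]) (\<lambda>a b. tens K [VD, VD] [D +>\<^bsub>C\<^esub> a, D +>\<^bsub>C\<^esub> b]) x = \<zero>\<^bsub>tensor K [VD, VD]\<^esub>"
    by (rule G[OF T bilin_comp[OF t \<pi>]])
      (simp_all add: z lin_maps_zero[OF V T bilin_left[OF t]] lin_maps_zero[OF V T bilin_right[OF t]]
        lin_maps_closed[OF \<pi>])
  then show ?thesis
    unfolding coid_elt_def Let_def using x tensor_map_comult[OF C V \<pi> x(1)] by simp
qed

lemma submodule_coid_elts: "submodule {x. coid_elt K C D x} K C"
proof -
  have VV: "all_modules K [VD, VD]" using quot_module_module[OF C.A_module D] by simp
  note T = tensor_module[OF C.K_cring VV]
  interpret T: module K "tensor K [VD, VD]" by (rule T)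
  let ?L = "\<lambda>x. tensor_map K [VD, VD] [\<lambda>a. D +>\<^bsub>C\<^esub> a, \<lambda>a. D +>\<^bsub>C\<^esub> a] (comult C x)"
  have L: "?L \<in> lin_maps K C (tensor K [VD, VD])"
    by (rule lin_maps_comp[OF C.comult_linear tensor_map_lin[OF C.K_cring C.AA_modules VV
            lin_maps_list_pair[OF coset_lin[OF C.A_module D]]]])
  note e = C.counit_linear
  have ez: "counit C \<zero>\<^bsub>C\<^esub> = \<zero>\<^bsub>K\<^esub>"
    using lin_maps_zero[OF C.A_module ground_module_module[OF C.K_cring] e]
    by (simp add: ground_module_def)
  show ?thesis
    by (rule submoduleI'[OF C.A_module])
      (auto simp: coid_elt_def Let_def ez lin_maps_zero[OF C.A_module T L] lin_maps_add[OF L] lin_maps_smult[OF L]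
        lin_maps_add[OF e, unfolded ground_module_def, simplified]
        lin_maps_smult[OF e, unfolded ground_module_def, simplified])
qed

end

lemma coid_elt_mono:
  fixes K :: "('k, 'r) ring_scheme" and C :: "('k, 'c, 's) coalgebra_scheme"
  assumes C: "coc_coalgebra K C" and D: "submodule D K C" and E: "submodule E K C"
    and x: "coid_elt K C D x" and sub: "D \<subseteq> E"
  shows "coid_elt K C E x"
proof (rule coid_eltI[OF C E])
  show "x \<in> carrier C" "counit C x = \<zero>\<^bsub>K\<^esub>" using x by (auto simp: coid_elt_def)
  fix W :: "('k, ('c set list \<Rightarrow> 'k) set) module" and G
  assume "module K W" "bilin K C W G" "\<And>a b. a \<in> E \<Longrightarrow> b \<in> carrier C \<Longrightarrow> G a b = \<zero>\<^bsub>W\<^esub>"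
    "\<And>a b. a \<in> carrier C \<Longrightarrow> b \<in> E \<Longrightarrow> G a b = \<zero>\<^bsub>W\<^esub>"
  then show "cosum K C W G x = \<zero>\<^bsub>W\<^esub>"
    using sub by (intro coid_elt_cosum[OF C D x]) auto
qed

lemma coid_elt_hom:
  fixes K :: "('k, 'r) ring_scheme" and C :: "('k, 'b, 't) coalgebra_scheme"
    and C' :: "('k, 'c, 's) coalgebra_scheme"
  assumes C: "coc_coalgebra K C" and C': "coc_coalgebra K C'" and \<phi>: "\<phi> \<in> coalg_homs K C C'"
    and D: "submodule D K C" and E: "submodule E K C'" and sub: "\<phi> ` D \<subseteq> E" and x: "coid_elt K C D x"
  shows "coid_elt K C' E (\<phi> x)"
proof (rule coid_eltI[OF C' E])
  note l = coalg_homs_lin[OF \<phi>]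
  have xc: "x \<in> carrier C" "counit C x = \<zero>\<^bsub>K\<^esub>" using x by (auto simp: coid_elt_def)
  then show "\<phi> x \<in> carrier C'" "counit C' (\<phi> x) = \<zero>\<^bsub>K\<^esub>"
    by (simp_all add: lin_maps_closed[OF l] coalg_homs_counit[OF \<phi>])
  fix W :: "('k, ('c set list \<Rightarrow> 'k) set) module" and G
  assume W: "module K W" and G: "bilin K C' W G"
    and van: "\<And>a b. a \<in> E \<Longrightarrow> b \<in> carrier C' \<Longrightarrow> G a b = \<zero>\<^bsub>W\<^esub>" "\<And>a b. a \<in> carrier C' \<Longrightarrow> b \<in> E \<Longrightarrow> G a b = \<zero>\<^bsub>W\<^esub>"
  have "cosum K C W (\<lambda>a b. G (\<phi> a) (\<phi> b)) x = \<zero>\<^bsub>W\<^esub>"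
    using sub by (intro coid_elt_cosum[OF C D x W bilin_comp[OF G l]] van lin_maps_closed[OF l]) auto
  then show "cosum K C' W G (\<phi> x) = \<zero>\<^bsub>W\<^esub>"
    using cosum_hom[OF C C' W \<phi> G xc(1)] by simp
qed

lemma submodule_image:
  assumes V: "module K V" and W: "module K W" and \<phi>: "\<phi> \<in> lin_maps K V W" and N: "submodule N K V"
  shows "submodule (\<phi> ` N) K W"
proof (rule submoduleI'[OF W])
  note sub = submodule_subset[OF N]
  show "\<phi> ` N \<subseteq> carrier W" using lin_maps_closed[OF \<phi>] sub by auto
  show "\<zero>\<^bsub>W\<^esub> \<in> \<phi> ` N" using lin_maps_zero[OF V W \<phi>] submodule_zero[OF N] by (metis imageI)
  show "x \<oplus>\<^bsub>W\<^esub> y \<in> \<phi> ` N" if "x \<in> \<phi> ` N" "y \<in> \<phi> ` N" for x y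
    using that lin_maps_add[OF \<phi>, symmetric] submodule_add[OF N] sub by auto
  show "c \<odot>\<^bsub>W\<^esub> x \<in> \<phi> ` N" if "c \<in> carrier K" "x \<in> \<phi> ` N" for c x
    using that lin_maps_smult[OF \<phi>, symmetric] submodule_smult[OF N] sub by auto
qed

lemma submodule_preimage:
  assumes V: "module K V" and W: "module K W" and \<phi>: "\<phi> \<in> lin_maps K V W" and N: "submodule N K W"
  shows "submodule {x \<in> carrier V. \<phi> x \<in> N} K V"
proof -
  interpret V: module K V by (rule V)
  show ?thesis
    by (rule submoduleI'[OF V])
      (auto simp: lin_maps_add[OF \<phi>] lin_maps_smult[OF \<phi>] lin_maps_zero[OF V W \<phi>]
        submodule_zero[OF N] submodule_add[OF N] submodule_smult[OF N])
qed

lemma coideal_image: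
  assumes C: "coc_coalgebra K C" and C': "coc_coalgebra K C'" and \<phi>: "\<phi> \<in> coalg_homs K C C'" and D: "coideal K C D"
  shows "coideal K C' (\<phi> ` D)"
proof -
  have D': "submodule D K C" using D by (simp add: coideal_def)
  have s: "submodule (\<phi> ` D) K C'"
    by (rule submodule_image[OF coc_module[OF C] coc_module[OF C'] coalg_homs_lin[OF \<phi>] D'])
  show ?thesis
    unfolding coideal_def
    using s coid_elt_hom[OF C C' \<phi> D' s] D by (auto simp: coideal_def)
qed

text \<open>The condition \<^const>\<open>coid_elt\<close> is linear in the element and monotone in the subspace.\<close>

lemma coideal_span:
  assumes C: "coc_coalgebra K C" and \<E>: "\<And>E. E \<in> \<E> \<Longrightarrow> coideal K C E"
  shows "coideal K C (mod_span K C (\<Union>\<E>))"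
proof -
  have sub: "\<Union>\<E> \<subseteq> carrier C"
    using \<E> submodule_subset by (fastforce simp: coideal_def)
  have S: "submodule (mod_span K C (\<Union>\<E>)) K C"
    by (rule submodule_mod_span[OF coc_module[OF C] sub])
  have "\<Union>\<E> \<subseteq> {x. coid_elt K C (mod_span K C (\<Union>\<E>)) x}"
  proof
    fix x assume "x \<in> \<Union>\<E>"
    then obtain E where E: "E \<in> \<E>" "x \<in> E" by blast
    have "y \<in> mod_span K C (\<Union>\<E>)" if "y \<in> E" for y
      by (rule mod_span_incl[OF UnionI[OF E(1) that]])
    then have sub: "E \<subseteq> mod_span K C (\<Union>\<E>)" by (rule subsetI)
    have "submodule E K C" "coid_elt K C E x"
      using \<E>[OF E(1)] E(2) by (simp_all add: coideal_def)
    then have "coid_elt K C (mod_span K C (\<Union>\<E>)) x"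
      by (intro coid_elt_mono[OF C _ S _ sub])
    then show "x \<in> {x. coid_elt K C (mod_span K C (\<Union>\<E>)) x}" by simp
  qed
  then have "mod_span K C (\<Union>\<E>) \<subseteq> {x. coid_elt K C (mod_span K C (\<Union>\<E>)) x}"
    by (rule mod_span_least[OF submodule_coid_elts[OF C S]])
  then show ?thesis using S by (auto simp: coideal_def)
qed

lemma sw_zero:
  assumes "coc_coalgebra K C" "module K W" "x \<in> carrier C"
    and "\<And>p. p \<in> tuples (replicate n C) \<Longrightarrow> \<gamma> p = \<zero>\<^bsub>W\<^esub>"
  shows "sw K C W n \<gamma> x = \<zero>\<^bsub>W\<^esub>"
proof -
  interpret C: coc_coalgebra K C by fact
  show ?thesis
    unfolding sw_def by (rule tensor_lift_zero[OF C.K_cring C.A_modules assms(2) C.iter_comult_closed[OF assms(3)] assms(4)])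
qed

text \<open>In Sweedler notation: every summand of \<open>\<Delta>\<^sub>n x\<close> has a factor in the coideal.\<close>

lemma sw_coideal:
  assumes C: "coc_coalgebra K C" and W: "module K W" and D: "coideal K C D"
  shows "multilin K W (replicate n C) \<gamma> \<Longrightarrow>
    (\<And>p. p \<in> tuples (replicate n C) \<Longrightarrow> set p \<inter> D \<noteq> {} \<Longrightarrow> \<gamma> p = \<zero>\<^bsub>W\<^esub>) \<Longrightarrow> x \<in> D \<Longrightarrow>
    sw K C W n \<gamma> x = \<zero>\<^bsub>W\<^esub>"
proof (induction n arbitrary: \<gamma> x)
  interpret C: coc_coalgebra K C by (rule C)
  interpret W: module K W by (rule W)
  have D': "submodule D K C" using D by (simp add: coideal_def)
  {
    case 0
    then have "coid_elt K C D x" using D by (simp add: coideal_def)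
    then show ?case using 0(1) by (simp add: C.sw_0[OF W] coid_elt_def)
  next
    case (Suc n)
    have x: "coid_elt K C D x" using D Suc.prems(3) by (simp add: coideal_def)
    then have xc: "x \<in> carrier C" by (simp add: coid_elt_def)
    have \<gamma>: "multilin K W (C # replicate n C) \<gamma>" using Suc.prems(1) by simp
    have "cosum K C W (\<lambda>a b. sw K C W n (\<lambda>q. \<gamma> (a # q)) b) x = \<zero>\<^bsub>W\<^esub>"
    proof (rule coid_elt_cosum[OF C D' x W C.sw_Suc_bilin[OF W Suc.prems(1)]])
      show "sw K C W n (\<lambda>q. \<gamma> (a # q)) b = \<zero>\<^bsub>W\<^esub>" if "a \<in> D" "b \<in> carrier C" for a b
        using that submodule_subset[OF D' that(1)] by (intro sw_zero[OF C W] Suc.prems(2)) auto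
      show "sw K C W n (\<lambda>q. \<gamma> (a # q)) b = \<zero>\<^bsub>W\<^esub>" if "a \<in> carrier C" "b \<in> D" for a b
        using that by (intro Suc.IH[OF multilin_Cons_tail[OF \<gamma>]] Suc.prems(2)) auto
    qed
    then show ?case using C.sw_Suc[OF W Suc.prems(1) xc] by simp
  }
qed

text \<open>If \<open>\<Delta> c\<^sub>i \<in> D \<otimes> C\<^sub>i + C\<^sub>i \<otimes> D\<close>, then in every summand one of the two tuples has its \<open>i\<close>-th entry in \<open>D\<close>.\<close>

lemma dbl_coid:
  assumes W: "module K W"
  shows "all_coc K Cs \<Longrightarrow> bimultilin K W Cs \<Gamma> \<Longrightarrow> cs \<in> tuples Cs \<Longrightarrow> i < length Cs \<Longrightarrow>
    submodule D K (Cs ! i) \<Longrightarrow> coid_elt K (Cs ! i) D (cs ! i) \<Longrightarrow>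
    (\<And>r s. r \<in> tuples Cs \<Longrightarrow> s \<in> tuples Cs \<Longrightarrow> r ! i \<in> D \<or> s ! i \<in> D \<Longrightarrow> \<Gamma> r s = \<zero>\<^bsub>W\<^esub>) \<Longrightarrow>
    dbl K W Cs \<Gamma> cs = \<zero>\<^bsub>W\<^esub>"
proof (induction Cs arbitrary: \<Gamma> cs i)
  case (Cons C Cs)
  interpret C: coc_coalgebra K C using Cons.prems(1) by simp
  have C: "coc_coalgebra K C" and Cs: "all_coc K Cs" using Cons.prems(1) by auto
  from Cons.prems(3) obtain c cs' where cs: "cs = c # cs'" "c \<in> carrier C" "cs' \<in> tuples Cs"
    by (rule tuples_ConsE)
  show ?case
  proof (cases i)
    case 0
    have D: "submodule D K C" and c: "coid_elt K C D c" using Cons.prems(5,6) 0 cs by auto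
    have sub: "a \<in> carrier C" if "a \<in> D" for a by (rule submodule_subset[OF D that])
    have "cosum K C W (\<lambda>a b. dbl K W Cs (\<lambda>r s. \<Gamma> (a # r) (b # s)) cs') c = \<zero>\<^bsub>W\<^esub>"
      by (rule coid_elt_cosum[OF C D c W dbl_bilin[OF W Cons.prems(1,2) cs(3)]])
        (auto intro!: dbl_zero[OF W Cs _ cs(3)] Cons.prems(7) sub simp: 0)
    then show ?thesis by (simp add: cs)
  next
    case (Suc j)
    have "dbl K W Cs (\<lambda>r s. \<Gamma> (a # r) (b # s)) cs' = \<zero>\<^bsub>W\<^esub>" if ab: "a \<in> carrier C" "b \<in> carrier C" for a b
    proof (rule Cons.IH[OF Cs bimultilin_Cons(1)[OF Cons.prems(2) ab] cs(3)])
      show "j < length Cs" "submodule D K (Cs ! j)" "coid_elt K (Cs ! j) D (cs' ! j)"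
        using Cons.prems(4-6) Suc cs by auto
      show "\<Gamma> (a # r) (b # s) = \<zero>\<^bsub>W\<^esub>" if "r \<in> tuples Cs" "s \<in> tuples Cs" "r ! j \<in> D \<or> s ! j \<in> D" for r s
        using that ab Suc by (intro Cons.prems(7)) auto
    qed
    then show ?thesis using C.cosum_zero[OF W _ cs(2)] by (simp add: cs)
  qed
qed simp


subsection \<open>Quotient coalgebras\<close>

lemma quot_coalgebra_simps:
  "carrier (quot_coalgebra K C D) = carrier (quot_module C D)"
  "zero (quot_coalgebra K C D) = zero (quot_module C D)"
  "add (quot_coalgebra K C D) = add (quot_module C D)"
  "smult (quot_coalgebra K C D) = smult (quot_module C D)"
  "comult (quot_coalgebra K C D) X = the_elem ((\<lambda>a. tensor_map K [quot_module C D, quot_module C D]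
    [\<lambda>a. D +>\<^bsub>C\<^esub> a, \<lambda>a. D +>\<^bsub>C\<^esub> a] (comult C a)) ` X)"
  "counit (quot_coalgebra K C D) X = the_elem (counit C ` X)"
  by (simp_all add: quot_coalgebra_def Let_def)

lemma same_space_quot: "same_space (quot_module C D) (quot_coalgebra K C D)"
  by (simp add: same_space_def quot_coalgebra_simps)

context
  fixes K :: "('k, 'r) ring_scheme" and C :: "('k, 'c, 's) coalgebra_scheme" and D :: "'c set"
  assumes K: "field K" and C: "coc_coalgebra K C" and D: "submodule D K C"
begin

interpretation C: coc_coalgebra K C by (rule C)

abbreviation (input) "QD \<equiv> quot_coalgebra K C D"

lemma quot_coalgebra_module: "module K QD"
  by (rule module_same_space[OF same_space_quot quot_module_module[OF C.A_module D]])

lemma quot_coalgebra_proj_lin: "(\<lambda>x. D +>\<^bsub>C\<^esub> x) \<in> lin_maps K C QD"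
  using coset_lin[OF C.A_module D] lin_maps_same_space[OF same_space_quot] by blast

lemma quot_coalgebra_proj_surj: "(\<lambda>x. D +>\<^bsub>C\<^esub> x) ` carrier C = carrier QD"
  by (simp add: quot_coalgebra_simps quot_module_carrier[OF C.A_module D])

lemma quot_coalgebra_proj_zero_iff: "x \<in> carrier C \<Longrightarrow> D +>\<^bsub>C\<^esub> x = \<zero>\<^bsub>QD\<^esub> \<longleftrightarrow> x \<in> D"
  by (simp add: quot_coalgebra_simps coset_zero_iff[OF C D])

context
  assumes coid: "\<And>x. x \<in> D \<Longrightarrow> coid_elt K C D x"
begin

lemma quot_coalgebra_comult:
  assumes x: "x \<in> carrier C"
  shows "comult QD (D +>\<^bsub>C\<^esub> x) = tensor_map K [QD, QD] [\<lambda>a. D +>\<^bsub>C\<^esub> a, \<lambda>a. D +>\<^bsub>C\<^esub> a] (comult C x)"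
proof -
  let ?V = "quot_module C D"
  have VV: "all_modules K [?V, ?V]" using quot_module_module[OF C.A_module D] by simp
  let ?L = "\<lambda>x. tensor_map K [?V, ?V] [\<lambda>a. D +>\<^bsub>C\<^esub> a, \<lambda>a. D +>\<^bsub>C\<^esub> a] (comult C x)"
  have L: "?L \<in> lin_maps K C (tensor K [?V, ?V])"
    by (rule lin_maps_comp[OF C.comult_linear tensor_map_lin[OF C.K_cring C.AA_modules VV
            lin_maps_list_pair[OF coset_lin[OF C.A_module D]]]])
  have "?L ` (D +>\<^bsub>C\<^esub> x) = {?L x}"
    using coid by (intro lin_maps_coset_image[OF C.A_module tensor_module[OF C.K_cring VV] D L _ x])
      (auto simp: coid_elt_def Let_def)
  then have "comult QD (D +>\<^bsub>C\<^esub> x) = ?L x" by (simp add: quot_coalgebra_simps)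
  also have "tensor_map K [?V, ?V] = tensor_map K [QD, QD]"
    by (rule ext) (rule tensor_map_same_space, simp add: same_space_quot)
  finally show ?thesis .
qed

lemma quot_coalgebra_counit:
  assumes x: "x \<in> carrier C"
  shows "counit QD (D +>\<^bsub>C\<^esub> x) = counit C x"
proof -
  interpret field K by (rule K)
  have "counit C (h \<oplus>\<^bsub>C\<^esub> x) = counit C x" if "h \<in> D" for h
  proof -
    have "counit C h = \<zero>\<^bsub>K\<^esub>" "h \<in> carrier C" using coid[OF that] by (auto simp: coid_elt_def)
    then show ?thesis
      using lin_maps_add[OF C.counit_linear _ x, of h] C.counit_closed[OF x] by (simp add: ground_module_def)
  qed
  then have "counit C y = counit C x" if "y \<in> D +>\<^bsub>C\<^esub> x" for y
    using that unfolding a_r_coset_def' by blast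
  moreover have "\<zero>\<^bsub>C\<^esub> \<oplus>\<^bsub>C\<^esub> x \<in> D +>\<^bsub>C\<^esub> x"
    using submodule_zero[OF D] unfolding a_r_coset_def' by blast
  ultimately have "counit C ` (D +>\<^bsub>C\<^esub> x) = {counit C x}"
    by (metis (no_types, lifting) image_cong image_constant)
  then show ?thesis by (simp add: quot_coalgebra_simps)
qed

lemma quot_coalgebra_coc: "coc_coalgebra K QD"
  by (rule coc_coalgebra_surj[OF K C quot_coalgebra_module quot_coalgebra_proj_lin quot_coalgebra_proj_surj
        quot_coalgebra_comult quot_coalgebra_counit])

lemma quot_coalgebra_proj_hom: "(\<lambda>x. D +>\<^bsub>C\<^esub> x) \<in> coalg_homs K C QD"
  unfolding coalg_homs_def
  using quot_coalgebra_proj_lin quot_coalgebra_comult quot_coalgebra_counit by simp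

end

end

text \<open>Compatibility with the comultiplications is checked at \<open>\<pi> x\<close>, where it is that of \<open>\<phi>\<close> and \<open>\<pi>\<close>.\<close>

lemma coalg_hom_factor:
  assumes C: "coc_coalgebra K C" and D: "coc_coalgebra K D" and E: "coc_coalgebra K E"
    and \<pi>: "\<pi> \<in> coalg_homs K C D" and surj: "\<pi> ` carrier C = carrier D" and \<phi>: "\<phi> \<in> coalg_homs K C E"
    and \<psi>: "\<And>x. x \<in> carrier C \<Longrightarrow> \<psi> (\<pi> x) = \<phi> x"
  shows "\<psi> \<in> coalg_homs K D E"
proof -
  interpret C: coc_coalgebra K C by (rule C)
  interpret D: coc_coalgebra K D by (rule D)
  interpret E: coc_coalgebra K E by (rule E)
  note \<pi>l = coalg_homs_lin[OF \<pi>] and \<phi>l = coalg_homs_lin[OF \<phi>]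
  have rep: "\<exists>x\<in>carrier C. y = \<pi> x" if "y \<in> carrier D" for y
    using that surj by (metis imageE)
  have \<psi>l: "\<psi> \<in> lin_maps K D E"
    by (rule lin_maps_descend[OF \<pi>l surj lin_maps_cong[OF C.A_module \<phi>l \<psi>]])
  have "tensor_map K [E, E] [\<psi>, \<psi>] (comult D y) = comult E (\<psi> y) \<and> counit E (\<psi> y) = counit D y"
    if "y \<in> carrier D" for y
  proof -
    obtain x where x: "x \<in> carrier C" "y = \<pi> x" using rep \<open>y \<in> carrier D\<close> by blast
    have EE: "all_modules K [E, E]" by (rule E.AA_modules)
    note t = tens_pair_bilin[OF E.A_module]
    note T = tensor_module[OF E.K_cring EE]
    have "tensor_map K [E, E] [\<psi>, \<psi>] (comult D (\<pi> x))
        = cosum K D (tensor K [E, E]) (\<lambda>a b. tens K [E, E] [\<psi> a, \<psi> b]) (\<pi> x)"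
      by (rule tensor_map_comult[OF D E.A_module \<psi>l lin_maps_closed[OF \<pi>l x(1)]])
    also have "\<dots> = cosum K C (tensor K [E, E]) (\<lambda>a b. tens K [E, E] [\<psi> (\<pi> a), \<psi> (\<pi> b)]) x"
      by (rule cosum_hom[OF C D T \<pi> bilin_comp[OF t \<psi>l] x(1)])
    also have "\<dots> = cosum K C (tensor K [E, E]) (\<lambda>a b. tens K [E, E] [\<phi> a, \<phi> b]) x"
      by (rule C.cosum_cong[OF T bilin_comp[OF t \<phi>l] _ x(1)]) (simp add: \<psi>)
    also have "\<dots> = comult E (\<phi> x)"
      using tensor_map_comult[OF C E.A_module \<phi>l x(1)] coalg_homs_comult[OF \<phi> x(1)] by simp
    finally show ?thesis
      using x \<psi> coalg_homs_counit[OF \<pi> x(1)] coalg_homs_counit[OF \<phi> x(1)] by simp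
  qed
  then show ?thesis using \<psi>l by (simp add: coalg_homs_def)
qed

lemma coalg_homs_comp:
  assumes C: "coc_coalgebra K C" and D: "coc_coalgebra K D" and E: "coc_coalgebra K E"
    and \<phi>: "\<phi> \<in> coalg_homs K C D" and \<psi>: "\<psi> \<in> coalg_homs K D E"
  shows "(\<lambda>x. \<psi> (\<phi> x)) \<in> coalg_homs K C E"
proof -
  interpret E: coc_coalgebra K E by (rule E)
  note \<phi>l = coalg_homs_lin[OF \<phi>] and \<psi>l = coalg_homs_lin[OF \<psi>]
  note l = lin_maps_comp[OF \<phi>l \<psi>l]
  note t = tens_pair_bilin[OF E.A_module]
  note T = tensor_module[OF E.K_cring E.AA_modules]
  have "tensor_map K [E, E] [\<lambda>x. \<psi> (\<phi> x), \<lambda>x. \<psi> (\<phi> x)] (comult C x) = comult E (\<psi> (\<phi> x))"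
    if x: "x \<in> carrier C" for x
  proof -
    have "tensor_map K [E, E] [\<lambda>x. \<psi> (\<phi> x), \<lambda>x. \<psi> (\<phi> x)] (comult C x)
        = cosum K C (tensor K [E, E]) (\<lambda>a b. tens K [E, E] [\<psi> (\<phi> a), \<psi> (\<phi> b)]) x"
      by (rule tensor_map_comult[OF C E.A_module l x])
    also have "\<dots> = cosum K D (tensor K [E, E]) (\<lambda>a b. tens K [E, E] [\<psi> a, \<psi> b]) (\<phi> x)"
      by (rule cosum_hom[OF C D T \<phi> bilin_comp[OF t \<psi>l] x, symmetric])
    also have "\<dots> = comult E (\<psi> (\<phi> x))"
      using tensor_map_comult[OF D E.A_module \<psi>l] coalg_homs_comult[OF \<psi>] lin_maps_closed[OF \<phi>l x] by simp
    finally show ?thesis .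
  qed
  then show ?thesis
    using l coalg_homs_counit[OF \<phi>] coalg_homs_counit[OF \<psi>] lin_maps_closed[OF \<phi>l]
    by (simp add: coalg_homs_def)
qed


section \<open>Products in a coalgebra of a Lawvere theory\<close>

subsection \<open>Naturality of the pairing\<close>

lemma pairing_natural:
  assumes P: "coc_coalgebra K P" and P': "coc_coalgebra K P'" and Cs: "all_coc K Cs" and Cs': "all_coc K Cs'"
    and qs: "list_all2 (\<lambda>q C. q \<in> coalg_homs K P C) qs Cs"
    and qs': "list_all2 (\<lambda>q C. q \<in> coalg_homs K P' C) qs' Cs'"
    and \<eta>: "\<eta> \<in> coalg_homs K P P'" and \<eta>s: "lin_maps_list K Cs Cs' \<eta>s"
    and nat: "\<And>i x. i < length Cs \<Longrightarrow> x \<in> carrier P \<Longrightarrow> (qs' ! i) (\<eta> x) = (\<eta>s ! i) ((qs ! i) x)"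
    and x: "x \<in> carrier P"
  shows "pairing K P' Cs' qs' (\<eta> x) = tensor_map K Cs' \<eta>s (pairing K P Cs qs x)"
proof -
  interpret P: coc_coalgebra K P by (rule P)
  interpret P': coc_coalgebra K P' by (rule P')
  have len: "length Cs' = length Cs" "length \<eta>s = length Cs" "length qs = length Cs" "length qs' = length Cs"
    using lin_maps_list_length[OF \<eta>s] list_all2_lengthD[OF qs] list_all2_lengthD[OF qs'] by auto
  note m = all_coc_modules[OF Cs] and m' = all_coc_modules[OF Cs']
  note T = tensor_module[OF P.K_cring m']
  note l = lin_maps_list_homs[OF qs] and l' = lin_maps_list_homs[OF qs']
  note t\<eta> = multilin_tens_apply_each[OF P.K_cring m m' \<eta>s]
  have "pairing K P' Cs' qs' (\<eta> x)
      = sw K P (tensor K Cs') (length Cs') (\<lambda>r. tens K Cs' (apply_each qs' (map \<eta> r))) x"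
    unfolding pairing_sw
    by (rule sw_hom[OF P P' T \<eta> multilin_tens_apply_each[OF P.K_cring P'.A_modules m' l'] x])
  also have "\<dots> = sw K P (tensor K Cs') (length Cs) (\<lambda>r. tens K Cs' (apply_each \<eta>s (apply_each qs r))) x"
    unfolding len(1)
  proof (rule P.sw_cong[OF T multilin_apply_each[OF l t\<eta>] _ x])
    fix r assume r: "r \<in> tuples (replicate (length Cs) P)"
    have "apply_each qs' (map \<eta> r) = apply_each \<eta>s (apply_each qs r)"
      using tuples_length[OF r] tuples_nth[OF r] nat len by (intro nth_equalityI) auto
    then show "tens K Cs' (apply_each qs' (map \<eta> r)) = tens K Cs' (apply_each \<eta>s (apply_each qs r))"
      by simp
  qed
  also have "\<dots> = tensor_map K Cs' \<eta>s (pairing K P Cs qs x)"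
    unfolding tensor_map_def by (rule tensor_lift_pairing[OF P m l T t\<eta> x, symmetric])
  finally show ?thesis .
qed

lemma inv_into_lin:
  assumes V: "module K V" and \<phi>: "\<phi> \<in> lin_maps K V W" and bij: "bij_betw \<phi> (carrier V) (carrier W)"
  shows "inv_into (carrier V) \<phi> \<in> lin_maps K W V"
proof -
  interpret V: module K V by (rule V)
  let ?i = "inv_into (carrier V) \<phi>"
  have i: "?i y \<in> carrier V" "\<phi> (?i y) = y" if "y \<in> carrier W" for y
    using bij that by (auto simp: bij_betw_def inv_into_into f_inv_into_f)
  have j: "?i (\<phi> x) = x" if "x \<in> carrier V" for x
    using bij that by (simp add: bij_betw_def inv_into_f_f)
  show ?thesis
  proof (rule lin_mapsI)
    show "?i y \<in> carrier V" if "y \<in> carrier W" for y by (rule i[OF that])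
    show "?i (y \<oplus>\<^bsub>W\<^esub> y') = ?i y \<oplus>\<^bsub>V\<^esub> ?i y'" if "y \<in> carrier W" "y' \<in> carrier W" for y y'
      using j[of "?i y \<oplus>\<^bsub>V\<^esub> ?i y'"] that i by (simp add: lin_maps_add[OF \<phi>])
    show "?i (c \<odot>\<^bsub>W\<^esub> y) = c \<odot>\<^bsub>V\<^esub> ?i y" if "c \<in> carrier K" "y \<in> carrier W" for c y
      using j[of "c \<odot>\<^bsub>V\<^esub> ?i y"] that i by (simp add: lin_maps_smult[OF \<phi>])
  qed
qed


subsection \<open>The counit of a product\<close>

primrec counit_prod :: "('k, 'r) ring_scheme \<Rightarrow> ('k, 'c, 's) coalgebra_scheme list \<Rightarrow> 'c list \<Rightarrow> 'k"
  where
    "counit_prod K [] = (\<lambda>cs. \<one>\<^bsub>K\<^esub>)"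
  | "counit_prod K (C # Cs) = (\<lambda>cs. counit C (hd cs) \<otimes>\<^bsub>K\<^esub> counit_prod K Cs (tl cs))"

lemma multilin_counit_prod:
  assumes K: "cring K"
  shows "all_coc K Cs \<Longrightarrow> multilin K (ground_module K) Cs (counit_prod K Cs)"
proof (induction Cs)
  interpret cring K by (rule K)
  {
    case Nil
    then show ?case by (simp add: ground_module_simps)
  next
    case (Cons C Cs)
    interpret C: coc_coalgebra K C using Cons.prems by simp
    note gm = ground_module_module[OF K]
    have IH: "multilin K (ground_module K) Cs (counit_prod K Cs)" using Cons by simp
    show ?case
    proof (rule multilin_ConsI)
      show "multilin K (ground_module K) Cs (\<lambda>p. counit_prod K (C # Cs) (c # p))" if "c \<in> carrier C" for c
        using multilin_scale[OF gm IH C.counit_closed[OF that]] by (simp add: ground_module_simps)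
      show "(\<lambda>c. counit_prod K (C # Cs) (c # p)) \<in> lin_maps K C (ground_module K)" if "p \<in> tuples Cs" for p
        using C.counit_scale_lin[OF gm multilin_closed[OF IH that]] by (simp add: ground_module_simps)
    qed
  }
qed

text \<open>In Sweedler notation this is \<open>\<Sum> \<epsilon>(x\<^sub>1) \<dots> \<epsilon>(x\<^sub>n) = \<epsilon>(x)\<close>, as the \<open>q\<^sub>j\<close> preserve the counit.\<close>

lemma sw_counit_prod:
  assumes P: "coc_coalgebra K P"
  shows "all_coc K Cs \<Longrightarrow> list_all2 (\<lambda>q C. q \<in> coalg_homs K P C) qs Cs \<Longrightarrow> x \<in> carrier P \<Longrightarrow>
    sw K P (ground_module K) (length Cs) (\<lambda>r. counit_prod K Cs (apply_each qs r)) x = counit P x"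
proof (induction Cs arbitrary: qs x)
  interpret P: coc_coalgebra K P by (rule P)
  note gm = ground_module_module[OF P.K_cring]
  {
    case Nil
    then show ?case
      using P.sw_0[OF gm, of "\<lambda>_. \<one>\<^bsub>K\<^esub>" x] P.counit_closed[OF Nil(3)] by (simp add: ground_module_simps)
  next
    case (Cons C Cs)
    interpret C: coc_coalgebra K C using Cons.prems by simp
    have Cs: "all_coc K Cs" using Cons.prems(1) by simp
    obtain q qs' where qs: "qs = q # qs'" and q: "q \<in> coalg_homs K P C"
      and qs': "list_all2 (\<lambda>q C. q \<in> coalg_homs K P C) qs' Cs"
      using Cons.prems(2) by (auto simp: list_all2_Cons2)
    have m: "multilin K (ground_module K) (replicate (length (C # Cs)) P) (\<lambda>r. counit_prod K (C # Cs) (apply_each qs r))"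
      by (rule multilin_apply_each[OF lin_maps_list_homs[OF Cons.prems(2)] multilin_counit_prod[OF P.K_cring Cons.prems(1)]])
    have m': "multilin K (ground_module K) (replicate (length Cs) P) (\<lambda>r. counit_prod K Cs (apply_each qs' r))"
      by (rule multilin_apply_each[OF lin_maps_list_homs[OF qs'] multilin_counit_prod[OF P.K_cring Cs]])
    have "sw K P (ground_module K) (Suc (length Cs)) (\<lambda>r. counit_prod K (C # Cs) (apply_each qs r)) x
        = cosum K P (ground_module K) (\<lambda>a b. sw K P (ground_module K) (length Cs)
            (\<lambda>r. counit_prod K (C # Cs) (apply_each qs (a # r))) b) x"
      using m by (intro P.sw_Suc[OF gm _ Cons.prems(3)]) simp
    also have "\<dots> = cosum K P (ground_module K) (\<lambda>a b. counit P a \<odot>\<^bsub>ground_module K\<^esub> counit P b) x"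
    proof (rule P.cosum_cong[OF gm P.counit_bilin(1)[OF gm P.counit_linear] _ Cons.prems(3)])
      fix a b assume a: "a \<in> carrier P" and b: "b \<in> carrier P"
      have s: "(\<lambda>z. counit P a \<odot>\<^bsub>ground_module K\<^esub> z) \<in> lin_maps K (ground_module K) (ground_module K)"
        by (rule lin_maps_scale[OF gm lin_maps_id P.counit_closed[OF a]])
      have "sw K P (ground_module K) (length Cs) (\<lambda>r. counit_prod K (C # Cs) (apply_each qs (a # r))) b
          = sw K P (ground_module K) (length Cs)
              (\<lambda>r. counit P a \<odot>\<^bsub>ground_module K\<^esub> counit_prod K Cs (apply_each qs' r)) b"
        using coalg_homs_counit[OF q a] by (simp add: qs ground_module_simps)
      also have "\<dots> = counit P a \<odot>\<^bsub>ground_module K\<^esub> counit P b"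
        unfolding Cons.IH[OF Cs qs' b, symmetric] by (rule P.sw_lin_comp[OF gm gm m' s b, symmetric])
      finally show "sw K P (ground_module K) (length Cs) (\<lambda>r. counit_prod K (C # Cs) (apply_each qs (a # r))) b
          = counit P a \<odot>\<^bsub>ground_module K\<^esub> counit P b" .
    qed
    also have "\<dots> = counit P x"
      by (rule P.cosum_counit_left[OF gm P.counit_linear Cons.prems(3)])
    finally show ?case by simp
  }
qed

lemma counit_prod_zero:
  assumes K: "cring K"
  shows "all_coc K Cs \<Longrightarrow> cs \<in> tuples Cs \<Longrightarrow> i < length Cs \<Longrightarrow> counit (Cs ! i) (cs ! i) = \<zero>\<^bsub>K\<^esub> \<Longrightarrow>
    counit_prod K Cs cs = \<zero>\<^bsub>K\<^esub>"
proof (induction Cs arbitrary: cs i)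
  interpret cring K by (rule K)
  {
    case (Cons C Cs)
    interpret C: coc_coalgebra K C using Cons.prems by simp
    have Cs: "all_coc K Cs" using Cons.prems by simp
    from Cons.prems(2) obtain c cs' where cs: "cs = c # cs'" "c \<in> carrier C" "cs' \<in> tuples Cs"
      by (rule tuples_ConsE)
    have "counit_prod K Cs cs' \<in> carrier K"
      using multilin_closed[OF multilin_counit_prod[OF K Cs] cs(3)] by (simp add: ground_module_simps)
    then show ?case
      using Cons.IH[OF Cs cs(3)] Cons.prems(3,4) cs C.counit_closed[OF cs(2)] by (cases i) auto
  }
qed auto


subsection \<open>Elements with given components\<close>

text \<open>The element of \<open>F(P)\<close>, for a product \<open>P\<close> of \<open>X\<^sub>1, \<dots>, X\<^sub>n\<close>, that corresponds to \<open>a\<^sub>1 \<otimes> \<dots> \<otimes> a\<^sub>n\<close>.\<close>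

definition prod_elt ::
  "('k, 'r) ring_scheme \<Rightarrow> ('o, 'm, 'k, 'a) coalg_functor \<Rightarrow> 'o list \<Rightarrow> 'o \<Rightarrow> 'm list \<Rightarrow> 'a list \<Rightarrow> 'a"
  where "prod_elt K F Xs P ps as = inv_into (carrier (on_obj F P))
    (pairing K (on_obj F P) (map (on_obj F) Xs) (map (on_arr F) ps)) (tens K (map (on_obj F) Xs) as)"

abbreviation pow_elt ::
  "('k, 'r) ring_scheme \<Rightarrow> ('o, 'm, 's) lawvere_scheme \<Rightarrow> ('o, 'm, 'k, 'a) coalg_functor \<Rightarrow> nat \<Rightarrow> 'a list \<Rightarrow> 'a"
  where "pow_elt K Th F n \<equiv> prod_elt K F (replicate n (Tpow Th 1)) (Tpow Th n) (Tproj Th n)"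

lemma T_op_pow_elt: "T_op K Th F n t as = on_arr F t (pow_elt K Th F n as)"
  by (simp add: T_op_def prod_elt_def Let_def)

lemma homset_src_tgt:
  assumes "category C" "u \<in> homset C X Y"
  shows "X \<in> obj C" "Y \<in> obj C"
  using category.src_obj[OF assms(1), of u] category.tgt_obj[OF assms(1), of u] assms(2)
  by (auto simp: homset_def)

context T_coalgebra
begin

lemma K_cring: "cring K" by (rule is_cring)

lemma K_field: "field K" by (rule field_axioms)

lemma coc_src: "u \<in> homset Th X Y \<Longrightarrow> coc_coalgebra K (on_obj F X)"
  using on_obj_coalgebra homset_src_tgt(1)[OF category_axioms] by blast

lemma coc_tgt: "u \<in> homset Th X Y \<Longrightarrow> coc_coalgebra K (on_obj F Y)"
  using on_obj_coalgebra homset_src_tgt(2)[OF category_axioms] by blast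

lemma on_arr_lin: "u \<in> homset Th X Y \<Longrightarrow> on_arr F u \<in> lin_maps K (on_obj F X) (on_obj F Y)"
  by (rule coalg_homs_lin[OF on_arr_hom])

lemma on_arr_closed: "u \<in> homset Th X Y \<Longrightarrow> x \<in> carrier (on_obj F X) \<Longrightarrow> on_arr F u x \<in> carrier (on_obj F Y)"
  by (rule lin_maps_closed[OF on_arr_lin])

lemma Tpow_obj: "Tpow Th n \<in> obj Th"
  by (simp add: obj_pow)

lemma obj_cases:
  assumes "X \<in> obj Th"
  obtains n where "X = Tpow Th n"
  using assms obj_pow by auto

lemma coc_Tpow: "coc_coalgebra K (on_obj F (Tpow Th n))"
  by (rule on_obj_coalgebra[OF Tpow_obj])

context
  fixes Xs :: "'o list" and P :: 'o and ps :: "'m list"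
  assumes prod: "is_product Th Xs P ps"
begin

abbreviation (input) "FP \<equiv> on_obj F P"
abbreviation (input) "Fs \<equiv> map (on_obj F) Xs"
abbreviation (input) "qs \<equiv> map (on_arr F) ps"
abbreviation (input) "elt \<equiv> prod_elt K F Xs P ps"

lemma prod_coc: "coc_coalgebra K FP"
  using prod on_obj_coalgebra by (simp add: is_product_def)

lemma prod_all_coc: "all_coc K Fs"
  using prod on_obj_coalgebra by (auto simp: is_product_def)

lemma prod_modules: "all_modules K Fs"
  by (rule all_coc_modules[OF prod_all_coc])

lemma prod_homs: "list_all2 (\<lambda>q C. q \<in> coalg_homs K FP C) qs Fs"
  using prod on_arr_hom unfolding is_product_def by (auto simp: list_all2_conv_all_nth)

lemma prod_lin_list: "lin_maps_list K (replicate (length Fs) FP) Fs qs"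
  by (rule lin_maps_list_homs[OF prod_homs])

lemma pairing_prod_lin: "pairing K FP Fs qs \<in> lin_maps K FP (tensor K Fs)"
  by (rule pairing_lin[OF prod_coc prod_modules prod_lin_list])

lemma pairing_prod_inj: "x \<in> carrier FP \<Longrightarrow> y \<in> carrier FP \<Longrightarrow> pairing K FP Fs qs x = pairing K FP Fs qs y \<Longrightarrow> x = y"
  using preserves_products[OF prod] by (auto simp: bij_betw_def inj_on_def)

lemma inv_pairing_lin: "inv_into (carrier FP) (pairing K FP Fs qs) \<in> lin_maps K (tensor K Fs) FP"
  by (rule inv_into_lin[OF coc_module[OF prod_coc] pairing_prod_lin preserves_products[OF prod]])

lemma multilin_prod_elt: "multilin K FP Fs elt"
  unfolding prod_elt_def[abs_def]
  by (rule multilin_lin_comp[OF multilin_tens[OF K_cring prod_modules] inv_pairing_lin])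

lemma prod_elt_closed: "as \<in> tuples Fs \<Longrightarrow> elt as \<in> carrier FP"
  by (rule multilin_closed[OF multilin_prod_elt])

lemma pairing_prod_elt:
  assumes "as \<in> tuples Fs"
  shows "pairing K FP Fs qs (elt as) = tens K Fs as"
  unfolding prod_elt_def
  using preserves_products[OF prod] tens_closed[OF K_cring prod_modules assms]
  by (simp add: bij_betw_def f_inv_into_f)

lemma prod_eltI: "x \<in> carrier FP \<Longrightarrow> as \<in> tuples Fs \<Longrightarrow> pairing K FP Fs qs x = tens K Fs as \<Longrightarrow> x = elt as"
  using pairing_prod_elt prod_elt_closed by (intro pairing_prod_inj) auto

text \<open>As the pairing is bijective, the elements \<open>elt as\<close> span \<open>F(P)\<close>. Linear maps on \<open>F(P)\<close> are studied
  below through their restrictions to these elements.\<close>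

lemma lin_prod_lift:
  assumes W: "module K W" and L: "L \<in> lin_maps K FP W" and x: "x \<in> carrier FP"
  shows "L x = tensor_lift K W (\<lambda>as. L (elt as)) (pairing K FP Fs qs x)"
proof -
  have X: "pairing K FP Fs qs x \<in> carrier (tensor K Fs)"
    by (rule lin_maps_closed[OF pairing_prod_lin x])
  have "x = inv_into (carrier FP) (pairing K FP Fs qs) (pairing K FP Fs qs x)"
    using preserves_products[OF prod] x by (simp add: bij_betw_def inv_into_f_f)
  also have "\<dots> = inv_into (carrier FP) (pairing K FP Fs qs) (tensor_lift K (tensor K Fs) (tens K Fs) (pairing K FP Fs qs x))"
    by (simp add: tensor_lift_tens_id[OF K_cring prod_modules X])
  also have "\<dots> = tensor_lift K FP elt (pairing K FP Fs qs x)"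
    unfolding prod_elt_def[abs_def]
    by (rule tensor_lift_comp[OF K_cring prod_modules tensor_module[OF K_cring prod_modules] coc_module[OF prod_coc]
          multilin_tens[OF K_cring prod_modules] inv_pairing_lin X])
  finally have "L x = L (tensor_lift K FP elt (pairing K FP Fs qs x))" by simp
  also have "\<dots> = tensor_lift K W (\<lambda>as. L (elt as)) (pairing K FP Fs qs x)"
    by (rule tensor_lift_comp[OF K_cring prod_modules coc_module[OF prod_coc] W multilin_prod_elt L X])
  finally show ?thesis .
qed

lemma lin_prod_sw:
  assumes W: "module K W" and L: "L \<in> lin_maps K FP W" and x: "x \<in> carrier FP"
  shows "sw K FP W (length Xs) (\<lambda>r. L (elt (apply_each qs r))) x = L x"
  using tensor_lift_pairing[OF prod_coc prod_modules prod_lin_list W multilin_lin_comp[OF multilin_prod_elt L] x]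
    lin_prod_lift[OF W L x] by simp

lemma sw_prod_elt:
  assumes W: "module K W" and \<beta>: "multilin K W Fs \<beta>" and as: "as \<in> tuples Fs"
  shows "sw K FP W (length Xs) (\<lambda>r. \<beta> (apply_each qs r)) (elt as) = \<beta> as"
  using tensor_lift_pairing[OF prod_coc prod_modules prod_lin_list W \<beta> prod_elt_closed[OF as]]
    pairing_prod_elt[OF as] tensor_lift_tens[OF K_cring prod_modules W \<beta> as] by simp

lemma counit_prod_elt: "as \<in> tuples Fs \<Longrightarrow> counit FP (elt as) = counit_prod K Fs as"
  using sw_prod_elt[OF ground_module_module[OF K_cring] multilin_counit_prod[OF K_cring prod_all_coc]]
    sw_counit_prod[OF prod_coc prod_all_coc prod_homs prod_elt_closed] by simp

lemma bimultilin_prod_elt: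
  assumes "bilin K FP W G"
  shows "bimultilin K W Fs (\<lambda>r s. G (elt r) (elt s))"
  unfolding bimultilin_def
  using multilin_lin_comp[OF multilin_prod_elt bilin_right[OF assms prod_elt_closed]]
    multilin_lin_comp[OF multilin_prod_elt bilin_left[OF assms prod_elt_closed]] by blast

text \<open>Replacing \<open>G x y\<close> by its expansion in components of \<open>x\<close> and \<open>y\<close> brings the left side into the form of
  \<open>cosum_sw_sw\<close>. So \<open>F(P)\<close> has the comultiplication of the tensor product of the \<open>F(X\<^sub>i)\<close>.\<close>

lemma cosum_prod_elt:
  assumes W: "module K W" and G: "bilin K FP W G" and as: "as \<in> tuples Fs"
  shows "cosum K FP W G (elt as) = dbl K W Fs (\<lambda>r s. G (elt r) (elt s)) as"
proof -
  interpret P: coc_coalgebra K FP by (rule prod_coc)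
  note \<Gamma> = bimultilin_prod_elt[OF G]
  have "cosum K FP W G (elt as) = cosum K FP W (\<lambda>x y. sw K FP W (length Fs) (\<lambda>r. sw K FP W (length Fs)
      (\<lambda>s. G (elt (apply_each qs r)) (elt (apply_each qs s))) y) x) (elt as)"
  proof (rule P.cosum_cong[OF W G _ prod_elt_closed[OF as], symmetric])
    fix x y assume x: "x \<in> carrier FP" and y: "y \<in> carrier FP"
    note Gy = bilin_left[OF G y]
    have m: "multilin K W (replicate (length Xs) FP) (\<lambda>r. G (elt (apply_each qs r)) y)"
      using multilin_apply_each[OF prod_lin_list multilin_lin_comp[OF multilin_prod_elt Gy]] by simp
    have "sw K FP W (length Xs) (\<lambda>r. sw K FP W (length Xs) (\<lambda>s. G (elt (apply_each qs r)) (elt (apply_each qs s))) y) x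
        = sw K FP W (length Xs) (\<lambda>r. G (elt (apply_each qs r)) y) x"
    proof (rule P.sw_cong[OF W m _ x])
      fix r assume "r \<in> tuples (replicate (length Xs) FP)"
      then have "apply_each qs r \<in> tuples Fs" using apply_each_tuples[OF prod_lin_list] by simp
      then show "sw K FP W (length Xs) (\<lambda>s. G (elt (apply_each qs r)) (elt (apply_each qs s))) y = G (elt (apply_each qs r)) y"
        by (intro lin_prod_sw[OF W _ y] bilin_right[OF G] prod_elt_closed)
    qed
    also have "\<dots> = G x y" by (rule lin_prod_sw[OF W Gy x])
    finally show "sw K FP W (length Fs) (\<lambda>r. sw K FP W (length Fs)
        (\<lambda>s. G (elt (apply_each qs r)) (elt (apply_each qs s))) y) x = G x y" by simp
  qed
  also have "\<dots> = sw K FP W (length Xs) (\<lambda>r. dbl K W Fs (\<lambda>r s. G (elt r) (elt s)) (apply_each qs r)) (elt as)"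
    using cosum_sw_sw[OF prod_coc W prod_all_coc prod_homs \<Gamma> prod_elt_closed[OF as]] by simp
  also have "\<dots> = dbl K W Fs (\<lambda>r s. G (elt r) (elt s)) as"
    by (rule sw_prod_elt[OF W multilin_dbl[OF W prod_all_coc \<Gamma>] as])
  finally show ?thesis .
qed

end


subsection \<open>A product of powers of \<open>T\<close> as a power of \<open>T\<close>\<close>

lemma apply_each_cmp:
  assumes ps: "list_all2 (\<lambda>p X. p \<in> homset Th P X) ps Xs" and s: "s \<in> homset Th Y P"
    and r: "r \<in> tuples (replicate (length Xs) (on_obj F Y))"
  shows "apply_each (map (on_arr F) ps) (map (on_arr F s) r)
    = apply_each (map (on_arr F) (map (\<lambda>p. cmp Th p s) ps)) r"
proof (rule nth_equalityI)
  have len: "length r = length Xs" "length ps = length Xs"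
    using tuples_length[OF r] list_all2_lengthD[OF ps] by simp_all
  then show "length (apply_each (map (on_arr F) ps) (map (on_arr F s) r))
    = length (apply_each (map (on_arr F) (map (\<lambda>p. cmp Th p s) ps)) r)" by simp
  fix i assume "i < length (apply_each (map (on_arr F) ps) (map (on_arr F s) r))"
  then have i: "i < length Xs" using len by simp
  have "on_arr F (cmp Th (ps ! i) s) (r ! i) = on_arr F (ps ! i) (on_arr F s (r ! i))"
    using tuples_nth[OF r, of i] i list_all2_nthD2[OF ps i] by (intro on_arr_cmp[OF s]) auto
  then show "apply_each (map (on_arr F) ps) (map (on_arr F s) r) ! i
      = apply_each (map (on_arr F) (map (\<lambda>p. cmp Th p s) ps)) r ! i"
    using i len by simp
qed

text \<open>An arrow into a product acts through its components \<open>p\<^sub>i \<circ> s\<close>, combined with the iterated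
  comultiplication of \<open>F(Y)\<close>.\<close>

lemma on_arr_via_product:
  assumes prod: "is_product Th Xs P ps" and s: "s \<in> homset Th Y P" and a: "a \<in> carrier (on_obj F Y)"
  shows "on_arr F s a = sw K (on_obj F Y) (on_obj F P) (length Xs)
    (\<lambda>r. prod_elt K F Xs P ps (apply_each (map (on_arr F) (map (\<lambda>p. cmp Th p s) ps)) r)) a"
proof -
  note Y = coc_src[OF s] and P = prod_coc[OF prod]
  interpret Y: coc_coalgebra K "on_obj F Y" by (rule Y)
  interpret P: coc_coalgebra K "on_obj F P" by (rule P)
  let ?qs = "map (on_arr F) ps" and ?elt = "prod_elt K F Xs P ps"
  have ps: "list_all2 (\<lambda>p X. p \<in> homset Th P X) ps Xs" using prod by (simp add: is_product_def)
  have m: "multilin K (on_obj F P) (replicate (length Xs) (on_obj F P)) (\<lambda>r. ?elt (apply_each ?qs r))"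
    using multilin_apply_each[OF prod_lin_list[OF prod] multilin_prod_elt[OF prod]] by simp
  have m': "multilin K (on_obj F P) (replicate (length Xs) (on_obj F Y)) (\<lambda>r. ?elt (apply_each ?qs (map (on_arr F s) r)))"
    by (rule multilin_map[OF on_arr_lin[OF s] Y.A_module m])
  have "on_arr F s a = sw K (on_obj F P) (on_obj F P) (length Xs) (\<lambda>r. ?elt (apply_each ?qs r)) (on_arr F s a)"
    by (rule lin_prod_sw[OF prod P.A_module lin_maps_id on_arr_closed[OF s a], symmetric])
  also have "\<dots> = sw K (on_obj F Y) (on_obj F P) (length Xs) (\<lambda>r. ?elt (apply_each ?qs (map (on_arr F s) r))) a"
    by (rule sw_hom[OF Y P P.A_module on_arr_hom[OF s] m a])
  also have "\<dots> = sw K (on_obj F Y) (on_obj F P) (length Xs)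
      (\<lambda>r. ?elt (apply_each (map (on_arr F) (map (\<lambda>p. cmp Th p s) ps)) r)) a"
    by (rule Y.sw_cong[OF P.A_module m' _ a, symmetric]) (simp only: apply_each_cmp[OF ps s])
  finally show ?thesis .
qed

end

primrec chop :: "nat list \<Rightarrow> 'x list \<Rightarrow> 'x list list"
  where
    "chop [] xs = []"
  | "chop (n # ns) xs = take n xs # chop ns (drop n xs)"

lemma length_chop [simp]: "length (chop ns xs) = length ns"
  by (induction ns arbitrary: xs) auto

lemma chop_map: "chop ns (map f xs) = map (map f) (chop ns xs)"
  by (induction ns arbitrary: xs) (simp_all add: take_map drop_map)

text \<open>The universal property of \<open>T\<^sup>n\<close>, applied to each block of arrows.\<close>

lemma (in lawvere_theory) tuple_arrows:
  assumes Y: "Y \<in> obj Th"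
  shows "\<forall>q\<in>set Q. q \<in> homset Th Y (Tpow Th 1) \<Longrightarrow> length Q = sum_list ns \<Longrightarrow>
    \<exists>ss. list_all2 (\<lambda>s n. s \<in> homset Th Y (Tpow Th n)) ss ns \<and>
      chop ns Q = map2 (\<lambda>s n. map (\<lambda>p. cmp Th p s) (Tproj Th n)) ss ns"
proof (induction ns arbitrary: Q)
  case Nil
  then show ?case by simp
next
  case (Cons n ns)
  have "\<forall>q\<in>set (drop n Q). q \<in> homset Th Y (Tpow Th 1)"
    using Cons.prems(1) in_set_dropD by fast
  moreover have "length (drop n Q) = sum_list ns" using Cons.prems(2) by simp
  ultimately obtain ss where ss: "list_all2 (\<lambda>s n. s \<in> homset Th Y (Tpow Th n)) ss ns"
      "chop ns (drop n Q) = map2 (\<lambda>s n. map (\<lambda>p. cmp Th p s) (Tproj Th n)) ss ns"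
    using Cons.IH by blast
  have "list_all2 (\<lambda>u X. u \<in> homset Th Y X) (take n Q) (replicate n (Tpow Th 1))"
    using Cons.prems by (auto simp: list_all2_conv_all_nth)
  then have "\<exists>!h. h \<in> homset Th Y (Tpow Th n) \<and> map (\<lambda>p. cmp Th p h) (Tproj Th n) = take n Q"
    using pow_product[of n] Y unfolding is_product_def by blast
  then obtain s where "s \<in> homset Th Y (Tpow Th n)" "map (\<lambda>p. cmp Th p s) (Tproj Th n) = take n Q"
    by blast
  then show ?case
    using ss by (intro exI[of _ "s # ss"]) simp
qed

lemma apply_blocks_chop:
  "length qs = sum_list ns \<Longrightarrow> length r = sum_list ns \<Longrightarrow>
    apply_blocks (map2 (\<lambda>n qs. (n, \<lambda>r. g n (apply_each qs r))) ns (chop ns qs)) r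
    = apply_blocks (map (\<lambda>n. (n, g n)) ns) (apply_each qs r)"
  by (induction ns arbitrary: qs r) (simp_all add: take_map drop_map take_zip drop_zip)

lemma apply_blocks_concat:
  "list_all2 (\<lambda>bs n. length bs = n) bss ns \<Longrightarrow>
    apply_blocks (map (\<lambda>n. (n, g n)) ns) (concat bss) = map2 g ns bss"
  by (induction bss ns rule: list_all2_induct) auto

context T_coalgebra
begin

lemma multilin_blocks_pow:
  "multilin_blocks K (on_obj F (Tpow Th 1)) (map (\<lambda>n. (n, pow_elt K Th F n)) ns)
    (map (on_obj F) (map (Tpow Th) ns))"
  using multilin_prod_elt[OF pow_product] coc_module[OF coc_Tpow]
  by (auto simp: multilin_blocks_def list_all2_conv_all_nth)

text \<open>The arrow \<open>\<sigma>\<close> is the identification of \<open>T\<^sup>N\<close>, for \<open>N\<close> the sum of the exponents, with the product of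
  the \<open>T\<^sup>n\<close>. It turns an operation \<open>F(u)\<close> with \<open>u : P \<rightarrow> T\<close> into \<open>F(u \<circ> \<sigma>)\<close>, to which the definition of a
  \<open>\<T>\<close>-ideal applies. That \<open>F(\<sigma>)\<close> groups elementary tensors into blocks is seen by comparing components:
  the block of projections of \<open>T\<^sup>N\<close> makes up the component \<open>p\<^sub>i \<circ> \<sigma>\<close>, so that \<open>\<Delta>\<^sub>k\<close> followed by the
  comultiplications hidden in these components is \<open>\<Delta>\<^sub>N\<close>, by \<open>sw_blocks\<close>.\<close>

lemma product_of_powers:
  assumes prod: "is_product Th (map (Tpow Th) ns) P ps"
  obtains \<sigma> where "\<sigma> \<in> homset Th (Tpow Th (sum_list ns)) P"
    and "\<And>cs. cs \<in> tuples (replicate (sum_list ns) (on_obj F (Tpow Th 1))) \<Longrightarrow>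
      on_arr F \<sigma> (pow_elt K Th F (sum_list ns) cs)
      = prod_elt K F (map (Tpow Th) ns) P ps (apply_blocks (map (\<lambda>n. (n, pow_elt K Th F n)) ns) cs)"
proof -
  let ?N = "sum_list ns" and ?Xs = "map (Tpow Th) ns" and ?T = "Tpow Th 1"
  let ?Y = "Tpow Th (sum_list ns)" and ?Q = "Tproj Th (sum_list ns)"
  let ?FY = "on_obj F ?Y" and ?FT = "on_obj F ?T" and ?Fs = "map (on_obj F) (map (Tpow Th) ns)"
  let ?pw = "pow_elt K Th F" and ?blk = "map (\<lambda>n. (n, pow_elt K Th F n)) ns"
  note pN = pow_product[of ?N]
  interpret Y: coc_coalgebra K ?FY by (rule coc_Tpow)
  have Q: "list_all2 (\<lambda>p X. p \<in> homset Th ?Y X) ?Q (replicate ?N ?T)"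
    using pN by (simp add: is_product_def)
  then have lenQ: "length ?Q = ?N" by (auto dest: list_all2_lengthD)
  have Q': "\<forall>q\<in>set ?Q. q \<in> homset Th ?Y ?T"
    using Q lenQ by (auto simp: list_all2_conv_all_nth in_set_conv_nth)
  obtain ss where ss: "list_all2 (\<lambda>s n. s \<in> homset Th ?Y (Tpow Th n)) ss ns"
      "chop ns ?Q = map2 (\<lambda>s n. map (\<lambda>p. cmp Th p s) (Tproj Th n)) ss ns"
    using tuple_arrows[OF Tpow_obj Q' lenQ] by blast
  have lss: "length ss = length ns" using ss(1) by (rule list_all2_lengthD)
  have "list_all2 (\<lambda>u X. u \<in> homset Th ?Y X) ss ?Xs"
    using ss(1) by (simp add: list_all2_map2)
  then have "\<exists>!h. h \<in> homset Th ?Y P \<and> map (\<lambda>p. cmp Th p h) ps = ss"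
    using prod Tpow_obj[of ?N] unfolding is_product_def by blast
  then obtain \<sigma> where \<sigma>: "\<sigma> \<in> homset Th ?Y P" "map (\<lambda>p. cmp Th p \<sigma>) ps = ss" by blast
  have ps: "list_all2 (\<lambda>p X. p \<in> homset Th P X) ps ?Xs" using prod by (simp add: is_product_def)
  note mods = prod_modules[OF prod]
  note T = tensor_module[OF K_cring mods] and t = multilin_tens[OF K_cring mods]
  have P: "coc_coalgebra K (on_obj F P)" by (rule prod_coc[OF prod])
  let ?bs = "map2 (\<lambda>n qs. (n, \<lambda>r. ?pw n (apply_each qs r))) ns (chop ns (map (on_arr F) ?Q))"
  have bs_nth: "?bs ! i = (ns ! i, \<lambda>r. ?pw (ns ! i)
        (apply_each (map (on_arr F) (map (\<lambda>p. cmp Th p (ss ! i)) (Tproj Th (ns ! i)))) r))"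
    if "i < length ns" for i
    using that lss by (simp add: chop_map ss(2))
  have fst_bs: "map fst ?bs = ns"
    by (rule nth_equalityI) (use bs_nth in auto)
  have ss_nth: "ss ! i \<in> homset Th ?Y (Tpow Th (ns ! i))" if "i < length ns" for i
    using list_all2_nthD2[OF ss(1) that] .
  have bs: "multilin_blocks K ?FY ?bs ?Fs"
    unfolding multilin_blocks_def
  proof (rule list_all2_all_nthI)
    fix i assume "i < length ?bs"
    then have i: "i < length ns" by simp
    let ?n = "ns ! i" and ?qs = "map (on_arr F) (map (\<lambda>p. cmp Th p (ss ! i)) (Tproj Th (ns ! i)))"
    note pn = pow_product[of "ns ! i"]
    have len: "length (Tproj Th ?n) = ?n"
      using pn by (auto simp: is_product_def dest: list_all2_lengthD)
    have "lin_maps_list K (replicate ?n ?FY) (replicate ?n ?FT) ?qs"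
    proof (rule lin_maps_listI[where n = ?n])
      fix j assume j: "j < ?n"
      have "Tproj Th ?n ! j \<in> homset Th (Tpow Th ?n) ?T"
        using pn j by (auto simp: is_product_def dest: list_all2_nthD2)
      then show "?qs ! j \<in> lin_maps K (replicate ?n ?FY ! j) (replicate ?n ?FT ! j)"
        using j len on_arr_lin[OF cmp_hom[OF ss_nth[OF i]]] by simp
    qed (use len in auto)
    moreover have "multilin K (on_obj F (Tpow Th ?n)) (replicate ?n ?FT) (?pw ?n)"
      using multilin_prod_elt[OF pn] by simp
    ultimately have "multilin K (on_obj F (Tpow Th ?n)) (replicate ?n ?FY) (\<lambda>r. ?pw ?n (apply_each ?qs r))"
      by (rule multilin_apply_each)
    then show "(\<lambda>(n, \<gamma>) V. module K V \<and> multilin K V (replicate n ?FY) \<gamma>) (?bs ! i) (?Fs ! i)"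
      unfolding bs_nth[OF i] using i coc_module[OF coc_Tpow] by simp
  qed simp
  show thesis
  proof (rule that[OF \<sigma>(1)])
    fix cs assume cs: "cs \<in> tuples (replicate ?N ?FT)"
    show "on_arr F \<sigma> (?pw ?N cs) = prod_elt K F ?Xs P ps (apply_blocks ?blk cs)"
    proof (rule prod_eltI[OF prod])
      let ?y = "?pw ?N cs" and ?\<tau> = "tens K ?Fs" and ?TT = "tensor K ?Fs"
      have cs': "cs \<in> tuples (map (on_obj F) (replicate ?N ?T))" using cs by simp
      have y: "?y \<in> carrier ?FY" by (rule prod_elt_closed[OF pN cs'])
      show "on_arr F \<sigma> ?y \<in> carrier (on_obj F P)" by (rule on_arr_closed[OF \<sigma>(1) y])
      show "apply_blocks ?blk cs \<in> tuples ?Fs"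
        using cs by (intro apply_blocks_tuples[OF multilin_blocks_pow]) (simp add: comp_def)
      have mP: "multilin K ?TT (replicate (length ?Fs) (on_obj F P)) (\<lambda>r. ?\<tau> (apply_each (map (on_arr F) ps) r))"
        by (rule multilin_apply_each[OF prod_lin_list[OF prod] t])
      have mY: "multilin K ?TT (replicate (length ?Fs) ?FY) (\<lambda>r. ?\<tau> (apply_each (map (on_arr F) ps) (map (on_arr F \<sigma>) r)))"
        by (rule multilin_map[OF on_arr_lin[OF \<sigma>(1)] Y.A_module mP])
      have "pairing K (on_obj F P) ?Fs (map (on_arr F) ps) (on_arr F \<sigma> ?y)
          = sw K ?FY ?TT (length ?Fs) (\<lambda>r. ?\<tau> (apply_each (map (on_arr F) ps) (map (on_arr F \<sigma>) r))) ?y"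
        unfolding pairing_sw by (rule sw_hom[OF coc_Tpow P T on_arr_hom[OF \<sigma>(1)] mP y])
      also have "\<dots> = sw K ?FY ?TT (length ?Fs) (\<lambda>r. ?\<tau> (apply_each (map2 (\<lambda>(n, \<gamma>) V. sw K ?FY V n \<gamma>) ?bs ?Fs) r)) ?y"
      proof (rule Y.sw_cong[OF T mY _ y, symmetric])
        fix r assume r: "r \<in> tuples (replicate (length ?Fs) ?FY)"
        then have r': "length r = length ns" "\<And>i. i < length ns \<Longrightarrow> r ! i \<in> carrier ?FY"
          using tuples_length[OF r] tuples_nth[OF r] by auto
        have "apply_each (map (on_arr F) ps) (map (on_arr F \<sigma>) r) = apply_each (map (on_arr F) ss) r"
          using apply_each_cmp[OF ps \<sigma>(1), of r] r \<sigma>(2) by simp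
        also have "\<dots> = apply_each (map2 (\<lambda>(n, \<gamma>) V. sw K ?FY V n \<gamma>) ?bs ?Fs) r"
        proof (rule nth_equalityI)
          fix i assume "i < length (apply_each (map (on_arr F) ss) r)"
          then have i: "i < length ns" using r'(1) lss by simp
          have "on_arr F (ss ! i) (r ! i) = (case ?bs ! i of (n, \<gamma>) \<Rightarrow> sw K ?FY (?Fs ! i) n \<gamma>) (r ! i)"
            unfolding bs_nth[OF i]
            using on_arr_via_product[OF pow_product ss_nth[OF i] r'(2)[OF i]] i by simp
          then show "apply_each (map (on_arr F) ss) r ! i
              = apply_each (map2 (\<lambda>(n, \<gamma>) V. sw K ?FY V n \<gamma>) ?bs ?Fs) r ! i"
            using i r'(1) lss by (simp add: case_prod_beta)
        qed (use r'(1) lss in simp)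
        finally show "?\<tau> (apply_each (map2 (\<lambda>(n, \<gamma>) V. sw K ?FY V n \<gamma>) ?bs ?Fs) r)
            = ?\<tau> (apply_each (map (on_arr F) ps) (map (on_arr F \<sigma>) r))" by simp
      qed
      also have "\<dots> = sw K ?FY ?TT ?N (\<lambda>r. ?\<tau> (apply_blocks ?bs r)) ?y"
        using sw_blocks[OF coc_Tpow T bs t y] unfolding fst_bs by simp
      also have "\<dots> = sw K ?FY ?TT ?N (\<lambda>r. ?\<tau> (apply_blocks ?blk (apply_each (map (on_arr F) ?Q) r))) ?y"
      proof (rule Y.sw_cong[OF T _ _ y, symmetric])
        show "multilin K ?TT (replicate ?N ?FY) (\<lambda>r. ?\<tau> (apply_blocks ?bs r))"
          using multilin_apply_blocks[OF bs Y.A_module t] unfolding fst_bs .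
        fix r assume "r \<in> tuples (replicate ?N ?FY)"
        then have "length r = ?N" using tuples_length by fastforce
        then show "?\<tau> (apply_blocks ?blk (apply_each (map (on_arr F) ?Q) r)) = ?\<tau> (apply_blocks ?bs r)"
          using lenQ apply_blocks_chop[of "map (on_arr F) ?Q" ns r ?pw] by simp
      qed
      also have "\<dots> = ?\<tau> (apply_blocks ?blk cs)"
      proof -
        have "multilin K ?TT (replicate ?N ?FT) (\<lambda>c. ?\<tau> (apply_blocks ?blk c))"
          using multilin_apply_blocks[OF multilin_blocks_pow coc_module[OF coc_Tpow] t] by (simp add: comp_def)
        then show ?thesis
          using sw_prod_elt[OF pN T _ cs'] by simp
      qed
      finally show "pairing K (on_obj F P) ?Fs (map (on_arr F) ps) (on_arr F \<sigma> ?y) = ?\<tau> (apply_blocks ?blk cs)" .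
    qed
  qed
qed

end


section \<open>Ideals and quotients\<close>

lemma multilin_zero_entry:
  assumes Vs: "all_modules K Vs" and W: "module K W" and \<beta>: "multilin K W Vs \<beta>"
    and p: "p \<in> tuples Vs" "i < length Vs" "p ! i = \<zero>\<^bsub>Vs ! i\<^esub>"
  shows "\<beta> p = \<zero>\<^bsub>W\<^esub>"
proof -
  have "module K (Vs ! i)" using Vs p(2) by simp
  then have "\<beta> (p[i := \<zero>\<^bsub>Vs ! i\<^esub>]) = \<zero>\<^bsub>W\<^esub>"
    by (rule lin_maps_zero[OF _ W multilin_slot[OF \<beta> p(1,2)]])
  then show ?thesis using p(3) by (metis list_update_id)
qed

text \<open>A bilinear \<open>G\<close> that vanishes on \<open>J\<close> does not distinguish \<open>f\<close> from \<open>g\<close>, and \<open>\<Delta>\<close> commutes with both, so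
  \<open>\<Sum> G (f a\<^sub>1) (f a\<^sub>2) = \<Sum> G (g a\<^sub>1) (g a\<^sub>2)\<close>.\<close>

lemma coid_elt_diff:
  fixes K :: "('k, 'r) ring_scheme" and D :: "('k, 'c, 's) coalgebra_scheme"
  assumes C: "coc_coalgebra K C" and D: "coc_coalgebra K D" and f: "f \<in> coalg_homs K C D" and g: "g \<in> coalg_homs K C D"
    and J: "submodule J K D" and diff: "\<And>a. a \<in> carrier C \<Longrightarrow> f a \<ominus>\<^bsub>D\<^esub> g a \<in> J" and a: "a \<in> carrier C"
  shows "coid_elt K D J (f a \<ominus>\<^bsub>D\<^esub> g a)"
proof (rule coid_eltI[OF D J])
  interpret C: coc_coalgebra K C by (rule C)
  interpret D: coc_coalgebra K D by (rule D)
  note fl = coalg_homs_lin[OF f] and gl = coalg_homs_lin[OF g]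
  note fc = lin_maps_closed[OF fl] and gc = lin_maps_closed[OF gl]
  show "f a \<ominus>\<^bsub>D\<^esub> g a \<in> carrier D" by (rule submodule_subset[OF J diff[OF a]])
  note gm = ground_module_module[OF C.K_cring]
  have "counit D (f a \<ominus>\<^bsub>D\<^esub> g a) = counit D (f a) \<ominus>\<^bsub>ground_module K\<^esub> counit D (g a)"
    by (rule lin_maps_minus[OF D.A_module gm D.counit_linear fc[OF a] gc[OF a]])
  also have "\<dots> = \<zero>\<^bsub>ground_module K\<^esub>"
    using C.counit_closed[OF a] coalg_homs_counit[OF f a] coalg_homs_counit[OF g a]
    by (simp add: module_minus_eq_zero_iff[OF gm] ground_module_simps(1))
  finally show "counit D (f a \<ominus>\<^bsub>D\<^esub> g a) = \<zero>\<^bsub>K\<^esub>" by (simp add: ground_module_simps)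
  fix W :: "('k, ('c set list \<Rightarrow> 'k) set) module" and G
  assume W: "module K W" and G: "bilin K D W G"
    and van: "\<And>a b. a \<in> J \<Longrightarrow> b \<in> carrier D \<Longrightarrow> G a b = \<zero>\<^bsub>W\<^esub>" "\<And>a b. a \<in> carrier D \<Longrightarrow> b \<in> J \<Longrightarrow> G a b = \<zero>\<^bsub>W\<^esub>"
  have eq: "G (f a) (f b) = G (g a) (g b)" if ab: "a \<in> carrier C" "b \<in> carrier C" for a b
  proof -
    note fg = fc[OF ab(1)] fc[OF ab(2)] gc[OF ab(1)] gc[OF ab(2)]
    have "G (f a) (f b) \<ominus>\<^bsub>W\<^esub> G (g a) (f b) = G (f a \<ominus>\<^bsub>D\<^esub> g a) (f b)"
      by (rule lin_maps_minus[OF D.A_module W bilin_left[OF G fg(2)] fg(1,3), symmetric])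
    also have "\<dots> = \<zero>\<^bsub>W\<^esub>" by (rule van(1)[OF diff[OF ab(1)] fg(2)])
    finally have 1: "G (f a) (f b) = G (g a) (f b)"
      using module_minus_eq_zero_iff[OF W] lin_maps_closed[OF bilin_left[OF G fg(2)]] fg by blast
    have "G (g a) (f b) \<ominus>\<^bsub>W\<^esub> G (g a) (g b) = G (g a) (f b \<ominus>\<^bsub>D\<^esub> g b)"
      by (rule lin_maps_minus[OF D.A_module W bilin_right[OF G fg(3)] fg(2,4), symmetric])
    also have "\<dots> = \<zero>\<^bsub>W\<^esub>" by (rule van(2)[OF fg(3) diff[OF ab(2)]])
    finally have 2: "G (g a) (f b) = G (g a) (g b)"
      using module_minus_eq_zero_iff[OF W] lin_maps_closed[OF bilin_right[OF G fg(3)]] fg by blast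
    from 1 2 show ?thesis by simp
  qed
  have "cosum K D W G (f a) = cosum K C W (\<lambda>a b. G (f a) (f b)) a"
    by (rule cosum_hom[OF C D W f G a])
  also have "\<dots> = cosum K C W (\<lambda>a b. G (g a) (g b)) a"
    by (rule C.cosum_cong[OF W bilin_comp[OF G gl] eq a])
  also have "\<dots> = cosum K D W G (g a)"
    by (rule cosum_hom[OF C D W g G a, symmetric])
  finally have "cosum K D W G (f a) = cosum K D W G (g a)" .
  then show "cosum K D W G (f a \<ominus>\<^bsub>D\<^esub> g a) = \<zero>\<^bsub>W\<^esub>"
    using lin_maps_minus[OF D.A_module W D.cosum_lin[OF W G] fc[OF a] gc[OF a]]
      module_minus_eq_zero_iff[OF W] D.cosum_closed[OF W G gc[OF a]] by simp
qed

context T_coalgebra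
begin

abbreviation (input) "FT \<equiv> on_obj F (Tpow Th 1)"

lemma prod_elt_coid:
  assumes prod: "is_product Th Xs P ps" and as: "as \<in> tuples (map (on_obj F) Xs)" and i: "i < length Xs"
    and D: "submodule D K (on_obj F (Xs ! i))" and a: "coid_elt K (on_obj F (Xs ! i)) D (as ! i)"
  shows "counit (on_obj F P) (prod_elt K F Xs P ps as) = \<zero>\<^bsub>K\<^esub>"
    and "module K W \<Longrightarrow> bilin K (on_obj F P) W G \<Longrightarrow>
      (\<And>r y. r \<in> tuples (map (on_obj F) Xs) \<Longrightarrow> r ! i \<in> D \<Longrightarrow> y \<in> carrier (on_obj F P) \<Longrightarrow>
        G (prod_elt K F Xs P ps r) y = \<zero>\<^bsub>W\<^esub> \<and> G y (prod_elt K F Xs P ps r) = \<zero>\<^bsub>W\<^esub>) \<Longrightarrow>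
      cosum K (on_obj F P) W G (prod_elt K F Xs P ps as) = \<zero>\<^bsub>W\<^esub>"
proof -
  have i': "i < length (map (on_obj F) Xs)" using i by simp
  have D': "submodule D K (map (on_obj F) Xs ! i)" and a': "coid_elt K (map (on_obj F) Xs ! i) D (as ! i)"
    using D a i by simp_all
  show "counit (on_obj F P) (prod_elt K F Xs P ps as) = \<zero>\<^bsub>K\<^esub>"
    unfolding counit_prod_elt[OF prod as]
    by (rule counit_prod_zero[OF K_cring prod_all_coc[OF prod] as i']) (use a' in \<open>simp add: coid_elt_def\<close>)
  assume W: "module K W" and G: "bilin K (on_obj F P) W G"
    and van: "\<And>r y. r \<in> tuples (map (on_obj F) Xs) \<Longrightarrow> r ! i \<in> D \<Longrightarrow> y \<in> carrier (on_obj F P) \<Longrightarrow>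
        G (prod_elt K F Xs P ps r) y = \<zero>\<^bsub>W\<^esub> \<and> G y (prod_elt K F Xs P ps r) = \<zero>\<^bsub>W\<^esub>"
  show "cosum K (on_obj F P) W G (prod_elt K F Xs P ps as) = \<zero>\<^bsub>W\<^esub>"
    unfolding cosum_prod_elt[OF prod W G as]
    by (rule dbl_coid[OF W prod_all_coc[OF prod] bimultilin_prod_elt[OF prod G] as i' D' a'])
      (use van prod_elt_closed[OF prod] in blast)
qed

text \<open>The identification of \<open>F(T\<^sup>1)\<close> with the first tensor power of \<open>F(T)\<close> is the obvious one, because the
  projection is the identity.\<close>

lemma pow_elt_1:
  assumes a: "a \<in> carrier FT"
  shows "pow_elt K Th F 1 [a] = a"
proof -
  interpret C: coc_coalgebra K FT by (rule coc_Tpow)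
  let ?elt = "pow_elt K Th F 1"
  have qs: "map (on_arr F) (Tproj Th 1) = [on_arr F (idt Th (Tpow Th 1))]" by (simp only: proj_one list.map)
  have m: "multilin K FT [FT] (\<lambda>r. ?elt (apply_each (map (on_arr F) (Tproj Th 1)) r))"
    using multilin_apply_each[OF prod_lin_list[OF pow_product[of 1]] multilin_prod_elt[OF pow_product[of 1]]] by simp
  have "a = sw K FT FT 1 (\<lambda>r. ?elt (apply_each (map (on_arr F) (Tproj Th 1)) r)) a"
    using lin_prod_sw[OF pow_product[of 1] C.A_module lin_maps_id a] by simp
  also have "\<dots> = ?elt (apply_each (map (on_arr F) (Tproj Th 1)) [a])"
    by (rule C.sw_1[OF C.A_module m a])
  also have "\<dots> = ?elt [a]"
    unfolding qs using on_arr_idt[OF Tpow_obj a] by simp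
  finally show ?thesis by simp
qed

lemma T_ideal_submodule: "T_ideal K Th F J \<Longrightarrow> submodule J K FT"
  by (simp add: T_ideal_def)

lemma T_ideal_op:
  assumes "T_ideal K Th F J" "t \<in> homset Th (Tpow Th n) (Tpow Th 1)" "as \<in> tuples (replicate n FT)" "set as \<inter> J \<noteq> {}"
  shows "on_arr F t (pow_elt K Th F n as) \<in> J"
  using assms unfolding T_ideal_def tuples_replicate T_op_pow_elt[symmetric] by blast

lemma T_idealI:
  assumes "submodule J K FT"
    and "\<And>n t as i. t \<in> homset Th (Tpow Th n) (Tpow Th 1) \<Longrightarrow> as \<in> tuples (replicate n FT) \<Longrightarrow> i < n \<Longrightarrow>
      as ! i \<in> J \<Longrightarrow> on_arr F t (pow_elt K Th F n as) \<in> J"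
  shows "T_ideal K Th F J"
  unfolding T_ideal_def T_op_pow_elt
proof (intro conjI allI ballI impI assms(1))
  fix n t as
  assume t: "t \<in> homset Th (Tpow Th n) (Tpow Th 1)"
    and as: "length as = n \<and> set as \<subseteq> carrier FT \<and> set as \<inter> J \<noteq> {}"
  then obtain i where "i < n" "as ! i \<in> J" by (auto simp: in_set_conv_nth)
  then show "on_arr F t (pow_elt K Th F n as) \<in> J"
    using as by (intro assms(2)[OF t]) (auto simp: listset_replicate)
qed

lemma T_ideal_unary:
  assumes J: "T_ideal K Th F J" and u: "u \<in> homset Th (Tpow Th 1) (Tpow Th 1)" and a: "a \<in> J"
  shows "on_arr F u a \<in> J"
proof -
  have ac: "a \<in> carrier FT" by (rule submodule_subset[OF T_ideal_submodule[OF J] a])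
  have "[a] \<in> tuples (replicate 1 FT)"
    unfolding tuples_replicate using ac by simp
  then have "on_arr F u (pow_elt K Th F 1 [a]) \<in> J"
    by (rule T_ideal_op[OF J u]) (use a in simp)
  then show ?thesis unfolding pow_elt_1[OF ac] .
qed

lemma pow_elt_closed: "as \<in> tuples (replicate n FT) \<Longrightarrow> pow_elt K Th F n as \<in> carrier (on_obj F (Tpow Th n))"
  by (rule prod_elt_closed[OF pow_product]) simp

lemma T_ideal_carrier: "T_ideal K Th F (carrier FT)"
  by (rule T_idealI[OF module.carrier_is_submodule[OF coc_module[OF coc_Tpow]]])
    (rule on_arr_closed[OF _ pow_elt_closed])

lemma T_ideal_hull_ideal:
  assumes I: "I \<subseteq> carrier FT"
  shows "T_ideal K Th F (T_ideal_hull K Th F I)"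
proof (rule T_idealI)
  let ?\<J> = "{J. T_ideal K Th F J \<and> I \<subseteq> J}"
  have "carrier FT \<in> ?\<J>" using T_ideal_carrier I by simp
  then have "?\<J> \<noteq> {}" by blast
  then show "submodule (T_ideal_hull K Th F I) K FT"
    unfolding T_ideal_hull_def
    by (rule submodule_Inter[OF coc_module[OF coc_Tpow]]) (elim CollectE conjE, rule T_ideal_submodule)
  fix n t as i
  assume t: "t \<in> homset Th (Tpow Th n) (Tpow Th 1)" and as: "as \<in> tuples (replicate n FT)" "i < n"
    and ai: "as ! i \<in> T_ideal_hull K Th F I"
  have "on_arr F t (pow_elt K Th F n as) \<in> J" if J: "T_ideal K Th F J" "I \<subseteq> J" for J
  proof (rule T_ideal_op[OF J(1) t as(1)])
    have "as ! i \<in> J" using ai J unfolding T_ideal_hull_def by blast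
    moreover have "as ! i \<in> set as" using as by (simp add: listset_replicate)
    ultimately show "set as \<inter> J \<noteq> {}" by blast
  qed
  then show "on_arr F t (pow_elt K Th F n as) \<in> T_ideal_hull K Th F I"
    unfolding T_ideal_hull_def by blast
qed

lemma T_ideal_hull_least: "T_ideal K Th F J \<Longrightarrow> I \<subseteq> J \<Longrightarrow> T_ideal_hull K Th F I \<subseteq> J"
  unfolding T_ideal_hull_def by blast

lemma T_ideal_hull_incl: "I \<subseteq> T_ideal_hull K Th F I"
  unfolding T_ideal_hull_def by blast

text \<open>By \<open>cosum_prod_elt\<close>, the comultiplication of \<open>t(a\<^sub>1, \<dots>, a\<^sub>n)\<close> is
  \<open>\<Sum> t(a\<^sub>1\<^sub>1, \<dots>, a\<^sub>n\<^sub>1) \<otimes> t(a\<^sub>1\<^sub>2, \<dots>, a\<^sub>n\<^sub>2)\<close>. If \<open>a\<^sub>i\<close> satisfies the coideal condition, then in each summand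
  one of the two \<open>i\<close>-th arguments is in \<open>J\<close>, and so is the corresponding value of \<open>t\<close>.\<close>

lemma T_ideal_coid_elts:
  assumes J: "T_ideal K Th F J"
  shows "T_ideal K Th F {x \<in> J. coid_elt K FT J x}"
proof (rule T_idealI)
  note JT = T_ideal_submodule[OF J] and C = coc_Tpow[of 1]
  have "submodule (\<Inter>{J, {x. coid_elt K FT J x}}) K FT"
    using JT submodule_coid_elts[OF C JT] by (intro submodule_Inter[OF coc_module[OF C]]) auto
  moreover have "\<Inter>{J, {x. coid_elt K FT J x}} = {x \<in> J. coid_elt K FT J x}" by auto
  ultimately show "submodule {x \<in> J. coid_elt K FT J x} K FT" by simp
  fix n t as i
  assume t: "t \<in> homset Th (Tpow Th n) (Tpow Th 1)" and as: "as \<in> tuples (replicate n FT)" and i: "i < n"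
    and "as ! i \<in> {x \<in> J. coid_elt K FT J x}"
  then have ai: "as ! i \<in> J" "coid_elt K FT J (as ! i)" by auto
  let ?x = "pow_elt K Th F n as" and ?P = "on_obj F (Tpow Th n)"
  note pn = pow_product[of n]
  have as': "as \<in> tuples (map (on_obj F) (replicate n (Tpow Th 1)))" using as by simp
  have i': "i < length (replicate n (Tpow Th 1))" using i by simp
  have D': "submodule J K (on_obj F (replicate n (Tpow Th 1) ! i))"
    and a': "coid_elt K (on_obj F (replicate n (Tpow Th 1) ! i)) J (as ! i)"
    using JT ai(2) i by simp_all
  note coid = prod_elt_coid[OF pn as' i' D' a']
  have op: "on_arr F t (pow_elt K Th F n r) \<in> J" if "r \<in> tuples (replicate n FT)" "r ! i \<in> J" for r
  proof (rule T_ideal_op[OF J t that(1)])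
    have "r ! i \<in> set r" using that(1) i by (simp add: listset_replicate)
    then show "set r \<inter> J \<noteq> {}" using that(2) by blast
  qed
  have xc: "?x \<in> carrier ?P" by (rule pow_elt_closed[OF as])
  have "coid_elt K FT J (on_arr F t ?x)"
  proof (rule coid_eltI[OF C JT])
    show "on_arr F t ?x \<in> carrier FT" by (rule on_arr_closed[OF t xc])
    show "counit FT (on_arr F t ?x) = \<zero>\<^bsub>K\<^esub>"
      using coalg_homs_counit[OF on_arr_hom[OF t] xc] coid(1) by simp
    fix W :: "('k, ('a set list \<Rightarrow> 'k) set) module" and G
    assume W: "module K W" and G: "bilin K FT W G"
      and van: "\<And>a b. a \<in> J \<Longrightarrow> b \<in> carrier FT \<Longrightarrow> G a b = \<zero>\<^bsub>W\<^esub>" "\<And>a b. a \<in> carrier FT \<Longrightarrow> b \<in> J \<Longrightarrow> G a b = \<zero>\<^bsub>W\<^esub>"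
    have "cosum K ?P W (\<lambda>a b. G (on_arr F t a) (on_arr F t b)) ?x = \<zero>\<^bsub>W\<^esub>"
    proof (rule coid(2)[OF W bilin_comp[OF G on_arr_lin[OF t]]])
      fix r y assume r: "r \<in> tuples (map (on_obj F) (replicate n (Tpow Th 1)))" "r ! i \<in> J" and y: "y \<in> carrier ?P"
      have "on_arr F t (pow_elt K Th F n r) \<in> J" using op[of r] r by simp
      then show "G (on_arr F t (pow_elt K Th F n r)) (on_arr F t y) = \<zero>\<^bsub>W\<^esub> \<and>
          G (on_arr F t y) (on_arr F t (pow_elt K Th F n r)) = \<zero>\<^bsub>W\<^esub>"
        using van on_arr_closed[OF t y] by blast
    qed
    then show "cosum K FT W G (on_arr F t ?x) = \<zero>\<^bsub>W\<^esub>"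
      using cosum_hom[OF coc_Tpow C W on_arr_hom[OF t] G xc] by simp
  qed
  then show "on_arr F t ?x \<in> {x \<in> J. coid_elt K FT J x}"
    using op[OF as ai(1)] by simp
qed

text \<open>The elements of the hull that satisfy the coideal condition form a \<open>\<T>\<close>-ideal that contains \<open>I\<close>, hence
  are the whole hull, which is the smallest one.\<close>

lemma T_ideal_hull_coideal:
  assumes I: "I \<subseteq> carrier FT" and coid: "\<And>x. x \<in> I \<Longrightarrow> coid_elt K FT (T_ideal_hull K Th F I) x"
  shows "coideal K FT (T_ideal_hull K Th F I)"
proof -
  let ?J = "T_ideal_hull K Th F I"
  note J = T_ideal_hull_ideal[OF I]
  have "?J \<subseteq> {x \<in> ?J. coid_elt K FT ?J x}"
    using T_ideal_hull_incl coid by (intro T_ideal_hull_least[OF T_ideal_coid_elts[OF J]]) blast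
  then show ?thesis
    using T_ideal_submodule[OF J] by (auto simp: coideal_def)
qed

text \<open>An iterated comultiplication of \<open>a \<in> E\<close> has a factor in \<open>E\<close> in every summand, and the projections send
  this factor into \<open>J\<close>.\<close>

lemma ideal_kernel:
  assumes J: "submodule J K FT" and X: "X = Tpow Th n" and E: "coideal K (on_obj F X) E"
    and u: "\<And>u. u \<in> homset Th X (Tpow Th 1) \<Longrightarrow> on_arr F u ` E \<subseteq> J" and a: "a \<in> E"
  shows "tensor_map K (replicate n (quot_module FT J)) (replicate n (\<lambda>x. J +>\<^bsub>FT\<^esub> x))
    (pairing K (on_obj F X) (replicate n FT) (map (on_arr F) (Tproj Th n)) a)
    = \<zero>\<^bsub>tensor K (replicate n (quot_module FT J))\<^esub>"
proof -
  note pn = pow_product[of n]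
  let ?V = "quot_module FT J" and ?\<pi> = "\<lambda>x. J +>\<^bsub>FT\<^esub> x"
  let ?qs = "map (on_arr F) (Tproj Th n)"
  have C: "coc_coalgebra K FT" and CX: "coc_coalgebra K (on_obj F X)" using coc_Tpow X by auto
  have V: "module K ?V" by (rule quot_module_module[OF coc_module[OF C] J])
  have Vs: "all_modules K (replicate n ?V)" and Fs: "all_modules K (replicate n FT)"
    using V coc_module[OF C] by auto
  note T = tensor_module[OF K_cring Vs]
  have \<pi>s: "lin_maps_list K (replicate n FT) (replicate n ?V) (replicate n ?\<pi>)"
    by (rule lin_maps_list_replicate[OF coset_lin[OF coc_module[OF C] J]])
  have t: "multilin K (tensor K (replicate n ?V)) (replicate n FT) (\<lambda>p. tens K (replicate n ?V) (apply_each (replicate n ?\<pi>) p))"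
    by (rule multilin_tens_apply_each[OF K_cring Fs Vs \<pi>s])
  have l: "lin_maps_list K (replicate (length (replicate n FT)) (on_obj F X)) (replicate n FT) ?qs"
    using prod_lin_list[OF pn] X by simp
  have Esub: "submodule E K (on_obj F X)" using E by (simp add: coideal_def)
  have ac: "a \<in> carrier (on_obj F X)" by (rule submodule_subset[OF Esub a])
  have len: "length (Tproj Th n) = n"
    using pn by (auto simp: is_product_def dest: list_all2_lengthD)
  have "tensor_map K (replicate n ?V) (replicate n ?\<pi>) (pairing K (on_obj F X) (replicate n FT) ?qs a)
      = sw K (on_obj F X) (tensor K (replicate n ?V)) n
          (\<lambda>r. tens K (replicate n ?V) (apply_each (replicate n ?\<pi>) (apply_each ?qs r))) a"
    unfolding tensor_map_def
    using tensor_lift_pairing[OF CX Fs l T t ac] by simp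
  also have "\<dots> = \<zero>\<^bsub>tensor K (replicate n ?V)\<^esub>"
  proof (rule sw_coideal[OF CX T E _ _ a])
    show "multilin K (tensor K (replicate n ?V)) (replicate n (on_obj F X))
        (\<lambda>r. tens K (replicate n ?V) (apply_each (replicate n ?\<pi>) (apply_each ?qs r)))"
      using multilin_apply_each[OF l t] by simp
    fix r assume r: "r \<in> tuples (replicate n (on_obj F X))" "set r \<inter> E \<noteq> {}"
    then obtain j where j: "j < n" "r ! j \<in> E" "length r = n"
      by (auto simp: listset_replicate in_set_conv_nth)
    have "Tproj Th n ! j \<in> homset Th X (Tpow Th 1)"
      using pn j(1) X by (auto simp: is_product_def dest: list_all2_nthD2)
    then have "on_arr F (Tproj Th n ! j) (r ! j) \<in> J" using u j(2) by blast
    then have z: "?\<pi> (on_arr F (Tproj Th n ! j) (r ! j)) = \<zero>\<^bsub>?V\<^esub>"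
      using coset_zero_iff[OF C J] submodule_subset[OF J] by blast
    have r': "r \<in> tuples (replicate (length (replicate n FT)) (on_obj F X))" using r(1) by simp
    show "tens K (replicate n ?V) (apply_each (replicate n ?\<pi>) (apply_each ?qs r)) = \<zero>\<^bsub>tensor K (replicate n ?V)\<^esub>"
      by (rule multilin_zero_entry[OF Vs T multilin_tens[OF K_cring Vs]
            apply_each_tuples[OF \<pi>s apply_each_tuples[OF l r']], of j])
        (use j len z in simp_all)
  qed
  finally show ?thesis .
qed

text \<open>By multilinearity it suffices to consider entries that are elementary tensors
  \<open>pow_elt n\<^sub>j bs\<^sub>j\<close> over \<open>T\<close>, where by \<open>ideal_kernel\<close> the tuple \<open>bs\<^sub>i\<close> may be assumed to contain an
  element of \<open>J\<close>. Then \<open>product_of_powers\<close> turns the operation into one of \<open>T\<^sup>N\<close>.\<close>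

lemma T_ideal_product:
  assumes J: "T_ideal K Th F J" and prod: "is_product Th Xs P ps" and u: "u \<in> homset Th P (Tpow Th 1)"
    and as: "as \<in> tuples (map (on_obj F) Xs)" and i: "i < length Xs"
    and E: "coideal K (on_obj F (Xs ! i)) E"
    and EJ: "\<And>v. v \<in> homset Th (Xs ! i) (Tpow Th 1) \<Longrightarrow> on_arr F v ` E \<subseteq> J" and ai: "as ! i \<in> E"
  shows "on_arr F u (prod_elt K F Xs P ps as) \<in> J"
proof -
  have "\<forall>X\<in>set Xs. \<exists>n. X = Tpow Th n"
    using prod obj_pow unfolding is_product_def by auto
  then obtain ns where ns: "Xs = map (Tpow Th) ns"
    by (metis ex_map_conv)
  have len: "length ns = length Xs" using ns by simp
  note JT = T_ideal_submodule[OF J] and C = coc_Tpow[of 1]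
  let ?V = "quot_module FT J" and ?\<pi> = "\<lambda>x. J +>\<^bsub>FT\<^esub> x"
  let ?Fs = "map (on_obj F) Xs" and ?pw = "pow_elt K Th F" and ?blk = "map (\<lambda>n. (n, pow_elt K Th F n)) ns"
  have V: "module K ?V" by (rule quot_module_module[OF coc_module[OF C] JT])
  have \<pi>: "?\<pi> \<in> lin_maps K FT ?V" by (rule coset_lin[OF coc_module[OF C] JT])
  define G where "G as = ?\<pi> (on_arr F u (prod_elt K F Xs P ps as))" for as
  have G: "multilin K ?V ?Fs G"
    unfolding G_def
    by (rule multilin_lin_comp[OF multilin_lin_comp[OF multilin_prod_elt[OF prod] on_arr_lin[OF u]] \<pi>])
  \<comment> \<open>The \<open>j\<close>-th entry is tested on \<open>S j\<close>; these elements span all of \<open>F(X\<^sub>j)\<close>, or \<open>E\<close> for \<open>j = i\<close>.\<close>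
  define S where "S j = {?pw (ns ! j) bs | bs. bs \<in> tuples (replicate (ns ! j) FT) \<and> (j = i \<longrightarrow> set bs \<inter> J \<noteq> {})}" for j
  define Ss where "Ss = map S [0..<length Xs]"
  define Ts where "Ts = (map (\<lambda>X. carrier (on_obj F X)) Xs)[i := E]"
  have Esub: "E \<subseteq> carrier (on_obj F (Xs ! i))"
    using E submodule_subset by (auto simp: coideal_def)
  have "G as = \<zero>\<^bsub>?V\<^esub>"
  proof (rule multilin_zero_on_tuples[OF _ _ _ _ G, of Ss Ts])
    show "length Ss = length ?Fs" "length Ts = length ?Fs" by (simp_all add: Ss_def Ts_def)
    show "Ss ! j \<subseteq> carrier (?Fs ! j) \<and> Ts ! j \<subseteq> carrier (?Fs ! j)" if "j < length ?Fs" for j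
      using that Esub i pow_elt_closed ns by (auto simp: Ss_def Ts_def S_def nth_list_update)
    show "as \<in> listset Ts"
      using as i ai unfolding listset_iff Ts_def
      by (auto simp: list_all2_conv_all_nth nth_list_update)
  next
    fix j \<phi> x
    assume j: "j < length ?Fs" and \<phi>: "\<phi> \<in> lin_maps K (?Fs ! j) ?V" and z: "\<And>s. s \<in> Ss ! j \<Longrightarrow> \<phi> s = \<zero>\<^bsub>?V\<^esub>"
      and x: "x \<in> Ts ! j"
    have Xj: "Xs ! j = Tpow Th (ns ! j)" using j ns by simp
    let ?n = "ns ! j"
    note pn = pow_product[of "ns ! j"]
    have \<phi>': "\<phi> \<in> lin_maps K (on_obj F (Tpow Th ?n)) ?V" using \<phi> j Xj by simp
    have xc: "x \<in> carrier (on_obj F (Tpow Th ?n))"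
    proof (cases "j = i")
      case True
      then have "x \<in> E" using x i by (simp add: Ts_def)
      then show ?thesis using Esub True Xj by auto
    next
      case False
      then show ?thesis using x j Xj by (simp add: Ts_def)
    qed
    have z': "\<phi> (?pw ?n bs) = \<zero>\<^bsub>?V\<^esub>" if "bs \<in> tuples (replicate ?n FT)" "j = i \<longrightarrow> set bs \<inter> J \<noteq> {}" for bs
      using that j by (intro z) (auto simp: Ss_def S_def)
    let ?X = "pairing K (on_obj F (Tpow Th ?n)) (replicate ?n FT) (map (on_arr F) (Tproj Th ?n)) x"
    have X: "?X \<in> carrier (tensor K (replicate ?n FT))"
      using lin_maps_closed[OF pairing_prod_lin[OF pn] xc] by simp
    have mods: "all_modules K (replicate ?n FT)" using coc_module[OF C] by simp
    have "\<phi> x = tensor_lift K ?V (\<lambda>bs. \<phi> (?pw ?n bs)) ?X"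
      using lin_prod_lift[OF pn V \<phi>' xc] by simp
    also have "\<dots> = \<zero>\<^bsub>?V\<^esub>"
    proof (cases "j = i")
      case False
      then show ?thesis using z' by (intro tensor_lift_zero[OF K_cring mods V X]) auto
    next
      case True
      have m: "multilin K ?V (replicate ?n FT) (\<lambda>bs. \<phi> (?pw ?n bs))"
        using multilin_lin_comp[OF multilin_prod_elt[OF pn] \<phi>'] by simp
      have Vs: "all_modules K (replicate ?n ?V)" using V by simp
      have s: "surj_list K (replicate ?n FT) (replicate ?n ?V) (replicate ?n ?\<pi>)"
        unfolding surj_list_def
        using lin_maps_list_replicate[OF \<pi>] quot_module_carrier[OF coc_module[OF C] JT] by simp
      have xE: "x \<in> E" using x True i by (simp add: Ts_def)
      have E': "coideal K (on_obj F (Tpow Th ?n)) E" "\<And>v. v \<in> homset Th (Tpow Th ?n) (Tpow Th 1) \<Longrightarrow> on_arr F v ` E \<subseteq> J"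
        using E EJ True Xj by auto
      show ?thesis
      proof (rule tensor_lift_kernel[OF K_cring mods Vs V s m _ X ideal_kernel[OF JT refl E' xE]])
        fix p k assume p: "p \<in> tuples (replicate ?n FT)" "k < length (replicate ?n FT)"
          and "(replicate ?n ?\<pi> ! k) (p ! k) = \<zero>\<^bsub>replicate ?n ?V ! k\<^esub>"
        then have "?\<pi> (p ! k) = \<zero>\<^bsub>?V\<^esub>" by simp
        moreover have "p ! k \<in> set p" "set p \<subseteq> carrier FT" using p by (auto simp: listset_replicate)
        ultimately have "p ! k \<in> J" using coset_zero_iff[OF C JT] by blast
        then show "\<phi> (?pw ?n p) = \<zero>\<^bsub>?V\<^esub>" using z'[OF p(1)] \<open>p ! k \<in> set p\<close> by blast
      qed
    qed
    finally show "\<phi> x = \<zero>\<^bsub>?V\<^esub>" .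
  next
    fix p assume p: "p \<in> listset Ss"
    then have pS: "p ! j \<in> S j" if "j < length Xs" for j
      using that by (auto simp: listset_iff Ss_def list_all2_conv_all_nth)
    have lp: "length p = length Xs" using p by (auto simp: listset_iff Ss_def dest: list_all2_lengthD)
    have "\<forall>j<length Xs. \<exists>bs. bs \<in> tuples (replicate (ns ! j) FT) \<and> (j = i \<longrightarrow> set bs \<inter> J \<noteq> {}) \<and> p ! j = ?pw (ns ! j) bs"
      using pS unfolding S_def by blast
    then obtain b where b: "\<And>j. j < length Xs \<Longrightarrow> b j \<in> tuples (replicate (ns ! j) FT)"
        "set (b i) \<inter> J \<noteq> {}" "\<And>j. j < length Xs \<Longrightarrow> p ! j = ?pw (ns ! j) (b j)"
      using i by metis
    define bss where "bss = map b [0..<length Xs]"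
    have bss: "list_all2 (\<lambda>bs n. length bs = n) bss ns"
      using b(1) len by (auto simp: bss_def list_all2_conv_all_nth listset_replicate)
    have p_eq: "apply_blocks ?blk (concat bss) = p"
      unfolding apply_blocks_concat[OF bss]
      by (rule nth_equalityI) (use b(3) len lp in \<open>auto simp: bss_def\<close>)
    have "length (concat bss) = sum_list ns"
      using bss by (induction rule: list_all2_induct) auto
    moreover have "set (b j) \<subseteq> carrier FT" if "j < length Xs" for j
      using b(1)[OF that] unfolding tuples_replicate by blast
    then have "set (concat bss) \<subseteq> carrier FT"
      unfolding bss_def by fastforce
    ultimately have cs: "concat bss \<in> tuples (replicate (sum_list ns) FT)"
      by (simp add: listset_replicate)
    have csJ: "set (concat bss) \<inter> J \<noteq> {}"
    proof -
      have "set (b i) \<subseteq> set (concat bss)" using i by (force simp: bss_def)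
      then show ?thesis using b(2) by blast
    qed
    obtain \<sigma> where \<sigma>: "\<sigma> \<in> homset Th (Tpow Th (sum_list ns)) P"
      and grp: "\<And>cs. cs \<in> tuples (replicate (sum_list ns) FT) \<Longrightarrow> on_arr F \<sigma> (?pw (sum_list ns) cs)
        = prod_elt K F (map (Tpow Th) ns) P ps (apply_blocks ?blk cs)"
      by (rule product_of_powers[OF prod[unfolded ns]]) (rule that)
    have "on_arr F u (prod_elt K F Xs P ps p) = on_arr F (cmp Th u \<sigma>) (?pw (sum_list ns) (concat bss))"
      using on_arr_cmp[OF \<sigma> u pow_elt_closed[OF cs]] grp[OF cs] p_eq ns by simp
    also have "\<dots> \<in> J"
      by (rule T_ideal_op[OF J cmp_hom[OF \<sigma> u] cs csJ])
    finally show "G p = \<zero>\<^bsub>?V\<^esub>"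
      unfolding G_def using coset_zero_iff[OF C JT] submodule_subset[OF JT] by blast
  qed
  then show ?thesis
    unfolding G_def
    using coset_zero_iff[OF C JT] on_arr_closed[OF u prod_elt_closed[OF prod as]] by blast
qed

end


subsection \<open>The ideal at an arbitrary object\<close>

text \<open>The quotient functor has to be defined at every object, and an object can be \<open>T\<^sup>n\<close> for several
  \<open>n\<close>. The following description of the kernel at \<open>X\<close> does not depend on such a choice: the largest
  coideal that all arrows \<open>X \<rightarrow> T\<close> send into \<open>J\<close>.\<close>

definition ideal_at ::
  "('k, 'r) ring_scheme \<Rightarrow> ('o, 'm, 's) lawvere_scheme \<Rightarrow> ('o, 'm, 'k, 'a) coalg_functor \<Rightarrow> 'a set \<Rightarrow> 'o \<Rightarrow> 'a set"
  where "ideal_at K Th F J X = mod_span K (on_obj F X)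
    (\<Union>{E. coideal K (on_obj F X) E \<and> (\<forall>u\<in>homset Th X (Tpow Th 1). on_arr F u ` E \<subseteq> J)})"

definition quot_functor ::
  "('k, 'r) ring_scheme \<Rightarrow> ('o, 'm, 's) lawvere_scheme \<Rightarrow> ('o, 'm, 'k, 'a) coalg_functor \<Rightarrow> 'a set \<Rightarrow>
    ('o, 'm, 'k, 'a set) coalg_functor"
  where "quot_functor K Th F J =
    \<lparr>on_obj = (\<lambda>X. quot_coalgebra K (on_obj F X) (ideal_at K Th F J X)),
     on_arr = (\<lambda>u Y. the_elem ((\<lambda>x. ideal_at K Th F J (tgt Th u) +>\<^bsub>on_obj F (tgt Th u)\<^esub> on_arr F u x) ` Y))\<rparr>"

context T_coalgebra
begin

context
  fixes J :: "'a set"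
  assumes J: "T_ideal K Th F J" and J_coideal: "coideal K (on_obj F (Tpow Th 1)) J"
begin

abbreviation (input) "D \<equiv> ideal_at K Th F J"

lemma ideal_at_coideal: "X \<in> obj Th \<Longrightarrow> coideal K (on_obj F X) (D X)"
  unfolding ideal_at_def by (rule coideal_span[OF on_obj_coalgebra]) auto

lemma ideal_at_submodule: "X \<in> obj Th \<Longrightarrow> submodule (D X) K (on_obj F X)"
  using ideal_at_coideal by (simp add: coideal_def)

lemma ideal_at_coid: "X \<in> obj Th \<Longrightarrow> x \<in> D X \<Longrightarrow> coid_elt K (on_obj F X) (D X) x"
  using ideal_at_coideal by (simp add: coideal_def)

lemma ideal_at_greatest:
  assumes "coideal K (on_obj F X) E" "\<And>u. u \<in> homset Th X (Tpow Th 1) \<Longrightarrow> on_arr F u ` E \<subseteq> J" "x \<in> E"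
  shows "x \<in> D X"
  unfolding ideal_at_def using assms by (intro mod_span_incl UnionI[of E]) auto

lemma ideal_at_image:
  assumes u: "u \<in> homset Th X (Tpow Th 1)"
  shows "on_arr F u ` D X \<subseteq> J"
proof -
  have "submodule {x \<in> carrier (on_obj F X). on_arr F u x \<in> J} K (on_obj F X)"
    by (rule submodule_preimage[OF coc_module[OF coc_src[OF u]] coc_module[OF coc_Tpow] on_arr_lin[OF u]
          T_ideal_submodule[OF J]])
  then have "D X \<subseteq> {x \<in> carrier (on_obj F X). on_arr F u x \<in> J}"
    unfolding ideal_at_def
  proof (rule mod_span_least, intro Union_least subsetI CollectI conjI)
    fix E x
    assume E: "E \<in> {E. coideal K (on_obj F X) E \<and> (\<forall>u\<in>homset Th X (Tpow Th 1). on_arr F u ` E \<subseteq> J)}" and x: "x \<in> E"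
    then have "submodule E K (on_obj F X)" by (simp add: coideal_def)
    then show "x \<in> carrier (on_obj F X)" by (rule submodule_subset[OF _ x])
    show "on_arr F u x \<in> J" using E x u by blast
  qed
  then show ?thesis by blast
qed

text \<open>The image of a coideal is a coideal, so maximality makes the family \<open>D\<close> functorial.\<close>

lemma ideal_at_arr:
  assumes v: "v \<in> homset Th X Y" and x: "x \<in> D X"
  shows "on_arr F v x \<in> D Y"
proof (rule ideal_at_greatest)
  have X: "X \<in> obj Th" by (rule homset_src_tgt(1)[OF category_axioms v])
  show "coideal K (on_obj F Y) (on_arr F v ` D X)"
    by (rule coideal_image[OF coc_src[OF v] coc_tgt[OF v] on_arr_hom[OF v] ideal_at_coideal[OF X]])
  show "on_arr F u ` on_arr F v ` D X \<subseteq> J" if u: "u \<in> homset Th Y (Tpow Th 1)" for u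
  proof -
    have "on_arr F u (on_arr F v y) \<in> J" if y: "y \<in> D X" for y
      using on_arr_cmp[OF v u submodule_subset[OF ideal_at_submodule[OF X] y]]
        ideal_at_image[OF cmp_hom[OF v u]] y by auto
    then show ?thesis by blast
  qed
  show "on_arr F v x \<in> on_arr F v ` D X" using x by blast
qed

text \<open>Being closed under unary operations, \<open>J\<close> competes in the definition of \<open>D(T)\<close>; the identity of \<open>T\<close> shows
  that nothing larger does.\<close>

lemma ideal_at_T: "D (Tpow Th 1) = J"
proof
  show "J \<subseteq> D (Tpow Th 1)"
    using ideal_at_greatest[OF J_coideal] T_ideal_unary[OF J] by blast
  show "D (Tpow Th 1) \<subseteq> J"
  proof
    fix x assume x: "x \<in> D (Tpow Th 1)"
    have xc: "x \<in> carrier (on_obj F (Tpow Th 1))"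
      by (rule submodule_subset[OF ideal_at_submodule[OF Tpow_obj] x])
    show "x \<in> J"
      using ideal_at_image[OF idt_hom[OF Tpow_obj]] x on_arr_idt[OF Tpow_obj xc] by force
  qed
qed

abbreviation (input) "Q X \<equiv> quot_coalgebra K (on_obj F X) (D X)"
abbreviation (input) "\<pi> X \<equiv> (\<lambda>x. D X +>\<^bsub>on_obj F X\<^esub> x)"

lemma quot_at_coc: "X \<in> obj Th \<Longrightarrow> coc_coalgebra K (Q X)"
  by (rule quot_coalgebra_coc[OF K_field on_obj_coalgebra ideal_at_submodule ideal_at_coid])

lemma quot_at_proj_hom: "X \<in> obj Th \<Longrightarrow> \<pi> X \<in> coalg_homs K (on_obj F X) (Q X)"
  by (rule quot_coalgebra_proj_hom[OF K_field on_obj_coalgebra ideal_at_submodule ideal_at_coid])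

lemma quot_at_proj_surj: "X \<in> obj Th \<Longrightarrow> \<pi> X ` carrier (on_obj F X) = carrier (Q X)"
  by (rule quot_coalgebra_proj_surj[OF K_field on_obj_coalgebra ideal_at_submodule])

lemma quot_at_proj_zero_iff:
  "X \<in> obj Th \<Longrightarrow> x \<in> carrier (on_obj F X) \<Longrightarrow> \<pi> X x = \<zero>\<^bsub>Q X\<^esub> \<longleftrightarrow> x \<in> D X"
  by (rule quot_coalgebra_proj_zero_iff[OF K_field on_obj_coalgebra ideal_at_submodule])

lemma quot_at_proj_surj_list:
  assumes Xs: "set Xs \<subseteq> obj Th"
  shows "surj_list K (map (on_obj F) Xs) (map Q Xs) (map \<pi> Xs)"
  unfolding surj_list_def
proof (intro conjI allI impI lin_maps_listI[where n = "length Xs"])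
  have Xi: "Xs ! i \<in> obj Th" if "i < length Xs" for i using Xs that by auto
  show "map \<pi> Xs ! i \<in> lin_maps K (map (on_obj F) Xs ! i) (map Q Xs ! i)" if "i < length Xs" for i
    using coalg_homs_lin[OF quot_at_proj_hom[OF Xi[OF that]]] that by simp
  show "(map \<pi> Xs ! i) ` carrier (map (on_obj F) Xs ! i) = carrier (map Q Xs ! i)"
    if "i < length (map (on_obj F) Xs)" for i
    using quot_at_proj_surj[OF Xi] that by simp
qed simp_all

text \<open>The kernel \<open>N\<close> of \<open>F(P) \<cong> F(X\<^sub>1) \<otimes> \<dots> \<otimes> F(X\<^sub>n) \<rightarrow> Q(X\<^sub>1) \<otimes> \<dots> \<otimes> Q(X\<^sub>n)\<close> is a coideal that all arrows
  \<open>P \<rightarrow> T\<close> send into \<open>J\<close>, hence contained in the largest one. Both properties say that a linear map \<open>L\<close> on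
  \<open>F(P)\<close> vanishes on \<open>N\<close>, which by right exactness may be tested on elementary tensors with an entry in
  some \<open>D(X\<^sub>i)\<close>.\<close>

lemma ideal_at_product:
  assumes prod: "is_product Th Xs P ps" and x: "x \<in> carrier (on_obj F P)"
    and zero: "tensor_map K (map Q Xs) (map \<pi> Xs)
      (pairing K (on_obj F P) (map (on_obj F) Xs) (map (on_arr F) ps) x) = \<zero>\<^bsub>tensor K (map Q Xs)\<^esub>"
  shows "x \<in> D P"
proof -
  let ?FP = "on_obj F P" and ?Fs = "map (on_obj F) Xs" and ?Qs = "map Q Xs" and ?\<pi>s = "map \<pi> Xs"
  let ?elt = "prod_elt K F Xs P ps"
  let ?pr = "pairing K ?FP ?Fs (map (on_arr F) ps)"
  have Xs: "set Xs \<subseteq> obj Th" and P: "P \<in> obj Th" using prod by (auto simp: is_product_def)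
  have Xi: "Xs ! i \<in> obj Th" if "i < length Xs" for i using Xs that by auto
  note coc = prod_coc[OF prod] and Fs = prod_modules[OF prod]
  have Qs: "all_modules K ?Qs" using Xs quot_at_coc coc_module by fastforce
  have s: "surj_list K ?Fs ?Qs ?\<pi>s" by (rule quot_at_proj_surj_list[OF Xs])
  then have \<pi>s: "lin_maps_list K ?Fs ?Qs ?\<pi>s" by (simp add: surj_list_def)
  note T = tensor_module[OF K_cring Qs]
  note prl = pairing_prod_lin[OF prod]
  note tm = tensor_map_lin[OF K_cring Fs Qs \<pi>s]
  define N where "N = {x \<in> carrier ?FP. tensor_map K ?Qs ?\<pi>s (?pr x) = \<zero>\<^bsub>tensor K ?Qs\<^esub>}"
  have N: "submodule N K ?FP"
    unfolding N_def by (rule submodule_kernel[OF coc_module[OF coc] T lin_maps_comp[OF prl tm]])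
  have entry: "p ! i \<in> D (Xs ! i)" if "p \<in> tuples ?Fs" "i < length ?Fs" "(?\<pi>s ! i) (p ! i) = \<zero>\<^bsub>?Qs ! i\<^esub>" for p i
    using that tuples_nth[OF that(1,2)] quot_at_proj_zero_iff[OF Xi] by simp
  \<comment> \<open>The test for vanishing on \<open>N\<close>.\<close>
  have kernel: "L y = \<zero>\<^bsub>W\<^esub>"
    if W: "module K W" and L: "L \<in> lin_maps K ?FP W" and y: "y \<in> N"
      and van: "\<And>p i. p \<in> tuples ?Fs \<Longrightarrow> i < length Xs \<Longrightarrow> p ! i \<in> D (Xs ! i) \<Longrightarrow> L (?elt p) = \<zero>\<^bsub>W\<^esub>"
    for W :: "('k, 'w, 'z) module_scheme" and L y
  proof -
    have yc: "y \<in> carrier ?FP" "tensor_map K ?Qs ?\<pi>s (?pr y) = \<zero>\<^bsub>tensor K ?Qs\<^esub>" using y by (auto simp: N_def)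
    show ?thesis
      unfolding lin_prod_lift[OF prod W L yc(1)]
      by (rule tensor_lift_kernel[OF K_cring Fs Qs W s multilin_lin_comp[OF multilin_prod_elt[OF prod] L] _
            lin_maps_closed[OF prl yc(1)] yc(2)])
        (use van entry in simp)
  qed
  have eltN: "?elt r \<in> N" if r: "r \<in> tuples ?Fs" and i: "i < length Xs" "r ! i \<in> D (Xs ! i)" for r i
  proof -
    have ri: "r ! i \<in> carrier (on_obj F (Xs ! i))" using tuples_nth[OF r, of i] i by simp
    have "tens K ?Qs (apply_each ?\<pi>s r) = \<zero>\<^bsub>tensor K ?Qs\<^esub>"
      by (rule multilin_zero_entry[OF Qs T multilin_tens[OF K_cring Qs] apply_each_tuples[OF \<pi>s r], of i])
        (use i ri tuples_length[OF r] quot_at_proj_zero_iff[OF Xi[OF i(1)] ri] in simp_all)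
    then show ?thesis
      unfolding N_def
      using prod_elt_closed[OF prod r] pairing_prod_elt[OF prod r] tensor_map_tens[OF K_cring Fs Qs \<pi>s r] by simp
  qed
  have coid: "coid_elt K ?FP N y" if y: "y \<in> N" for y
  proof (rule coid_eltI[OF coc N])
    show "y \<in> carrier ?FP" using y by (simp add: N_def)
    have "counit ?FP y = \<zero>\<^bsub>ground_module K\<^esub>"
    proof (rule kernel[OF ground_module_module[OF K_cring] coc_coalgebra.counit_linear[OF coc] y])
      fix p i assume p: "p \<in> tuples ?Fs" "i < length Xs" "p ! i \<in> D (Xs ! i)"
      show "counit ?FP (?elt p) = \<zero>\<^bsub>ground_module K\<^esub>"
        using prod_elt_coid(1)[OF prod p(1,2) ideal_at_submodule[OF Xi[OF p(2)]] ideal_at_coid[OF Xi[OF p(2)] p(3)]]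
        by (simp add: ground_module_simps)
    qed
    then show "counit ?FP y = \<zero>\<^bsub>K\<^esub>" by (simp add: ground_module_simps)
    fix W :: "('k, ('a set list \<Rightarrow> 'k) set) module" and G
    assume W: "module K W" and G: "bilin K ?FP W G"
      and van: "\<And>a b. a \<in> N \<Longrightarrow> b \<in> carrier ?FP \<Longrightarrow> G a b = \<zero>\<^bsub>W\<^esub>" "\<And>a b. a \<in> carrier ?FP \<Longrightarrow> b \<in> N \<Longrightarrow> G a b = \<zero>\<^bsub>W\<^esub>"
    show "cosum K ?FP W G y = \<zero>\<^bsub>W\<^esub>"
    proof (rule kernel[OF W coc_coalgebra.cosum_lin[OF coc W G] y])
      fix p i assume p: "p \<in> tuples ?Fs" "i < length Xs" "p ! i \<in> D (Xs ! i)"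
      show "cosum K ?FP W G (?elt p) = \<zero>\<^bsub>W\<^esub>"
        by (rule prod_elt_coid(2)[OF prod p(1,2) ideal_at_submodule[OF Xi[OF p(2)]] ideal_at_coid[OF Xi[OF p(2)] p(3)] W G])
          (use van eltN p(2) in blast)
    qed
  qed
  have image: "on_arr F u ` N \<subseteq> J" if u: "u \<in> homset Th P (Tpow Th 1)" for u
  proof
    fix z assume "z \<in> on_arr F u ` N"
    then obtain y where y: "y \<in> N" "z = on_arr F u y" by blast
    let ?FT = "on_obj F (Tpow Th 1)"
    note C = coc_Tpow[of 1] and JT = T_ideal_submodule[OF J]
    have V: "module K (quot_module ?FT J)" by (rule quot_module_module[OF coc_module[OF C] JT])
    have "J +>\<^bsub>?FT\<^esub> on_arr F u y = \<zero>\<^bsub>quot_module ?FT J\<^esub>"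
    proof (rule kernel[OF V lin_maps_comp[OF on_arr_lin[OF u] coset_lin[OF coc_module[OF C] JT]] y(1)])
      fix p i assume p: "p \<in> tuples ?Fs" "i < length Xs" "p ! i \<in> D (Xs ! i)"
      have "on_arr F u (?elt p) \<in> J"
        by (rule T_ideal_product[OF J prod u p(1,2) ideal_at_coideal[OF Xi[OF p(2)]] ideal_at_image p(3)])
      then show "J +>\<^bsub>?FT\<^esub> on_arr F u (?elt p) = \<zero>\<^bsub>quot_module ?FT J\<^esub>"
        using coset_zero_iff[OF C JT] submodule_subset[OF JT] by blast
    qed
    moreover have "on_arr F u y \<in> carrier ?FT" using on_arr_closed[OF u] y by (simp add: N_def)
    ultimately show "z \<in> J" using coset_zero_iff[OF C JT] y(2) by blast
  qed
  show ?thesis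
  proof (rule ideal_at_greatest)
    show "coideal K ?FP N" using N coid by (simp add: coideal_def)
    show "on_arr F u ` N \<subseteq> J" if "u \<in> homset Th P (Tpow Th 1)" for u by (rule image[OF that])
    show "x \<in> N" using x zero by (simp add: N_def)
  qed
qed


subsection \<open>The quotient functor\<close>

lemma quot_functor_obj: "on_obj (quot_functor K Th F J) X = Q X"
  by (simp add: quot_functor_def)

lemma quot_functor_arr:
  assumes u: "u \<in> homset Th X Y" and x: "x \<in> carrier (on_obj F X)"
  shows "on_arr (quot_functor K Th F J) u (\<pi> X x) = \<pi> Y (on_arr F u x)"
proof -
  have X: "X \<in> obj Th" and Y: "Y \<in> obj Th" using homset_src_tgt[OF category_axioms u] by auto
  have tgt: "tgt Th u = Y" using u by (simp add: homset_def)
  have z: "\<pi> Y (on_arr F u y) = \<zero>\<^bsub>Q Y\<^esub>" if y: "y \<in> D X" for y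
    using quot_at_proj_zero_iff[OF Y on_arr_closed[OF u submodule_subset[OF ideal_at_submodule[OF X] y]]]
      ideal_at_arr[OF u y] by simp
  have "(\<lambda>x. \<pi> Y (on_arr F u x)) ` \<pi> X x = {\<pi> Y (on_arr F u x)}"
    by (rule lin_maps_coset_image[OF coc_module[OF coc_src[OF u]] coc_module[OF quot_at_coc[OF Y]]
          ideal_at_submodule[OF X] lin_maps_comp[OF on_arr_lin[OF u] coalg_homs_lin[OF quot_at_proj_hom[OF Y]]] z x])
  then show ?thesis by (simp add: quot_functor_def tgt)
qed

text \<open>Everything but the preservation of products descends along the surjections \<open>\<pi>\<close>. The pairing of \<open>Q\<close> is
  induced by that of \<open>F\<close>; it is onto because \<open>\<pi> \<otimes> \<dots> \<otimes> \<pi>\<close> is, and injective by \<open>ideal_at_product\<close>.\<close>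

lemma quot_functor_coalgebra: "T_coalgebra K Th (quot_functor K Th F J)"
proof (intro T_coalgebra.intro T_coalgebra_axioms.intro)
  let ?G = "quot_functor K Th F J"
  show "lawvere_theory Th" by (rule lawvere_theory_axioms)
  show "field K" by (rule K_field)
  have rep: "\<exists>x\<in>carrier (on_obj F X). y = \<pi> X x" if "X \<in> obj Th" "y \<in> carrier (on_obj ?G X)" for X y
    using quot_at_proj_surj[OF that(1)] that(2) unfolding quot_functor_obj by (metis imageE)
  show coc: "coc_coalgebra K (on_obj ?G X)" if "X \<in> obj Th" for X
    unfolding quot_functor_obj by (rule quot_at_coc[OF that])
  show hom: "on_arr ?G u \<in> coalg_homs K (on_obj ?G X) (on_obj ?G Y)" if u: "u \<in> homset Th X Y" for u X Y
  proof -
    have X: "X \<in> obj Th" and Y: "Y \<in> obj Th" using homset_src_tgt[OF category_axioms u] by auto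
    show ?thesis
      unfolding quot_functor_obj
      by (rule coalg_hom_factor[OF on_obj_coalgebra[OF X] quot_at_coc[OF X] quot_at_coc[OF Y] quot_at_proj_hom[OF X]
            quot_at_proj_surj[OF X] coalg_homs_comp[OF on_obj_coalgebra[OF X] on_obj_coalgebra[OF Y] quot_at_coc[OF Y]
              on_arr_hom[OF u] quot_at_proj_hom[OF Y]] quot_functor_arr[OF u]])
  qed
  show "on_arr ?G (idt Th X) y = y" if X: "X \<in> obj Th" and y: "y \<in> carrier (on_obj ?G X)" for X y
  proof -
    obtain x where "x \<in> carrier (on_obj F X)" "y = \<pi> X x" using rep[OF X y] by blast
    then show ?thesis using quot_functor_arr[OF idt_hom[OF X]] on_arr_idt[OF X] by simp
  qed
  show "on_arr ?G (cmp Th v u) y = on_arr ?G v (on_arr ?G u y)"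
    if u: "u \<in> homset Th X Y" and v: "v \<in> homset Th Y Z" and y: "y \<in> carrier (on_obj ?G X)" for u v X Y Z y
  proof -
    obtain x where x: "x \<in> carrier (on_obj F X)" "y = \<pi> X x"
      using rep[OF homset_src_tgt(1)[OF category_axioms u] y] by blast
    then show ?thesis
      using quot_functor_arr[OF cmp_hom[OF u v] x(1)] quot_functor_arr[OF u x(1)]
        quot_functor_arr[OF v on_arr_closed[OF u x(1)]] on_arr_cmp[OF u v x(1)] by simp
  qed
  fix Xs P ps assume prod: "is_product Th Xs P ps"
  let ?Fs = "map (on_obj F) Xs" and ?Gs = "map (on_obj ?G) Xs" and ?\<pi>s = "map \<pi> Xs"
  let ?prF = "pairing K (on_obj F P) ?Fs (map (on_arr F) ps)"
  let ?prG = "pairing K (on_obj ?G P) ?Gs (map (on_arr ?G) ps)"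
  have Xs: "set Xs \<subseteq> obj Th" and P: "P \<in> obj Th" using prod by (auto simp: is_product_def)
  have ps: "list_all2 (\<lambda>p X. p \<in> homset Th P X) ps Xs" using prod by (simp add: is_product_def)
  have Gs_eq: "?Gs = map Q Xs" by (simp add: quot_functor_obj)
  have Gcoc: "all_coc K ?Gs" using Xs coc by auto
  note Gmod = all_coc_modules[OF Gcoc] and Fmod = prod_modules[OF prod]
  have Ghoms: "list_all2 (\<lambda>q C. q \<in> coalg_homs K (on_obj ?G P) C) (map (on_arr ?G) ps) ?Gs"
    using ps hom by (auto simp: list_all2_conv_all_nth)
  have s: "surj_list K ?Fs ?Gs ?\<pi>s"
    unfolding Gs_eq by (rule quot_at_proj_surj_list[OF Xs])
  then have \<pi>s: "lin_maps_list K ?Fs ?Gs ?\<pi>s" by (simp add: surj_list_def)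
  have \<pi>P: "\<pi> P \<in> coalg_homs K (on_obj F P) (on_obj ?G P)"
    unfolding quot_functor_obj by (rule quot_at_proj_hom[OF P])
  have nat: "?prG (\<pi> P x) = tensor_map K ?Gs ?\<pi>s (?prF x)" if x: "x \<in> carrier (on_obj F P)" for x
  proof (rule pairing_natural[OF prod_coc[OF prod] coc[OF P] prod_all_coc[OF prod] Gcoc prod_homs[OF prod] Ghoms \<pi>P \<pi>s _ x])
    fix i y assume i: "i < length ?Fs" and y: "y \<in> carrier (on_obj F P)"
    have "ps ! i \<in> homset Th P (Xs ! i)" using list_all2_nthD2[OF ps] i by simp
    then show "(map (on_arr ?G) ps ! i) (\<pi> P y) = (?\<pi>s ! i) ((map (on_arr F) ps ! i) y)"
      using quot_functor_arr[OF _ y] i list_all2_lengthD[OF ps] by simp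
  qed
  have prGl: "?prG \<in> lin_maps K (on_obj ?G P) (tensor K ?Gs)"
    by (rule pairing_lin[OF coc[OF P] Gmod lin_maps_list_homs[OF Ghoms]])
  note GPm = coc_module[OF coc[OF P]] and Tm = tensor_module[OF K_cring Gmod]
  show "bij_betw ?prG (carrier (on_obj ?G P)) (carrier (tensor K ?Gs))"
  proof (rule bij_betwI')
    fix y y' assume y: "y \<in> carrier (on_obj ?G P)" and y': "y' \<in> carrier (on_obj ?G P)"
    interpret GP: module K "on_obj ?G P" by (rule GPm)
    have "y = y'" if eq: "?prG y = ?prG y'"
    proof -
      let ?d = "y \<ominus>\<^bsub>on_obj ?G P\<^esub> y'"
      have dc: "?d \<in> carrier (on_obj ?G P)" using y y' by simp
      obtain x where x: "x \<in> carrier (on_obj F P)" "?d = \<pi> P x" using rep[OF P dc] by blast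
      have "?prG ?d = \<zero>\<^bsub>tensor K ?Gs\<^esub>"
        using lin_maps_minus[OF GPm Tm prGl y y'] eq module_minus_eq_zero_iff[OF Tm] lin_maps_closed[OF prGl y'] by simp
      then have "x \<in> D P"
        using ideal_at_product[OF prod x(1)] nat[OF x(1)] x(2) unfolding Gs_eq by simp
      then have "?d = \<zero>\<^bsub>on_obj ?G P\<^esub>"
        using quot_at_proj_zero_iff[OF P x(1)] x(2) unfolding quot_functor_obj by simp
      then show ?thesis using module_minus_eq_zero_iff[OF GPm y y'] by simp
    qed
    then show "(?prG y = ?prG y') = (y = y')" by blast
  next
    show "?prG y \<in> carrier (tensor K ?Gs)" if "y \<in> carrier (on_obj ?G P)" for y
      by (rule lin_maps_closed[OF prGl that])
  next
    fix Z assume "Z \<in> carrier (tensor K ?Gs)"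
    then have "Z \<in> tensor_map K ?Gs ?\<pi>s ` carrier (tensor K ?Fs)"
      unfolding tensor_map_surj[OF K_cring Fmod Gmod s] .
    then obtain X where X: "Z = tensor_map K ?Gs ?\<pi>s X" "X \<in> carrier (tensor K ?Fs)"
      by (rule imageE)
    have "X \<in> ?prF ` carrier (on_obj F P)"
      using preserves_products[OF prod] X(2) by (simp only: bij_betw_def)
    then obtain x where x: "X = ?prF x" "x \<in> carrier (on_obj F P)"
      by (rule imageE)
    have "\<pi> P x \<in> carrier (on_obj ?G P)"
      by (rule lin_maps_closed[OF coalg_homs_lin[OF \<pi>P] x(2)])
    then show "\<exists>y\<in>carrier (on_obj ?G P). Z = ?prG y"
      using nat[OF x(2)] X(1) x(1) by (intro bexI[of _ "\<pi> P x"]) simp_all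
  qed
qed

lemma T_quotient_exists: "\<exists>Q q. is_T_quotient K Th F J Q q"
proof (intro exI[of _ "quot_functor K Th F J"] exI[of _ \<pi>])
  have "\<pi> \<in> nat_trans K Th F (quot_functor K Th F J)"
    unfolding nat_trans_def quot_functor_obj
    using quot_at_proj_hom quot_functor_arr by auto
  then show "is_T_quotient K Th F J (quot_functor K Th F J) \<pi>"
    unfolding is_T_quotient_def quot_functor_obj ideal_at_T
    using quot_functor_coalgebra by simp
qed

end

end


section \<open>Morphisms and the universal property\<close>

lemma nat_trans_hom: "\<eta> \<in> nat_trans K Th F G \<Longrightarrow> X \<in> obj Th \<Longrightarrow> \<eta> X \<in> coalg_homs K (on_obj F X) (on_obj G X)"
  by (simp add: nat_trans_def)

lemma nat_trans_natural:
  "\<eta> \<in> nat_trans K Th F G \<Longrightarrow> u \<in> homset Th X Y \<Longrightarrow> x \<in> carrier (on_obj F X) \<Longrightarrow>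
    \<eta> Y (on_arr F u x) = on_arr G u (\<eta> X x)"
  unfolding nat_trans_def by blast

lemma nat_trans_closed:
  "\<eta> \<in> nat_trans K Th F G \<Longrightarrow> X \<in> obj Th \<Longrightarrow> x \<in> carrier (on_obj F X) \<Longrightarrow> \<eta> X x \<in> carrier (on_obj G X)"
  by (rule lin_maps_closed[OF coalg_homs_lin[OF nat_trans_hom]])

lemma nat_trans_comp:
  assumes F: "T_coalgebra K Th F" and G: "T_coalgebra K Th G" and H: "T_coalgebra K Th H"
    and \<eta>: "\<eta> \<in> nat_trans K Th F G" and \<theta>: "\<theta> \<in> nat_trans K Th G H"
  shows "(\<lambda>X. \<theta> X \<circ> \<eta> X) \<in> nat_trans K Th F H"
proof -
  interpret F: T_coalgebra K Th F by (rule F)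
  note coc = F.on_obj_coalgebra T_coalgebra.on_obj_coalgebra[OF G] T_coalgebra.on_obj_coalgebra[OF H]
  have "(\<theta> X \<circ> \<eta> X) \<in> coalg_homs K (on_obj F X) (on_obj H X)" if "X \<in> obj Th" for X
    unfolding comp_def
    by (rule coalg_homs_comp[OF coc(1)[OF that] coc(2)[OF that] coc(3)[OF that]
          nat_trans_hom[OF \<eta> that] nat_trans_hom[OF \<theta> that]])
  moreover have "\<theta> Y (\<eta> Y (on_arr F u x)) = on_arr H u (\<theta> X (\<eta> X x))"
    if u: "u \<in> homset Th X Y" and x: "x \<in> carrier (on_obj F X)" for u X Y x
    using nat_trans_natural[OF \<eta> u x] nat_trans_natural[OF \<theta> u]
      nat_trans_closed[OF \<eta> homset_src_tgt(1)[OF F.category_axioms u] x] by simp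
  ultimately show ?thesis unfolding nat_trans_def by simp
qed

context
  fixes K :: "('k, 'r) ring_scheme" and Th :: "('o, 'm, 's) lawvere_scheme"
    and F :: "('o, 'm, 'k, 'a) coalg_functor" and G :: "('o, 'm, 'k, 'b) coalg_functor"
    and \<eta> :: "'o \<Rightarrow> 'a \<Rightarrow> 'b"
  assumes F: "T_coalgebra K Th F" and G: "T_coalgebra K Th G" and \<eta>: "\<eta> \<in> nat_trans K Th F G"
begin

interpretation F: T_coalgebra K Th F by (rule F)
interpretation G: T_coalgebra K Th G by (rule G)

lemma nat_trans_power_list:
  "lin_maps_list K (replicate n (underlying Th F)) (replicate n (underlying Th G)) (replicate n (\<eta> (Tpow Th 1)))"
  by (rule lin_maps_list_replicate[OF coalg_homs_lin[OF nat_trans_hom[OF \<eta> F.Tpow_obj]]])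

lemma pairing_nat_trans:
  assumes x: "x \<in> carrier (on_obj F (Tpow Th n))"
  shows "pairing K (on_obj G (Tpow Th n)) (replicate n (underlying Th G)) (map (on_arr G) (Tproj Th n)) (\<eta> (Tpow Th n) x)
    = tensor_map K (replicate n (underlying Th G)) (replicate n (\<eta> (Tpow Th 1)))
        (pairing K (on_obj F (Tpow Th n)) (replicate n (underlying Th F)) (map (on_arr F) (Tproj Th n)) x)"
proof -
  note pn = F.pow_product[of n]
  have ps: "list_all2 (\<lambda>p X. p \<in> homset Th (Tpow Th n) X) (Tproj Th n) (replicate n (Tpow Th 1))"
    using pn by (simp add: is_product_def)
  then have len: "length (Tproj Th n) = n" by (auto dest: list_all2_lengthD)
  show ?thesis
  proof (rule pairing_natural[OF F.coc_Tpow G.coc_Tpow _ _ _ _ nat_trans_hom[OF \<eta> F.Tpow_obj] nat_trans_power_list _ x])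
    show "all_coc K (replicate n (underlying Th F))" "all_coc K (replicate n (underlying Th G))"
      using F.coc_Tpow G.coc_Tpow by auto
    show "list_all2 (\<lambda>q C. q \<in> coalg_homs K (on_obj F (Tpow Th n)) C) (map (on_arr F) (Tproj Th n)) (replicate n (underlying Th F))"
      using F.prod_homs[OF pn] by simp
    show "list_all2 (\<lambda>q C. q \<in> coalg_homs K (on_obj G (Tpow Th n)) C) (map (on_arr G) (Tproj Th n)) (replicate n (underlying Th G))"
      using G.prod_homs[OF pn] by simp
    fix i y assume i: "i < length (replicate n (underlying Th F))" and y: "y \<in> carrier (on_obj F (Tpow Th n))"
    then have "Tproj Th n ! i \<in> homset Th (Tpow Th n) (Tpow Th 1)"
      using list_all2_nthD2[OF ps, of i] by simp
    then show "(map (on_arr G) (Tproj Th n) ! i) (\<eta> (Tpow Th n) y)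
        = (replicate n (\<eta> (Tpow Th 1)) ! i) ((map (on_arr F) (Tproj Th n) ! i) y)"
      using nat_trans_natural[OF \<eta> _ y] i len by simp
  qed
qed

lemma nat_trans_pow_elt:
  assumes as: "as \<in> tuples (replicate n (underlying Th F))"
  shows "\<eta> (Tpow Th n) (pow_elt K Th F n as) = pow_elt K Th G n (map (\<eta> (Tpow Th 1)) as)"
proof (rule G.prod_eltI[OF F.pow_product])
  have FTs: "all_modules K (replicate n (underlying Th F))" and GTs: "all_modules K (replicate n (underlying Th G))"
    using coc_module[OF F.coc_Tpow] coc_module[OF G.coc_Tpow] by auto
  note x = F.pow_elt_closed[OF as]
  show "\<eta> (Tpow Th n) (pow_elt K Th F n as) \<in> carrier (on_obj G (Tpow Th n))"
    by (rule nat_trans_closed[OF \<eta> F.Tpow_obj x])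
  have m: "map (\<eta> (Tpow Th 1)) as = apply_each (replicate n (\<eta> (Tpow Th 1))) as"
    using tuples_length[OF as] by (simp add: map2_replicate)
  show "map (\<eta> (Tpow Th 1)) as \<in> tuples (map (on_obj G) (replicate n (Tpow Th 1)))"
    unfolding m using apply_each_tuples[OF nat_trans_power_list as] by simp
  have "pairing K (on_obj F (Tpow Th n)) (replicate n (underlying Th F)) (map (on_arr F) (Tproj Th n)) (pow_elt K Th F n as)
      = tens K (replicate n (underlying Th F)) as"
    using F.pairing_prod_elt[OF F.pow_product[of n], of as] as by simp
  then show "pairing K (on_obj G (Tpow Th n)) (map (on_obj G) (replicate n (Tpow Th 1))) (map (on_arr G) (Tproj Th n))
      (\<eta> (Tpow Th n) (pow_elt K Th F n as))
      = tens K (map (on_obj G) (replicate n (Tpow Th 1))) (map (\<eta> (Tpow Th 1)) as)"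
    using pairing_nat_trans[OF x] tensor_map_tens[OF F.K_cring FTs GTs nat_trans_power_list as] m by simp
qed

text \<open>\<open>\<eta>\<close> turns \<open>t(a\<^sub>1, \<dots>, a\<^sub>n)\<close> into \<open>t(\<eta> a\<^sub>1, \<dots>, \<eta> a\<^sub>n)\<close>, which is zero as soon as one argument is.\<close>

lemma T_ideal_kernel:
  "T_ideal K Th F {x \<in> carrier (underlying Th F). \<eta> (Tpow Th 1) x = \<zero>\<^bsub>underlying Th G\<^esub>}" (is "T_ideal K Th F ?L")
proof (rule F.T_idealI)
  note \<eta>T = coalg_homs_lin[OF nat_trans_hom[OF \<eta> F.Tpow_obj]]
  have GTs: "all_modules K (map (on_obj G) (replicate n (Tpow Th 1)))" for n
    using coc_module[OF G.coc_Tpow] by simp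
  show "submodule ?L K (underlying Th F)"
    by (rule submodule_kernel[OF coc_module[OF F.coc_Tpow] coc_module[OF G.coc_Tpow] \<eta>T])
  fix n t as i
  assume t: "t \<in> homset Th (Tpow Th n) (Tpow Th 1)" and as: "as \<in> tuples (replicate n (underlying Th F))"
    and i: "i < n" "as ! i \<in> ?L"
  note x = F.pow_elt_closed[OF as]
  have m: "map (\<eta> (Tpow Th 1)) as \<in> tuples (map (on_obj G) (replicate n (Tpow Th 1)))"
    using as lin_maps_closed[OF \<eta>T] by (auto simp: listset_replicate)
  have "pow_elt K Th G n (map (\<eta> (Tpow Th 1)) as) = \<zero>\<^bsub>on_obj G (Tpow Th n)\<^esub>"
    by (rule multilin_zero_entry[OF GTs coc_module[OF G.coc_Tpow] G.multilin_prod_elt[OF F.pow_product] m, of i])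
      (use i tuples_length[OF as] in auto)
  then have "\<eta> (Tpow Th 1) (on_arr F t (pow_elt K Th F n as)) = \<zero>\<^bsub>underlying Th G\<^esub>"
    using nat_trans_natural[OF \<eta> t x] nat_trans_pow_elt[OF as]
      lin_maps_zero[OF coc_module[OF G.coc_Tpow] coc_module[OF G.coc_Tpow] G.on_arr_lin[OF t]] by simp
  then show "on_arr F t (pow_elt K Th F n as) \<in> ?L"
    using F.on_arr_closed[OF t x] by simp
qed

text \<open>At \<open>T\<^sup>n\<close> the transformation is \<open>\<eta>\<^sub>T \<otimes> \<dots> \<otimes> \<eta>\<^sub>T\<close>, up to the pairings, which are bijective.\<close>

lemma nat_trans_surj:
  assumes surj: "\<eta> (Tpow Th 1) ` carrier (underlying Th F) = carrier (underlying Th G)" and X: "X \<in> obj Th"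
  shows "\<eta> X ` carrier (on_obj F X) = carrier (on_obj G X)"
proof
  show "\<eta> X ` carrier (on_obj F X) \<subseteq> carrier (on_obj G X)"
    using nat_trans_closed[OF \<eta> X] by blast
  show "carrier (on_obj G X) \<subseteq> \<eta> X ` carrier (on_obj F X)"
  proof
    fix y assume y: "y \<in> carrier (on_obj G X)"
    obtain n where n: "X = Tpow Th n" using F.obj_cases[OF X] by blast
    let ?FT = "replicate n (underlying Th F)" and ?GT = "replicate n (underlying Th G)"
    let ?\<eta>s = "replicate n (\<eta> (Tpow Th 1))"
    let ?pF = "pairing K (on_obj F (Tpow Th n)) ?FT (map (on_arr F) (Tproj Th n))"
    let ?pG = "pairing K (on_obj G (Tpow Th n)) ?GT (map (on_arr G) (Tproj Th n))"
    have FTs: "all_modules K ?FT" and GTs: "all_modules K ?GT"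
      using coc_module[OF F.coc_Tpow] coc_module[OF G.coc_Tpow] by auto
    have s: "surj_list K ?FT ?GT ?\<eta>s"
      unfolding surj_list_def using nat_trans_power_list surj by simp
    have "?pG y \<in> carrier (tensor K ?GT)"
      using lin_maps_closed[OF G.pairing_prod_lin[OF F.pow_product[of n]], of y] y n by simp
    then have "?pG y \<in> tensor_map K ?GT ?\<eta>s ` carrier (tensor K ?FT)"
      unfolding tensor_map_surj[OF F.K_cring FTs GTs s] .
    then obtain Z where Z: "?pG y = tensor_map K ?GT ?\<eta>s Z" "Z \<in> carrier (tensor K ?FT)"
      by (rule imageE)
    have "bij_betw ?pF (carrier (on_obj F (Tpow Th n))) (carrier (tensor K ?FT))"
      using F.preserves_products[OF F.pow_product[of n]] by simp
    then have "Z \<in> ?pF ` carrier (on_obj F (Tpow Th n))"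
      using Z(2) by (simp only: bij_betw_def)
    then obtain x where x: "Z = ?pF x" "x \<in> carrier (on_obj F (Tpow Th n))"
      by (rule imageE)
    have "?pG (\<eta> (Tpow Th n) x) = ?pG y"
      using pairing_nat_trans[OF x(2)] Z(1) x(1) by simp
    then have "\<eta> (Tpow Th n) x = y"
      using G.pairing_prod_inj[OF F.pow_product[of n] nat_trans_closed[OF \<eta> F.Tpow_obj x(2)], of y] y n by simp
    then show "y \<in> \<eta> X ` carrier (on_obj F X)" using x(2) n by blast
  qed
qed

end

text \<open>At \<open>T\<^sup>n\<close> the kernel of \<open>\<eta>\<close> is that of \<open>\<eta>\<^sub>T \<otimes> \<dots> \<otimes> \<eta>\<^sub>T\<close>. On elementary tensors \<open>\<theta>\<close> is a multilinear map that
  vanishes when one entry is in the kernel of \<open>\<eta>\<^sub>T\<close>, so right exactness applies.\<close>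

lemma nat_trans_kernel:
  assumes F: "T_coalgebra K Th F" and G: "T_coalgebra K Th G" and H: "T_coalgebra K Th H"
    and \<eta>: "\<eta> \<in> nat_trans K Th F G" and \<theta>: "\<theta> \<in> nat_trans K Th F H"
    and surj: "\<eta> (Tpow Th 1) ` carrier (underlying Th F) = carrier (underlying Th G)"
    and ker: "\<And>a. a \<in> carrier (underlying Th F) \<Longrightarrow> \<eta> (Tpow Th 1) a = \<zero>\<^bsub>underlying Th G\<^esub> \<Longrightarrow>
      \<theta> (Tpow Th 1) a = \<zero>\<^bsub>underlying Th H\<^esub>"
    and x: "x \<in> carrier (on_obj F X)" "\<eta> X x = \<zero>\<^bsub>on_obj G X\<^esub>" and X: "X \<in> obj Th"
  shows "\<theta> X x = \<zero>\<^bsub>on_obj H X\<^esub>"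
proof -
  interpret F: T_coalgebra K Th F by (rule F)
  interpret G: T_coalgebra K Th G by (rule G)
  interpret H: T_coalgebra K Th H by (rule H)
  obtain n where n: "X = Tpow Th n" using F.obj_cases[OF X] by blast
  let ?FT = "replicate n (underlying Th F)" and ?GT = "replicate n (underlying Th G)"
  let ?\<eta>s = "replicate n (\<eta> (Tpow Th 1))"
  let ?pF = "pairing K (on_obj F X) ?FT (map (on_arr F) (Tproj Th n))"
  let ?pG = "pairing K (on_obj G X) ?GT (map (on_arr G) (Tproj Th n))"
  note pn = F.pow_product[of n]
  have FTs: "all_modules K ?FT" and GTs: "all_modules K ?GT"
    and HTs: "all_modules K (map (on_obj H) (replicate n (Tpow Th 1)))"
    using coc_module[OF F.coc_Tpow] coc_module[OF G.coc_Tpow] coc_module[OF H.coc_Tpow] by auto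
  have s: "surj_list K ?FT ?GT ?\<eta>s"
    unfolding surj_list_def using nat_trans_power_list[OF F G \<eta>] surj by simp
  note HX = coc_module[OF H.on_obj_coalgebra[OF X]]
  have \<theta>X: "\<theta> X \<in> lin_maps K (on_obj F X) (on_obj H X)"
    by (rule coalg_homs_lin[OF nat_trans_hom[OF \<theta> X]])
  have Z: "?pF x \<in> carrier (tensor K ?FT)"
    using lin_maps_closed[OF F.pairing_prod_lin[OF pn], of x] x n by simp
  have "tensor_map K ?GT ?\<eta>s (?pF x) = ?pG (\<eta> X x)"
    using pairing_nat_trans[OF F G \<eta>, of x n] x n by simp
  also have "\<dots> = \<zero>\<^bsub>tensor K ?GT\<^esub>"
    using lin_maps_zero[OF coc_module[OF G.coc_Tpow] tensor_module[OF F.K_cring] G.pairing_prod_lin[OF pn]] GTs x n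
    by simp
  finally have 0: "tensor_map K ?GT ?\<eta>s (?pF x) = \<zero>\<^bsub>tensor K ?GT\<^esub>" .
  have m: "multilin K (on_obj H X) ?FT (\<lambda>as. \<theta> X (pow_elt K Th F n as))"
    using multilin_lin_comp[OF F.multilin_prod_elt[OF pn]] \<theta>X n by simp
  have "\<theta> X x = tensor_lift K (on_obj H X) (\<lambda>as. \<theta> X (pow_elt K Th F n as)) (?pF x)"
    using F.lin_prod_lift[OF pn HX, of "\<theta> X" x] \<theta>X x n by simp
  also have "\<dots> = \<zero>\<^bsub>on_obj H X\<^esub>"
  proof (rule tensor_lift_kernel[OF F.K_cring FTs GTs HX s m _ Z 0])
    fix p i assume p: "p \<in> tuples ?FT" "i < length ?FT" and z: "(?\<eta>s ! i) (p ! i) = \<zero>\<^bsub>?GT ! i\<^esub>"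
    have \<theta>p: "map (\<theta> (Tpow Th 1)) p \<in> tuples (map (on_obj H) (replicate n (Tpow Th 1)))"
      using p(1) nat_trans_closed[OF \<theta> F.Tpow_obj] by (auto simp: listset_replicate)
    have "p ! i \<in> carrier (underlying Th F)" using tuples_nth[OF p] p(2) by simp
    then have "\<theta> (Tpow Th 1) (p ! i) = \<zero>\<^bsub>underlying Th H\<^esub>" using ker z p(2) by simp
    then have "pow_elt K Th H n (map (\<theta> (Tpow Th 1)) p) = \<zero>\<^bsub>on_obj H (Tpow Th n)\<^esub>"
      using p tuples_length[OF p(1)]
      by (intro multilin_zero_entry[OF HTs coc_module[OF H.coc_Tpow] H.multilin_prod_elt[OF pn] \<theta>p, of i]) auto
    then show "\<theta> X (pow_elt K Th F n p) = \<zero>\<^bsub>on_obj H X\<^esub>"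
      using nat_trans_pow_elt[OF F H \<theta> p(1)] n by simp
  qed
  finally show ?thesis .
qed

text \<open>The pairing of \<open>G(T\<^sup>n)\<close> is injective and expresses a component at \<open>T\<^sup>n\<close> through the one at \<open>T\<close>.\<close>

lemma nat_trans_eqI:
  assumes F: "T_coalgebra K Th F" and G: "T_coalgebra K Th G"
    and \<eta>: "\<eta> \<in> nat_trans K Th F G" and \<theta>: "\<theta> \<in> nat_trans K Th F G"
    and eq: "\<And>x. x \<in> carrier (underlying Th F) \<Longrightarrow> \<eta> (Tpow Th 1) x = \<theta> (Tpow Th 1) x"
  shows "nat_trans_eq Th F \<eta> \<theta>"
  unfolding nat_trans_eq_def
proof (intro ballI)
  interpret F: T_coalgebra K Th F by (rule F)
  interpret G: T_coalgebra K Th G by (rule G)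
  fix X x assume X: "X \<in> obj Th" and x: "x \<in> carrier (on_obj F X)"
  obtain n where n: "X = Tpow Th n" using F.obj_cases[OF X] by blast
  let ?FT = "replicate n (underlying Th F)" and ?GT = "replicate n (underlying Th G)"
  note pn = F.pow_product[of n]
  have FTs: "all_modules K ?FT" and GTs: "all_modules K ?GT"
    using coc_module[OF F.coc_Tpow] coc_module[OF G.coc_Tpow] by auto
  let ?pF = "pairing K (on_obj F X) ?FT (map (on_arr F) (Tproj Th n))"
  let ?pG = "pairing K (on_obj G X) ?GT (map (on_arr G) (Tproj Th n))"
  have Z: "?pF x \<in> carrier (tensor K ?FT)"
    using lin_maps_closed[OF F.pairing_prod_lin[OF pn], of x] x n by simp
  have "tensor_map K ?GT (replicate n (\<eta> (Tpow Th 1))) (?pF x) = tensor_map K ?GT (replicate n (\<theta> (Tpow Th 1))) (?pF x)"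
    unfolding tensor_map_def
  proof (rule tensor_lift_cong[OF F.K_cring FTs tensor_module[OF F.K_cring GTs]
        multilin_tens_apply_each[OF F.K_cring FTs GTs nat_trans_power_list[OF F G \<theta>]] _ Z])
    fix p assume p: "p \<in> tuples ?FT"
    then have "map (\<eta> (Tpow Th 1)) p = map (\<theta> (Tpow Th 1)) p"
      using eq unfolding tuples_replicate by (intro map_cong refl) blast
    moreover have "length p = n" using tuples_length[OF p] by simp
    ultimately show "tens K ?GT (apply_each (replicate n (\<eta> (Tpow Th 1))) p) = tens K ?GT (apply_each (replicate n (\<theta> (Tpow Th 1))) p)"
      by (simp only: map2_replicate)
  qed
  then have "?pG (\<eta> X x) = ?pG (\<theta> X x)"
    using pairing_nat_trans[OF F G \<eta>, of x n] pairing_nat_trans[OF F G \<theta>, of x n] x n by simp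
  then show "\<eta> X x = \<theta> X x"
    using G.pairing_prod_inj[OF pn, of "\<eta> X x" "\<theta> X x"] nat_trans_closed[OF \<eta> X x] nat_trans_closed[OF \<theta> X x] n by simp
qed

lemma nat_trans_factor:
  assumes B: "T_coalgebra K Th B" and Q: "T_coalgebra K Th Q" and C: "T_coalgebra K Th C"
    and q: "q \<in> nat_trans K Th B Q" and h: "h \<in> nat_trans K Th B C"
    and surj: "q (Tpow Th 1) ` carrier (underlying Th B) = carrier (underlying Th Q)"
    and ker: "\<And>b. b \<in> carrier (underlying Th B) \<Longrightarrow> q (Tpow Th 1) b = \<zero>\<^bsub>underlying Th Q\<^esub> \<Longrightarrow>
      h (Tpow Th 1) b = \<zero>\<^bsub>underlying Th C\<^esub>"
  shows "\<exists>k \<in> nat_trans K Th Q C. nat_trans_eq Th B (\<lambda>X. k X \<circ> q X) h \<and>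
    (\<forall>k' \<in> nat_trans K Th Q C. nat_trans_eq Th B (\<lambda>X. k' X \<circ> q X) h \<longrightarrow> nat_trans_eq Th Q k' k)"
proof -
  interpret B: T_coalgebra K Th B by (rule B)
  interpret Q: T_coalgebra K Th Q by (rule Q)
  interpret C: T_coalgebra K Th C by (rule C)
  note sX = nat_trans_surj[OF B Q q surj]
  define k where "k X y = h X (inv_into (carrier (on_obj B X)) (q X) y)" for X y
  have kq: "k X (q X x) = h X x" if X: "X \<in> obj Th" and x: "x \<in> carrier (on_obj B X)" for X x
  proof -
    have BX: "module K (on_obj B X)" and QX: "module K (on_obj Q X)" and CX: "module K (on_obj C X)"
      by (rule coc_module[OF B.on_obj_coalgebra[OF X]] coc_module[OF Q.on_obj_coalgebra[OF X]]
          coc_module[OF C.on_obj_coalgebra[OF X]])+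
    interpret BX: module K "on_obj B X" by (rule BX)
    note ql = coalg_homs_lin[OF nat_trans_hom[OF q X]] and hl = coalg_homs_lin[OF nat_trans_hom[OF h X]]
    let ?x' = "inv_into (carrier (on_obj B X)) (q X) (q X x)"
    have x': "?x' \<in> carrier (on_obj B X)" "q X ?x' = q X x"
      using x by (auto intro: inv_into_into f_inv_into_f)
    let ?d = "?x' \<ominus>\<^bsub>on_obj B X\<^esub> x"
    have "q X ?d = \<zero>\<^bsub>on_obj Q X\<^esub>"
      using lin_maps_minus[OF BX QX ql x'(1) x] x'(2) module_minus_eq_zero_iff[OF QX] lin_maps_closed[OF ql x] by simp
    then have "h X ?d = \<zero>\<^bsub>on_obj C X\<^esub>"
      using x x'(1) by (intro nat_trans_kernel[OF B Q C q h surj ker _ _ X]) auto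
    then show ?thesis
      unfolding k_def
      using lin_maps_minus[OF BX CX hl x'(1) x] module_minus_eq_zero_iff[OF CX] lin_maps_closed[OF hl] x x'(1) by simp
  qed
  have rep: "\<exists>x\<in>carrier (on_obj B X). y = q X x" if "X \<in> obj Th" "y \<in> carrier (on_obj Q X)" for X y
    using that(2) sX[OF that(1)] by (metis imageE)
  have k: "k \<in> nat_trans K Th Q C"
    unfolding nat_trans_def
  proof (intro CollectI conjI allI ballI)
    fix X assume X: "X \<in> obj Th"
    show "k X \<in> coalg_homs K (on_obj Q X) (on_obj C X)"
      by (rule coalg_hom_factor[OF B.on_obj_coalgebra[OF X] Q.on_obj_coalgebra[OF X] C.on_obj_coalgebra[OF X]
            nat_trans_hom[OF q X] sX[OF X] nat_trans_hom[OF h X] kq[OF X]])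
  next
    fix X Y u y assume u: "u \<in> homset Th X Y" and y: "y \<in> carrier (on_obj Q X)"
    have X: "X \<in> obj Th" and Y: "Y \<in> obj Th" using homset_src_tgt[OF B.category_axioms u] by auto
    obtain x where x: "x \<in> carrier (on_obj B X)" "y = q X x" using rep[OF X y] by blast
    show "k Y (on_arr Q u y) = on_arr C u (k X y)"
      using nat_trans_natural[OF q u x(1)] nat_trans_natural[OF h u x(1)] kq[OF X x(1)]
        kq[OF Y B.on_arr_closed[OF u x(1)]] x(2) by simp
  qed
  moreover have "nat_trans_eq Th B (\<lambda>X. k X \<circ> q X) h"
    unfolding nat_trans_eq_def using kq by simp
  moreover have "nat_trans_eq Th Q k' k" if "nat_trans_eq Th B (\<lambda>X. k' X \<circ> q X) h" for k'
    unfolding nat_trans_eq_def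
  proof (intro ballI)
    fix X y assume X: "X \<in> obj Th" and y: "y \<in> carrier (on_obj Q X)"
    obtain x where x: "x \<in> carrier (on_obj B X)" "y = q X x" using rep[OF X y] by blast
    show "k' X y = k X y"
      using that X x kq[OF X x(1)] unfolding nat_trans_eq_def by simp
  qed
  ultimately show ?thesis by blast
qed

theorem proposition5p5:
  fixes K :: "('k, 'r) ring_scheme" and Th :: "('o, 'm, 's) lawvere_scheme"
    and A :: "('o, 'm, 'k, 'a) coalg_functor" and B :: "('o, 'm, 'k, 'b) coalg_functor"
    and f g :: "'o \<Rightarrow> 'a \<Rightarrow> 'b" and I :: "'b set"
  assumes "field K" and "lawvere_theory Th"
    and "T_coalgebra K Th A" and "T_coalgebra K Th B"
    and "f \<in> nat_trans K Th A B" and "g \<in> nat_trans K Th A B"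
    and "I = {f (Tpow Th 1) a \<ominus>\<^bsub>underlying Th B\<^esub> g (Tpow Th 1) a | a. a \<in> carrier (underlying Th A)}"
  shows "(\<exists>Q q. is_T_quotient K Th B (T_ideal_hull K Th B I) Q q) \<and>
    (\<forall>Q q. is_T_quotient K Th B (T_ideal_hull K Th B I) Q q \<longrightarrow>
      is_coequalizer TYPE('c) K Th A B f g Q q)"
proof -
  note A = assms(3) and B = assms(4) and f = assms(5) and g = assms(6) and I = assms(7)
  interpret A: T_coalgebra K Th A by (rule A)
  interpret B: T_coalgebra K Th B by (rule B)
  let ?T = "Tpow Th 1" and ?J = "T_ideal_hull K Th B I"
  let ?AT = "underlying Th A" and ?BT = "underlying Th B"
  interpret BT: coc_coalgebra K ?BT by (rule B.coc_Tpow)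
  note fT = nat_trans_hom[OF f A.Tpow_obj[of 1]] and gT = nat_trans_hom[OF g A.Tpow_obj[of 1]]
  note fc = lin_maps_closed[OF coalg_homs_lin[OF fT]] and gc = lin_maps_closed[OF coalg_homs_lin[OF gT]]
  have IB: "I \<subseteq> carrier ?BT"
    unfolding I using BT.M.minus_closed[OF fc gc] by blast
  note J = B.T_ideal_hull_ideal[OF IB]
  note Jsub = B.T_ideal_submodule[OF J]
  have diff: "f ?T a \<ominus>\<^bsub>?BT\<^esub> g ?T a \<in> ?J" if "a \<in> carrier ?AT" for a
    using that B.T_ideal_hull_incl[of I] unfolding I by blast
  have "coid_elt K ?BT ?J x" if "x \<in> I" for x
    using that coid_elt_diff[OF A.coc_Tpow B.coc_Tpow fT gT Jsub diff] unfolding I by blast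
  then have Jcoid: "coideal K ?BT ?J" by (rule B.T_ideal_hull_coideal[OF IB])
  have "is_coequalizer TYPE('c) K Th A B f g Q q" if "is_T_quotient K Th B ?J Q q" for Q q
  proof -
    have Q: "T_coalgebra K Th Q" and q: "q \<in> nat_trans K Th B Q" and QT: "underlying Th Q = quot_coalgebra K ?BT ?J"
      and qT: "\<And>b. b \<in> carrier ?BT \<Longrightarrow> q ?T b = ?J +>\<^bsub>?BT\<^esub> b"
      using that unfolding is_T_quotient_def by blast+
    have surj: "q ?T ` carrier ?BT = carrier (underlying Th Q)"
      unfolding QT quot_coalgebra_proj_surj[OF assms(1) B.coc_Tpow Jsub, symmetric]
      by (rule image_cong[OF refl qT])
    have zero: "q ?T b = \<zero>\<^bsub>underlying Th Q\<^esub> \<longleftrightarrow> b \<in> ?J" if "b \<in> carrier ?BT" for b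
      unfolding QT qT[OF that] by (rule quot_coalgebra_proj_zero_iff[OF assms(1) B.coc_Tpow Jsub that])
    have "nat_trans_eq Th A (\<lambda>X. q X \<circ> f X) (\<lambda>X. q X \<circ> g X)"
    proof (rule nat_trans_eqI[OF A Q nat_trans_comp[OF A B Q f q] nat_trans_comp[OF A B Q g q]])
      fix a assume a: "a \<in> carrier ?AT"
      show "(q ?T \<circ> f ?T) a = (q ?T \<circ> g ?T) a"
        using diff[OF a] coset_eq_iff[OF BT.A_module Jsub fc[OF a] gc[OF a]] qT[OF fc[OF a]] qT[OF gc[OF a]] by simp
    qed
    moreover have "\<exists>k \<in> nat_trans K Th Q C. nat_trans_eq Th B (\<lambda>X. k X \<circ> q X) h \<and>
        (\<forall>k' \<in> nat_trans K Th Q C. nat_trans_eq Th B (\<lambda>X. k' X \<circ> q X) h \<longrightarrow> nat_trans_eq Th Q k' k)"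
      if C: "T_coalgebra K Th C" and h: "h \<in> nat_trans K Th B C"
        and eq: "nat_trans_eq Th A (\<lambda>X. h X \<circ> f X) (\<lambda>X. h X \<circ> g X)"
      for C :: "('o, 'm, 'k, 'c) coalg_functor" and h
    proof (rule nat_trans_factor[OF B Q C q h surj])
      let ?CT = "underlying Th C" and ?L = "{b \<in> carrier ?BT. h ?T b = \<zero>\<^bsub>underlying Th C\<^esub>}"
      have CT: "module K ?CT" by (rule coc_module[OF T_coalgebra.coc_Tpow[OF C]])
      note hl = coalg_homs_lin[OF nat_trans_hom[OF h A.Tpow_obj[of 1]]]
      have "h ?T (f ?T a \<ominus>\<^bsub>?BT\<^esub> g ?T a) = \<zero>\<^bsub>?CT\<^esub>" if a: "a \<in> carrier ?AT" for a
      proof -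
        have "h ?T (f ?T a) = h ?T (g ?T a)"
          using eq a A.Tpow_obj[of 1] unfolding nat_trans_eq_def by simp
        then show ?thesis
          using lin_maps_minus[OF BT.A_module CT hl fc[OF a] gc[OF a]]
            module_minus_eq_zero_iff[OF CT] lin_maps_closed[OF hl gc[OF a]] by simp
      qed
      then have "I \<subseteq> ?L" using IB unfolding I by blast
      then have "?J \<subseteq> ?L" by (rule B.T_ideal_hull_least[OF T_ideal_kernel[OF B C h]])
      then show "h ?T b = \<zero>\<^bsub>?CT\<^esub>" if "b \<in> carrier ?BT" "q ?T b = \<zero>\<^bsub>underlying Th Q\<^esub>" for b
        using zero that by blast
    qed
    ultimately show ?thesis
      unfolding is_coequalizer_def using Q q by blast
  qed
  then show ?thesis
    using B.T_quotient_exists[OF J Jcoid] by blast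
qed

end
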